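(* Let $(B\subseteq A,\Omega^\bullet,\Omega^{(\bullet,\bullet)},\sigma)$ be a CQH-Hermitian space and $\mathcal{F}$ a covariant Hermitian module over $B$. Every morphism $f:\Omega^\bullet\otimes_B\mathcal{F}\to\Omega^\bullet\otimes_B\mathcal{F}$ in ${}^A_B\mathrm{mod}_0$ is bounded, and hence extends to a bounded operator on $L^2(\Omega^\bullet\otimes_B\mathcal{F})$.
   Context: All algebras are unital over $\mathbb{C}$. A differential calculus (dc) over an algebra $B$ is a differential graded algebra $(\Omega^\bullet=\bigoplus_{k\ge 0}\Omega^k,\mathrm{d})$ (product $\wedge$) with $\Omega^0=B$, generated as an algebra by the elements $a,\mathrm{d}b$, $a,b\in B$; it has total degree $m$ if $\Omega^m\ne 0$ and $\Omega^k=0$ for $k>m$. For $B$ a $*$-algebra, a $*$-dc is a dc such that $*$ extends to a conjugate-linear involution of $\Omega^\bullet$ with $\mathrm{d}(\omega^* )=(\mathrm{d}\omega)^*$ and $(\omega\wedge\nu)^*=(-1)^{kl}\nu^*\wedge\omega^*$ for $\omega\in\Omega^k$, $\nu\in\Omega^l$. A complex structure is a $\mathbb{Z}^2_{\ge0}$-algebra grading $\Omega^{(\bullet,\bullet)}$ with $\Omega^k=\bigoplus_{a+b=k}\Omega^{(a,b)}$, $(\Omega^{(a,b)})^*=\Omega^{(b,a)}$, such that $\mathrm{d}=\partial+\overline{\partial}$ with $\partial$ of degree $(1,0)$ and $\overline{\partial}$ of degree $(0,1)$. Hermitian structure $(\Omega^{(\bullet,\bullet)},\sigma)$ on a $*$-dc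 of total degree $2n$: a complex structure and a central real ($\sigma^*=\sigma$) form $\sigma\in\Omega^{(1,1)}$ such that, for $L_\sigma(\omega):=\sigma\wedge\omega$, the maps $L_\sigma^{n-k}:\Omega^k\to\Omega^{2n-k}$, $k=0,\dots,n-1$, are isomorphisms. Primitive forms: $P^k:=\{\alpha\in\Omega^k: L_\sigma^{n-k+1}(\alpha)=0\}$ for $k\le n$, $P^k:=0$ for $k>n$; one has $\Omega^k=\bigoplus_j L_\sigma^j(P^{k-2j})$. The Hodge map $\ast_\sigma$ is determined by $\ast_\sigma(L_\sigma^j(\alpha))=(-1)^{k(k+1)/2}\mathbf{i}^{a-b}\frac{j!}{(n-j-k)!}L_\sigma^{n-j-k}(\alpha)$ for $\alpha\in P^k\cap\Omega^{(a,b)}$, $a+b=k$. The metric is the sesquilinear form (conjugate-linear in the first variable) $g_\sigma:\Omega^\bullet\times\Omega^\bullet\to B$, $g_\sigma(\omega,\nu)=\ast_\sigma(\ast_\sigma(\omega^* )\wedge\nu)$ for $\omega,\nu$ of equal degree, zero for different degrees. $B_{>0}$ is the set of non-zero elements of the form $\sum_i b_i^*b_i$; the structure is positive definite if $g_\sigma(\omega,\omega)\in B_{>0}$ for all $\omega\neq0$. A CQGA is a cosemisimple Hopf $*$-algebra whose Haar functional $\mathbf{h}$ is a state. A quantum homogeneous $A$-space is a left coideal subalgebra $B\subseteq A$ with $A$ faithfully flat as right $B$-module and $B^+A=AB^+$, $B^+:=\ker(\varepsilon)\cap B$; put $\pi_B(A):=A/B^+A$. A CQGA-homogeneous space is a quantum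 homogeneous space $B\subseteq A$ with $A,\pi_B(A)$ CQGAs, $B$ a $*$-subalgebra, and $\pi_B:A\to\pi_B(A)$ a Hopf $*$-map. ${}^A_B\mathrm{mod}_0$ is the category of left relative Hopf modules (left $A$-comodules and left $B$-modules, compatibly) finitely generated over $B$, with right $B$-action $fb=f_{(-2)}bS(f_{(-1)})f_{(0)}$ (i.e. under $\mathcal{F}\cong A\,\square_{\pi_B}(\mathcal{F}/B^+\mathcal{F})$, $f\mapsto f_{(-1)}\otimes[f_{(0)}]$, right multiplication by $b$ on $A$); morphisms are left $A$-comodule, left $B$-module maps. A CQH-Hermitian space is a quadruple $(B\subseteq A,\Omega^\bullet,\Omega^{(\bullet,\bullet)},\sigma)$ with $B\subseteq A$ a CQGA-homogeneous space, $\Omega^\bullet$ a left $A$-covariant $*$-dc over $B$ (an object of ${}^A_B\mathrm{mod}_0$, $\mathrm d$ a comodule map), and $(\Omega^{(\bullet,\bullet)},\sigma)$ a positive definite Hermitian structure which is covariant (the bigrading is one of objects of ${}^A_B\mathrm{mod}_0$, $\sigma$ is coinvariant) and $\int$-closed: for $\int:=\mathbf{h}\circ\ast_\sigma:\Omega^{2n}\to\mathbb{C}$ one has $\int\circ\,\mathrm{d}=0$ on $\Omega^{2n-1}$. Modules. For a $B$-bimodule $\mathcal{F}$, $\mathcal{F}^\vee$ is the bimodule of right $B$-module maps $\mathcal{F}\to B$ and $\overline{\mathcal{F}}$ the conjugate bimodule ($b\overline{f}=\overline{fb^*}$, $\overline{f}b=\overline{b^*f}$). A weak Hermitian module is a pair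 $(\mathcal{F},h_{\mathcal{F}})$ with $h_{\mathcal{F}}:\overline{\mathcal{F}}\to\mathcal{F}^\vee$ a bimodule isomorphism such that $h'_{\mathcal{F}}(f,k):=h_{\mathcal{F}}(\overline{f})(k)$ satisfies $h'_{\mathcal{F}}(f,k)=h'_{\mathcal{F}}(k,f)^*$ and $h'_{\mathcal{F}}(f,f)\in B_{>0}$ for $f\ne0$. It is an Hermitian module if $g_{\mathcal{F}}(\omega\otimes f,\nu\otimes k):=h'_{\mathcal{F}}(f,g_\sigma(\omega,\nu)k)$ makes $\Omega^\bullet\otimes_B\mathcal{F}$ a weak Hermitian module; covariant if $\mathcal{F}\in{}^A_B\mathrm{mod}_0$ and $h_{\mathcal{F}}$ is a morphism there. $L^2(\Omega^\bullet\otimes_B\mathcal{F})$ is the completion of $\Omega^\bullet\otimes_B\mathcal{F}$ for the inner product $\mathbf{h}\circ g_{\mathcal{F}}$. *)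

theory Defs
  imports
    "HOL-Analysis.Analysis"
    "HOL-Library.Poly_Mapping"
    "HOL-Library.Nonpos_Ints"
    "HOL-Algebra.Module"
    "HOL-Algebra.Ideal_Product"
    "HOL-Algebra.QuotRing"
begin

section \<open>Complex vector spaces and algebras\<close>

text \<open>
  A complex vector space is a \<^locale>\<open>module\<close> over the ring of complex numbers; the fields
  \<^const>\<open>mult\<close> and \<^const>\<open>one\<close> of its record are only meaningful for algebras.  The library locale
  \<^locale>\<open>algebra\<close> is not used because it forces commutativity.
\<close>

definition CC :: "(complex, complex) module" where
  "CC = \<lparr>carrier = UNIV, mult = (*), one = 1, zero = 0, add = (+), smult = (*)\<rparr>"

definition lin_hom :: "(complex, 'v, 'x) module_scheme \<Rightarrow> (complex, 'w, 'y) module_scheme \<Rightarrow> ('v \<Rightarrow> 'w) set" where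
  "lin_hom V W = {f \<in> carrier V \<rightarrow> carrier W.
     (\<forall>x\<in>carrier V. \<forall>y\<in>carrier V. f (x \<oplus>\<^bsub>V\<^esub> y) = f x \<oplus>\<^bsub>W\<^esub> f y) \<and>
     (\<forall>c. \<forall>x\<in>carrier V. f (c \<odot>\<^bsub>V\<^esub> x) = c \<odot>\<^bsub>W\<^esub> f x)}"

definition bilin :: "(complex, 'v, 'x) module_scheme \<Rightarrow> (complex, 'w, 'y) module_scheme \<Rightarrow>
    (complex, 'u, 'z) module_scheme \<Rightarrow> ('v \<Rightarrow> 'w \<Rightarrow> 'u) \<Rightarrow> bool" where
  "bilin V W U \<phi> \<longleftrightarrow> (\<forall>v\<in>carrier V. \<phi> v \<in> lin_hom W U) \<and> (\<forall>w\<in>carrier W. (\<lambda>v. \<phi> v w) \<in> lin_hom V U)"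

definition conj_vs :: "(complex, 'v, 'x) module_scheme \<Rightarrow> (complex, 'v, 'x) module_scheme" where
  "conj_vs V = V\<lparr>smult := \<lambda>c v. cnj c \<odot>\<^bsub>V\<^esub> v\<rparr>"

definition calgebra :: "(complex, 'a, 'x) module_scheme \<Rightarrow> bool" where
  "calgebra A \<longleftrightarrow> ring A \<and> module CC A \<and> bilin A A A (\<lambda>a b. a \<otimes>\<^bsub>A\<^esub> b)"

definition subalg :: "(complex, 'a, 'x) module_scheme \<Rightarrow> 'a set \<Rightarrow> bool" where
  "subalg A B \<longleftrightarrow> submodule B CC A \<and> \<one>\<^bsub>A\<^esub> \<in> B \<and> (\<forall>a\<in>B. \<forall>b\<in>B. a \<otimes>\<^bsub>A\<^esub> b \<in> B)"

definition decomposition :: "(complex, 'v, 'x) module_scheme \<Rightarrow> 'i set \<Rightarrow> ('i \<Rightarrow> 'v set) \<Rightarrow> 'v \<Rightarrow> ('i \<Rightarrow> 'v) \<Rightarrow> bool" where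
  "decomposition V I U v c \<longleftrightarrow> c \<in> Pi\<^sub>E I U \<and> finite {i \<in> I. c i \<noteq> \<zero>\<^bsub>V\<^esub>} \<and>
     v = finsum V c {i \<in> I. c i \<noteq> \<zero>\<^bsub>V\<^esub>}"

text \<open>\<open>direct_sum V I U W\<close>: the subspace \<open>W\<close> of \<open>V\<close> is the (internal) direct sum of the \<open>U i\<close>, \<open>i \<in> I\<close>.\<close>

definition direct_sum :: "(complex, 'v, 'x) module_scheme \<Rightarrow> 'i set \<Rightarrow> ('i \<Rightarrow> 'v set) \<Rightarrow> 'v set \<Rightarrow> bool" where
  "direct_sum V I U W \<longleftrightarrow> submodule W CC V \<and> (\<forall>i\<in>I. submodule (U i) CC V \<and> U i \<subseteq> W) \<and>
     (\<forall>v\<in>W. \<exists>!c. decomposition V I U v c)"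


section \<open>Tensor products\<close>

text \<open>
  Elements of a tensor product are cosets in the free vector space on pairs.  The set \<open>N\<close> contains
  additional relators: it is empty for the tensor product over the complex numbers, and contains the
  balancing relators for a tensor product over a subalgebra.
\<close>

type_synonym ('v, 'w) tensor = "('v \<times> 'w \<Rightarrow>\<^sub>0 complex) set"

definition pscale :: "complex \<Rightarrow> ('k \<Rightarrow>\<^sub>0 complex) \<Rightarrow> ('k \<Rightarrow>\<^sub>0 complex)" where
  "pscale c p = Poly_Mapping.map ((*) c) p"

abbreviation gen :: "'v \<Rightarrow> 'w \<Rightarrow> ('v \<times> 'w \<Rightarrow>\<^sub>0 complex)" where
  "gen v w \<equiv> Poly_Mapping.single (v, w) 1"

inductive_set tnull :: "(complex, 'v, 'x) module_scheme \<Rightarrow> (complex, 'w, 'y) module_scheme \<Rightarrow>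
    ('v \<times> 'w \<Rightarrow>\<^sub>0 complex) set \<Rightarrow> ('v \<times> 'w \<Rightarrow>\<^sub>0 complex) set"
  for V W N where
  zero: "0 \<in> tnull V W N"
| add: "p \<in> tnull V W N \<Longrightarrow> q \<in> tnull V W N \<Longrightarrow> p + q \<in> tnull V W N"
| scale: "p \<in> tnull V W N \<Longrightarrow> pscale c p \<in> tnull V W N"
| extra: "p \<in> N \<Longrightarrow> p \<in> tnull V W N"
| add_left: "v \<in> carrier V \<Longrightarrow> v' \<in> carrier V \<Longrightarrow> w \<in> carrier W \<Longrightarrow>
    gen (v \<oplus>\<^bsub>V\<^esub> v') w - gen v w - gen v' w \<in> tnull V W N"
| add_right: "v \<in> carrier V \<Longrightarrow> w \<in> carrier W \<Longrightarrow> w' \<in> carrier W \<Longrightarrow>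
    gen v (w \<oplus>\<^bsub>W\<^esub> w') - gen v w - gen v w' \<in> tnull V W N"
| scale_left: "v \<in> carrier V \<Longrightarrow> w \<in> carrier W \<Longrightarrow>
    gen (c \<odot>\<^bsub>V\<^esub> v) w - pscale c (gen v w) \<in> tnull V W N"
| scale_right: "v \<in> carrier V \<Longrightarrow> w \<in> carrier W \<Longrightarrow>
    gen v (c \<odot>\<^bsub>W\<^esub> w) - pscale c (gen v w) \<in> tnull V W N"

definition tclass :: "(complex, 'v, 'x) module_scheme \<Rightarrow> (complex, 'w, 'y) module_scheme \<Rightarrow>
    ('v \<times> 'w \<Rightarrow>\<^sub>0 complex) set \<Rightarrow> ('v \<times> 'w \<Rightarrow>\<^sub>0 complex) \<Rightarrow> ('v, 'w) tensor" where
  "tclass V W N p = {q. q - p \<in> tnull V W N}"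

definition tspace :: "(complex, 'v, 'x) module_scheme \<Rightarrow> (complex, 'w, 'y) module_scheme \<Rightarrow>
    ('v \<times> 'w \<Rightarrow>\<^sub>0 complex) set \<Rightarrow> (complex, ('v, 'w) tensor) module" where
  "tspace V W N =
    \<lparr>carrier = tclass V W N ` {p. Poly_Mapping.keys p \<subseteq> carrier V \<times> carrier W},
     mult = undefined, one = undefined,
     zero = tclass V W N 0,
     add = (\<lambda>s t. tclass V W N ((SOME p. p \<in> s) + (SOME q. q \<in> t))),
     smult = (\<lambda>c t. tclass V W N (pscale c (SOME p. p \<in> t)))\<rparr>"

text \<open>
  The linear map on a tensor product induced by a bilinear (balanced) map \<open>\<phi>\<close> with values in \<open>U\<close>.
\<close>

definition tlift :: "(complex, 'u, 'z) module_scheme \<Rightarrow> ('v \<Rightarrow> 'w \<Rightarrow> 'u) \<Rightarrow> ('v, 'w) tensor \<Rightarrow> 'u" where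
  "tlift U \<phi> t = (let p = (SOME p. p \<in> t) in
     finsum U (\<lambda>(v, w). Poly_Mapping.lookup p (v, w) \<odot>\<^bsub>U\<^esub> \<phi> v w) (Poly_Mapping.keys p))"

definition ctel :: "(complex, 'v, 'x) module_scheme \<Rightarrow> (complex, 'w, 'y) module_scheme \<Rightarrow> 'v \<Rightarrow> 'w \<Rightarrow> ('v, 'w) tensor" where
  "ctel V W v w = tclass V W {} (gen v w)"

text \<open>The product of \<open>ctens V W\<close> is only meaningful if \<open>V\<close> and \<open>W\<close> are algebras.\<close>

definition ctens :: "(complex, 'v, 'x) module_scheme \<Rightarrow> (complex, 'w, 'y) module_scheme \<Rightarrow> (complex, ('v, 'w) tensor) module" where
  "ctens V W = (tspace V W {})
    \<lparr>mult := \<lambda>s t. tlift (tspace V W {}) (\<lambda>v w.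
        tlift (tspace V W {}) (\<lambda>v' w'. ctel V W (v \<otimes>\<^bsub>V\<^esub> v') (w \<otimes>\<^bsub>W\<^esub> w')) t) s,
     one := ctel V W \<one>\<^bsub>V\<^esub> \<one>\<^bsub>W\<^esub>\<rparr>"

definition id_tens :: "(complex, 'v, 'x) module_scheme \<Rightarrow> (complex, 'w, 'y) module_scheme \<Rightarrow> ('u \<Rightarrow> 'w) \<Rightarrow>
    ('v, 'u) tensor \<Rightarrow> ('v, 'w) tensor" where
  "id_tens V W g = tlift (ctens V W) (\<lambda>v u. ctel V W v (g u))"

text \<open>For subspaces \<open>V' \<subseteq> V\<close>, \<open>W' \<subseteq> W\<close>: the tensor lies in the image of \<open>V' \<otimes> W'\<close> in \<open>V \<otimes> W\<close>.\<close>

definition tens_in :: "('v, 'w) tensor \<Rightarrow> 'v set \<Rightarrow> 'w set \<Rightarrow> bool" where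
  "tens_in t V' W' \<longleftrightarrow> (\<exists>p\<in>t. Poly_Mapping.keys p \<subseteq> V' \<times> W')"


section \<open>Hopf *-algebras and CQGAs\<close>

record 'a hopf = "(complex, 'a) module" +
  comult :: "'a \<Rightarrow> ('a, 'a) tensor"
  counit :: "'a \<Rightarrow> complex"
  antipode :: "'a \<Rightarrow> 'a"
  star :: "'a \<Rightarrow> 'a"

text \<open>The coassociativity axiom compares two elements of \<open>A \<otimes> (A \<otimes> V)\<close>.\<close>

definition comodule :: "'a hopf \<Rightarrow> (complex, 'v, 'x) module_scheme \<Rightarrow> ('v \<Rightarrow> ('a, 'v) tensor) \<Rightarrow> bool" where
  "comodule A V \<rho> \<longleftrightarrow> \<rho> \<in> lin_hom V (ctens A V) \<and>
     (\<forall>v\<in>carrier V.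
        id_tens A (ctens A V) \<rho> (\<rho> v) =
        tlift (ctens A (ctens A V)) (\<lambda>a v'.
          tlift (ctens A (ctens A V)) (\<lambda>x y. ctel A (ctens A V) x (ctel A V y v')) (comult A a)) (\<rho> v)) \<and>
     (\<forall>v\<in>carrier V. tlift V (\<lambda>a v'. counit A a \<odot>\<^bsub>V\<^esub> v') (\<rho> v) = v)"

definition hopf_algebra :: "'a hopf \<Rightarrow> bool" where
  "hopf_algebra A \<longleftrightarrow> calgebra A \<and>
     comodule A A (comult A) \<and>
     (\<forall>a\<in>carrier A. tlift A (\<lambda>x y. counit A y \<odot>\<^bsub>A\<^esub> x) (comult A a) = a) \<and>
     comult A \<in> ring_hom A (ctens A A) \<and>
     counit A \<in> ring_hom A CC \<inter> lin_hom A CC \<and>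
     antipode A \<in> lin_hom A A \<and>
     (\<forall>a\<in>carrier A.
        tlift A (\<lambda>x y. antipode A x \<otimes>\<^bsub>A\<^esub> y) (comult A a) = counit A a \<odot>\<^bsub>A\<^esub> \<one>\<^bsub>A\<^esub> \<and>
        tlift A (\<lambda>x y. x \<otimes>\<^bsub>A\<^esub> antipode A y) (comult A a) = counit A a \<odot>\<^bsub>A\<^esub> \<one>\<^bsub>A\<^esub>)"

definition hopf_star_algebra :: "'a hopf \<Rightarrow> bool" where
  "hopf_star_algebra A \<longleftrightarrow> hopf_algebra A \<and>
     star A \<in> lin_hom A (conj_vs A) \<and>
     (\<forall>a\<in>carrier A. star A (star A a) = a) \<and>
     (\<forall>a\<in>carrier A. \<forall>b\<in>carrier A. star A (a \<otimes>\<^bsub>A\<^esub> b) = star A b \<otimes>\<^bsub>A\<^esub> star A a) \<and>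
     (\<forall>a\<in>carrier A. comult A (star A a) =
        tlift (conj_vs (ctens A A)) (\<lambda>x y. ctel A A (star A x) (star A y)) (comult A a))"

definition hopf_star_hom :: "'a hopf \<Rightarrow> 'b hopf \<Rightarrow> ('a \<Rightarrow> 'b) \<Rightarrow> bool" where
  "hopf_star_hom A H \<pi> \<longleftrightarrow> \<pi> \<in> ring_hom A H \<inter> lin_hom A H \<and>
     (\<forall>a\<in>carrier A.
        comult H (\<pi> a) = tlift (ctens H H) (\<lambda>x y. ctel H H (\<pi> x) (\<pi> y)) (comult A a) \<and>
        counit H (\<pi> a) = counit A a \<and>
        antipode H (\<pi> a) = \<pi> (antipode A a) \<and>
        star H (\<pi> a) = \<pi> (star A a))"

definition subcoalgebra :: "'a hopf \<Rightarrow> 'a set \<Rightarrow> bool" where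
  "subcoalgebra A C \<longleftrightarrow> submodule C CC A \<and> (\<forall>c\<in>C. tens_in (comult A c) C C)"

definition simple_subcoalgebra :: "'a hopf \<Rightarrow> 'a set \<Rightarrow> bool" where
  "simple_subcoalgebra A C \<longleftrightarrow> subcoalgebra A C \<and> C \<noteq> {\<zero>\<^bsub>A\<^esub>} \<and>
     (\<forall>D. subcoalgebra A D \<and> D \<subseteq> C \<longrightarrow> D = {\<zero>\<^bsub>A\<^esub>} \<or> D = C)"

definition cosemisimple :: "'a hopf \<Rightarrow> bool" where
  "cosemisimple A \<longleftrightarrow> direct_sum A {C. simple_subcoalgebra A C} (\<lambda>C. C) (carrier A)"

definition haar_functional :: "'a hopf \<Rightarrow> ('a \<Rightarrow> complex) \<Rightarrow> bool" where
  "haar_functional A h \<longleftrightarrow> h \<in> lin_hom A CC \<inter> extensional (carrier A) \<and> h \<one>\<^bsub>A\<^esub> = 1 \<and>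
     (\<forall>a\<in>carrier A.
        tlift A (\<lambda>x y. h y \<odot>\<^bsub>A\<^esub> x) (comult A a) = h a \<odot>\<^bsub>A\<^esub> \<one>\<^bsub>A\<^esub> \<and>
        tlift A (\<lambda>x y. h x \<odot>\<^bsub>A\<^esub> y) (comult A a) = h a \<odot>\<^bsub>A\<^esub> \<one>\<^bsub>A\<^esub>)"

definition haar :: "'a hopf \<Rightarrow> 'a \<Rightarrow> complex" where
  "haar A = (THE h. haar_functional A h)"

definition cqga :: "'a hopf \<Rightarrow> bool" where
  "cqga A \<longleftrightarrow> hopf_star_algebra A \<and> cosemisimple A \<and>
     (\<exists>h. haar_functional A h \<and> (\<forall>a\<in>carrier A. h (star A a \<otimes>\<^bsub>A\<^esub> a) \<in> \<real>\<^sub>\<ge>\<^sub>0))"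


section \<open>Bimodules\<close>

record ('a, 'f) bimod = "(complex, 'f) module" +
  lact :: "'a \<Rightarrow> 'f \<Rightarrow> 'f"
  ract :: "'f \<Rightarrow> 'a \<Rightarrow> 'f"

definition left_module :: "'a hopf \<Rightarrow> 'a set \<Rightarrow> ('a, 'f, 'z) bimod_scheme \<Rightarrow> bool" where
  "left_module A B M \<longleftrightarrow> module CC M \<and> bilin (A\<lparr>carrier := B\<rparr>) M M (lact M) \<and>
     (\<forall>m\<in>carrier M. lact M \<one>\<^bsub>A\<^esub> m = m \<and>
        (\<forall>b\<in>B. \<forall>b'\<in>B. lact M (b \<otimes>\<^bsub>A\<^esub> b') m = lact M b (lact M b' m)))"

definition right_module :: "'a hopf \<Rightarrow> 'a set \<Rightarrow> ('a, 'f, 'z) bimod_scheme \<Rightarrow> bool" where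
  "right_module A B M \<longleftrightarrow> module CC M \<and> bilin M (A\<lparr>carrier := B\<rparr>) M (ract M) \<and>
     (\<forall>m\<in>carrier M. ract M m \<one>\<^bsub>A\<^esub> = m \<and>
        (\<forall>b\<in>B. \<forall>b'\<in>B. ract M m (b \<otimes>\<^bsub>A\<^esub> b') = ract M (ract M m b) b'))"

definition bimodule :: "'a hopf \<Rightarrow> 'a set \<Rightarrow> ('a, 'f, 'z) bimod_scheme \<Rightarrow> bool" where
  "bimodule A B M \<longleftrightarrow> left_module A B M \<and> right_module A B M \<and>
     (\<forall>m\<in>carrier M. \<forall>b\<in>B. \<forall>b'\<in>B. ract M (lact M b m) b' = lact M b (ract M m b'))"

definition left_hom :: "'a set \<Rightarrow> ('a, 'f, 'z) bimod_scheme \<Rightarrow> ('a, 'g, 'y) bimod_scheme \<Rightarrow> ('f \<Rightarrow> 'g) \<Rightarrow> bool" where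
  "left_hom B M M' f \<longleftrightarrow> f \<in> lin_hom M M' \<and> (\<forall>b\<in>B. \<forall>m\<in>carrier M. f (lact M b m) = lact M' b (f m))"

definition right_hom :: "'a set \<Rightarrow> ('a, 'f, 'z) bimod_scheme \<Rightarrow> ('a, 'g, 'y) bimod_scheme \<Rightarrow> ('f \<Rightarrow> 'g) \<Rightarrow> bool" where
  "right_hom B M M' f \<longleftrightarrow> f \<in> lin_hom M M' \<and> (\<forall>b\<in>B. \<forall>m\<in>carrier M. f (ract M m b) = ract M' (f m) b)"

definition bimod_iso :: "'a set \<Rightarrow> ('a, 'f, 'z) bimod_scheme \<Rightarrow> ('a, 'g, 'y) bimod_scheme \<Rightarrow> ('f \<Rightarrow> 'g) \<Rightarrow> bool" where
  "bimod_iso B M M' f \<longleftrightarrow> left_hom B M M' f \<and> right_hom B M M' f \<and> bij_betw f (carrier M) (carrier M')"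

definition left_fin_gen :: "'a set \<Rightarrow> ('a, 'f, 'z) bimod_scheme \<Rightarrow> bool" where
  "left_fin_gen B M \<longleftrightarrow> (\<exists>X. finite X \<and> X \<subseteq> carrier M \<and>
     (\<forall>m\<in>carrier M. \<exists>c\<in>(X \<rightarrow> B). m = finsum M (\<lambda>x. lact M (c x) x) X))"

definition regular :: "'a hopf \<Rightarrow> 'a set \<Rightarrow> ('a, 'a) bimod" where
  "regular A B = \<lparr>carrier = B, mult = mult A, one = one A, zero = zero A, add = add A, smult = smult A,
     lact = mult A, ract = mult A\<rparr>"

definition balancing :: "'a set \<Rightarrow> ('a, 'v, 'x) bimod_scheme \<Rightarrow> ('a, 'w, 'y) bimod_scheme \<Rightarrow> ('v \<times> 'w \<Rightarrow>\<^sub>0 complex) set" where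
  "balancing B V W = {gen (ract V v b) w - gen v (lact W b w) | v b w. v \<in> carrier V \<and> b \<in> B \<and> w \<in> carrier W}"

definition btens :: "'a set \<Rightarrow> ('a, 'v, 'x) bimod_scheme \<Rightarrow> ('a, 'w, 'y) bimod_scheme \<Rightarrow> (complex, ('v, 'w) tensor) module" where
  "btens B V W = tspace V W (balancing B V W)"

definition btel :: "'a set \<Rightarrow> ('a, 'v, 'x) bimod_scheme \<Rightarrow> ('a, 'w, 'y) bimod_scheme \<Rightarrow> 'v \<Rightarrow> 'w \<Rightarrow> ('v, 'w) tensor" where
  "btel B V W v w = tclass V W (balancing B V W) (gen v w)"

definition exact :: "(complex, 'u, 'x) module_scheme \<Rightarrow> (complex, 'v, 'y) module_scheme \<Rightarrow>
    (complex, 'w, 'z) module_scheme \<Rightarrow> ('u \<Rightarrow> 'v) \<Rightarrow> ('v \<Rightarrow> 'w) \<Rightarrow> bool" where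
  "exact U V W f g \<longleftrightarrow> f ` carrier U = {v \<in> carrier V. g v = \<zero>\<^bsub>W\<^esub>}"

text \<open>
  \<open>A\<close> is faithfully flat as a right \<open>B\<close>-module: \<open>A \<otimes>\<^sub>B -\<close> preserves and reflects exact sequences
  of left \<open>B\<close>-modules.  The underlying sets of the modules range over the type \<open>(nat \<Rightarrow> 'a) set\<close>.
  Every countably generated left \<open>B\<close>-module (a quotient of a direct sum of copies of \<open>B\<close>, realised as a
  set of cosets) is isomorphic to one with such an underlying set.  This loses nothing: flatness can be tested on the
  inclusions of finitely generated left ideals, and faithfulness of a flat module on the sequences
  \<open>0 \<rightarrow> B/J \<rightarrow> 0\<close> for left ideals \<open>J\<close>.
\<close>

definition faithfully_flat :: "'a hopf \<Rightarrow> 'a set \<Rightarrow> bool" where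
  "faithfully_flat A B \<longleftrightarrow>
     (\<forall>(M :: ('a, (nat \<Rightarrow> 'a) set) bimod) (M' :: ('a, (nat \<Rightarrow> 'a) set) bimod) (M'' :: ('a, (nat \<Rightarrow> 'a) set) bimod) f g.
        left_module A B M \<and> left_module A B M' \<and> left_module A B M'' \<and> left_hom B M M' f \<and> left_hom B M' M'' g \<longrightarrow>
        (let R = regular A (carrier A) in
         exact M M' M'' f g \<longleftrightarrow>
         exact (btens B R M) (btens B R M') (btens B R M'')
           (tlift (btens B R M') (\<lambda>a m. btel B R M' a (f m)))
           (tlift (btens B R M'') (\<lambda>a m. btel B R M'' a (g m)))))"


section \<open>Quantum homogeneous spaces\<close>

definition aug :: "'a hopf \<Rightarrow> 'a set \<Rightarrow> 'a set" where
  "aug A B = {b \<in> B. counit A b = 0}"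

definition left_coideal_subalgebra :: "'a hopf \<Rightarrow> 'a set \<Rightarrow> bool" where
  "left_coideal_subalgebra A B \<longleftrightarrow> subalg A B \<and> (\<forall>b\<in>B. tens_in (comult A b) (carrier A) B)"

definition quantum_homogeneous_space :: "'a hopf \<Rightarrow> 'a set \<Rightarrow> bool" where
  "quantum_homogeneous_space A B \<longleftrightarrow> left_coideal_subalgebra A B \<and> faithfully_flat A B \<and>
     aug A B \<cdot>\<^bsub>A\<^esub> carrier A = carrier A \<cdot>\<^bsub>A\<^esub> aug A B"

definition proj :: "'a hopf \<Rightarrow> 'a set \<Rightarrow> 'a \<Rightarrow> 'a set" where
  "proj A B a = (aug A B \<cdot>\<^bsub>A\<^esub> carrier A) +>\<^bsub>A\<^esub> a"

definition quotient_algebra :: "'a hopf \<Rightarrow> 'a set \<Rightarrow> (complex, 'a set) module" where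
  "quotient_algebra A B = (let Q = A Quot (aug A B \<cdot>\<^bsub>A\<^esub> carrier A) in
    \<lparr>carrier = carrier Q, mult = mult Q, one = one Q, zero = zero Q, add = add Q,
     smult = (\<lambda>c X. proj A B (c \<odot>\<^bsub>A\<^esub> (SOME a. a \<in> X)))\<rparr>)"

text \<open>
  The operations on \<open>\<pi>\<^sub>B(A) = A/B\<^sup>+A\<close> are defined on representatives; their independence of the
  choice is part of the requirement that \<^const>\<open>proj\<close> be a Hopf *-map in \<open>cqga_homogeneous_space\<close>.
\<close>

definition quotient_hopf :: "'a hopf \<Rightarrow> 'a set \<Rightarrow> 'a set hopf" where
  "quotient_hopf A B = (let Q = quotient_algebra A B in
    \<lparr>carrier = carrier Q, mult = mult Q, one = one Q, zero = zero Q, add = add Q, smult = smult Q,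
     comult = (\<lambda>X. tlift (ctens Q Q) (\<lambda>x y. ctel Q Q (proj A B x) (proj A B y)) (comult A (SOME a. a \<in> X))),
     counit = (\<lambda>X. counit A (SOME a. a \<in> X)),
     antipode = (\<lambda>X. proj A B (antipode A (SOME a. a \<in> X))),
     star = (\<lambda>X. proj A B (star A (SOME a. a \<in> X)))\<rparr>)"

definition cqga_homogeneous_space :: "'a hopf \<Rightarrow> 'a set \<Rightarrow> bool" where
  "cqga_homogeneous_space A B \<longleftrightarrow> cqga A \<and> quantum_homogeneous_space A B \<and> cqga (quotient_hopf A B) \<and>
     (\<forall>b\<in>B. star A b \<in> B) \<and> hopf_star_hom A (quotient_hopf A B) (proj A B)"

definition positive_elements :: "'a hopf \<Rightarrow> 'a set \<Rightarrow> 'a set" where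
  "positive_elements A B = {finsum A (\<lambda>i. star A (b i) \<otimes>\<^bsub>A\<^esub> b i) {..<m} | (m::nat) b. b \<in> {..<m} \<rightarrow> B} - {\<zero>\<^bsub>A\<^esub>}"


section \<open>Relative Hopf modules\<close>

record ('a, 'f) relmod = "('a, 'f) bimod" +
  coact :: "'f \<Rightarrow> ('a, 'f) tensor"

text \<open>
  The comultiplication restricts to a coaction of \<open>A\<close> on \<open>B\<close>; its values are re-read as elements of
  \<open>A \<otimes> B\<close> (rather than \<open>A \<otimes> A\<close>), so that second legs can act on \<open>B\<close>-modules.
\<close>

definition base_coact :: "'a hopf \<Rightarrow> 'a set \<Rightarrow> 'a \<Rightarrow> ('a, 'a) tensor" where
  "base_coact A B b = (THE t. t \<in> carrier (ctens A (regular A B)) \<and>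
     tlift (ctens A A) (\<lambda>x y. ctel A A x y) t = comult A b)"

text \<open>\<open>f b = f\<^sub>(\<^sub>-\<^sub>2\<^sub>) b S(f\<^sub>(\<^sub>-\<^sub>1\<^sub>)) f\<^sub>(\<^sub>0\<^sub>)\<close>\<close>

definition induced_ract :: "'a hopf \<Rightarrow> ('a, 'f, 'z) relmod_scheme \<Rightarrow> 'f \<Rightarrow> 'a \<Rightarrow> 'f" where
  "induced_ract A F f b = tlift F (\<lambda>a f'.
     lact F (tlift A (\<lambda>x y. x \<otimes>\<^bsub>A\<^esub> b \<otimes>\<^bsub>A\<^esub> antipode A y) (comult A a)) f') (coact F f)"

text \<open>Objects and morphisms of \<open>\<^sup>A\<^sub>Bmod\<^sub>0\<close>.\<close>

definition relmod_obj :: "'a hopf \<Rightarrow> 'a set \<Rightarrow> ('a, 'f, 'z) relmod_scheme \<Rightarrow> bool" where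
  "relmod_obj A B F \<longleftrightarrow> left_module A B F \<and> comodule A F (coact F) \<and>
     (\<forall>b\<in>B. \<forall>f\<in>carrier F. coact F (lact F b f) =
        tlift (ctens A F) (\<lambda>x b'.
          tlift (ctens A F) (\<lambda>y f'. ctel A F (x \<otimes>\<^bsub>A\<^esub> y) (lact F b' f')) (coact F f)) (base_coact A B b)) \<and>
     left_fin_gen B F \<and>
     (\<forall>f\<in>carrier F. \<forall>b\<in>B. ract F f b = induced_ract A F f b)"

definition comodule_map :: "'a hopf \<Rightarrow> ('a, 'f, 'z) relmod_scheme \<Rightarrow> ('a, 'g, 'y) relmod_scheme \<Rightarrow> ('f \<Rightarrow> 'g) \<Rightarrow> bool" where
  "comodule_map A X Y f \<longleftrightarrow> f \<in> lin_hom X Y \<and>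
     (\<forall>x\<in>carrier X. coact Y (f x) = id_tens A Y f (coact X x))"

definition relmod_hom :: "'a hopf \<Rightarrow> 'a set \<Rightarrow> ('a, 'f, 'z) relmod_scheme \<Rightarrow> ('a, 'g, 'y) relmod_scheme \<Rightarrow> ('f \<Rightarrow> 'g) \<Rightarrow> bool" where
  "relmod_hom A B X Y f \<longleftrightarrow> left_hom B X Y f \<and> comodule_map A X Y f"

definition subobject :: "'a hopf \<Rightarrow> 'a set \<Rightarrow> ('a, 'f, 'z) relmod_scheme \<Rightarrow> 'f set \<Rightarrow> bool" where
  "subobject A B X U \<longleftrightarrow> submodule U CC X \<and> (\<forall>b\<in>B. \<forall>u\<in>U. lact X b u \<in> U) \<and>
     (\<forall>u\<in>U. tens_in (coact X u) (carrier A) U) \<and> left_fin_gen B (X\<lparr>carrier := U\<rparr>)"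

text \<open>The conjugate: \<open>f\<close> itself represents the element usually written with a bar over \<open>f\<close>.\<close>

definition conj_bimod :: "'a hopf \<Rightarrow> ('a, 'f, 'z) bimod_scheme \<Rightarrow> ('a, 'f, 'z) bimod_scheme" where
  "conj_bimod A F = F\<lparr>smult := \<lambda>c f. cnj c \<odot>\<^bsub>F\<^esub> f,
     lact := \<lambda>b f. ract F f (star A b), ract := \<lambda>f b. lact F (star A b) f\<rparr>"

definition conj_relmod :: "'a hopf \<Rightarrow> ('a, 'f, 'z) relmod_scheme \<Rightarrow> ('a, 'f, 'z) relmod_scheme" where
  "conj_relmod A F = (conj_bimod A F)\<lparr>coact := \<lambda>f.
     tlift (conj_vs (ctens A (conj_bimod A F))) (\<lambda>a f'. ctel A (conj_bimod A F) (star A a) f') (coact F f)\<rparr>"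

definition dual_bimod :: "'a hopf \<Rightarrow> 'a set \<Rightarrow> ('a, 'f, 'z) bimod_scheme \<Rightarrow> ('a, 'f \<Rightarrow> 'a) bimod" where
  "dual_bimod A B F =
    \<lparr>carrier = {\<phi> \<in> extensional (carrier F). right_hom B F (regular A B) \<phi>},
     mult = undefined, one = undefined,
     zero = (\<lambda>f\<in>carrier F. \<zero>\<^bsub>A\<^esub>),
     add = (\<lambda>\<phi> \<psi>. \<lambda>f\<in>carrier F. \<phi> f \<oplus>\<^bsub>A\<^esub> \<psi> f),
     smult = (\<lambda>c \<phi>. \<lambda>f\<in>carrier F. c \<odot>\<^bsub>A\<^esub> \<phi> f),
     lact = (\<lambda>b \<phi>. \<lambda>f\<in>carrier F. b \<otimes>\<^bsub>A\<^esub> \<phi> f),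
     ract = (\<lambda>\<phi> b. \<lambda>f\<in>carrier F. \<phi> (lact F b f))\<rparr>"

text \<open>
  The coaction on the dual is the unique one making the evaluation of \<open>F\<^sup>\<or> \<otimes>\<^sub>B F\<close> in \<open>B\<close> a comodule map,
  \<open>\<phi>\<^sub>(\<^sub>-\<^sub>1\<^sub>) f\<^sub>(\<^sub>-\<^sub>1\<^sub>) \<otimes> \<phi>\<^sub>(\<^sub>0\<^sub>)(f\<^sub>(\<^sub>0\<^sub>)) = \<phi>(f)\<^sub>(\<^sub>-\<^sub>1\<^sub>) \<otimes> \<phi>(f)\<^sub>(\<^sub>0\<^sub>)\<close>; explicitly
  \<open>\<phi>\<^sub>(\<^sub>-\<^sub>1\<^sub>) \<otimes> \<phi>\<^sub>(\<^sub>0\<^sub>)(f) = \<phi>(f\<^sub>(\<^sub>0\<^sub>))\<^sub>(\<^sub>-\<^sub>1\<^sub>) S\<^sup>-\<^sup>1(f\<^sub>(\<^sub>-\<^sub>1\<^sub>)) \<otimes> \<phi>(f\<^sub>(\<^sub>0\<^sub>))\<^sub>(\<^sub>0\<^sub>)\<close>.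
\<close>

definition dual_coact :: "'a hopf \<Rightarrow> 'a set \<Rightarrow> ('a, 'f, 'z) relmod_scheme \<Rightarrow> ('f \<Rightarrow> 'a) \<Rightarrow> ('a, 'f \<Rightarrow> 'a) tensor" where
  "dual_coact A B F \<phi> = (THE t. t \<in> carrier (ctens A (dual_bimod A B F)) \<and>
     (\<forall>f\<in>carrier F.
        tlift (ctens A (regular A B)) (\<lambda>x \<psi>.
          tlift (ctens A (regular A B)) (\<lambda>y k. ctel A (regular A B) (x \<otimes>\<^bsub>A\<^esub> y) (\<psi> k)) (coact F f)) t
        = base_coact A B (\<phi> f)))"

definition dual_relmod :: "'a hopf \<Rightarrow> 'a set \<Rightarrow> ('a, 'f, 'z) relmod_scheme \<Rightarrow> ('a, 'f \<Rightarrow> 'a) relmod" where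
  "dual_relmod A B F = bimod.extend (dual_bimod A B F) (relmod.fields (dual_coact A B F))"

definition tens_relmod :: "'a hopf \<Rightarrow> 'a set \<Rightarrow> ('a, 'v, 'x) relmod_scheme \<Rightarrow> ('a, 'w, 'y) relmod_scheme \<Rightarrow> ('a, ('v, 'w) tensor) relmod" where
  "tens_relmod A B V W = (let T = btens B V W in
    \<lparr>carrier = carrier T, mult = mult T, one = one T, zero = zero T, add = add T, smult = smult T,
     lact = (\<lambda>b. tlift T (\<lambda>v w. btel B V W (lact V b v) w)),
     ract = (\<lambda>t b. tlift T (\<lambda>v w. btel B V W v (ract W w b)) t),
     coact = tlift (ctens A T) (\<lambda>v w.
       tlift (ctens A T) (\<lambda>x v'.
         tlift (ctens A T) (\<lambda>y w'. ctel A T (x \<otimes>\<^bsub>A\<^esub> y) (btel B V W v' w')) (coact W w)) (coact V v))\<rparr>)"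


section \<open>Covariant *-differential calculi\<close>

text \<open>
  The product of the record is the wedge product, and \<open>emb\<close> identifies \<open>B\<close> with the degree zero part
  \<open>grade 0\<close>.
\<close>

record ('a, 'w) dcalc = "('a, 'w) relmod" +
  grade :: "nat \<Rightarrow> 'w set"
  dif :: "'w \<Rightarrow> 'w"
  fstar :: "'w \<Rightarrow> 'w"
  emb :: "'a \<Rightarrow> 'w"

definition differential_calculus :: "'a hopf \<Rightarrow> 'a set \<Rightarrow> ('a, 'w) dcalc \<Rightarrow> bool" where
  "differential_calculus A B \<Omega> \<longleftrightarrow> calgebra \<Omega> \<and>
     direct_sum \<Omega> UNIV (grade \<Omega>) (carrier \<Omega>) \<and>
     (\<forall>k l. \<forall>\<omega>\<in>grade \<Omega> k. \<forall>\<nu>\<in>grade \<Omega> l. \<omega> \<otimes>\<^bsub>\<Omega>\<^esub> \<nu> \<in> grade \<Omega> (k + l)) \<and>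
     emb \<Omega> \<in> ring_hom (A\<lparr>carrier := B\<rparr>) \<Omega> \<inter> lin_hom (A\<lparr>carrier := B\<rparr>) \<Omega> \<and>
     bij_betw (emb \<Omega>) B (grade \<Omega> 0) \<and>
     (\<forall>b\<in>B. \<forall>\<omega>\<in>carrier \<Omega>. lact \<Omega> b \<omega> = emb \<Omega> b \<otimes>\<^bsub>\<Omega>\<^esub> \<omega> \<and> ract \<Omega> \<omega> b = \<omega> \<otimes>\<^bsub>\<Omega>\<^esub> emb \<Omega> b) \<and>
     dif \<Omega> \<in> lin_hom \<Omega> \<Omega> \<and>
     (\<forall>k. \<forall>\<omega>\<in>grade \<Omega> k. dif \<Omega> \<omega> \<in> grade \<Omega> (k + 1)) \<and>
     (\<forall>\<omega>\<in>carrier \<Omega>. dif \<Omega> (dif \<Omega> \<omega>) = \<zero>\<^bsub>\<Omega>\<^esub>) \<and>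
     (\<forall>k. \<forall>\<omega>\<in>grade \<Omega> k. \<forall>\<nu>\<in>carrier \<Omega>.
        dif \<Omega> (\<omega> \<otimes>\<^bsub>\<Omega>\<^esub> \<nu>) = (dif \<Omega> \<omega> \<otimes>\<^bsub>\<Omega>\<^esub> \<nu>) \<oplus>\<^bsub>\<Omega>\<^esub> ((-1) ^ k \<odot>\<^bsub>\<Omega>\<^esub> (\<omega> \<otimes>\<^bsub>\<Omega>\<^esub> dif \<Omega> \<nu>))) \<and>
     (\<forall>X. subalg \<Omega> X \<and> emb \<Omega> ` B \<subseteq> X \<and> dif \<Omega> ` emb \<Omega> ` B \<subseteq> X \<longrightarrow> X = carrier \<Omega>)"

definition total_degree :: "('a, 'w) dcalc \<Rightarrow> nat \<Rightarrow> bool" where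
  "total_degree \<Omega> m \<longleftrightarrow> grade \<Omega> m \<noteq> {\<zero>\<^bsub>\<Omega>\<^esub>} \<and> (\<forall>k>m. grade \<Omega> k = {\<zero>\<^bsub>\<Omega>\<^esub>})"

definition star_calculus :: "'a hopf \<Rightarrow> 'a set \<Rightarrow> ('a, 'w) dcalc \<Rightarrow> bool" where
  "star_calculus A B \<Omega> \<longleftrightarrow> differential_calculus A B \<Omega> \<and>
     fstar \<Omega> \<in> lin_hom \<Omega> (conj_vs \<Omega>) \<and>
     (\<forall>b\<in>B. fstar \<Omega> (emb \<Omega> b) = emb \<Omega> (star A b)) \<and>
     (\<forall>\<omega>\<in>carrier \<Omega>. fstar \<Omega> (fstar \<Omega> \<omega>) = \<omega>) \<and>
     (\<forall>\<omega>\<in>carrier \<Omega>. dif \<Omega> (fstar \<Omega> \<omega>) = fstar \<Omega> (dif \<Omega> \<omega>)) \<and>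
     (\<forall>k l. \<forall>\<omega>\<in>grade \<Omega> k. \<forall>\<nu>\<in>grade \<Omega> l.
        fstar \<Omega> (\<omega> \<otimes>\<^bsub>\<Omega>\<^esub> \<nu>) = (-1) ^ (k * l) \<odot>\<^bsub>\<Omega>\<^esub> (fstar \<Omega> \<nu> \<otimes>\<^bsub>\<Omega>\<^esub> fstar \<Omega> \<omega>))"

text \<open>
  Since \<open>\<Omega>\<close> is an object of \<open>\<^sup>A\<^sub>Bmod\<^sub>0\<close>, right multiplication by \<open>B\<close> is the right action determined by
  the coaction.
\<close>

definition covariant_calculus :: "'a hopf \<Rightarrow> 'a set \<Rightarrow> ('a, 'w) dcalc \<Rightarrow> bool" where
  "covariant_calculus A B \<Omega> \<longleftrightarrow> relmod_obj A B \<Omega> \<and>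
     coact \<Omega> \<in> ring_hom \<Omega> (ctens A \<Omega>) \<and>
     (\<forall>b\<in>B. coact \<Omega> (emb \<Omega> b) = id_tens A \<Omega> (emb \<Omega>) (base_coact A B b)) \<and>
     comodule_map A \<Omega> \<Omega> (dif \<Omega>)"


section \<open>Complex and Hermitian structures\<close>

definition complex_structure :: "('a, 'w) dcalc \<Rightarrow> (nat \<Rightarrow> nat \<Rightarrow> 'w set) \<Rightarrow> bool" where
  "complex_structure \<Omega> \<Omega>\<Omega> \<longleftrightarrow>
     (\<forall>k. direct_sum \<Omega> {(a, b). a + b = k} (\<lambda>(a, b). \<Omega>\<Omega> a b) (grade \<Omega> k)) \<and>
     (\<forall>a b c e. \<forall>\<omega>\<in>\<Omega>\<Omega> a b. \<forall>\<nu>\<in>\<Omega>\<Omega> c e. \<omega> \<otimes>\<^bsub>\<Omega>\<^esub> \<nu> \<in> \<Omega>\<Omega> (a + c) (b + e)) \<and>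
     (\<forall>a b. fstar \<Omega> ` \<Omega>\<Omega> a b = \<Omega>\<Omega> b a) \<and>
     (\<exists>del delbar. del \<in> lin_hom \<Omega> \<Omega> \<and> delbar \<in> lin_hom \<Omega> \<Omega> \<and>
        (\<forall>a b. \<forall>\<omega>\<in>\<Omega>\<Omega> a b. del \<omega> \<in> \<Omega>\<Omega> (a + 1) b \<and> delbar \<omega> \<in> \<Omega>\<Omega> a (b + 1)) \<and>
        (\<forall>\<omega>\<in>carrier \<Omega>. dif \<Omega> \<omega> = del \<omega> \<oplus>\<^bsub>\<Omega>\<^esub> delbar \<omega>))"

definition lefschetz :: "('a, 'w) dcalc \<Rightarrow> 'w \<Rightarrow> 'w \<Rightarrow> 'w" where
  "lefschetz \<Omega> \<sigma> \<omega> = \<sigma> \<otimes>\<^bsub>\<Omega>\<^esub> \<omega>"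

definition hermitian_structure :: "('a, 'w) dcalc \<Rightarrow> (nat \<Rightarrow> nat \<Rightarrow> 'w set) \<Rightarrow> 'w \<Rightarrow> nat \<Rightarrow> bool" where
  "hermitian_structure \<Omega> \<Omega>\<Omega> \<sigma> n \<longleftrightarrow> total_degree \<Omega> (2 * n) \<and> complex_structure \<Omega> \<Omega>\<Omega> \<and>
     \<sigma> \<in> \<Omega>\<Omega> 1 1 \<and> fstar \<Omega> \<sigma> = \<sigma> \<and> (\<forall>\<omega>\<in>carrier \<Omega>. \<sigma> \<otimes>\<^bsub>\<Omega>\<^esub> \<omega> = \<omega> \<otimes>\<^bsub>\<Omega>\<^esub> \<sigma>) \<and>
     (\<forall>k<n. bij_betw (lefschetz \<Omega> \<sigma> ^^ (n - k)) (grade \<Omega> k) (grade \<Omega> (2 * n - k)))"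

definition primitive :: "('a, 'w) dcalc \<Rightarrow> 'w \<Rightarrow> nat \<Rightarrow> nat \<Rightarrow> 'w set" where
  "primitive \<Omega> \<sigma> n k =
     (if k \<le> n then {\<alpha> \<in> grade \<Omega> k. (lefschetz \<Omega> \<sigma> ^^ (n - k + 1)) \<alpha> = \<zero>\<^bsub>\<Omega>\<^esub>} else {\<zero>\<^bsub>\<Omega>\<^esub>})"

definition hodge :: "('a, 'w) dcalc \<Rightarrow> (nat \<Rightarrow> nat \<Rightarrow> 'w set) \<Rightarrow> 'w \<Rightarrow> nat \<Rightarrow> 'w \<Rightarrow> 'w" where
  "hodge \<Omega> \<Omega>\<Omega> \<sigma> n = (THE H. H \<in> lin_hom \<Omega> \<Omega> \<inter> extensional (carrier \<Omega>) \<and>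
     (\<forall>a b j k. \<forall>\<alpha>\<in>primitive \<Omega> \<sigma> n k \<inter> \<Omega>\<Omega> a b. a + b = k \<and> j + k \<le> n \<longrightarrow>
        H ((lefschetz \<Omega> \<sigma> ^^ j) \<alpha>) =
        ((-1) ^ (k * (k + 1) div 2) * \<i> powi (int a - int b) * (fact j / fact (n - j - k)))
          \<odot>\<^bsub>\<Omega>\<^esub> (lefschetz \<Omega> \<sigma> ^^ (n - j - k)) \<alpha>))"

definition component :: "('a, 'w) dcalc \<Rightarrow> nat \<Rightarrow> 'w \<Rightarrow> 'w" where
  "component \<Omega> k \<omega> = (THE c. decomposition \<Omega> UNIV (grade \<Omega>) \<omega> c) k"

definition metric :: "'a hopf \<Rightarrow> 'a set \<Rightarrow> ('a, 'w) dcalc \<Rightarrow> (nat \<Rightarrow> nat \<Rightarrow> 'w set) \<Rightarrow> 'w \<Rightarrow> nat \<Rightarrow> 'w \<Rightarrow> 'w \<Rightarrow> 'a" where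
  "metric A B \<Omega> \<Omega>\<Omega> \<sigma> n \<omega> \<nu> = finsum A (\<lambda>k. the_inv_into B (emb \<Omega>)
     (hodge \<Omega> \<Omega>\<Omega> \<sigma> n (hodge \<Omega> \<Omega>\<Omega> \<sigma> n (fstar \<Omega> (component \<Omega> k \<omega>)) \<otimes>\<^bsub>\<Omega>\<^esub> component \<Omega> k \<nu>))) {..2 * n}"

definition positive_definite :: "'a hopf \<Rightarrow> 'a set \<Rightarrow> ('a, 'w) dcalc \<Rightarrow> (nat \<Rightarrow> nat \<Rightarrow> 'w set) \<Rightarrow> 'w \<Rightarrow> nat \<Rightarrow> bool" where
  "positive_definite A B \<Omega> \<Omega>\<Omega> \<sigma> n \<longleftrightarrow>
     (\<forall>\<omega>\<in>carrier \<Omega> - {\<zero>\<^bsub>\<Omega>\<^esub>}. metric A B \<Omega> \<Omega>\<Omega> \<sigma> n \<omega> \<omega> \<in> positive_elements A B)"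

definition form_integral :: "'a hopf \<Rightarrow> 'a set \<Rightarrow> ('a, 'w) dcalc \<Rightarrow> (nat \<Rightarrow> nat \<Rightarrow> 'w set) \<Rightarrow> 'w \<Rightarrow> nat \<Rightarrow> 'w \<Rightarrow> complex" where
  "form_integral A B \<Omega> \<Omega>\<Omega> \<sigma> n \<omega> = haar A (the_inv_into B (emb \<Omega>) (hodge \<Omega> \<Omega>\<Omega> \<sigma> n \<omega>))"

definition cqh_hermitian_space :: "'a hopf \<Rightarrow> 'a set \<Rightarrow> ('a, 'w) dcalc \<Rightarrow> (nat \<Rightarrow> nat \<Rightarrow> 'w set) \<Rightarrow> 'w \<Rightarrow> nat \<Rightarrow> bool" where
  "cqh_hermitian_space A B \<Omega> \<Omega>\<Omega> \<sigma> n \<longleftrightarrow>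
     cqga_homogeneous_space A B \<and> star_calculus A B \<Omega> \<and> covariant_calculus A B \<Omega> \<and>
     hermitian_structure \<Omega> \<Omega>\<Omega> \<sigma> n \<and> positive_definite A B \<Omega> \<Omega>\<Omega> \<sigma> n \<and>
     (\<forall>a b. subobject A B \<Omega> (\<Omega>\<Omega> a b)) \<and>
     coact \<Omega> \<sigma> = ctel A \<Omega> \<one>\<^bsub>A\<^esub> \<sigma> \<and>
     (\<forall>k. k + 1 = 2 * n \<longrightarrow> (\<forall>\<omega>\<in>grade \<Omega> k. form_integral A B \<Omega> \<Omega>\<Omega> \<sigma> n (dif \<Omega> \<omega>) = 0))"


section \<open>Hermitian modules\<close>

definition weak_hermitian_module :: "'a hopf \<Rightarrow> 'a set \<Rightarrow> ('a, 'f, 'z) bimod_scheme \<Rightarrow> ('f \<Rightarrow> 'f \<Rightarrow> 'a) \<Rightarrow> bool" where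
  "weak_hermitian_module A B F h \<longleftrightarrow> bimodule A B F \<and>
     bimod_iso B (conj_bimod A F) (dual_bimod A B F) h \<and>
     (\<forall>f\<in>carrier F. \<forall>k\<in>carrier F. h f k = star A (h k f)) \<and>
     (\<forall>f\<in>carrier F - {\<zero>\<^bsub>F\<^esub>}. h f f \<in> positive_elements A B)"

text \<open>
  \<open>g\<^sub>F(\<omega> \<otimes> f, \<nu> \<otimes> k) = h(f, g\<^sub>\<sigma>(\<omega>, \<nu>) k)\<close>, conjugate-linear in the first argument; as a function of its
  second argument it is extensional, like the elements of \<^const>\<open>dual_bimod\<close>.
\<close>

definition twisted_metric :: "'a hopf \<Rightarrow> 'a set \<Rightarrow> ('a, 'w) dcalc \<Rightarrow> (nat \<Rightarrow> nat \<Rightarrow> 'w set) \<Rightarrow> 'w \<Rightarrow> nat \<Rightarrow>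
    ('a, 'f) relmod \<Rightarrow> ('f \<Rightarrow> 'f \<Rightarrow> 'a) \<Rightarrow> ('w, 'f) tensor \<Rightarrow> ('w, 'f) tensor \<Rightarrow> 'a" where
  "twisted_metric A B \<Omega> \<Omega>\<Omega> \<sigma> n F h s = (\<lambda>t\<in>carrier (btens B \<Omega> F).
     tlift (conj_vs A) (\<lambda>\<omega> f.
       tlift A (\<lambda>\<nu> k. h f (lact F (metric A B \<Omega> \<Omega>\<Omega> \<sigma> n \<omega> \<nu>) k)) t) s)"

definition covariant_hermitian_module :: "'a hopf \<Rightarrow> 'a set \<Rightarrow> ('a, 'w) dcalc \<Rightarrow> (nat \<Rightarrow> nat \<Rightarrow> 'w set) \<Rightarrow> 'w \<Rightarrow> nat \<Rightarrow>
    ('a, 'f) relmod \<Rightarrow> ('f \<Rightarrow> 'f \<Rightarrow> 'a) \<Rightarrow> bool" where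
  "covariant_hermitian_module A B \<Omega> \<Omega>\<Omega> \<sigma> n F h \<longleftrightarrow>
     weak_hermitian_module A B F h \<and>
     weak_hermitian_module A B (tens_relmod A B \<Omega> F) (twisted_metric A B \<Omega> \<Omega>\<Omega> \<sigma> n F h) \<and>
     relmod_obj A B F \<and>
     relmod_hom A B (conj_relmod A F) (dual_relmod A B F) h"


section \<open>Completion and bounded operators\<close>

record 'm ipspace = "(complex, 'm) module" +
  iprod :: "'m \<Rightarrow> 'm \<Rightarrow> complex"

definition hnorm :: "'m ipspace \<Rightarrow> 'm \<Rightarrow> real" where
  "hnorm H x = sqrt (Re (iprod H x x))"

definition cauchy_seqs :: "'m ipspace \<Rightarrow> (nat \<Rightarrow> 'm) set" where
  "cauchy_seqs H = {s. range s \<subseteq> carrier H \<and>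
     (\<forall>e>0. \<exists>N. \<forall>i\<ge>N. \<forall>j\<ge>N. hnorm H (s i \<ominus>\<^bsub>H\<^esub> s j) < e)}"

definition seq_class :: "'m ipspace \<Rightarrow> (nat \<Rightarrow> 'm) \<Rightarrow> (nat \<Rightarrow> 'm) set" where
  "seq_class H s = {t \<in> cauchy_seqs H. (\<lambda>i. hnorm H (s i \<ominus>\<^bsub>H\<^esub> t i)) \<longlonglongrightarrow> 0}"

definition completion :: "'m ipspace \<Rightarrow> (nat \<Rightarrow> 'm) set ipspace" where
  "completion H =
    \<lparr>carrier = seq_class H ` cauchy_seqs H,
     mult = undefined, one = undefined,
     zero = seq_class H (\<lambda>_. \<zero>\<^bsub>H\<^esub>),
     add = (\<lambda>X Y. seq_class H (\<lambda>i. (SOME s. s \<in> X) i \<oplus>\<^bsub>H\<^esub> (SOME t. t \<in> Y) i)),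
     smult = (\<lambda>c X. seq_class H (\<lambda>i. c \<odot>\<^bsub>H\<^esub> (SOME s. s \<in> X) i)),
     iprod = (\<lambda>X Y. lim (\<lambda>i. iprod H ((SOME s. s \<in> X) i) ((SOME t. t \<in> Y) i)))\<rparr>"

definition to_completion :: "'m ipspace \<Rightarrow> 'm \<Rightarrow> (nat \<Rightarrow> 'm) set" where
  "to_completion H x = seq_class H (\<lambda>_. x)"

definition bounded_operator :: "'m ipspace \<Rightarrow> ('m \<Rightarrow> 'm) \<Rightarrow> bool" where
  "bounded_operator H T \<longleftrightarrow> T \<in> lin_hom H H \<and> (\<exists>C. \<forall>x\<in>carrier H. hnorm H (T x) \<le> C * hnorm H x)"

definition twisted_forms :: "'a hopf \<Rightarrow> 'a set \<Rightarrow> ('a, 'w) dcalc \<Rightarrow> (nat \<Rightarrow> nat \<Rightarrow> 'w set) \<Rightarrow> 'w \<Rightarrow> nat \<Rightarrow>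
    ('a, 'f) relmod \<Rightarrow> ('f \<Rightarrow> 'f \<Rightarrow> 'a) \<Rightarrow> ('w, 'f) tensor ipspace" where
  "twisted_forms A B \<Omega> \<Omega>\<Omega> \<sigma> n F h = module.extend (btens B \<Omega> F)
     (ipspace.fields (\<lambda>s t. haar A (twisted_metric A B \<Omega> \<Omega>\<Omega> \<sigma> n F h s t)))"

definition L2_space :: "'a hopf \<Rightarrow> 'a set \<Rightarrow> ('a, 'w) dcalc \<Rightarrow> (nat \<Rightarrow> nat \<Rightarrow> 'w set) \<Rightarrow> 'w \<Rightarrow> nat \<Rightarrow>
    ('a, 'f) relmod \<Rightarrow> ('f \<Rightarrow> 'f \<Rightarrow> 'a) \<Rightarrow> (nat \<Rightarrow> ('w, 'f) tensor) set ipspace" where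
  "L2_space A B \<Omega> \<Omega>\<Omega> \<sigma> n F h = completion (twisted_forms A B \<Omega> \<Omega>\<Omega> \<sigma> n F h)"

end

theory Submission
 imports Defs
begin

text \<open>
The proof rests on the fact that a covariant metric is determined by finitely many matrix
coefficients.  Let \<open>M\<close> be the module of twisted forms, the tensor product over \<open>B\<close> of the calculus \<open>Om\<close> and \<open>F\<close>,
let \<open>g\<close> be its metric and put \<open>\<beta> m m' = eps (g m m')\<close>, a positive semidefinite form with complex
values.

The metric on \<open>Om\<close>, the Hermitian form \<open>h\<close> and hence \<open>g\<close> are covariant; applying the counit to the
second leg of this statement expresses \<open>g m m'\<close> as the sum of
\<open>m(-1)^* m'(-1)\<close> times \<open>\<beta> m(0) m'(0)\<close> (\<open>metric_covariant\<close>).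

The form \<open>\<beta>\<close> has finite rank (\<open>\<beta>_finite_rank\<close>).  Indeed \<open>M\<close> is finitely generated as a left module,
and \<open>B\<close> acts on \<open>M\<close> modulo the radical of \<open>\<beta>\<close> through the counit: this is clear for the right action,
because \<open>g\<close> is right linear in its second argument, and the left action can be rewritten as a right
action with the inverse of the antipode (\<open>rel_lact_as_ract\<close>).  Hence there are finitely many
\<open>e\<close> with \<open>\<beta> x y\<close> the sum of the products \<open>\<beta> x e * \<beta> e y\<close>, and with the coefficients
\<open>u e m = \<beta> e m(0) m(-1)\<close> in \<open>A\<close> the metric \<open>g m m'\<close> becomes the sum of the elements \<open>(u e m)^* u e m'\<close>
(\<open>metric_sum_of_squares\<close>).

A morphism \<open>f\<close> is right linear, because the right action is determined by the left action and the
coaction.  Since \<open>g\<close> identifies the conjugate of \<open>M\<close> with the right dual of \<open>M\<close>, there is for every \<open>y\<close> a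
\<open>y'\<close> with \<open>g y (f m) = g y' m\<close>; in particular \<open>f\<close> preserves the radical of \<open>\<beta>\<close>.  Therefore \<open>f\<close> acts on the
coefficients by a finite scalar matrix, \<open>u e (f m)\<close> being the sum of \<open>\<beta> e (f l)\<close> times \<open>u l m\<close>
(\<open>u_f\<close>), and the triangle inequality for the seminorm of the Haar state bounds \<open>f\<close>.

Four things must be built before this argument makes sense.  The adjoint action of \<open>A\<close> has to preserve
\<open>B\<close>, which comes from faithfully flat descent (\<open>act_B\<close>).  The coaction on the dual module has to exist
(\<open>dual_coact_spec\<close>).  The involution of the calculus has to be covariant (\<open>star_covariant\<close>).
The Hodge map has to exist and to be colinear: it exists by the Lefschetz decomposition, and it commutes with every operator that preserves the bigrading and commutes with
multiplication by \<open>\<sigma>\<close> (\<open>H_commute\<close>), in particular with the slices of the coaction.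

Sweedler sums are written with \<open>tlift U p t\<close>, the value on \<open>t\<close> of the linear map induced by the
bilinear map \<open>p\<close> with values in \<open>U\<close>; a formula with several Sweedler legs is a nested \<open>tlift\<close>.
Conjugate-linear maps are linear maps into \<open>conj_vs U\<close>.
\<close>

section \<open>Complex vector spaces\<close>

lemma CC_simps [simp]:
 "carrier CC = UNIV" "x \<oplus>\<^bsub>CC\<^esub> y = x + y" "\<zero>\<^bsub>CC\<^esub> = 0" "x \<otimes>\<^bsub>CC\<^esub> y = x * y" "\<one>\<^bsub>CC\<^esub> = 1" "x \<odot>\<^bsub>CC\<^esub> y = x * y"
 by (simp_all add: CC_def)

lemma cring_CC: "cring CC"
 by (rule cringI, rule abelian_groupI, auto simp: algebra_simps intro!: monoid.monoid_comm_monoidI monoidI)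
  (metis add.commute add.right_inverse)

text \<open>Carriers are written like types.\<close>

abbreviation vmem :: "'v \<Rightarrow> (complex, 'v, 'x) module_scheme \<Rightarrow> bool" (infix ".:" 50) where
 "x .: V \<equiv> x \<in> (carrier V)"

abbreviation vs :: "(complex, 'v, 'x) module_scheme \<Rightarrow> bool" where
 "vs V \<equiv> module CC V"

lemma vsI:
 assumes "abelian_group V"
  and "\<And>c v. v .: V ==> c \<odot>\<^bsub>V\<^esub> v .: V"
  and "\<And>c d v. v .: V ==> (c + d) \<odot>\<^bsub>V\<^esub> v = c \<odot>\<^bsub>V\<^esub> v \<oplus>\<^bsub>V\<^esub> d \<odot>\<^bsub>V\<^esub> v"
  and "\<And>c v w. v .: V ==> w .: V ==> c \<odot>\<^bsub>V\<^esub> (v \<oplus>\<^bsub>V\<^esub> w) = c \<odot>\<^bsub>V\<^esub> v \<oplus>\<^bsub>V\<^esub> c \<odot>\<^bsub>V\<^esub> w"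
  and "\<And>c d v. v .: V ==> (c * d) \<odot>\<^bsub>V\<^esub> v = c \<odot>\<^bsub>V\<^esub> (d \<odot>\<^bsub>V\<^esub> v)"
  and "\<And>v. v .: V ==> 1 \<odot>\<^bsub>V\<^esub> v = v"
 shows "vs V"
 by (rule moduleI) (use assms cring_CC in auto)

lemma vs_ag: "vs V ==> abelian_group V"
 by (simp add: module_def)

lemma vs_CC [simp]: "vs CC"
 by (rule vsI) (auto simp: algebra_simps cring.axioms(1)[OF cring_CC] ring.is_abelian_group)

context
 fixes V :: "(complex, 'v, 'x) module_scheme" (structure)
 assumes V: "vs V"
begin

interpretation V: module CC V by (rule V)

lemma vs_zero [simp, intro]: "\<zero> .: V" by simp
lemma vs_add [simp, intro]: "x .: V ==> y .: V ==> x \<oplus> y .: V" by simp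
lemma vs_minus [simp, intro]: "x .: V ==> y .: V ==> x \<ominus> y .: V" by simp
lemma vs_smult [simp, intro]: "x .: V ==> c \<odot> x .: V" using V.smult_closed by simp
lemma vs_l_zero [simp]: "x .: V ==> \<zero> \<oplus> x = x" by simp
lemma vs_r_zero [simp]: "x .: V ==> x \<oplus> \<zero> = x" by simp
lemma vs_smult_add: "x .: V ==> y .: V ==> c \<odot> (x \<oplus> y) = c \<odot> x \<oplus> c \<odot> y"
 using V.smult_r_distr by simp
lemma vs_add_smult: "x .: V ==> (c + d) \<odot> x = c \<odot> x \<oplus> d \<odot> x"
 using V.smult_l_distr[of c d x] by simp
lemma vs_smult_smult [simp]: "x .: V ==> c \<odot> (d \<odot> x) = (c * d) \<odot> x"
 using V.smult_assoc1[of c d x] by simp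
lemma vs_smult_one [simp]: "x .: V ==> 1 \<odot> x = x"
 using V.smult_one by simp
lemma vs_smult_0 [simp]: "x .: V ==> 0 \<odot> x = \<zero>"
 using V.smult_l_null by simp
lemma vs_smult_zero [simp]: "c \<odot> \<zero> = \<zero>"
 using V.smult_r_null by simp
lemma vs_neg: "x .: V ==> \<ominus> x = (-1) \<odot> x"
 using vs_add_smult[of x "-1" 1] V.minus_equality[of "(-1) \<odot> x" x] vs_smult[of x "-1"] by simp
lemma vs_minus_eq: "x .: V ==> y .: V ==> x \<ominus> y = x \<oplus> (-1) \<odot> y"
 by (simp add: a_minus_def vs_neg)
lemma vs_add_comm: "x .: V ==> y .: V ==> x \<oplus> y = y \<oplus> x"
 using V.a_comm by simp
lemma vs_add_assoc: "x .: V ==> y .: V ==> z .: V ==> (x \<oplus> y) \<oplus> z = x \<oplus> (y \<oplus> z)"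
 using V.a_assoc by simp
lemma vs_add_left_comm: "x .: V ==> y .: V ==> z .: V ==> x \<oplus> (y \<oplus> z) = y \<oplus> (x \<oplus> z)"
 using V.a_lcomm by simp
lemma vs_minus_add: "x .: V ==> y .: V ==> (x \<ominus> y) \<oplus> y = x"
 by (simp add: a_minus_def vs_add_assoc V.l_neg)
lemma vs_minus_zero_iff: "x .: V ==> y .: V ==> x \<ominus> y = \<zero> \<longleftrightarrow> x = y"
 by (metis V.r_neg a_minus_def vs_l_zero vs_minus_add)
lemma vs_add_diff_diff: "x .: V ==> y .: V ==> x \<oplus> y \<ominus> x \<ominus> y = \<zero>"
 by (simp add: a_minus_def V.a_comm V.a_assoc V.r_neg V.l_neg V.r_neg1 V.r_neg2)
lemma finsum_closed' [simp, intro]: "(\<And>i. i \<in> I ==> f i .: V) ==> finsum V f I .: V"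
 by (rule V.finsum_closed) auto

lemma submodule_iff: "submodule U CC V \<longleftrightarrow> U \<subseteq> carrier V \<and> \<zero> \<in> U \<and> (\<forall>x\<in>U. \<forall>y\<in>U. x \<oplus> y \<in> U) \<and> (\<forall>c. \<forall>x\<in>U. c \<odot> x \<in> U)"
proof
 assume "submodule U CC V"
 then interpret U: submodule U CC V .
 show "U \<subseteq> carrier V \<and> \<zero> \<in> U \<and> (\<forall>x\<in>U. \<forall>y\<in>U. x \<oplus> y \<in> U) \<and> (\<forall>c. \<forall>x\<in>U. c \<odot> x \<in> U)"
  using U.subset U.one_closed U.m_closed U.smult_closed by auto
next
 assume U: "U \<subseteq> carrier V \<and> \<zero> \<in> U \<and> (\<forall>x\<in>U. \<forall>y\<in>U. x \<oplus> y \<in> U) \<and> (\<forall>c. \<forall>x\<in>U. c \<odot> x \<in> U)"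
 show "submodule U CC V"
 proof (rule V.submoduleI)
  show "\<ominus> a \<in> U" if "a \<in> U" for a
   using that U vs_neg[of a] by auto
 qed (use U in auto)
qed

end

lemmas submoduleD = submodule_iff[THEN iffD1, THEN conjunct1] submodule_iff[THEN iffD1, THEN conjunct2, THEN conjunct1]
 submodule_iff[THEN iffD1, THEN conjunct2, THEN conjunct2, THEN conjunct1, rule_format]
 submodule_iff[THEN iffD1, THEN conjunct2, THEN conjunct2, THEN conjunct2, rule_format]

lemma vs_sub: "vs V ==> submodule U CC V ==> vs (V\<lparr>carrier := U\<rparr>)"
 using submodule.submodule_is_module by auto

lemma vs_cong:
 assumes "vs V" "carrier W = carrier V" "add W = add V" "zero W = zero V" "smult W = smult V"
 shows "vs W"
proof -
 interpret V: module CC V by fact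
 have "abelian_group W"
  by (rule abelian_groupI) (insert assms V.a_assoc V.a_comm V.l_neg V.a_inv_closed, auto)
 then show ?thesis
  by (rule vsI) (insert assms, auto simp: vs_add_smult vs_smult_add)
qed

section \<open>Linear and bilinear maps\<close>

lemma lin_homI:
 assumes "\<And>x. x .: V ==> f x .: W"
  and "\<And>x y. x .: V ==> y .: V ==> f (x \<oplus>\<^bsub>V\<^esub> y) = f x \<oplus>\<^bsub>W\<^esub> f y"
  and "\<And>c x. x .: V ==> f (c \<odot>\<^bsub>V\<^esub> x) = c \<odot>\<^bsub>W\<^esub> f x"
 shows "f \<in> lin_hom V W"
 using assms by (auto simp: lin_hom_def)

lemma lin_homD:
 assumes "f \<in> lin_hom V W"
 shows lin_closed: "x .: V ==> f x .: W"
  and lin_add: "x .: V ==> y .: V ==> f (x \<oplus>\<^bsub>V\<^esub> y) = f x \<oplus>\<^bsub>W\<^esub> f y"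
  and lin_smult: "x .: V ==> f (c \<odot>\<^bsub>V\<^esub> x) = c \<odot>\<^bsub>W\<^esub> f x"
 using assms by (auto simp: lin_hom_def)

lemma lin_map_zero:
 assumes "f \<in> lin_hom V W" "vs V" "vs W"
 shows "f \<zero>\<^bsub>V\<^esub> = \<zero>\<^bsub>W\<^esub>"
 using lin_smult[OF assms(1), of "\<zero>\<^bsub>V\<^esub>" 0] assms lin_closed[OF assms(1), of "\<zero>\<^bsub>V\<^esub>"] by simp

lemma lin_map_minus:
 assumes "f \<in> lin_hom V W" "vs V" "vs W" "x .: V" "y .: V"
 shows "f (x \<ominus>\<^bsub>V\<^esub> y) = f x \<ominus>\<^bsub>W\<^esub> f y"
 using assms lin_closed[OF assms(1)] by (simp add: vs_minus_eq lin_add[OF assms(1)] lin_smult[OF assms(1)])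

lemma lin_map_finsum:
 assumes "f \<in> lin_hom V W" "vs V" "vs W" "finite I" "\<And>i. i \<in> I ==> g i .: V"
 shows "f (finsum V g I) = finsum W (\<lambda>i. f (g i)) I"
proof -
 interpret V: module CC V by fact
 interpret W: module CC W by fact
 show ?thesis using assms(4,5)
 proof (induction I rule: finite_induct)
  case empty
  then show ?case using lin_map_zero[OF assms(1-3)] by simp
 next
  case (insert i I)
  have "f (g i) .: W" "\<forall>j\<in>I. f (g j) .: W"
   using insert.prems lin_closed[OF assms(1)] by auto
  then show ?case using insert
   by (simp add: V.finsum_insert W.finsum_insert Pi_iff lin_add[OF assms(1)])
 qed
qed

named_theorems lin

lemma lin_id [lin]: "(\<lambda>x. x) \<in> lin_hom V V"
 by (rule lin_homI) auto

lemma lin_comp: "T \<in> lin_hom V W ==> g \<in> lin_hom X V ==> (\<lambda>x. T (g x)) \<in> lin_hom X W"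
 by (rule lin_homI) (auto simp: lin_add lin_smult lin_closed)

lemma lin_add_fun [lin]:
 assumes "vs W" "f \<in> lin_hom V W" "g \<in> lin_hom V W"
 shows "(\<lambda>x. f x \<oplus>\<^bsub>W\<^esub> g x) \<in> lin_hom V W"
 by (rule lin_homI)
  (auto simp: assms lin_add[OF assms(2)] lin_add[OF assms(3)] lin_smult[OF assms(2)] lin_smult[OF assms(3)]
   vs_smult_add vs_add_assoc vs_add_left_comm lin_closed[OF assms(2)] lin_closed[OF assms(3)])

lemma lin_zero_fun [lin]:
 assumes "vs W"
 shows "(\<lambda>x. \<zero>\<^bsub>W\<^esub>) \<in> lin_hom V W"
 by (rule lin_homI) (use assms in auto)

lemma lin_smult_fun [lin]:
 assumes "vs W" "g \<in> lin_hom V W"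
 shows "(\<lambda>x. c \<odot>\<^bsub>W\<^esub> g x) \<in> lin_hom V W"
 by (rule lin_homI)
  (auto simp: assms lin_add[OF assms(2)] lin_smult[OF assms(2)] vs_smult_add lin_closed[OF assms(2)] mult.commute)

lemma lin_scalar_fun [lin]:
 assumes "vs W" "g \<in> lin_hom V CC" "w .: W"
 shows "(\<lambda>x. g x \<odot>\<^bsub>W\<^esub> w) \<in> lin_hom V W"
 by (rule lin_homI)
  (insert assms, auto simp: lin_add[OF assms(2)] lin_smult[OF assms(2)] vs_add_smult)

lemma lin_mult_CC [lin]:
 assumes "g \<in> lin_hom V CC"
 shows "(\<lambda>x. g x * c) \<in> lin_hom V CC" "(\<lambda>x. c * g x) \<in> lin_hom V CC"
 by (rule lin_homI; use assms in \<open>auto simp: lin_add[OF assms] lin_smult[OF assms] algebra_simps\<close>)+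


lemma lin_finsum_fun [lin]:
 assumes "vs W" "finite I" "\<And>i. i \<in> I ==> f i \<in> lin_hom V W" and V: "vs V"
 shows "(\<lambda>x. finsum W (\<lambda>i. f i x) I) \<in> lin_hom V W"
proof -
 interpret W: module CC W by fact
 show ?thesis using assms(2,3)
 proof (induction I rule: finite_induct)
  case empty
  then show ?case using lin_zero_fun[OF assms(1)] by simp
 next
  case (insert i I)
  have "f i \<in> lin_hom V W" "(\<lambda>x. finsum W (\<lambda>i. f i x) I) \<in> lin_hom V W"
   using insert by auto
  from lin_add_fun[OF assms(1) this] have "(\<lambda>x. f i x \<oplus>\<^bsub>W\<^esub> finsum W (\<lambda>i. f i x) I) \<in> lin_hom V W" .
  moreover have "finsum W (\<lambda>i. f i x) (insert i I) = f i x \<oplus>\<^bsub>W\<^esub> finsum W (\<lambda>i. f i x) I" if "x .: V" for x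
   using that insert by (intro W.finsum_insert) (auto simp: Pi_iff intro: lin_closed)
  ultimately show ?case
   by (auto simp: lin_hom_def Pi_iff V)
 qed
qed

lemma lin_cong:
 assumes "g \<in> lin_hom V W" "vs V" "\<And>x. x .: V ==> f x = g x"
 shows "f \<in> lin_hom V W"
 using assms by (auto simp: lin_hom_def Pi_iff)

lemma bilinI:
 assumes "\<And>v. v .: V ==> (\<lambda>w. ph v w) \<in> lin_hom W U"
  and "\<And>w. w .: W ==> (\<lambda>v. ph v w) \<in> lin_hom V U"
 shows "bilin V W U ph"
 using assms by (auto simp: bilin_def)

lemma bilinD:
 assumes "bilin V W U ph"
 shows bilin_right: "v .: V ==> ph v \<in> lin_hom W U"
  and bilin_left: "w .: W ==> (\<lambda>v. ph v w) \<in> lin_hom V U"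
  and bilin_closed: "v .: V ==> w .: W ==> ph v w .: U"
 using assms by (auto simp: bilin_def lin_hom_def)

lemma lin_bilin_right: "bilin V W U ph ==> v .: V ==> g \<in> lin_hom X W ==> (\<lambda>x. ph v (g x)) \<in> lin_hom X U"
 using lin_comp[OF bilin_right] .

lemma lin_bilin_left: "bilin V W U ph ==> w .: W ==> g \<in> lin_hom X V ==> (\<lambda>x. ph (g x) w) \<in> lin_hom X U"
 using lin_comp[OF bilin_left] .

lemma bilin_comp: "T \<in> lin_hom U U' ==> bilin V W U ph ==> bilin V W U' (\<lambda>v w. T (ph v w))"
 by (auto simp: bilin_def intro: lin_comp)

lemma conj_vs_simps [simp]:
 "carrier (conj_vs V) = carrier V" "add (conj_vs V) = add V" "zero (conj_vs V) = zero V"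
 "c \<odot>\<^bsub>conj_vs V\<^esub> v = cnj c \<odot>\<^bsub>V\<^esub> v" "conj_vs (conj_vs V) = V"
 by (simp_all add: conj_vs_def)

lemma vs_conj [simp]: "vs V ==> vs (conj_vs V)"
proof -
 assume V: "vs V"
 interpret V: module CC V by fact
 have "abelian_group (conj_vs V)"
  by (rule abelian_groupI) (insert V.a_assoc V.a_comm V.l_neg V.a_inv_closed, auto)
 then show ?thesis
  by (rule vsI) (insert V, auto simp: vs_add_smult vs_smult_add)
qed

lemma lin_conj_both: "lin_hom (conj_vs V) (conj_vs W) = lin_hom V W"
 by (auto simp: lin_hom_def) (metis complex_cnj_cnj)+

lemma lin_conj_swap: "lin_hom V (conj_vs W) = lin_hom (conj_vs V) W"
 using lin_conj_both[of "conj_vs V" W] by simp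

lemma lin_hom_cong:
 assumes "carrier V = carrier V'" "add V = add V'" "smult V = smult V'"
  "carrier W = carrier W'" "add W = add W'" "smult W = smult W'"
 shows "lin_hom V W = lin_hom V' W'"
 using assms by (auto simp: lin_hom_def)

section \<open>Tensor products\<close>

lemma lookup_pscale [simp]: "Poly_Mapping.lookup (pscale c p) k = c * Poly_Mapping.lookup p k"
 by (simp add: pscale_def Poly_Mapping.map.rep_eq when_def)

lemma keys_pscale: "Poly_Mapping.keys (pscale c p) \<subseteq> Poly_Mapping.keys p"
 by (auto simp: in_keys_iff)

lemma pscale_simps:
 "pscale c (p + q) = pscale c p + pscale c q" "pscale c (p - q) = pscale c p - pscale c q"
 "pscale (c + d) p = pscale c p + pscale d p" "pscale c (pscale d p) = pscale (c * d) p"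
 "pscale 1 p = p" "pscale c 0 = 0" "pscale (-1) p = - p"
 "pscale c (Poly_Mapping.single k x) = Poly_Mapping.single k (c * x)"
 by (rule poly_mapping_eqI; simp add: lookup_add lookup_minus lookup_single when_def algebra_simps)+

text \<open>The value of the linear extension of \<open>th\<close> at a formal combination of the generators.\<close>

definition ev :: "(complex, 'u, 'z) module_scheme \<Rightarrow> ('k \<Rightarrow> 'u) \<Rightarrow> ('k \<Rightarrow>\<^sub>0 complex) \<Rightarrow> 'u" where
 "ev U th p = finsum U (\<lambda>k. Poly_Mapping.lookup p k \<odot>\<^bsub>U\<^esub> th k) (Poly_Mapping.keys p)"

lemma tlift_ev: "tlift U ph t = ev U (case_prod ph) (SOME p. p \<in> t)"
 by (simp add: tlift_def ev_def Let_def case_prod_unfold)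

context
 fixes U :: "(complex, 'u, 'z) module_scheme" and th :: "'k \<Rightarrow> 'u" and K :: "'k set"
 assumes U: "vs U" and th: "\<And>k. k \<in> K ==> th k .: U"
begin

interpretation U: module CC U by (rule U)

lemma ev_superset:
 assumes "finite S" "S \<subseteq> K" "Poly_Mapping.keys p \<subseteq> S"
 shows "ev U th p = finsum U (\<lambda>k. Poly_Mapping.lookup p k \<odot>\<^bsub>U\<^esub> th k) S"
 unfolding ev_def
 by (rule U.add.finprod_mono_neutral_cong_left) (insert assms th U, auto simp: in_keys_iff)

lemma ev_closed: "Poly_Mapping.keys p \<subseteq> K ==> ev U th p .: U"
 unfolding ev_def using th U by auto

lemma ev_add:
 assumes "Poly_Mapping.keys p \<subseteq> K" "Poly_Mapping.keys q \<subseteq> K"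
 shows "ev U th (p + q) = ev U th p \<oplus>\<^bsub>U\<^esub> ev U th q"
proof -
 let ?S = "Poly_Mapping.keys p \<union> Poly_Mapping.keys q"
 have S: "finite ?S" "?S \<subseteq> K" using assms by auto
 have "ev U th (p + q) = finsum U (\<lambda>k. Poly_Mapping.lookup p k \<odot>\<^bsub>U\<^esub> th k \<oplus>\<^bsub>U\<^esub> Poly_Mapping.lookup q k \<odot>\<^bsub>U\<^esub> th k) ?S"
  unfolding ev_superset[OF S Poly_Mapping.keys_add] using S th U
  by (intro U.finsum_cong') (auto simp: lookup_add vs_add_smult)
 also have "... = finsum U (\<lambda>k. Poly_Mapping.lookup p k \<odot>\<^bsub>U\<^esub> th k) ?S \<oplus>\<^bsub>U\<^esub> finsum U (\<lambda>k. Poly_Mapping.lookup q k \<odot>\<^bsub>U\<^esub> th k) ?S"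
  using S th U by (intro U.finsum_addf) auto
 also have "... = ev U th p \<oplus>\<^bsub>U\<^esub> ev U th q"
  using ev_superset[OF S, of p] ev_superset[OF S, of q] by simp
 finally show ?thesis .
qed

lemma ev_pscale:
 assumes "Poly_Mapping.keys p \<subseteq> K"
 shows "ev U th (pscale c p) = c \<odot>\<^bsub>U\<^esub> ev U th p"
proof -
 have "ev U th (pscale c p) = finsum U (\<lambda>k. c \<odot>\<^bsub>U\<^esub> (Poly_Mapping.lookup p k \<odot>\<^bsub>U\<^esub> th k)) (Poly_Mapping.keys p)"
  unfolding ev_superset[OF finite_keys assms keys_pscale] using assms th U
  by (intro U.finsum_cong') auto
 also have "... = c \<odot>\<^bsub>U\<^esub> ev U th p"
  unfolding ev_def using assms th U
  by (intro lin_map_finsum[symmetric] lin_smult_fun lin_id) auto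
 finally show ?thesis .
qed

lemma ev_single: "k \<in> K ==> ev U th (Poly_Mapping.single k c) = c \<odot>\<^bsub>U\<^esub> th k"
 using ev_superset[of "{k}" "Poly_Mapping.single k c"] th U by (simp add: U.finsum_insert)

lemma ev_diff:
 assumes "Poly_Mapping.keys p \<subseteq> K" "Poly_Mapping.keys q \<subseteq> K"
 shows "ev U th (p - q) = ev U th p \<ominus>\<^bsub>U\<^esub> ev U th q"
proof -
 have "ev U th (p - q) = ev U th (p + pscale (-1) q)"
  by (simp add: pscale_simps)
 also have "... = ev U th p \<oplus>\<^bsub>U\<^esub> (-1) \<odot>\<^bsub>U\<^esub> ev U th q"
  using assms keys_pscale[of "-1" q] by (subst ev_add) (auto simp: ev_pscale)
 finally show ?thesis using assms by (simp add: vs_minus_eq U ev_closed)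
qed

end

lemma tnull_uminus: "p \<in> tnull V W N ==> - p \<in> tnull V W N"
 using tnull.scale[of p V W N "-1"] by (simp add: pscale_simps)

lemma tnull_diff: "p \<in> tnull V W N ==> q \<in> tnull V W N ==> p - q \<in> tnull V W N"
 using tnull.add[OF _ tnull_uminus] by fastforce

lemma tclass_self [simp]: "p \<in> tclass V W N p"
 by (simp add: tclass_def tnull.zero)

lemma tclass_eq_iff: "tclass V W N p = tclass V W N q \<longleftrightarrow> p - q \<in> tnull V W N"
proof
 assume "tclass V W N p = tclass V W N q"
 then show "p - q \<in> tnull V W N" using tclass_self[of p V W N] by (simp add: tclass_def)
next
 assume pq: "p - q \<in> tnull V W N"
 have "r - q \<in> tnull V W N" if "r - p \<in> tnull V W N" for r
  using tnull.add[OF that pq] by simp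
 moreover have "r - p \<in> tnull V W N" if "r - q \<in> tnull V W N" for r
  using tnull_diff[OF that pq] by simp
 ultimately show "tclass V W N p = tclass V W N q" by (auto simp: tclass_def)
qed

lemma tclass_some: "(SOME q. q \<in> tclass V W N p) - p \<in> tnull V W N"
 using someI[of "\<lambda>q. q \<in> tclass V W N p", OF tclass_self] by (simp add: tclass_def)

lemma tspace_simps:
 "carrier (tspace V W N) = tclass V W N ` {p. Poly_Mapping.keys p \<subseteq> carrier V \<times> carrier W}"
 "\<zero>\<^bsub>tspace V W N\<^esub> = tclass V W N 0"
 "tclass V W N p \<oplus>\<^bsub>tspace V W N\<^esub> tclass V W N q = tclass V W N (p + q)"
 "c \<odot>\<^bsub>tspace V W N\<^esub> tclass V W N p = tclass V W N (pscale c p)"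
proof -
 have "(SOME p'. p' \<in> tclass V W N p) + (SOME q'. q' \<in> tclass V W N q) - (p + q) \<in> tnull V W N"
  using tnull.add[OF tclass_some[of V W N p] tclass_some[of V W N q]] by (simp add: algebra_simps)
 then show "tclass V W N p \<oplus>\<^bsub>tspace V W N\<^esub> tclass V W N q = tclass V W N (p + q)"
  by (simp add: tspace_def tclass_eq_iff)
 have "pscale c (SOME p'. p' \<in> tclass V W N p) - pscale c p \<in> tnull V W N"
  using tnull.scale[OF tclass_some[of V W N p], of c] by (simp add: pscale_simps)
 then show "c \<odot>\<^bsub>tspace V W N\<^esub> tclass V W N p = tclass V W N (pscale c p)"
  by (simp add: tspace_def tclass_eq_iff)
qed (simp_all add: tspace_def)

lemma tclass_carrier [intro]: "Poly_Mapping.keys p \<subseteq> carrier V \<times> carrier W ==> tclass V W N p .: (tspace V W N)"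
 by (auto simp: tspace_simps)

lemma vs_tspace [simp]: "vs (tspace V W N)"
proof -
 let ?T = "tspace V W N" and ?C = "tclass V W N"
 define K where "K = {p :: _ \<Rightarrow>\<^sub>0 complex. Poly_Mapping.keys p \<subseteq> carrier V \<times> carrier W}"
 have carr: "carrier ?T = ?C ` K" by (simp add: tspace_simps K_def)
 have K [intro]: "0 \<in> K" "\<And>p q. p \<in> K ==> q \<in> K ==> p + q \<in> K" "\<And>c p. p \<in> K ==> pscale c p \<in> K"
  unfolding K_def mem_Collect_eq
  by (simp, (rule order_trans[OF Poly_Mapping.keys_add Un_least]; assumption), (rule order_trans[OF keys_pscale]; assumption))
 have "abelian_group ?T"
 proof (rule abelian_groupI)
  fix x assume "x .: ?T"
  then obtain p where p: "p \<in> K" "x = ?C p" by (auto simp: carr)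
  then show "\<exists>y\<in>carrier ?T. y \<oplus>\<^bsub>?T\<^esub> x = \<zero>\<^bsub>?T\<^esub>"
   using K(3)[of p "-1"] by (intro bexI[of _ "?C (pscale (-1) p)"]) (auto simp: carr tspace_simps(2-) pscale_simps)
 qed (auto simp: carr tspace_simps(2-) ac_simps)
 then show ?thesis
  by (rule vsI) (auto simp: carr tspace_simps(2-) pscale_simps)
qed

text \<open>A bilinear map that is compatible with the extra relators \<open>N\<close>.\<close>

definition mid :: "(complex, 'v, 'x) module_scheme \<Rightarrow> (complex, 'w, 'y) module_scheme \<Rightarrow>
  ('v \<times> 'w \<Rightarrow>\<^sub>0 complex) set \<Rightarrow> (complex, 'u, 'z) module_scheme \<Rightarrow> ('v \<Rightarrow> 'w \<Rightarrow> 'u) \<Rightarrow> bool" where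
 "mid V W N U ph \<longleftrightarrow> bilin V W U ph \<and>
   (\<forall>p\<in>N. Poly_Mapping.keys p \<subseteq> carrier V \<times> carrier W \<and> ev U (case_prod ph) p = \<zero>\<^bsub>U\<^esub>)"

context
 fixes V :: "(complex, 'v, 'x) module_scheme" and W :: "(complex, 'w, 'y) module_scheme"
  and N and U :: "(complex, 'u, 'z) module_scheme" and ph
 assumes V: "vs V" and W: "vs W" and U: "vs U" and ph: "mid V W N U ph"
begin

lemma mid_bilin: "bilin V W U ph"
 using ph by (simp add: mid_def)

lemma mid_case: "k \<in> carrier V \<times> carrier W ==> case_prod ph k .: U"
 using bilin_closed[OF mid_bilin] by auto

lemmas ev_mid = ev_add[OF U mid_case] ev_diff[OF U mid_case] ev_pscale[OF U mid_case]
 ev_single[OF U mid_case] ev_closed[OF U mid_case]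

lemma keys_sub: "Poly_Mapping.keys p \<subseteq> K ==> Poly_Mapping.keys q \<subseteq> K ==> Poly_Mapping.keys (p - q) \<subseteq> K"
 using keys_diff[of p q] by blast


lemma keys_gen: "k \<in> K ==> Poly_Mapping.keys (Poly_Mapping.single k c) \<subseteq> K"
 by (simp split: if_splits)

lemma tnull_ev:
 assumes "p \<in> tnull V W N"
 shows "Poly_Mapping.keys p \<subseteq> carrier V \<times> carrier W \<and> ev U (case_prod ph) p = \<zero>\<^bsub>U\<^esub>"
 using assms
proof induction
 case zero
 interpret U: module CC U by (rule U)
 show ?case by (simp add: ev_def)
next
 case (add p q)
 then show ?case using Poly_Mapping.keys_add[of p q] U by (auto simp: ev_mid)
next
 case (scale p c)
 then show ?case using keys_pscale[of c p] U by (auto simp: ev_mid)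
next
 case (extra p)
 then show ?case using ph by (auto simp: mid_def)
next
 case (add_left v v' w)
 then show ?case using V U bilin_closed[OF mid_bilin]
  by (auto simp: ev_mid keys_sub keys_gen lin_add[OF bilin_left[OF mid_bilin]] vs_add_diff_diff)
next
 case (add_right v w w')
 then show ?case using W U bilin_closed[OF mid_bilin]
  by (auto simp: ev_mid keys_sub keys_gen lin_add[OF bilin_right[OF mid_bilin]] vs_add_diff_diff)
next
 case (scale_left v w c)
 then show ?case using V U bilin_closed[OF mid_bilin]
  by (auto simp: ev_mid keys_sub keys_gen lin_smult[OF bilin_left[OF mid_bilin]] pscale_simps vs_minus_zero_iff)
next
 case (scale_right v w c)
 then show ?case using W U bilin_closed[OF mid_bilin]
  by (auto simp: ev_mid keys_sub keys_gen lin_smult[OF bilin_right[OF mid_bilin]] pscale_simps vs_minus_zero_iff)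
qed

lemma tlift_tclass:
 assumes "Poly_Mapping.keys p \<subseteq> carrier V \<times> carrier W"
 shows "tlift U ph (tclass V W N p) = ev U (case_prod ph) p"
proof -
 let ?q = "SOME q. q \<in> tclass V W N p"
 have 1: "Poly_Mapping.keys (?q - p) \<subseteq> carrier V \<times> carrier W \<and> ev U (case_prod ph) (?q - p) = \<zero>\<^bsub>U\<^esub>"
  by (rule tnull_ev[OF tclass_some])
 have "ev U (case_prod ph) ?q = ev U (case_prod ph) ((?q - p) + p)"
  by simp
 also have "... = ev U (case_prod ph) p"
  using 1 assms U by (subst ev_mid(1)) (auto simp: ev_mid)
 finally show ?thesis by (simp add: tlift_ev)
qed

lemma tlift_lin_mid: "tlift U ph \<in> lin_hom (tspace V W N) U"
proof (rule lin_homI)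
 fix x y c assume "x .: (tspace V W N)"
 then obtain p where p: "Poly_Mapping.keys p \<subseteq> carrier V \<times> carrier W" "x = tclass V W N p"
  by (auto simp: tspace_simps)
 show "tlift U ph x .: U" using p by (simp add: tlift_tclass ev_mid)
 show "tlift U ph (c \<odot>\<^bsub>tspace V W N\<^esub> x) = c \<odot>\<^bsub>U\<^esub> tlift U ph x"
  using p keys_pscale[of c p] by (simp add: tlift_tclass ev_mid tspace_simps)
 assume "y .: (tspace V W N)"
 then obtain q where q: "Poly_Mapping.keys q \<subseteq> carrier V \<times> carrier W" "y = tclass V W N q"
  by (auto simp: tspace_simps)
 show "tlift U ph (x \<oplus>\<^bsub>tspace V W N\<^esub> y) = tlift U ph x \<oplus>\<^bsub>U\<^esub> tlift U ph y"
  using p q order_trans[OF Poly_Mapping.keys_add[of p q] Un_least] by (simp add: tlift_tclass ev_mid tspace_simps)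
qed

lemma tlift_gen_mid: "v .: V ==> w .: W ==> tlift U ph (tclass V W N (gen v w)) = ph v w"
 using bilin_closed[OF mid_bilin] U by (simp add: tlift_tclass ev_mid)

end

lemma vs_minus_self [simp]: "vs V ==> x .: V ==> x \<ominus>\<^bsub>V\<^esub> x = \<zero>\<^bsub>V\<^esub>"
 by (simp add: vs_minus_zero_iff)

lemma gen_single: "pscale c (Poly_Mapping.single k 1) = Poly_Mapping.single k c"
 by (simp add: pscale_simps)

lemma poly_mapping_decompose_induct [consumes 1, case_names zero add]:
 fixes p :: "'k \<Rightarrow>\<^sub>0 complex"
 assumes "Poly_Mapping.keys p \<subseteq> K" and zero: "P 0"
  and add: "\<And>k c p. k \<in> K ==> Poly_Mapping.keys p \<subseteq> K ==> P p ==> P (Poly_Mapping.single k c + p)"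
 shows "P p"
 using assms(1)
proof (induction "card (Poly_Mapping.keys p)" arbitrary: p)
 case 0
 then show ?case using zero by simp
next
 case (Suc n)
 then obtain k where k: "k \<in> Poly_Mapping.keys p" by fastforce
 define q where "q = p - Poly_Mapping.single k (Poly_Mapping.lookup p k)"
 have keys: "Poly_Mapping.keys q = Poly_Mapping.keys p - {k}"
  by (auto simp: in_keys_iff q_def lookup_minus lookup_single when_def split: if_splits)
 have "P q"
  by (rule Suc.hyps(1)) (use Suc.hyps(2) Suc.prems k keys in auto)
 then have "P (Poly_Mapping.single k (Poly_Mapping.lookup p k) + q)"
  using k Suc.prems keys by (intro add) auto
 then show ?case by (simp add: q_def)
qed

lemma bilin_tgen: "bilin V W (tspace V W N) (\<lambda>v w. tclass V W N (gen v w))"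
proof (intro bilinI lin_homI)
 fix v w assume "v .: V" "w .: W"
 then show "tclass V W N (gen v w) .: (tspace V W N)" "tclass V W N (gen v w) .: (tspace V W N)"
  by auto
qed (auto simp: tspace_simps tclass_eq_iff diff_diff_eq[symmetric] intro: tnull.intros)

lemma tens_induct [consumes 2, case_names zero gen add]:
 assumes "t .: (tspace V W N)" "vs V"
  and zero: "P \<zero>\<^bsub>tspace V W N\<^esub>"
  and gen: "\<And>v w. v .: V ==> w .: W ==> P (tclass V W N (gen v w))"
  and add: "\<And>s t. s .: (tspace V W N) ==> t .: (tspace V W N) ==> P s ==> P t ==> P (s \<oplus>\<^bsub>tspace V W N\<^esub> t)"
 shows "P t"
proof -
 obtain p where p: "Poly_Mapping.keys p \<subseteq> carrier V \<times> carrier W" "t = tclass V W N p"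
  using assms(1) by (auto simp: tspace_simps)
 have "P (tclass V W N p)"
  using p(1)
 proof (induction p rule: poly_mapping_decompose_induct)
  case zero
  then show ?case using \<open>P \<zero>\<^bsub>tspace V W N\<^esub>\<close> by (simp add: tspace_simps)
 next
  case (add k c p)
  obtain v w where k: "k = (v, w)" "v .: V" "w .: W" using add by auto
  have eq: "tclass V W N (Poly_Mapping.single k c) = tclass V W N (gen (c \<odot>\<^bsub>V\<^esub> v) w)"
   using lin_smult[OF bilin_left[OF bilin_tgen[of V W N] k(3)] k(2), of c] k
   by (simp add: tspace_simps gen_single)
  have "P (tclass V W N (Poly_Mapping.single k c) \<oplus>\<^bsub>tspace V W N\<^esub> tclass V W N p)"
   unfolding eq using k \<open>vs V\<close> add by (intro assms(5) gen) auto
  then show ?case by (simp add: tspace_simps)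
 qed
 then show ?thesis using p by simp
qed

lemma tens_lin_eqI:
 assumes "T \<in> lin_hom (tspace V W N) U" "T' \<in> lin_hom (tspace V W N) U" "vs V" "vs U"
  and "\<And>v w. v .: V ==> w .: W ==> T (tclass V W N (gen v w)) = T' (tclass V W N (gen v w))"
  and "t .: (tspace V W N)"
 shows "T t = T' t"
 using assms(6,3)
proof (induction t rule: tens_induct)
 case zero
 then show ?case using lin_map_zero[OF assms(1)] lin_map_zero[OF assms(2)] assms by simp
next
 case (gen v w)
 then show ?case using assms by simp
next
 case (add s t)
 then show ?case using lin_add[OF assms(1)] lin_add[OF assms(2)] by simp
qed

lemma ctens_simps:
 "carrier (ctens V W) = carrier (tspace V W {})" "add (ctens V W) = add (tspace V W {})"
 "zero (ctens V W) = zero (tspace V W {})" "smult (ctens V W) = smult (tspace V W {})"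
 "\<one>\<^bsub>ctens V W\<^esub> = ctel V W \<one>\<^bsub>V\<^esub> \<one>\<^bsub>W\<^esub>"
 by (simp_all add: ctens_def)

lemma lin_ctens: "lin_hom (ctens V W) U = lin_hom (tspace V W {}) U" "lin_hom U (ctens V W) = lin_hom U (tspace V W {})"
 by (rule lin_hom_cong; simp add: ctens_simps)+

lemma vs_ctens [simp]: "vs (ctens V W)"
 by (rule vs_cong[OF vs_tspace[of V W "{}"]]) (simp_all add: ctens_simps)

lemma bilin_ctel: "bilin V W (ctens V W) (ctel V W)"
 using bilin_tgen[of V W "{}"] by (simp add: bilin_def lin_ctens ctel_def[abs_def])

lemmas ctel_closed [simp, intro] = bilin_closed[OF bilin_ctel]
lemmas ctel_lin [lin] = lin_bilin_right[OF bilin_ctel] lin_bilin_left[OF bilin_ctel]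

lemma mid_empty: "bilin V W U ph ==> mid V W {} U ph"
 by (simp add: mid_def)

lemma tlift_lin: "vs V ==> vs W ==> vs U ==> bilin V W U ph ==> tlift U ph \<in> lin_hom (ctens V W) U"
 using tlift_lin_mid[OF _ _ _ mid_empty] by (simp add: lin_ctens)

lemma tlift_ctel: "vs V ==> vs W ==> vs U ==> bilin V W U ph ==> v .: V ==> w .: W ==>
  tlift U ph (ctel V W v w) = ph v w"
 using tlift_gen_mid[OF _ _ _ mid_empty] by (simp add: ctel_def)

lemma tlift_closed: "vs V ==> vs W ==> vs U ==> bilin V W U ph ==> t .: (ctens V W) ==> tlift U ph t .: U"
 using lin_closed[OF tlift_lin] .

lemmas lin_tlift_arg = lin_comp[OF tlift_lin]

lemma ctens_induct [consumes 2, case_names zero gen add]: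
 assumes "t .: (ctens V W)" "vs V"
  and "P \<zero>\<^bsub>ctens V W\<^esub>"
  and "\<And>v w. v .: V ==> w .: W ==> P (ctel V W v w)"
  and "\<And>s t. s .: (ctens V W) ==> t .: (ctens V W) ==> P s ==> P t ==> P (s \<oplus>\<^bsub>ctens V W\<^esub> t)"
 shows "P t"
 using assms tens_induct[of t V W "{}" P] by (simp add: ctel_def ctens_simps)

lemma ctens_lin_eqI:
 assumes "T \<in> lin_hom (ctens V W) U" "T' \<in> lin_hom (ctens V W) U" "vs V" "vs U"
  and "\<And>v w. v .: V ==> w .: W ==> T (ctel V W v w) = T' (ctel V W v w)"
  and "t .: (ctens V W)"
 shows "T t = T' t"
 using tens_lin_eqI[of T V W "{}" U T' t] assms by (simp add: lin_ctens ctel_def ctens_simps)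

lemma lin_through_tlift:
 assumes "T \<in> lin_hom U U'" "vs V" "vs W" "vs U" "vs U'" "bilin V W U ph" "t .: (ctens V W)"
 shows "T (tlift U ph t) = tlift U' (\<lambda>v w. T (ph v w)) t"
 by (rule ctens_lin_eqI[of "\<lambda>t. T (tlift U ph t)" V W U'])
  (insert assms, auto intro!: lin_comp[OF assms(1)] tlift_lin bilin_comp[OF assms(1)] simp: tlift_ctel bilin_comp[OF assms(1)])

lemma tlift_ctel_id:
 assumes "vs V" "vs W" "t .: (ctens V W)"
 shows "tlift (ctens V W) (ctel V W) t = t"
 by (rule ctens_lin_eqI[of _ V W "ctens V W"]) (insert assms, auto intro!: tlift_lin bilin_ctel lin_id simp: tlift_ctel bilin_ctel)

lemma tlift_cong:
 assumes "vs V" "vs W" "vs U" "bilin V W U ps" "t .: (ctens V W)"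
  and "\<And>v w. v .: V ==> w .: W ==> ph v w = ps v w"
 shows "tlift U ph t = tlift U ps t"
proof -
 have ph: "bilin V W U ph"
  using assms by (intro bilinI lin_cong[OF bilin_left[OF assms(4)] assms(1)] lin_cong[OF bilin_right[OF assms(4)] assms(2)])
 show ?thesis
  by (rule ctens_lin_eqI[of _ V W U]) (insert assms ph, auto intro!: tlift_lin simp: tlift_ctel)
qed

lemma bilin_cong:
 assumes "bilin V W U ps" "vs V" "vs W" "\<And>v w. v .: V ==> w .: W ==> ph v w = ps v w"
 shows "bilin V W U ph"
 using assms by (intro bilinI lin_cong[OF bilin_left[OF assms(1)] assms(2)] lin_cong[OF bilin_right[OF assms(1)] assms(3)])

lemma lin_tlift_fun:
 assumes V: "vs V" and W: "vs W" and U: "vs U" and t: "t .: (ctens V W)"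
  and ph: "\<And>x. x .: X ==> bilin V W U (ph x)"
  and x: "\<And>v w. v .: V ==> w .: W ==> (\<lambda>x. ph x v w) \<in> lin_hom X U"
  and X: "vs X"
 shows "(\<lambda>x. tlift U (ph x) t) \<in> lin_hom X U"
 using t V
proof (induction t rule: ctens_induct)
 case zero
 have "tlift U (ph x) \<zero>\<^bsub>ctens V W\<^esub> = \<zero>\<^bsub>U\<^esub>" if "x .: X" for x
  using lin_map_zero[OF tlift_lin[OF V W U ph[OF that]]] U by simp
 then show ?case
  using lin_cong[OF lin_zero_fun[OF U] X] by auto
next
 case (gen v w)
 show ?case
  by (rule lin_cong[OF x[OF gen] X]) (insert gen, simp add: tlift_ctel V W U ph)
next
 case (add s t)
 show ?case
  by (rule lin_cong[OF lin_add_fun[OF U add(3,4)] X])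
   (insert add, simp add: lin_add[OF tlift_lin[OF V W U ph]])
qed

lemma tlift_swap:
 assumes "vs V" "vs W" "vs X" "vs Y" "vs U" "s .: (ctens V W)" "t .: (ctens X Y)"
  and "\<And>x y. x .: X ==> y .: Y ==> bilin V W U (\<lambda>v w. ph v w x y)"
  and "\<And>v w. v .: V ==> w .: W ==> bilin X Y U (ph v w)"
 shows "tlift U (\<lambda>v w. tlift U (ph v w) t) s = tlift U (\<lambda>x y. tlift U (\<lambda>v w. ph v w x y) s) t"
proof -
 have b: "(\<lambda>w. ph v w x y) \<in> lin_hom W U" "(\<lambda>v. ph v w x y) \<in> lin_hom V U"
   "(\<lambda>y. ph v w x y) \<in> lin_hom Y U" "(\<lambda>x. ph v w x y) \<in> lin_hom X U"
  if "v .: V" "w .: W" "x .: X" "y .: Y" for v w x y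
  using that bilin_right[OF assms(8), of x y v] bilin_left[OF assms(8), of x y w]
   bilin_right[OF assms(9), of v w x] bilin_left[OF assms(9), of v w y] by auto
 have 1: "bilin X Y U (\<lambda>x y. tlift U (\<lambda>v w. ph v w x y) s)" if "s .: (ctens V W)" for s
  using that by (intro bilinI lin_tlift_fun[of V W U s]) (insert assms, auto intro: b)
 have 2: "bilin V W U (\<lambda>v w. tlift U (ph v w) t)"
  by (intro bilinI lin_tlift_fun[of X Y U t]) (insert assms, auto intro: b)
 have "tlift U (\<lambda>x y. tlift U (\<lambda>v w. ph v w x y) s) t .: U" if "s .: (ctens V W)" for s
  by (rule tlift_closed[OF _ _ _ 1]) (use assms that in auto)
 show ?thesis
 proof (rule ctens_lin_eqI[of _ V W U])
  show "tlift U (\<lambda>v w. tlift U (ph v w) t) \<in> lin_hom (ctens V W) U"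
   using 2 assms by (intro tlift_lin) auto
  show "(\<lambda>s. tlift U (\<lambda>x y. tlift U (\<lambda>v w. ph v w x y) s) t) \<in> lin_hom (ctens V W) U"
   using assms 1 by (intro lin_tlift_fun[of X Y U t]) (auto intro!: tlift_lin)
  fix v w assume vw: "v .: V" "w .: W"
  have "tlift U (\<lambda>x y. tlift U (\<lambda>v w. ph v w x y) (ctel V W v w)) t = tlift U (ph v w) t"
   by (rule tlift_cong[of X Y]) (insert assms vw, auto simp: tlift_ctel)
  then show "tlift U (\<lambda>v w. tlift U (ph v w) t) (ctel V W v w) = tlift U (\<lambda>x y. tlift U (\<lambda>v w. ph v w x y) (ctel V W v w)) t"
   using 2 assms vw by (simp add: tlift_ctel)
 qed (use assms in auto)
qed

section \<open>Tensor products over \<open>B\<close>\<close>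

lemma lin_btens: "lin_hom (btens B V W) U = lin_hom (tspace V W (balancing B V W)) U"
 by (simp add: btens_def)

lemma vs_btens [simp]: "vs (btens B V W)"
 by (simp add: btens_def)

lemma bilin_btel: "bilin V W (btens B V W) (btel B V W)"
 using bilin_tgen[of V W "balancing B V W"] by (simp add: btens_def btel_def[abs_def])

lemmas btel_closed [simp, intro] = bilin_closed[OF bilin_btel]
lemmas btel_lin [lin] = lin_bilin_right[OF bilin_btel] lin_bilin_left[OF bilin_btel]

definition balanced :: "'a set \<Rightarrow> ('a, 'v, 'x) bimod_scheme \<Rightarrow> ('a, 'w, 'y) bimod_scheme \<Rightarrow> ('v \<Rightarrow> 'w \<Rightarrow> 'u) \<Rightarrow> bool" where
 "balanced B V W ph \<longleftrightarrow> (\<forall>v\<in>carrier V. \<forall>b\<in>B. \<forall>w\<in>carrier W.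
   ract V v b .: V \<and> lact W b w .: W \<and> ph (ract V v b) w = ph v (lact W b w))"

lemma mid_balancing:
 assumes "bilin V W U ph" "balanced B V W ph" "vs U"
 shows "mid V W (balancing B V W) U ph"
 unfolding mid_def
proof (intro conjI ballI assms)
 fix p assume "p \<in> balancing B V W"
 then obtain v b w where p: "p = gen (ract V v b) w - gen v (lact W b w)" "v .: V" "b \<in> B" "w .: W"
  by (auto simp: balancing_def)
 have c: "ract V v b .: V" "lact W b w .: W" "ph (ract V v b) w = ph v (lact W b w)"
  using assms p by (auto simp: balanced_def)
 show "Poly_Mapping.keys p \<subseteq> carrier V \<times> carrier W"
  using keys_diff[of "gen (ract V v b) w" "gen v (lact W b w)"] p c by auto
 have k: "\<And>k. k \<in> carrier V \<times> carrier W ==> case_prod ph k .: U"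
  using bilin_closed[OF assms(1)] by auto
 note ev_diff[where K = "carrier V \<times> carrier W", OF assms(3) k] ev_single[where K = "carrier V \<times> carrier W", OF assms(3) k]
 then  show "ev U (case_prod ph) p = \<zero>\<^bsub>U\<^esub>"
  using p c bilin_closed[OF assms(1)] assms(3) by (simp add: vs_minus_zero_iff)
qed

lemma tlift_blin:
 "vs V ==> vs W ==> vs U ==> bilin V W U ph ==> balanced B V W ph ==> tlift U ph \<in> lin_hom (btens B V W) U"
 using tlift_lin_mid[OF _ _ _ mid_balancing] by (simp add: lin_btens)

lemma tlift_btel:
 "vs V ==> vs W ==> vs U ==> bilin V W U ph ==> balanced B V W ph ==> v .: V ==> w .: W ==>
  tlift U ph (btel B V W v w) = ph v w"
 using tlift_gen_mid[OF _ _ _ mid_balancing] by (simp add: btel_def)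

lemma btens_induct [consumes 2, case_names zero gen add]:
 assumes "t .: (btens B V W)" "vs V"
  and "P \<zero>\<^bsub>btens B V W\<^esub>"
  and "\<And>v w. v .: V ==> w .: W ==> P (btel B V W v w)"
  and "\<And>s t. s .: (btens B V W) ==> t .: (btens B V W) ==> P s ==> P t ==> P (s \<oplus>\<^bsub>btens B V W\<^esub> t)"
 shows "P t"
 using assms tens_induct[of t V W "balancing B V W" P] by (simp add: btel_def btens_def)

lemma btens_lin_eqI:
 assumes "T \<in> lin_hom (btens B V W) U" "T' \<in> lin_hom (btens B V W) U" "vs V" "vs U"
  and "\<And>v w. v .: V ==> w .: W ==> T (btel B V W v w) = T' (btel B V W v w)"
  and "t .: (btens B V W)"
 shows "T t = T' t"
 using tens_lin_eqI[of T V W "balancing B V W" U T' t] assms by (simp add: btens_def btel_def)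

lemma btel_balanced:
 assumes "v .: V" "b \<in> B" "w .: W"
 shows "btel B V W (ract V v b) w = btel B V W v (lact W b w)"
 using assms by (auto simp: btel_def tclass_eq_iff balancing_def intro!: tnull.extra)

section \<open>Functionals and slices\<close>

text \<open>A functional on the free vector space over the elements of \<open>V\<close> that kills the relations and the
generators from \<open>U\<close> descends to \<open>V\<close>; the free vector space is used because it is an instance of the
library notion of a vector space, where bases exist.\<close>

lemma functional_separates:
 fixes V :: "(complex, 'v, 'x) module_scheme" (structure)
 assumes V: "vs V" and U: "submodule U CC V" and v: "v .: V" "v \<notin> U"
 shows "\<exists>xi\<in>lin_hom V CC. (\<forall>u\<in>U. xi u = 0) \<and> xi v = 1"
proof -
 note UD = U[unfolded submodule_iff[OF V]]
 define th where "th k = (if k .: V then k else \<zero>)" for k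
 define e where "e = ev V th"
 have th: "th k .: V" for k using V by (simp add: th_def)
 have e: "e (p + q) = e p \<oplus> e q" "e (p - q) = e p \<ominus> e q" "e (pscale c p) = c \<odot> e p"
   "e (Poly_Mapping.single k c) = c \<odot> th k" "e p .: V" for p q c k
  unfolding e_def using V th by (auto simp: ev_add[of V UNIV] ev_diff[of V UNIV] ev_pscale[of V UNIV] ev_single[of V UNIV] ev_closed[of V UNIV])
 define K where "K = {p. e p \<in> U}"
 interpret pv: vector_space "pscale :: complex \<Rightarrow> ('v \<Rightarrow>\<^sub>0 complex) \<Rightarrow> ('v \<Rightarrow>\<^sub>0 complex)"
  by unfold_locales (simp_all add: pscale_simps)
 interpret cv: vector_space "(*) :: complex \<Rightarrow> complex \<Rightarrow> complex"
  by unfold_locales (simp_all add: algebra_simps)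
 interpret pc: vector_space_pair "pscale :: complex \<Rightarrow> ('v \<Rightarrow>\<^sub>0 complex) \<Rightarrow> ('v \<Rightarrow>\<^sub>0 complex)" "(*) :: complex \<Rightarrow> complex \<Rightarrow> complex" ..
 have "e 0 = \<zero>" using e(3)[of 0 0] e(5) V by (simp add: pscale_simps)
 then have K: "pv.subspace K"
 proof (intro pv.subspaceI)
  show "0 \<in> K" using \<open>e 0 = \<zero>\<close> UD by (simp add: K_def)
  show "x + y \<in> K" if "x \<in> K" "y \<in> K" for x y
   using that UD by (simp add: K_def e(1))
  show "pscale c x \<in> K" if "x \<in> K" for c x
   using that UD by (simp add: K_def e(3))
 qed
 obtain C where C: "C \<subseteq> K" "pv.independent C" "K \<subseteq> pv.span C"
  using pv.basis_exists[of K] by metis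
 have "pv.span C \<subseteq> K" using C(1) K by (simp add: pv.span_minimal)
 let ?p = "Poly_Mapping.single v 1"
 have "?p \<notin> K" using v V by (simp add: K_def e th_def)
 then have "?p \<notin> pv.span C" using \<open>pv.span C \<subseteq> K\<close> by blast
 then have ind: "pv.independent (insert ?p C)" using C(2) by (simp add: pv.independent_insert)
 obtain g where g: "Vector_Spaces.linear pscale (*) g" "\<forall>x\<in>insert ?p C. g x = (if x = ?p then 1 else 0)"
  using pc.linear_independent_extend[OF ind, of "\<lambda>x. if x = ?p then 1 else 0"] by blast
 have "?p \<notin> C" using \<open>?p \<notin> pv.span C\<close> pv.span_base by blast
 then have "g x = 0" if "x \<in> C" for x using g(2) that by auto
 then have gK: "g x = 0" if "x \<in> K" for x
  using pc.linear_eq_0_on_span[OF g(1), of C x] that C(3) by blast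
 have gl: "g (p + q) = g p + g q" "g (pscale c p) = c * g p" "g (p - q) = g p - g q" for p q c
  using g(1) by (simp_all add: pc.linear_add pc.linear_scale pc.linear_diff)
 define xi where "xi x = g (Poly_Mapping.single x 1)" for x
 have "xi \<in> lin_hom V CC"
 proof (rule lin_homI)
  fix x y c assume x: "x .: V"
  have "Poly_Mapping.single (c \<odot> x) 1 - pscale c (Poly_Mapping.single x 1) \<in> K"
   using x V UD by (simp add: K_def e th_def)
  then show "xi (c \<odot> x) = c \<odot>\<^bsub>CC\<^esub> xi x"
   using gK[of "Poly_Mapping.single (c \<odot> x) 1 - pscale c (Poly_Mapping.single x 1)"] gl by (simp add: xi_def)
  assume y: "y .: V"
  have "Poly_Mapping.single (x \<oplus> y) 1 - (Poly_Mapping.single x 1 + Poly_Mapping.single y 1) \<in> K"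
   using x y V UD by (simp add: K_def e th_def)
  then show "xi (x \<oplus> y) = xi x \<oplus>\<^bsub>CC\<^esub> xi y"
   using gK[of "Poly_Mapping.single (x \<oplus> y) 1 - (Poly_Mapping.single x 1 + Poly_Mapping.single y 1)"] gl
   by (simp add: xi_def)
 qed simp
 moreover have "xi u = 0" if "u \<in> U" for u
  unfolding xi_def by (rule gK) (insert that UD V, auto simp: K_def e th_def)
 moreover have "xi v = 1" using g(2) by (simp add: xi_def)
 ultimately show ?thesis by blast
qed

inductive frank :: "(complex, 'v, 'x) module_scheme \<Rightarrow> ('v \<Rightarrow> 'v) \<Rightarrow> bool" for V where
 zero: "frank V (\<lambda>v. \<zero>\<^bsub>V\<^esub>)"
| add: "frank V P ==> xi \<in> lin_hom V CC ==> e .: V ==> frank V (\<lambda>v. P v \<oplus>\<^bsub>V\<^esub> xi v \<odot>\<^bsub>V\<^esub> e)"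

lemma frank_lin: "frank V P ==> vs V ==> P \<in> lin_hom V V"
 by (induction rule: frank.induct) (auto intro!: lin)

text \<open>The projections are built one rank at a time: if \<open>P\<close> does not yet fix \<open>x\<close>, add the rank one map that sends
\<open>v\<close> to \<open>xi v\<close> times \<open>x - P x\<close> for a functional \<open>xi\<close> vanishing on the fixed points of \<open>P\<close>.\<close>

lemma finite_projection:
 assumes V: "vs V" and "finite S" "S \<subseteq> carrier V"
 shows "\<exists>P. frank V P \<and> (\<forall>x\<in>S. P x = x)"
 using assms(2,3)
proof (induction S rule: finite_induct)
 case empty
 then show ?case using frank.zero by blast
next
 case (insert x S)
 then obtain P where P: "frank V P" "\<forall>x\<in>S. P x = x" by auto
 note Pl = frank_lin[OF P(1) V]
 have x: "x .: V" "P x .: V" using insert lin_closed[OF Pl] by auto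
 show ?case
 proof (cases "P x = x")
  case True
  then show ?thesis using P by (intro exI[of _ P]) auto
 next
  case False
  let ?U = "{v \<in> carrier V. P v = v}"
  have "submodule ?U CC V"
   unfolding submodule_iff[OF V] using V by (auto simp: lin_map_zero[OF Pl V V] lin_add[OF Pl] lin_smult[OF Pl])
  then obtain xi where xi: "xi \<in> lin_hom V CC" "\<forall>u\<in>?U. xi u = 0" "xi x = 1"
   using functional_separates[OF V, of ?U x] False x by auto
  have "frank V (\<lambda>v. P v \<oplus>\<^bsub>V\<^esub> xi v \<odot>\<^bsub>V\<^esub> (x \<ominus>\<^bsub>V\<^esub> P x))"
   using x V by (intro frank.add P xi) auto
  moreover have "P x \<oplus>\<^bsub>V\<^esub> xi x \<odot>\<^bsub>V\<^esub> (x \<ominus>\<^bsub>V\<^esub> P x) = x"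
   using x V vs_minus_add[OF V, of x "P x"] vs_add_comm[OF V, of "P x"] by (simp add: xi)
  moreover have "P v \<oplus>\<^bsub>V\<^esub> xi v \<odot>\<^bsub>V\<^esub> (x \<ominus>\<^bsub>V\<^esub> P x) = v" if "v \<in> S" for v
   using that P insert xi x V by (auto simp: subset_iff)
  ultimately show ?thesis
   by (intro exI[of _ "\<lambda>v. P v \<oplus>\<^bsub>V\<^esub> xi v \<odot>\<^bsub>V\<^esub> (x \<ominus>\<^bsub>V\<^esub> P x)"]) auto
 qed
qed

definition slice :: "(complex, 'w, 'y) module_scheme \<Rightarrow> ('v \<Rightarrow> complex) \<Rightarrow> ('v, 'w) tensor \<Rightarrow> 'w" where
 "slice W xi = tlift W (\<lambda>v w. xi v \<odot>\<^bsub>W\<^esub> w)"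

lemma bilin_slice: "vs W ==> xi \<in> lin_hom V CC ==> bilin V W W (\<lambda>v w. xi v \<odot>\<^bsub>W\<^esub> w)"
 by (intro bilinI lin_smult_fun lin_scalar_fun lin_id) auto

lemma slice_lin: "vs V ==> vs W ==> xi \<in> lin_hom V CC ==> slice W xi \<in> lin_hom (ctens V W) W"
 unfolding slice_def by (intro tlift_lin bilin_slice)

lemma slice_ctel: "vs V ==> vs W ==> xi \<in> lin_hom V CC ==> v .: V ==> w .: W ==>
  slice W xi (ctel V W v w) = xi v \<odot>\<^bsub>W\<^esub> w"
 unfolding slice_def by (intro tlift_ctel bilin_slice)

lemma bilin_left_map: "P \<in> lin_hom V V' ==> vs V ==> bilin V W (ctens V' W) (\<lambda>v w. ctel V' W (P v) w)"
 by (intro bilinI lin) (auto intro: lin_closed)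

lemma finite_projection_tensor:
 assumes V: "vs V" and W: "vs W" and T: "finite T" "T \<subseteq> carrier (ctens V W)"
 shows "\<exists>P. frank V P \<and> (\<forall>t\<in>T. tlift (ctens V W) (\<lambda>v w. ctel V W (P v) w) t = t)"
proof -
 have "\<exists>S. finite S \<and> S \<subseteq> carrier V \<and> (\<forall>P. frank V P \<and> (\<forall>x\<in>S. P x = x) \<longrightarrow>
   tlift (ctens V W) (\<lambda>v w. ctel V W (P v) w) t = t)" if "t .: (ctens V W)" for t
  using that V
 proof (induction t rule: ctens_induct)
  case zero
  show ?case using lin_map_zero[OF tlift_lin[OF V W vs_ctens bilin_left_map[OF frank_lin]]] V
   by (intro exI[of _ "{}"]) auto
 next
  case (gen v w)
  then show ?case using V W
   by (intro exI[of _ "{v}"]) (auto simp: tlift_ctel[OF V W vs_ctens bilin_left_map[OF frank_lin]])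
 next
  case (add s t)
  then obtain S S' where S: "finite S" "S \<subseteq> carrier V" "\<forall>P. frank V P \<and> (\<forall>x\<in>S. P x = x) \<longrightarrow>
    tlift (ctens V W) (\<lambda>v w. ctel V W (P v) w) s = s"
   "finite S'" "S' \<subseteq> carrier V" "\<forall>P. frank V P \<and> (\<forall>x\<in>S'. P x = x) \<longrightarrow>
    tlift (ctens V W) (\<lambda>v w. ctel V W (P v) w) t = t" by auto
  then show ?case using V W add lin_add[OF tlift_lin[OF V W vs_ctens bilin_left_map[OF frank_lin]]]
   by (intro exI[of _ "S \<union> S'"]) auto
 qed
 then have "\<forall>t\<in>T. \<exists>S. finite S \<and> S \<subseteq> carrier V \<and> (\<forall>P. frank V P \<and> (\<forall>x\<in>S. P x = x) \<longrightarrow>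
   tlift (ctens V W) (\<lambda>v w. ctel V W (P v) w) t = t)" using T by auto
 then obtain S where S: "\<forall>t\<in>T. finite (S t) \<and> S t \<subseteq> carrier V \<and> (\<forall>P. frank V P \<and> (\<forall>x\<in>S t. P x = x) \<longrightarrow>
   tlift (ctens V W) (\<lambda>v w. ctel V W (P v) w) t = t)" by metis
 have "finite (\<Union>(S ` T))" "\<Union>(S ` T) \<subseteq> carrier V" using S T by auto
 from finite_projection[OF V this]
 obtain P where P: "frank V P" "\<forall>x\<in>\<Union>(S ` T). P x = x" by (elim exE conjE)
 have "tlift (ctens V W) (\<lambda>v w. ctel V W (P v) w) t = t" if "t \<in> T" for t
 proof -
  have "\<forall>x\<in>S t. P x = x" using P(2) that by blast
  then show ?thesis using bspec[OF S that] P(1) by blast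
 qed
 then show ?thesis using P(1) by blast
qed

lemma frank_tensor_expand:
 assumes V: "vs V" and W: "vs W" and "P \<in> lin_hom V V" "xi \<in> lin_hom V CC" "e .: V" "t .: (ctens V W)"
 shows "tlift (ctens V W) (\<lambda>v w. ctel V W (P v \<oplus>\<^bsub>V\<^esub> xi v \<odot>\<^bsub>V\<^esub> e) w) t =
  tlift (ctens V W) (\<lambda>v w. ctel V W (P v) w) t \<oplus>\<^bsub>ctens V W\<^esub> ctel V W e (slice W xi t)"
proof (rule ctens_lin_eqI[of "tlift (ctens V W) (\<lambda>v w. ctel V W (P v \<oplus>\<^bsub>V\<^esub> xi v \<odot>\<^bsub>V\<^esub> e) w)" V W "ctens V W"])
 have P': "(\<lambda>v. P v \<oplus>\<^bsub>V\<^esub> xi v \<odot>\<^bsub>V\<^esub> e) \<in> lin_hom V V"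
  by (intro lin assms)
 note b1 = bilin_left_map[OF P' V, of W] and b2 = bilin_left_map[OF assms(3) V, of W]
 show "tlift (ctens V W) (\<lambda>v w. ctel V W (P v \<oplus>\<^bsub>V\<^esub> xi v \<odot>\<^bsub>V\<^esub> e) w) \<in> lin_hom (ctens V W) (ctens V W)"
  by (rule tlift_lin[OF V W vs_ctens b1])
 show "(\<lambda>t. tlift (ctens V W) (\<lambda>v w. ctel V W (P v) w) t \<oplus>\<^bsub>ctens V W\<^esub> ctel V W e (slice W xi t)) \<in> lin_hom (ctens V W) (ctens V W)"
  by (intro lin_add_fun vs_ctens tlift_lin[OF V W vs_ctens b2] ctel_lin(1) slice_lin assms)
 fix v w assume vw: "v .: V" "w .: W"
 have c: "P v .: V" "xi v \<odot>\<^bsub>V\<^esub> e .: V"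
  using vw assms lin_closed[OF assms(3)] by auto
 have "ctel V W (P v \<oplus>\<^bsub>V\<^esub> xi v \<odot>\<^bsub>V\<^esub> e) w = ctel V W (P v) w \<oplus>\<^bsub>ctens V W\<^esub> ctel V W (xi v \<odot>\<^bsub>V\<^esub> e) w"
  by (rule lin_add[OF bilin_left[OF bilin_ctel]]) (use vw c in auto)
 also have "ctel V W (xi v \<odot>\<^bsub>V\<^esub> e) w = xi v \<odot>\<^bsub>ctens V W\<^esub> ctel V W e w"
  by (rule lin_smult[OF bilin_left[OF bilin_ctel]]) (use vw assms in auto)
 also have "... = ctel V W e (xi v \<odot>\<^bsub>W\<^esub> w)"
  by (rule lin_smult[OF bilin_right[OF bilin_ctel], symmetric]) (use vw assms in auto)
 finally show "tlift (ctens V W) (\<lambda>v w. ctel V W (P v \<oplus>\<^bsub>V\<^esub> xi v \<odot>\<^bsub>V\<^esub> e) w) (ctel V W v w) =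
   tlift (ctens V W) (\<lambda>v w. ctel V W (P v) w) (ctel V W v w) \<oplus>\<^bsub>ctens V W\<^esub> ctel V W e (slice W xi (ctel V W v w))"
  using vw assms by (simp add: tlift_ctel[OF V W vs_ctens b1] tlift_ctel[OF V W vs_ctens b2] slice_ctel)
qed (use assms in auto)

text \<open>A projection of finite rank that fixes the left legs writes the tensor as a finite sum of pure tensors
whose right legs are slices, so a tensor with vanishing slices vanishes.\<close>

lemma slices_zero:
 assumes V: "vs V" and W: "vs W" and t: "t .: (ctens V W)"
  and 0: "\<And>xi. xi \<in> lin_hom V CC ==> slice W xi t = \<zero>\<^bsub>W\<^esub>"
 shows "t = \<zero>\<^bsub>ctens V W\<^esub>"
proof -
 obtain P where P: "frank V P" "tlift (ctens V W) (\<lambda>v w. ctel V W (P v) w) t = t"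
  using finite_projection_tensor[OF V W, of "{t}"] t by auto
 have z: "e .: V ==> ctel V W e \<zero>\<^bsub>W\<^esub> = \<zero>\<^bsub>ctens V W\<^esub>" "w .: W ==> ctel V W \<zero>\<^bsub>V\<^esub> w = \<zero>\<^bsub>ctens V W\<^esub>" for e w
  using lin_map_zero[OF bilin_right[OF bilin_ctel, of e] W] lin_map_zero[OF bilin_left[OF bilin_ctel, of w] V] by auto
 have "tlift (ctens V W) (\<lambda>v w. ctel V W (P v) w) t = \<zero>\<^bsub>ctens V W\<^esub>"
  using P(1)
 proof induction
  case zero
  have "tlift (ctens V W) (\<lambda>v w. ctel V W \<zero>\<^bsub>V\<^esub> w) t = (\<lambda>t. \<zero>\<^bsub>ctens V W\<^esub>) t"
   by (rule ctens_lin_eqI[OF tlift_lin[OF V W vs_ctens] lin_zero_fun V])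
    (insert t V, auto simp: tlift_ctel[OF V W vs_ctens] bilin_left_map[OF lin_zero_fun] z)
  then show ?case by simp
 next
  case (add P xi e)
  then show ?case
   using t by (simp add: frank_tensor_expand[OF V W frank_lin[OF _ V]] 0 z)
 qed
 then show ?thesis using P by simp
qed

lemma slices_eqI:
 assumes V: "vs V" and W: "vs W" and t: "s .: (ctens V W)" "t .: (ctens V W)"
  and 0: "\<And>xi. xi \<in> lin_hom V CC ==> slice W xi s = slice W xi t"
 shows "s = t"
proof -
 have "s \<ominus>\<^bsub>ctens V W\<^esub> t = \<zero>\<^bsub>ctens V W\<^esub>"
  by (rule slices_zero[OF V W]) (use t 0 lin_closed[OF slice_lin[OF V W]] in
   \<open>auto simp: lin_map_minus[OF slice_lin[OF V W]] V W vs_minus_zero_iff\<close>)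
 then show ?thesis using t vs_minus_zero_iff[of "ctens V W" s t] by simp
qed

section \<open>Comodules\<close>

definition trilin :: "(complex, 'v, 'x) module_scheme \<Rightarrow> (complex, 'w, 'y) module_scheme \<Rightarrow> (complex, 't, 's) module_scheme \<Rightarrow>
  (complex, 'u, 'z) module_scheme \<Rightarrow> ('v \<Rightarrow> 'w \<Rightarrow> 't \<Rightarrow> 'u) \<Rightarrow> bool" where
 "trilin X Y Z U ph \<longleftrightarrow> (\<forall>y\<in>carrier Y. \<forall>z\<in>carrier Z. (\<lambda>x. ph x y z) \<in> lin_hom X U) \<and>
   (\<forall>x\<in>carrier X. \<forall>z\<in>carrier Z. (\<lambda>y. ph x y z) \<in> lin_hom Y U) \<and>
   (\<forall>x\<in>carrier X. \<forall>y\<in>carrier Y. (\<lambda>z. ph x y z) \<in> lin_hom Z U)"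

lemma trilinI:
 assumes "\<And>y z. y .: Y ==> z .: Z ==> (\<lambda>x. ph x y z) \<in> lin_hom X U"
  "\<And>x z. x .: X ==> z .: Z ==> (\<lambda>y. ph x y z) \<in> lin_hom Y U"
  "\<And>x y. x .: X ==> y .: Y ==> (\<lambda>z. ph x y z) \<in> lin_hom Z U"
 shows "trilin X Y Z U ph"
 using assms by (auto simp: trilin_def)

lemma trilinD:
 assumes "trilin X Y Z U ph"
 shows "y .: Y ==> z .: Z ==> (\<lambda>x. ph x y z) \<in> lin_hom X U"
  "x .: X ==> z .: Z ==> (\<lambda>y. ph x y z) \<in> lin_hom Y U"
  "x .: X ==> y .: Y ==> (\<lambda>z. ph x y z) \<in> lin_hom Z U"
  "x .: X ==> bilin Y Z U (ph x)"
  "z .: Z ==> bilin X Y U (\<lambda>x y. ph x y z)"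
 using assms by (auto simp: trilin_def intro!: bilinI)

lemma comoduleD:
 assumes "comodule A V \<rho>"
 shows comodule_lin: "\<rho> \<in> lin_hom V (ctens A V)"
  and comodule_closed [intro]: "v .: V ==> \<rho> v .: (ctens A V)"
  and comodule_coassoc: "v .: V ==> id_tens A (ctens A V) \<rho> (\<rho> v) =
    tlift (ctens A (ctens A V)) (\<lambda>a v'.
     tlift (ctens A (ctens A V)) (\<lambda>x y. ctel A (ctens A V) x (ctel A V y v')) (comult A a)) (\<rho> v)"
  and comodule_counit: "v .: V ==> tlift V (\<lambda>a v'. counit A a \<odot>\<^bsub>V\<^esub> v') (\<rho> v) = v"
 using assms by (auto simp: comodule_def intro: lin_closed)

context
 fixes A :: "'a hopf" and V :: "(complex, 'v, 'x) module_scheme" and \<rho>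
 assumes A: "vs A" and V: "vs V" and com: "comodule A V \<rho>"
begin

lemma cw_closed: "vs U ==> bilin A V U ph ==> v .: V ==> tlift U ph (\<rho> v) .: U"
 using com A V by (auto intro!: tlift_closed)

lemma cw_lin_arg: "vs U ==> bilin A V U ph ==> g \<in> lin_hom X V ==> (\<lambda>x. tlift U ph (\<rho> (g x))) \<in> lin_hom X U"
 by (rule lin_tlift_arg[OF A V], assumption, assumption, rule lin_comp[OF comodule_lin[OF com]])

lemma cw_lin_fun:
 assumes "vs U" "vs X" "v .: V" "\<And>x. x .: X ==> bilin A V U (ph x)"
  "\<And>a v. a .: A ==> v .: V ==> (\<lambda>x. ph x a v) \<in> lin_hom X U"
 shows "(\<lambda>x. tlift U (ph x) (\<rho> v)) \<in> lin_hom X U"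
 using assms com A V by (intro lin_tlift_fun[of A V U "\<rho> v" X]) auto

lemma cw_cong:
 "vs U ==> bilin A V U ps ==> v .: V ==> (\<And>a v. a .: A ==> v .: V ==> ph a v = ps a v) ==>
  tlift U ph (\<rho> v) = tlift U ps (\<rho> v)"
 using com A V by (intro tlift_cong[of A V U ps]) auto

lemma lin_through_cw:
 "T \<in> lin_hom U U' ==> vs U ==> vs U' ==> bilin A V U ph ==> v .: V ==>
  T (tlift U ph (\<rho> v)) = tlift U' (\<lambda>a v. T (ph a v)) (\<rho> v)"
 using com A V by (intro lin_through_tlift[of T U U' A V]) auto

lemma cw_counit:
 assumes "th \<in> lin_hom V U" "vs U" "counit A \<in> lin_hom A CC" "v .: V"
 shows "tlift U (\<lambda>a v'. counit A a \<odot>\<^bsub>U\<^esub> th v') (\<rho> v) = th v"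
proof -
 have b: "bilin A V V (\<lambda>a v'. counit A a \<odot>\<^bsub>V\<^esub> v')"
  using A V assms by (intro bilinI lin)
 have "th v = th (tlift V (\<lambda>a v'. counit A a \<odot>\<^bsub>V\<^esub> v') (\<rho> v))"
  using comodule_counit[OF com] assms by simp
 also have "... = tlift U (\<lambda>a v'. th (counit A a \<odot>\<^bsub>V\<^esub> v')) (\<rho> v)"
  using assms V b by (intro lin_through_cw)
 also have "... = tlift U (\<lambda>a v'. counit A a \<odot>\<^bsub>U\<^esub> th v') (\<rho> v)"
  using assms A V by (intro cw_cong) (auto simp: lin_smult[OF assms(1)] intro!: bilinI lin intro: lin_closed lin_comp)
 finally show ?thesis by simp
qed

text \<open>Coassociativity for nested Sweedler sums, without naming the threefold tensor product.\<close>

lemma cw_coassoc: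
 assumes U: "vs U" and ph: "trilin A A V U ph" and v: "v .: V" and \<Delta>: "comult A \<in> lin_hom A (ctens A A)"
 shows "tlift U (\<lambda>a v'. tlift U (ph a) (\<rho> v')) (\<rho> v) = tlift U (\<lambda>a v'. tlift U (\<lambda>x y. ph x y v') (comult A a)) (\<rho> v)"
proof -
 let ?T = "ctens A (ctens A V)"
 note phD = trilinD[OF ph]
 define J where "J = tlift U (\<lambda>x s. tlift U (ph x) s)"
 have bJ: "bilin A (ctens A V) U (\<lambda>x s. tlift U (ph x) s)"
  by (intro bilinI tlift_lin lin_tlift_fun[OF A V U]) (use A V U phD in auto)
 have J: "J \<in> lin_hom ?T U" unfolding J_def
  by (intro tlift_lin bJ A U vs_ctens)
 have b1: "bilin A V ?T (\<lambda>a v'. ctel A (ctens A V) a (\<rho> v'))"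
  by (intro bilinI ctel_lin lin_id comodule_lin[OF com] comodule_closed[OF com]) auto
 have b2: "bilin A A ?T (\<lambda>x y. ctel A (ctens A V) x (ctel A V y v'))" if "v' .: V" for v'
  using that by (intro bilinI ctel_lin lin_id) auto
 have b3: "bilin A V ?T (\<lambda>a v'. tlift ?T (\<lambda>x y. ctel A (ctens A V) x (ctel A V y v')) (comult A a))"
 proof (intro bilinI)
  fix a assume "a .: A"
  then show "(\<lambda>v'. tlift ?T (\<lambda>x y. ctel A (ctens A V) x (ctel A V y v')) (comult A a)) \<in> lin_hom V ?T"
   by (intro lin_tlift_fun[OF A A vs_ctens _ b2] ctel_lin lin_id V lin_closed[OF \<Delta>]) auto
 next
  fix v' assume "v' .: V"
  then show "(\<lambda>a. tlift ?T (\<lambda>x y. ctel A (ctens A V) x (ctel A V y v')) (comult A a)) \<in> lin_hom A ?T"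
   by (intro lin_tlift_arg[OF A A vs_ctens b2] \<Delta>)
 qed
 have "tlift U (\<lambda>a v'. tlift U (ph a) (\<rho> v')) (\<rho> v) = tlift U (\<lambda>a v'. J (ctel A (ctens A V) a (\<rho> v'))) (\<rho> v)"
  by (rule cw_cong[symmetric, OF U])
   (insert v A V U com bJ, auto simp: J_def tlift_ctel comodule_closed[OF com] intro!: bilinI lin_comp[OF comodule_lin[OF com]]
     lin_tlift_arg[OF A V U] lin_tlift_fun[OF A V U] lin_id phD)
 also have "... = J (tlift ?T (\<lambda>a v'. ctel A (ctens A V) a (\<rho> v')) (\<rho> v))"
  by (rule lin_through_cw[symmetric]) (use J U b1 v in auto)
 also have "... = J (tlift ?T (\<lambda>a v'. tlift ?T (\<lambda>x y. ctel A (ctens A V) x (ctel A V y v')) (comult A a)) (\<rho> v))"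
  using comodule_coassoc[OF com v] by (simp add: id_tens_def)
 also have "... = tlift U (\<lambda>a v'. J (tlift ?T (\<lambda>x y. ctel A (ctens A V) x (ctel A V y v')) (comult A a))) (\<rho> v)"
  by (rule lin_through_cw) (use J U b3 v in auto)
 also have "... = tlift U (\<lambda>a v'. tlift U (\<lambda>x y. ph x y v') (comult A a)) (\<rho> v)"
 proof (rule cw_cong[OF U _ v])
  show "bilin A V U (\<lambda>a v'. tlift U (\<lambda>x y. ph x y v') (comult A a))"
   by (intro bilinI lin_tlift_fun[OF A A U] lin_tlift_arg[OF A A U] \<Delta> phD V lin_closed[OF \<Delta>]) auto
  fix a v' assume av: "a .: A" "v' .: V"
  have "J (tlift ?T (\<lambda>x y. ctel A (ctens A V) x (ctel A V y v')) (comult A a)) =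
    tlift U (\<lambda>x y. J (ctel A (ctens A V) x (ctel A V y v'))) (comult A a)"
   by (rule lin_through_tlift[OF J A A]) (use b2 av U lin_closed[OF \<Delta>] in auto)
  also have "... = tlift U (\<lambda>x y. ph x y v') (comult A a)"
   by (rule tlift_cong[OF A A U]) (insert av phD A V U bJ lin_closed[OF \<Delta>], auto simp: J_def tlift_ctel)
  finally show "J (tlift ?T (\<lambda>x y. ctel A (ctens A V) x (ctel A V y v')) (comult A a)) =
    tlift U (\<lambda>x y. ph x y v') (comult A a)" .
 qed
 finally show ?thesis .
qed

end

section \<open>Hopf *-algebras\<close>

no_notation matrix_matrix_mult (infixl "**" 70)

locale hopf_star =
 fixes A :: "'a hopf" (structure)
 assumes hopf: "hopf_star_algebra A"
begin

abbreviation mul :: "'a \<Rightarrow> 'a \<Rightarrow> 'a" (infixl \<open>**\<close> 70) where "x ** y \<equiv> x \<otimes> y"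
abbreviation S where "S \<equiv> antipode A"
abbreviation eps where "eps \<equiv> counit A"
abbreviation st where "st \<equiv> star A"
abbreviation \<Delta> where "\<Delta> \<equiv> comult A"
abbreviation sw where "sw U ph a \<equiv> tlift U ph (comult A a)"

lemma hopfD:
 shows calg: "calgebra A" and com_\<Delta>: "comodule A A \<Delta>"
  and S_lin0: "S \<in> lin_hom A A" and st_lin0: "st \<in> lin_hom A (conj_vs A)"
  and st_st: "a .: A ==> st (st a) = a"
  and st_mult: "a .: A ==> b .: A ==> st (a ** b) = st b ** st a"
  and eps_lin0: "eps \<in> lin_hom A CC"
  and eps_mult: "a .: A ==> b .: A ==> eps (a ** b) = eps a * eps b"
  and eps_one: "eps \<one> = 1"
 using hopf by (auto simp: hopf_star_algebra_def hopf_algebra_def ring_hom_def)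

lemma vsA [simp, intro]: "vs A" and ringA: "ring A" and mult_bilin: "bilin A A A (\<lambda>a b. a ** b)"
 using calg by (auto simp: calgebra_def)

sublocale R: ring A by (rule ringA)

lemma mult_closed [simp, intro]: "a .: A ==> b .: A ==> a ** b .: A" by simp

lemmas mult_lin [lin] = lin_bilin_right[OF mult_bilin] lin_bilin_left[OF mult_bilin]
lemmas S_lin [lin] = lin_comp[OF S_lin0]
lemmas eps_lin [lin] = lin_comp[OF eps_lin0]
lemmas \<Delta>_lin0 = comodule_lin[OF com_\<Delta>]

lemma S_closed [simp, intro]: "a .: A ==> S a .: A" by (rule lin_closed[OF S_lin0])
lemma \<Delta>_closed [simp, intro]: "a .: A ==> \<Delta> a .: (ctens A A)" by (rule lin_closed[OF \<Delta>_lin0])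
lemma st_closed [simp, intro]: "a .: A ==> st a .: A" using lin_closed[OF st_lin0] by simp
declare st_st [simp]

lemma smult_mult: "a .: A ==> b .: A ==> (c \<odot> a) ** b = c \<odot> (a ** b)"
 and mult_smult: "a .: A ==> b .: A ==> a ** (c \<odot> b) = c \<odot> (a ** b)"
 using lin_smult[OF bilin_left[OF mult_bilin]] lin_smult[OF bilin_right[OF mult_bilin]] by auto

lemma st_smult: "a .: A ==> st (c \<odot> a) = cnj c \<odot> st a"
 and st_add: "a .: A ==> b .: A ==> st (a \<oplus> b) = st a \<oplus> st b"
 using lin_smult[OF st_lin0] lin_add[OF st_lin0] by auto

lemma st_one: "st \<one> = \<one>"
proof -
 have "\<one> = st (st \<one> ** \<one>)" by simp
 also have "... = st \<one> ** st (st \<one>)" by (rule st_mult) auto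
 finally show ?thesis by simp
qed

lemmas sw_closed [intro] = cw_closed[OF vsA vsA com_\<Delta>]
lemmas sw_lin_arg [lin] = cw_lin_arg[OF vsA vsA com_\<Delta>]
lemmas sw_lin_fun [lin] = cw_lin_fun[OF vsA vsA com_\<Delta>]
lemmas sw_cong = cw_cong[OF vsA vsA com_\<Delta>]
lemmas lin_through_sw = lin_through_cw[OF vsA vsA com_\<Delta>]
lemmas sw_counit_left = cw_counit[OF vsA vsA com_\<Delta> _ _ eps_lin0]
lemmas sw_coassoc = cw_coassoc[OF vsA vsA com_\<Delta> _ _ _ \<Delta>_lin0]

lemma sw_counit_right:
 assumes "th \<in> lin_hom A U" "vs U" "a .: A"
 shows "sw U (\<lambda>x y. eps y \<odot>\<^bsub>U\<^esub> th x) a = th a"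
proof -
 have b: "bilin A A A (\<lambda>x y. eps y \<odot> x)"
  by (intro bilinI lin eps_lin0) auto
 have "th a = th (sw A (\<lambda>x y. eps y \<odot> x) a)"
  using hopf assms by (simp add: hopf_star_algebra_def hopf_algebra_def)
 also have "... = sw U (\<lambda>x y. th (eps y \<odot> x)) a"
  using assms b by (intro lin_through_sw) auto
 also have "... = sw U (\<lambda>x y. eps y \<odot>\<^bsub>U\<^esub> th x) a"
  using assms by (intro sw_cong) (auto simp: lin_smult[OF assms(1)] intro!: bilinI lin eps_lin0 assms intro: lin_closed)
 finally show ?thesis by simp
qed

lemma antipode_left:
 assumes "th \<in> lin_hom A U" "vs U" "a .: A"
 shows "sw U (\<lambda>x y. th (S x ** y)) a = eps a \<odot>\<^bsub>U\<^esub> th \<one>"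
proof -
 have b: "bilin A A A (\<lambda>x y. S x ** y)"
  by (intro bilinI lin S_lin0) auto
 have "sw A (\<lambda>x y. S x ** y) a = eps a \<odot> \<one>"
  using hopf assms by (simp add: hopf_star_algebra_def hopf_algebra_def)
 then show ?thesis
  using lin_through_sw[OF assms(1) vsA assms(2) b assms(3)] by (simp add: lin_smult[OF assms(1)])
qed

lemma antipode_right:
 assumes "th \<in> lin_hom A U" "vs U" "a .: A"
 shows "sw U (\<lambda>x y. th (x ** S y)) a = eps a \<odot>\<^bsub>U\<^esub> th \<one>"
proof -
 have b: "bilin A A A (\<lambda>x y. x ** S y)"
  by (intro bilinI lin S_lin0) auto
 have "sw A (\<lambda>x y. x ** S y) a = eps a \<odot> \<one>"
  using hopf assms by (simp add: hopf_star_algebra_def hopf_algebra_def)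
 then show ?thesis
  using lin_through_sw[OF assms(1) vsA assms(2) b assms(3)] by (simp add: lin_smult[OF assms(1)])
qed

lemma sw_one: "vs U ==> bilin A A U ph ==> sw U ph \<one> = ph \<one> \<one>"
proof -
 assume U: "vs U" "bilin A A U ph"
 have "\<Delta> \<one> = \<one>\<^bsub>ctens A A\<^esub>"
  using hopf by (simp add: hopf_star_algebra_def hopf_algebra_def ring_hom_def)
 then show ?thesis using U by (simp add: ctens_simps tlift_ctel)
qed

lemma sw_mult:
 assumes U: "vs U" and ph: "bilin A A U ph" and ab: "a .: A" "b .: A"
 shows "sw U ph (a ** b) = sw U (\<lambda>x y. sw U (\<lambda>x' y'. ph (x ** x') (y ** y')) b) a"
proof -
 let ?T = "tspace A A {}" and ?C = "ctens A A"
 have tl: "tlift ?T = (tlift ?C :: ('a \<Rightarrow> 'a \<Rightarrow> _) \<Rightarrow> _)"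
  by (intro ext) (simp add: tlift_def ctens_def finsum_def)
 note phl = lin_bilin_left[OF ph] lin_bilin_right[OF ph]
 have b2: "bilin A A ?C (\<lambda>v' w'. ctel A A (v ** v') (w ** w'))" if "v .: A" "w .: A" for v w
  using that by (intro bilinI lin) auto
 have b1: "bilin A A ?C (\<lambda>v w. sw ?C (\<lambda>v' w'. ctel A A (v ** v') (w ** w')) b)"
  using ab b2 by (intro bilinI lin) auto
 have b3: "bilin A A U (\<lambda>x' y'. ph (x ** x') (y ** y'))" if "x .: A" "y .: A" for x y
  using that by (intro bilinI lin phl) auto
 have "\<Delta> (a ** b) = \<Delta> a \<otimes>\<^bsub>?C\<^esub> \<Delta> b"
  using hopf ab by (simp add: hopf_star_algebra_def hopf_algebra_def ring_hom_def)
 also have "... = tlift ?C (\<lambda>v w. sw ?C (\<lambda>v' w'. ctel A A (v ** v') (w ** w')) b) (\<Delta> a)"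
  by (subst (1) ctens_def) (simp add: tl)
 finally have "sw U ph (a ** b) = tlift U ph (tlift ?C (\<lambda>v w. sw ?C (\<lambda>v' w'. ctel A A (v ** v') (w ** w')) b) (\<Delta> a))"
  by simp
 also have "... = tlift U (\<lambda>v w. tlift U ph (sw ?C (\<lambda>v' w'. ctel A A (v ** v') (w ** w')) b)) (\<Delta> a)"
  by (rule lin_through_sw) (insert U ph ab b1, auto intro: tlift_lin)
 also have "... = sw U (\<lambda>x y. sw U (\<lambda>x' y'. ph (x ** x') (y ** y')) b) a"
 proof (rule sw_cong[OF U _ ab(1)])
  show "bilin A A U (\<lambda>x y. sw U (\<lambda>x' y'. ph (x ** x') (y ** y')) b)"
   using ab b3 U by (intro bilinI lin phl) auto
  fix x y assume xy: "x .: A" "y .: A"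
  have "tlift U ph (sw ?C (\<lambda>v' w'. ctel A A (x ** v') (y ** w')) b) = sw U (\<lambda>x' y'. tlift U ph (ctel A A (x ** x') (y ** y'))) b"
   by (rule lin_through_sw) (insert U ph ab b2 xy, auto intro: tlift_lin)
  also have "... = sw U (\<lambda>x' y'. ph (x ** x') (y ** y')) b"
   by (rule sw_cong) (insert U ph ab b3 xy, auto simp: tlift_ctel)
  finally show "tlift U ph (sw ?C (\<lambda>v' w'. ctel A A (x ** v') (y ** w')) b) = sw U (\<lambda>x' y'. ph (x ** x') (y ** y')) b" .
 qed
 finally show ?thesis .
qed

lemma st_lin': "st \<in> lin_hom (conj_vs A) A"
 using st_lin0 by (simp add: lin_conj_swap)

lemma st_lin: "g \<in> lin_hom X A ==> (\<lambda>x. st (g x)) \<in> lin_hom (conj_vs X) A"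
 using lin_comp[OF st_lin0, of g] by (simp add: lin_conj_swap)

lemma sw_star:
 assumes U: "vs U" and ph: "bilin A A U ph" and a: "a .: A"
 shows "sw U ph (st a) = sw (conj_vs U) (\<lambda>x y. ph (st x) (st y)) a"
proof -
 let ?C = "ctens A A"
 have b: "bilin A A (conj_vs ?C) (\<lambda>x y. ctel A A (st x) (st y))"
  by (intro bilinI, unfold lin_conj_swap) (intro lin st_lin'; auto)+
 have "\<Delta> (st a) = sw (conj_vs ?C) (\<lambda>x y. ctel A A (st x) (st y)) a"
  using hopf a by (simp add: hopf_star_algebra_def)
 then have "sw U ph (st a) = tlift U ph (sw (conj_vs ?C) (\<lambda>x y. ctel A A (st x) (st y)) a)"
  by simp
 also have "... = sw (conj_vs U) (\<lambda>x y. tlift U ph (ctel A A (st x) (st y))) a"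
  by (rule lin_through_sw) (insert U ph a b, auto simp: lin_conj_both intro: tlift_lin)
 also have "... = sw (conj_vs U) (\<lambda>x y. ph (st x) (st y)) a"
  by (rule sw_cong)
   (insert U ph a, auto simp: tlift_ctel lin_conj_swap intro!: bilinI lin_bilin_left[OF ph] lin_bilin_right[OF ph] st_lin' st_lin lin_id)
 finally show ?thesis .
qed

lemma eps_st: "a .: A ==> eps (st a) = cnj (eps a)"
proof -
 assume a: "a .: A"
 define eps' where "eps' a = cnj (eps (st a))" for a
 have l: "eps' \<in> lin_hom A CC" unfolding eps'_def
  by (rule lin_homI) (auto simp: st_add st_smult lin_add[OF eps_lin0] lin_smult[OF eps_lin0])
 have b: "bilin A A (conj_vs A) (\<lambda>x y. eps (st y) \<odot> st x)"
  unfolding bilin_def lin_hom_def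
  by (auto simp: st_add st_smult lin_add[OF eps_lin0] lin_smult[OF eps_lin0] vs_smult_add vs_add_smult mult.commute)
 have b': "bilin A A A (\<lambda>x y. eps y \<odot> x)" "bilin A A A (\<lambda>x y. eps' y \<odot> x)"
  by (intro bilinI lin eps_lin0 l; simp)+
 have st': "st \<in> lin_hom (conj_vs A) A" using st_lin0 by (simp add: lin_conj_swap)
 have "a = st (sw A (\<lambda>x y. eps y \<odot> x) (st a))"
  using sw_counit_right[OF lin_id vsA, of "st a"] a by simp
 also have "... = st (sw (conj_vs A) (\<lambda>x y. eps (st y) \<odot> st x) a)"
  using a b' by (simp add: sw_star)
 also have "... = sw A (\<lambda>x y. st (eps (st y) \<odot> st x)) a"
  by (rule lin_through_sw) (use st' a b in auto)
 also have "... = sw A (\<lambda>x y. eps' y \<odot> x) a"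
  by (rule sw_cong) (insert a b', auto simp: st_smult eps'_def)
 finally have "eps a = eps (sw A (\<lambda>x y. eps' y \<odot> x) a)" by simp
 also have "... = sw CC (\<lambda>x y. eps (eps' y \<odot> x)) a"
  by (rule lin_through_sw) (use a b' eps_lin0 in auto)
 also have "... = sw CC (\<lambda>x y. eps x \<odot>\<^bsub>CC\<^esub> eps' y) a"
  by (rule sw_cong) (insert a, auto simp: lin_smult[OF eps_lin0] intro!: bilinI lin eps_lin0 l)
 also have "... = eps' a" by (rule sw_counit_left) (use l a in auto)
 finally show ?thesis by (simp add: eps'_def)
qed

text \<open>If the sum of \<open>Z b(1)\<close> times \<open>b(2)\<close> is \<open>eps b\<close> times \<open>c\<close>, multiply by \<open>S b(3)\<close> on the right.\<close>

lemma conv_cancel: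
 assumes Z: "Z \<in> lin_hom A A" and c: "c .: A"
  and eq: "\<And>b. b .: A ==> sw A (\<lambda>p q. Z p ** q) b = eps b \<odot> c" and b: "b .: A"
 shows "Z b = c ** S b"
proof -
 have Zc: "\<And>x. x .: A ==> Z x .: A" using lin_closed[OF Z] .
 have bi: "bilin A A A (\<lambda>p q. Z p ** q)" by (intro bilinI lin lin_comp[OF Z]) (auto simp: Zc)
 have tri: "trilin A A A A (\<lambda>p q w. Z p ** (q ** S w))"
  by (intro trilinI lin lin_comp[OF Z] S_lin0) (auto simp: Zc)
 have "Z b = sw A (\<lambda>p v. eps v \<odot> Z p) b"
  using sw_counit_right[OF Z vsA b] by simp
 also have "... = sw A (\<lambda>p v. sw A (\<lambda>q w. Z p ** (q ** S w)) v) b"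
 proof (rule sw_cong[OF _ _ b])
  show "bilin A A A (\<lambda>p v. sw A (\<lambda>q w. Z p ** (q ** S w)) v)"
   by (intro bilinI lin lin_comp[OF Z] trilinD[OF tri]) (auto simp: Zc)
  fix p v assume "p .: A" "v .: A"
  then show "eps v \<odot> Z p = sw A (\<lambda>q w. Z p ** (q ** S w)) v"
   using antipode_right[of "\<lambda>x. Z p ** x" A v] Zc by (simp add: mult_lin lin_id)
 qed simp
 also have "... = sw A (\<lambda>u w. sw A (\<lambda>p q. Z p ** (q ** S w)) u) b"
  by (rule sw_coassoc) (use tri b in auto)
 also have "... = sw A (\<lambda>u w. eps u \<odot> (c ** S w)) b"
 proof (rule sw_cong[OF _ _ b])
  show "bilin A A A (\<lambda>u w. eps u \<odot> (c ** S w))"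
   by (intro bilinI lin eps_lin0 S_lin0) (auto simp: c)
  fix u w assume uw: "u .: A" "w .: A"
  have "sw A (\<lambda>p q. Z p ** (q ** S w)) u = sw A (\<lambda>p q. Z p ** q ** S w) u"
   by (rule sw_cong) (insert uw Zc, auto simp: R.m_assoc intro!: bilinI lin lin_comp[OF Z])
  also have "... = sw A (\<lambda>p q. Z p ** q) u ** S w"
   by (rule lin_through_sw[symmetric, of "\<lambda>x. x ** S w"]) (insert uw bi, auto intro!: lin)
  finally show "sw A (\<lambda>p q. Z p ** (q ** S w)) u = eps u \<odot> (c ** S w)"
   using uw c by (simp add: eq smult_mult)
 qed simp
 also have "... = c ** S b"
  by (rule sw_counit_left) (insert c b, auto intro!: lin S_lin0)
 finally show ?thesis .
qed

text \<open>In \<open>S(a(1) b(1)) a(2) b(2) = eps a eps b\<close> first \<open>b(2)\<close> and then \<open>a(2)\<close> is cancelled with \<open>conv_cancel\<close>.\<close>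

lemma S_mult:
 assumes a: "a .: A" and b: "b .: A"
 shows "S (a ** b) = S b ** S a"
proof -
 have 1: "sw A (\<lambda>x y. S (x ** b) ** y) a = eps a \<odot> S b" if a: "a .: A" and b: "b .: A" for a b
 proof -
  define Z where "Z p = sw A (\<lambda>x y. S (x ** p) ** y) a" for p
  have bi: "bilin A A A (\<lambda>x y. S (x ** p) ** y)" if "p .: A" for p
   using that by (intro bilinI lin) auto
  have "Z b = (eps a \<odot> \<one>) ** S b"
  proof (rule conv_cancel)
   show "Z \<in> lin_hom A A" unfolding Z_def by (intro lin bi) (auto simp: a)
   show "eps a \<odot> \<one> .: A" by simp
   show "b .: A" by fact
   fix c assume c: "c .: A"
   have bc: "bilin A A A (\<lambda>p q. S (x ** p) ** (y ** q))" if "x .: A" "y .: A" for x y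
    using that by (intro bilinI lin) auto
   have "sw A (\<lambda>p q. Z p ** q) c = sw A (\<lambda>p q. sw A (\<lambda>x y. S (x ** p) ** (y ** q)) a) c"
   proof (rule sw_cong[OF _ _ c])
    show "bilin A A A (\<lambda>p q. sw A (\<lambda>x y. S (x ** p) ** (y ** q)) a)"
     by (intro bilinI lin a) auto
    fix p q assume pq: "p .: A" "q .: A"
    have "Z p ** q = sw A (\<lambda>x y. S (x ** p) ** y ** q) a"
     unfolding Z_def by (rule lin_through_sw[of "\<lambda>x. x ** q"]) (insert pq a bi, auto intro!: lin)
    also have "... = sw A (\<lambda>x y. S (x ** p) ** (y ** q)) a"
     by (rule sw_cong) (insert pq a, auto simp: R.m_assoc intro!: bilinI lin)
    finally show "Z p ** q = sw A (\<lambda>x y. S (x ** p) ** (y ** q)) a" .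
   qed simp
   also have "... = sw A (\<lambda>x y. sw A (\<lambda>p q. S (x ** p) ** (y ** q)) c) a"
    by (rule tlift_swap[OF vsA vsA vsA vsA]) (insert a c, auto intro!: bilinI lin)
   also have "... = sw A (\<lambda>p q. S p ** q) (a ** c)"
    by (rule sw_mult[symmetric]) (insert a c, auto intro!: bilinI lin S_lin0)
   also have "... = eps c \<odot> (eps a \<odot> \<one>)"
    using antipode_left[OF lin_id vsA, of "a ** c"] a c by (simp add: eps_mult mult.commute)
   finally show "sw A (\<lambda>p q. Z p ** q) c = eps c \<odot> (eps a \<odot> \<one>)" .
  qed
  then show ?thesis using b by (simp add: Z_def smult_mult)
 qed
 show ?thesis
  by (rule conv_cancel[of "\<lambda>x. S (x ** b)"]) (insert 1 a b, auto intro!: lin)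
qed

lemma S_one: "S \<one> = \<one>"
 using antipode_left[OF lin_id vsA, of "\<one>"] sw_one[OF vsA, of "\<lambda>x y. S x ** y"]
 by (simp add: eps_one bilinI lin S_lin0)

end

context hopf_star
begin

text \<open>The inverse of the antipode; in a Hopf *-algebra it is conjugate to the antipode by the involution.\<close>

definition S' where "S' a = st (S (st a))"

lemma S'_lin0: "S' \<in> lin_hom A A"
proof -
 have "S \<in> lin_hom (conj_vs A) (conj_vs A)" by (simp add: lin_conj_both S_lin0)
 from lin_comp[OF st_lin' lin_comp[OF this st_lin0]] show ?thesis
  by (simp add: S'_def[abs_def])
qed

lemmas S'_lin [lin] = lin_comp[OF S'_lin0]

lemma S'_closed [simp, intro]: "a .: A ==> S' a .: A" by (rule lin_closed[OF S'_lin0])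

lemma S'_mult: "a .: A ==> b .: A ==> S' (a ** b) = S' b ** S' a"
 by (simp add: S'_def st_mult S_mult)


lemma star_antipode_law:
 assumes eq: "\<And>a. a .: A ==> sw A ph a = eps a \<odot> \<one>" and ph: "bilin A A A ph"
  and ps: "bilin A A A ps" "\<And>x y. x .: A ==> y .: A ==> st (ph (st x) (st y)) = ps x y"
  and th: "th \<in> lin_hom A U" "vs U" and a: "a .: A"
 shows "sw U (\<lambda>x y. th (ps x y)) a = eps a \<odot>\<^bsub>U\<^esub> th \<one>"
proof -
 have b: "bilin A A (conj_vs A) (\<lambda>x y. ph (st x) (st y))"
  by (intro bilinI, unfold lin_conj_swap)
   (intro lin_bilin_left[OF ph] lin_bilin_right[OF ph] st_lin'; auto)+
 have "eps a \<odot> \<one> = st (sw A ph (st a))"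
  using a by (simp add: eq eps_st st_smult st_one)
 also have "... = st (sw (conj_vs A) (\<lambda>x y. ph (st x) (st y)) a)"
  using a ph by (simp add: sw_star)
 also have "... = sw A (\<lambda>x y. st (ph (st x) (st y))) a"
  by (rule lin_through_sw) (use st_lin' a b in auto)
 also have "... = sw A ps a"
  by (rule sw_cong) (use a ps in auto)
 finally have "th (sw A ps a) = eps a \<odot>\<^bsub>U\<^esub> th \<one>"
  using lin_smult[OF th(1), of "\<one>"] by (metis R.one_closed)
 then show ?thesis
  using lin_through_sw[OF th(1) vsA th(2) ps(1) a] by simp
qed

lemma S'_left:
 assumes "th \<in> lin_hom A U" "vs U" "a .: A"
 shows "sw U (\<lambda>x y. th (y ** S' x)) a = eps a \<odot>\<^bsub>U\<^esub> th \<one>"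
 by (rule star_antipode_law[of "\<lambda>x y. S x ** y"])
  (insert assms antipode_left[OF lin_id vsA], auto simp: st_mult S'_def[symmetric] intro!: bilinI lin S_lin0 S'_lin0)

lemma S'_right:
 assumes "th \<in> lin_hom A U" "vs U" "a .: A"
 shows "sw U (\<lambda>x y. th (S' y ** x)) a = eps a \<odot>\<^bsub>U\<^esub> th \<one>"
 by (rule star_antipode_law[of "\<lambda>x y. x ** S y"])
  (insert assms antipode_right[OF lin_id vsA], auto simp: st_mult S'_def[symmetric] intro!: bilinI lin S_lin0 S'_lin0)

definition act where "act a b = sw A (\<lambda>x y. x ** b ** S y) a"

lemma act_bilin: "bilin A A A act"
 unfolding act_def[abs_def] by (intro bilinI lin S_lin0) auto

lemmas act_lin [lin] = lin_bilin_right[OF act_bilin] lin_bilin_left[OF act_bilin]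
lemmas act_closed [simp, intro] = bilin_closed[OF act_bilin]

lemma act_one: "b .: A ==> act \<one> b = b"
 unfolding act_def by (subst sw_one) (auto simp: S_one intro!: bilinI lin S_lin0)

lemma act_mult:
 assumes a: "a .: A" "a' .: A" and b: "b .: A"
 shows "act (a ** a') b = act a (act a' b)"
proof -
 have bi: "bilin A A A (\<lambda>x y. x ** b ** S y)" by (intro bilinI lin S_lin0) (auto simp: b)
 have "act (a ** a') b = sw A (\<lambda>x y. sw A (\<lambda>x' y'. x ** x' ** b ** S (y ** y')) a') a"
  unfolding act_def by (rule sw_mult) (insert a b, auto intro!: bilinI lin S_lin0)
 also have "... = sw A (\<lambda>x y. x ** act a' b ** S y) a"
 proof (rule sw_cong[OF _ _ a(1)])
  show "bilin A A A (\<lambda>x y. x ** act a' b ** S y)" by (intro bilinI lin S_lin0) (auto simp: a b)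
  fix x y assume xy: "x .: A" "y .: A"
  have "x ** act a' b ** S y = sw A (\<lambda>x' y'. x ** (x' ** b ** S y') ** S y) a'"
   unfolding act_def by (rule lin_through_sw[of "\<lambda>u. x ** u ** S y"]) (insert xy a bi, auto intro!: lin)
  also have "... = sw A (\<lambda>x' y'. x ** x' ** b ** S (y ** y')) a'"
   by (rule sw_cong) (insert xy a b, auto simp: S_mult R.m_assoc intro!: bilinI lin)
  finally show "sw A (\<lambda>x' y'. x ** x' ** b ** S (y ** y')) a' = x ** act a' b ** S y" by simp
 qed simp
 finally show ?thesis by (simp add: act_def)
qed

lemma eps_act: "a .: A ==> b .: A ==> eps (act a b) = eps a * eps b"
proof -
 assume ab: "a .: A" "b .: A"
 have "eps (act a b) = sw CC (\<lambda>x y. eps (x ** b ** S y)) a"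
  unfolding act_def by (rule lin_through_sw) (insert ab eps_lin0, auto intro!: bilinI lin S_lin0)
 also have "... = sw CC (\<lambda>x y. eps b * eps (x ** S y)) a"
  by (rule sw_cong) (insert ab, auto simp: eps_mult intro!: bilinI lin S_lin0)
 also have "... = eps a * eps b"
  by (subst antipode_right[of "\<lambda>x. eps b * eps x"]) (insert ab, auto simp: eps_one intro!: lin eps_lin0)
 finally show ?thesis .
qed

lemma act_cancel:
 assumes a: "a .: A" and b: "b .: A"
 shows "sw A (\<lambda>x y. act x b ** y) a = a ** b"
proof -
 have "sw A (\<lambda>x y. act x b ** y) a = sw A (\<lambda>x y. sw A (\<lambda>p q. p ** b ** (S q ** y)) x) a"
 proof (rule sw_cong[OF _ _ a])
  show "bilin A A A (\<lambda>x y. sw A (\<lambda>p q. p ** b ** (S q ** y)) x)" by (intro bilinI lin S_lin0) (auto simp: b)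
  fix x y assume xy: "x .: A" "y .: A"
  have "act x b ** y = sw A (\<lambda>p q. p ** b ** S q ** y) x"
   unfolding act_def by (rule lin_through_sw[of "\<lambda>u. u ** y"]) (insert xy b, auto intro!: bilinI lin S_lin0)
  also have "... = sw A (\<lambda>p q. p ** b ** (S q ** y)) x"
   by (rule sw_cong) (insert xy b, auto simp: R.m_assoc intro!: bilinI lin S_lin0)
  finally show "act x b ** y = sw A (\<lambda>p q. p ** b ** (S q ** y)) x" .
 qed simp
 also have "... = sw A (\<lambda>p r. sw A (\<lambda>q y. p ** b ** (S q ** y)) r) a"
  by (rule sw_coassoc[symmetric, of _ "\<lambda>p q y. p ** b ** (S q ** y)"]) (insert a b, auto intro!: trilinI lin S_lin0)
 also have "... = sw A (\<lambda>p r. eps r \<odot> (p ** b)) a"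
 proof (rule sw_cong[OF _ _ a])
  show "bilin A A A (\<lambda>p r. eps r \<odot> (p ** b))" by (intro bilinI lin eps_lin0) (auto simp: b)
  fix p r assume "p .: A" "r .: A"
  then show "sw A (\<lambda>q y. p ** b ** (S q ** y)) r = eps r \<odot> (p ** b)"
   using antipode_left[of "\<lambda>u. p ** b ** u" A r] b by (simp add: mult_lin lin_id)
 qed simp
 also have "... = a ** b"
  by (rule sw_counit_right) (insert a b, auto intro!: lin)
 finally show ?thesis .
qed

end

section \<open>Coideal *-subalgebras\<close>

locale qhs = hopf_star A for A :: "'a hopf" (structure) +
 fixes B :: "'a set"
 assumes qh: "quantum_homogeneous_space A B" and B_st: "b \<in> B ==> star A b \<in> B"
begin

abbreviation BB where "BB \<equiv> regular A B"

lemma qhD: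
 shows B_sub: "submodule B CC A" and B_one [simp, intro]: "\<one> \<in> B"
  and B_mult [simp, intro]: "a \<in> B ==> b \<in> B ==> a ** b \<in> B"
  and B_coideal: "b \<in> B ==> tens_in (\<Delta> b) (carrier A) B"
  and ff: "faithfully_flat A B" and aug_comm: "aug A B \<cdot> carrier A = carrier A \<cdot> aug A B"
 using qh by (auto simp: quantum_homogeneous_space_def left_coideal_subalgebra_def subalg_def)

lemma B_carrier [simp, intro]: "b \<in> B ==> b .: A"
 using submoduleD(1)[OF vsA B_sub] by auto
lemma B_zero [simp, intro]: "\<zero> \<in> B" by (rule submoduleD(2)[OF vsA B_sub])
lemma B_add [simp, intro]: "a \<in> B ==> b \<in> B ==> a \<oplus> b \<in> B" by (rule submoduleD(3)[OF vsA B_sub])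
lemma B_smult [simp, intro]: "b \<in> B ==> c \<odot> b \<in> B" by (rule submoduleD(4)[OF vsA B_sub])

lemma BB_simps [simp]: "carrier BB = B" "x \<oplus>\<^bsub>BB\<^esub> y = x \<oplus> y" "\<zero>\<^bsub>BB\<^esub> = \<zero>" "c \<odot>\<^bsub>BB\<^esub> x = c \<odot> x"
 "x \<otimes>\<^bsub>BB\<^esub> y = x ** y" "lact BB x y = x ** y" "ract BB x y = x ** y"
 by (simp_all add: regular_def)

lemma vsBB [simp, intro]: "vs BB"
 by (rule vs_cong[OF vs_sub[OF vsA B_sub]]) (simp_all add: regular_def)

lemma lin_BB_A: "f \<in> lin_hom X BB ==> f \<in> lin_hom X A"
 by (auto simp: lin_hom_def)

lemma lin_A_BB: "f \<in> lin_hom X A ==> (\<And>x. x .: X ==> f x \<in> B) ==> f \<in> lin_hom X BB"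
 by (auto simp: lin_hom_def)

lemma lin_from_A_BB: "f \<in> lin_hom A X ==> f \<in> lin_hom BB X"
 by (auto simp: lin_hom_def)


lemma lin_hom_B: "lin_hom (A\<lparr>carrier := B\<rparr>) X = lin_hom BB X" "lin_hom X (A\<lparr>carrier := B\<rparr>) = lin_hom X BB"
 by (rule lin_hom_cong; simp add: regular_def)+

lemma bilin_A_BB: "bilin X A U ph ==> bilin X BB U ph" "bilin A X U ph ==> bilin BB X U ph"
 by (auto simp: bilin_def intro: lin_from_A_BB)

lemma slice_BB_A:
 assumes "xi \<in> lin_hom A CC" "t .: (ctens A BB)"
 shows "slice A xi (tlift (ctens A A) (\<lambda>x y. ctel A A x y) t) = slice BB xi t"
proof (rule ctens_lin_eqI[of "\<lambda>t. slice A xi (tlift (ctens A A) (\<lambda>x y. ctel A A x y) t)" A BB A])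
 have b: "bilin A BB (ctens A A) (\<lambda>x y. ctel A A x y)" by (rule bilin_A_BB[OF bilin_ctel])
 show "(\<lambda>t. slice A xi (tlift (ctens A A) (\<lambda>x y. ctel A A x y) t)) \<in> lin_hom (ctens A BB) A"
  by (intro lin_comp[OF slice_lin[OF vsA vsA assms(1)]] tlift_lin b) auto
 show "slice BB xi \<in> lin_hom (ctens A BB) A"
  by (intro lin_BB_A slice_lin assms) auto
 show "slice A xi (tlift (ctens A A) (ctel A A) (ctel A BB v w)) = slice BB xi (ctel A BB v w)"
  if "v .: A" "w .: BB" for v w
  using that assms b by (simp add: tlift_ctel slice_ctel)
qed (use assms in auto)

text \<open>The coideal condition provides an element of the smaller tensor product; it is unique because the
slices of its image determine its own slices.\<close>

lemma base_coact:
 assumes b: "b \<in> B"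
 shows bc_closed: "base_coact A B b .: (ctens A BB)"
  and bc_incl: "tlift (ctens A A) (\<lambda>x y. ctel A A x y) (base_coact A B b) = \<Delta> b"
proof -
 have bil: "bilin A BB (ctens A A) (\<lambda>x y. ctel A A x y)" by (rule bilin_A_BB[OF bilin_ctel])
 obtain p where p: "p \<in> \<Delta> b" "Poly_Mapping.keys p \<subseteq> carrier A \<times> B"
  using B_coideal[OF b] by (auto simp: tens_in_def)
 obtain q where q: "\<Delta> b = tclass A A {} q"
  using \<Delta>_closed[of b] b by (auto simp: ctens_simps tspace_simps)
 have "p - q \<in> tnull A A {}" using p q by (simp add: tclass_def)
 then have \<Delta>p: "\<Delta> b = tclass A A {} p" using q by (metis tclass_eq_iff)
 have p': "Poly_Mapping.keys p \<subseteq> carrier A \<times> carrier A" using p(2) by auto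
 define t where "t = tclass A BB {} p"
 have t: "t .: (ctens A BB)" using p(2) by (simp add: t_def ctens_simps tclass_carrier)
 have "tlift (ctens A A) (\<lambda>x y. ctel A A x y) t = ev (ctens A A) (case_prod (ctel A A)) p"
  unfolding t_def using p(2) bil by (intro tlift_tclass mid_empty) auto
 also have "... = tlift (ctens A A) (ctel A A) (\<Delta> b)"
  unfolding \<Delta>p using p' bilin_ctel by (intro tlift_tclass[symmetric] mid_empty) auto
 also have "... = \<Delta> b" using b by (simp add: tlift_ctel_id)
 finally have t2: "tlift (ctens A A) (\<lambda>x y. ctel A A x y) t = \<Delta> b" .
 have "base_coact A B b = t"
  unfolding base_coact_def
 proof (rule the_equality)
  fix s assume s: "s .: (ctens A BB) \<and> tlift (ctens A A) (\<lambda>x y. ctel A A x y) s = \<Delta> b"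
  show "s = t"
   by (rule slices_eqI[of A BB]) (insert s t t2 slice_BB_A, auto simp flip: slice_BB_A)
 qed (use t t2 in auto)
 then show "base_coact A B b .: (ctens A BB)"
  "tlift (ctens A A) (\<lambda>x y. ctel A A x y) (base_coact A B b) = \<Delta> b"
  using t t2 by auto
qed

lemma bc_eqI:
 assumes "s .: (ctens A BB)" "t .: (ctens A BB)"
  "tlift (ctens A A) (\<lambda>x y. ctel A A x y) s = tlift (ctens A A) (\<lambda>x y. ctel A A x y) t"
 shows "s = t"
 by (rule slices_eqI[of A BB]) (insert assms, auto simp flip: slice_BB_A)

lemma bc_sw:
 assumes U: "vs U" and ph: "bilin A A U ph" and b: "b \<in> B"
 shows "tlift U ph (base_coact A B b) = sw U ph b"
proof -
 have bil: "bilin A BB (ctens A A) (\<lambda>x y. ctel A A x y)" by (rule bilin_A_BB[OF bilin_ctel])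
 have "sw U ph b = tlift U ph (tlift (ctens A A) (\<lambda>x y. ctel A A x y) (base_coact A B b))"
  using bc_incl[OF b] by simp
 also have "... = tlift U (\<lambda>x y. tlift U ph (ctel A A x y)) (base_coact A B b)"
  by (rule lin_through_tlift[OF tlift_lin]) (use U ph bil bc_closed b in auto)
 also have "... = tlift U ph (base_coact A B b)"
  by (rule tlift_cong[of A BB]) (insert U ph bc_closed b, auto simp: tlift_ctel intro: bilin_A_BB)
 finally show ?thesis by simp
qed

lemma bc_lin: "base_coact A B \<in> lin_hom BB (ctens A BB)"
proof -
 have bil: "bilin A BB (ctens A A) (\<lambda>x y. ctel A A x y)" by (rule bilin_A_BB[OF bilin_ctel])
 note l = tlift_lin[OF vsA vsBB vs_ctens bil]
 show ?thesis
 proof (rule lin_homI)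
  fix x y c assume x: "x .: BB"
  show "base_coact A B x .: (ctens A BB)" using x bc_closed by simp
  show "base_coact A B (c \<odot>\<^bsub>BB\<^esub> x) = c \<odot>\<^bsub>ctens A BB\<^esub> base_coact A B x"
   by (rule bc_eqI) (insert x bc_closed, auto simp: lin_smult[OF l] bc_incl lin_smult[OF \<Delta>_lin0])
  assume y: "y .: BB"
  show "base_coact A B (x \<oplus>\<^bsub>BB\<^esub> y) = base_coact A B x \<oplus>\<^bsub>ctens A BB\<^esub> base_coact A B y"
   by (rule bc_eqI) (insert x y bc_closed, auto simp: lin_add[OF l] bc_incl lin_add[OF \<Delta>_lin0])
 qed
qed

lemma B_decompose: "b \<in> B ==> b \<ominus> eps b \<odot> \<one> \<in> aug A B"
 by (auto simp: aug_def vs_minus_eq lin_add[OF eps_lin0] lin_smult[OF eps_lin0] eps_one)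

section \<open>The adjoint action preserves \<open>B\<close>\<close>

text \<open>Faithful flatness speaks about modules whose elements are sets of sequences.  Left ideals of \<open>A\<close> are moved
there by sending an element to the singleton of the corresponding constant sequence.\<close>

definition \<iota> :: "'a \<Rightarrow> (nat \<Rightarrow> 'a) set" where "\<iota> a = {\<lambda>_. a}"
definition \<kappa> :: "(nat \<Rightarrow> 'a) set \<Rightarrow> 'a" where "\<kappa> X = the_elem X 0"

lemma \<kappa>_\<iota> [simp]: "\<kappa> (\<iota> a) = a" by (simp add: \<iota>_def \<kappa>_def)
lemma \<iota>_inj [simp]: "\<iota> a = \<iota> b \<longleftrightarrow> a = b" by (metis \<kappa>_\<iota>)

lemma \<iota>_mem [simp]: "\<iota> x \<in> \<iota> ` C \<longleftrightarrow> x \<in> C" by auto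

definition LM :: "'a set \<Rightarrow> ('a, (nat \<Rightarrow> 'a) set) bimod" where
 "LM C = \<lparr>carrier = \<iota> ` C, mult = undefined, one = undefined, zero = \<iota> \<zero>, add = (\<lambda>X Y. \<iota> (\<kappa> X \<oplus> \<kappa> Y)),
   smult = (\<lambda>c X. \<iota> (c \<odot> \<kappa> X)), lact = (\<lambda>b X. \<iota> (b ** \<kappa> X)), ract = undefined\<rparr>"

lemma LM_simps: "carrier (LM C) = \<iota> ` C" "\<zero>\<^bsub>LM C\<^esub> = \<iota> \<zero>" "X \<oplus>\<^bsub>LM C\<^esub> Y = \<iota> (\<kappa> X \<oplus> \<kappa> Y)"
 "c \<odot>\<^bsub>LM C\<^esub> X = \<iota> (c \<odot> \<kappa> X)" "lact (LM C) b X = \<iota> (b ** \<kappa> X)"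
 by (simp_all add: LM_def)

definition left_ideal where "left_ideal C \<longleftrightarrow> submodule C CC A \<and> (\<forall>b\<in>B. \<forall>c\<in>C. b ** c \<in> C)"

lemma vs_LM: "left_ideal C ==> vs (LM C)"
proof -
 assume C: "left_ideal C"
 then have C: "submodule C CC A" by (simp add: left_ideal_def)
 note CD = submoduleD[OF vsA C]
 have cC: "\<And>x. x \<in> C ==> x .: A" using CD(1) by auto
 have "abelian_group (LM C)"
 proof (rule abelian_groupI)
  fix x assume "x .: (LM C)"
  then show "\<exists>y\<in>carrier (LM C). y \<oplus>\<^bsub>LM C\<^esub> x = \<zero>\<^bsub>LM C\<^esub>"
   using CD(4)[of "\<kappa> x" "-1"] R.l_neg[of "\<kappa> x"] cC
   by (intro bexI[of _ "\<iota> ((-1) \<odot> \<kappa> x)"]) (auto simp: LM_simps vs_neg[OF vsA])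
 qed (insert CD(2,3) cC, auto simp: LM_simps R.a_ac)
 then show ?thesis
  by (rule vsI) (insert CD(4) cC, auto simp: LM_simps vs_smult_add vs_add_smult)
qed

lemma LM_left_module: "left_ideal C ==> left_module A B (LM C)"
proof -
 assume C: "left_ideal C"
 then have C': "submodule C CC A" and Cb: "\<And>b c. b \<in> B ==> c \<in> C ==> b ** c \<in> C" by (auto simp: left_ideal_def)
 have cC: "\<And>x. x \<in> C ==> x .: A" using submoduleD(1)[OF vsA C'] by auto
 have "bilin (A\<lparr>carrier := B\<rparr>) (LM C) (LM C) (lact (LM C))"
  unfolding bilin_def lin_hom_def using Cb
  by (auto simp: LM_simps R.l_distr R.r_distr smult_mult mult_smult cC)
 then show ?thesis
  unfolding left_module_def using vs_LM[OF C] by (auto simp: LM_simps cC R.m_assoc)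
qed

abbreviation AR where "AR \<equiv> regular A (carrier A)"
abbreviation TT where "TT C \<equiv> btens B AR (LM C)"
definition el where "el C p y = btel B AR (LM C) p (\<iota> y)"

lemma AR_simps [simp]: "carrier AR = carrier A" "add AR = add A" "zero AR = zero A" "smult AR = smult A" "ract AR = mult A"
 by (simp_all add: regular_def)

lemma vs_AR [simp]: "vs AR"
 by (rule vs_cong[OF vsA]) simp_all

lemma el_bilin: "left_ideal C ==> bilin A (A\<lparr>carrier := C\<rparr>) (TT C) (el C)"
proof -
 assume C: "left_ideal C"
 have \<iota>: "\<iota> \<in> lin_hom (A\<lparr>carrier := C\<rparr>) (LM C)"
  by (rule lin_homI) (insert C, auto simp: LM_simps left_ideal_def)
 have AR: "lin_hom A X = lin_hom AR X" for X :: "(complex, 'x, 'y) module_scheme"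
  by (rule lin_hom_cong) auto
 show ?thesis
  unfolding el_def[abs_def]
  by (intro bilinI lin_bilin_right[OF bilin_btel] \<iota>, simp, unfold AR, intro lin_bilin_left[OF bilin_btel] lin_id)
   (auto simp: LM_simps)
qed

lemma el_balanced: "p .: A ==> b \<in> B ==> y \<in> C ==> el C (p ** b) y = el C p (b ** y)"
 using btel_balanced[of p AR b B "\<iota> y" "LM C"] by (simp add: el_def LM_simps)

lemma left_ideal_A: "left_ideal (carrier A)"
 by (auto simp: left_ideal_def submodule_iff)

abbreviation TA where "TA \<equiv> TT (carrier A)"
abbreviation eA where "eA \<equiv> el (carrier A)"

lemma eA_bilin: "bilin A A TA eA"
 using el_bilin[OF left_ideal_A] by simp

lemmas eA_lin [lin] = lin_bilin_right[OF eA_bilin] lin_bilin_left[OF eA_bilin]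
lemmas eA_closed [simp, intro] = bilin_closed[OF eA_bilin]

text \<open>In the tensor product of \<open>A\<close> with itself over \<open>B\<close> this is the sum of \<open>p S(y(1))\<close> and \<open>y(2) z\<close>.  It
is a twisted canonical map, and by \<open>\<Phi>_left\<close> and \<open>\<Phi>_right\<close> the algebra \<open>B\<close> acts on \<open>y\<close> through the counit from either side.\<close>

definition \<Phi> where "\<Phi> p z y = sw TA (\<lambda>u v. eA (p ** S u) (v ** z)) y"

lemma \<Phi>_bi: "p .: A ==> z .: A ==> bilin A A TA (\<lambda>u v. eA (p ** S u) (v ** z))"
 by (intro bilinI lin S_lin0) auto

lemma \<Phi>_lin: "p .: A ==> z .: A ==> g \<in> lin_hom X A ==> (\<lambda>x. \<Phi> p z (g x)) \<in> lin_hom X TA"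
 "p .: A ==> y .: A ==> vs X ==> h \<in> lin_hom X A ==> (\<lambda>x. \<Phi> p (h x) y) \<in> lin_hom X TA"
 "z .: A ==> y .: A ==> vs X ==> h \<in> lin_hom X A ==> (\<lambda>x. \<Phi> (h x) z y) \<in> lin_hom X TA"
 unfolding \<Phi>_def by (intro lin S_lin0 \<Phi>_bi; auto intro: lin_closed)+

lemma \<Phi>_closed [simp, intro]: "p .: A ==> z .: A ==> y .: A ==> \<Phi> p z y .: TA"
 unfolding \<Phi>_def by (intro sw_closed \<Phi>_bi) auto

text \<open>The element \<open>b(2)\<close> lies in \<open>B\<close> and moves through the balanced tensor product, where it meets
\<open>S(b(1))\<close>.\<close>

lemma \<Phi>_left:
 assumes p: "p .: A" and z: "z .: A" and y: "y .: A" and b: "b \<in> B"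
 shows "\<Phi> p z (b ** y) = eps b \<odot>\<^bsub>TA\<^esub> \<Phi> p z y"
proof -
 define th where "th x = sw TA (\<lambda>u' v'. eA (p ** S u' ** x) (v' ** z)) y" for x
 have thbi: "bilin A A TA (\<lambda>u' v'. eA (p ** S u' ** x) (v' ** z))" if "x .: A" for x
  using that p z by (intro bilinI lin S_lin0) auto
 have th: "th \<in> lin_hom A TA" unfolding th_def by (intro lin thbi) (auto simp: p z y)
 have bi1: "bilin A A TA (\<lambda>u v. th (S u ** v))"
  by (intro bilinI lin_comp[OF th] lin S_lin0) auto
 have bi2: "bilin A A TA (\<lambda>u v. sw TA (\<lambda>u' v'. eA (p ** S (u ** u')) (v ** v' ** z)) y)"
  by (intro bilinI lin S_lin0) (auto simp: p z y)
 have "\<Phi> p z (b ** y) = sw TA (\<lambda>u v. sw TA (\<lambda>u' v'. eA (p ** S (u ** u')) (v ** v' ** z)) y) b"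
  unfolding \<Phi>_def by (rule sw_mult) (use \<Phi>_bi p z y b in auto)
 also have "... = tlift TA (\<lambda>u v. sw TA (\<lambda>u' v'. eA (p ** S (u ** u')) (v ** v' ** z)) y) (base_coact A B b)"
  by (rule bc_sw[symmetric]) (use bi2 b in auto)
 also have "... = tlift TA (\<lambda>u v. th (S u ** v)) (base_coact A B b)"
 proof (rule tlift_cong[OF vsA vsBB vs_btens bilin_A_BB(1)[OF bi1] bc_closed[OF b]])
  fix u v assume uv: "u .: A" "v .: BB"
  show "sw TA (\<lambda>u' v'. eA (p ** S (u ** u')) (v ** v' ** z)) y = th (S u ** v)"
   unfolding th_def
   by (rule sw_cong) (insert uv p z y thbi[of "S u ** v"], auto simp: S_mult R.m_assoc el_balanced[symmetric])
 qed
 also have "... = sw TA (\<lambda>u v. th (S u ** v)) b"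
  by (rule bc_sw) (use bi1 b in auto)
 also have "... = eps b \<odot>\<^bsub>TA\<^esub> th \<one>"
  by (rule antipode_left) (use th b in auto)
 also have "th \<one> = \<Phi> p z y"
  unfolding th_def \<Phi>_def by (rule sw_cong) (use p z y \<Phi>_bi in auto)
 finally show ?thesis .
qed

text \<open>Here \<open>A B\<^sup>+ = B\<^sup>+ A\<close> turns a right multiple by an augmentation element into left multiples.\<close>

lemma \<Phi>_right:
 assumes p: "p .: A" and z: "z .: A" and a: "a .: A" and b: "b \<in> B"
 shows "\<Phi> p z (a ** b) = eps b \<odot>\<^bsub>TA\<^esub> \<Phi> p z a"
proof -
 note l = \<Phi>_lin(1)[OF p z lin_id]
 have "x .: A \<and> \<Phi> p z x = \<zero>\<^bsub>TA\<^esub>" if "x \<in> aug A B \<cdot> carrier A" for x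
  using that
 proof (induction rule: ideal_prod.induct)
  case (prod i j)
  then show ?case using p z by (auto simp: aug_def \<Phi>_left)
 next
  case (sum s t)
  then show ?case using lin_add[OF l, of s t] by auto
 qed
 moreover have "a ** (b \<ominus> eps b \<odot> \<one>) \<in> aug A B \<cdot> carrier A"
  unfolding aug_comm using a b by (intro ideal_prod.prod B_decompose)
 ultimately have "\<Phi> p z (a ** (b \<ominus> eps b \<odot> \<one>)) = \<zero>\<^bsub>TA\<^esub>" by auto
 moreover have "a ** (b \<ominus> eps b \<odot> \<one>) = a ** b \<ominus> eps b \<odot> a"
  using a b by (simp add: vs_minus_eq R.r_distr mult_smult)
 ultimately show ?thesis
  using a b p z lin_map_minus[OF l, of "a ** b" "eps b \<odot> a"] lin_smult[OF l, of a "eps b"]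
  by (simp add: vs_minus_zero_iff)
qed

lemma eA_split:
 assumes p: "p .: A" and z: "z .: A" and c: "c .: A"
 shows "eA p (c ** z) = sw TA (\<lambda>u v. \<Phi> (p ** u) z v) c"
proof -
 have "sw TA (\<lambda>u v. \<Phi> (p ** u) z v) c = sw TA (\<lambda>w v2. sw TA (\<lambda>u v1. eA (p ** u ** S v1) (v2 ** z)) w) c"
  unfolding \<Phi>_def
  by (rule sw_coassoc[of _ "\<lambda>u v1 v2. eA (p ** u ** S v1) (v2 ** z)"]) (insert p z c, auto intro!: trilinI lin S_lin0)
 also have "... = sw TA (\<lambda>w v2. eps w \<odot>\<^bsub>TA\<^esub> eA p (v2 ** z)) c"
 proof (rule sw_cong[OF _ _ c])
  show "bilin A A TA (\<lambda>w v2. eps w \<odot>\<^bsub>TA\<^esub> eA p (v2 ** z))" by (intro bilinI lin eps_lin0) (auto simp: p z)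
  fix w v2 assume w: "w .: A" "v2 .: A"
  have "sw TA (\<lambda>u v1. eA (p ** u ** S v1) (v2 ** z)) w = sw TA (\<lambda>u v1. eA (p ** (u ** S v1)) (v2 ** z)) w"
   by (rule sw_cong) (insert w p z, auto simp: R.m_assoc intro!: bilinI lin S_lin0)
  then show "sw TA (\<lambda>u v1. eA (p ** u ** S v1) (v2 ** z)) w = eps w \<odot>\<^bsub>TA\<^esub> eA p (v2 ** z)"
   using antipode_right[of "\<lambda>x. eA (p ** x) (v2 ** z)" TA w] w p z by (simp add: eA_lin mult_lin lin_id)
 qed simp
 also have "... = eA p (c ** z)"
  by (rule sw_counit_left) (insert p z c, auto intro!: lin)
 finally show ?thesis by simp
qed

lemma eA_split_B:
 assumes p: "p .: A" and z: "z .: A" and x: "x .: A" and b: "b \<in> B"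
 shows "eA p (x ** b ** z) = sw TA (\<lambda>u v. \<Phi> (p ** (u ** b)) z v) x"
proof -
 have bi1: "bilin A A TA (\<lambda>u' v'. \<Phi> (p ** (u ** u')) z (v ** v'))" if "u .: A" "v .: A" for u v
  using that by (intro bilinI lin \<Phi>_lin) (auto simp: p z)
 have "eA p (x ** b ** z) = sw TA (\<lambda>u v. \<Phi> (p ** u) z v) (x ** b)"
  by (rule eA_split) (use p z x b in auto)
 also have "... = sw TA (\<lambda>u v. sw TA (\<lambda>u' v'. \<Phi> (p ** (u ** u')) z (v ** v')) b) x"
  by (rule sw_mult) (insert p z x b, auto intro!: bilinI lin \<Phi>_lin)
 also have "... = sw TA (\<lambda>u v. \<Phi> (p ** (u ** b)) z v) x"
 proof (rule sw_cong[OF _ _ x])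
  show "bilin A A TA (\<lambda>u v. \<Phi> (p ** (u ** b)) z v)" by (intro bilinI lin \<Phi>_lin) (auto simp: p z b)
  fix u v assume uv: "u .: A" "v .: A"
  have bi2: "bilin A A TA (\<lambda>u' v'. eps v' \<odot>\<^bsub>TA\<^esub> \<Phi> (p ** (u ** u')) z v)"
   using uv by (intro bilinI lin \<Phi>_lin eps_lin0) (auto simp: p z)
  have "sw TA (\<lambda>u' v'. \<Phi> (p ** (u ** u')) z (v ** v')) b = tlift TA (\<lambda>u' v'. \<Phi> (p ** (u ** u')) z (v ** v')) (base_coact A B b)"
   by (rule bc_sw[symmetric]) (use bi1 uv b in auto)
  also have "... = tlift TA (\<lambda>u' v'. eps v' \<odot>\<^bsub>TA\<^esub> \<Phi> (p ** (u ** u')) z v) (base_coact A B b)"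
   by (rule tlift_cong[OF vsA vsBB vs_btens bilin_A_BB(1)[OF bi2] bc_closed[OF b]]) (insert uv p z, auto simp: \<Phi>_right)
  also have "... = sw TA (\<lambda>u' v'. eps v' \<odot>\<^bsub>TA\<^esub> \<Phi> (p ** (u ** u')) z v) b"
   by (rule bc_sw) (use bi2 b in auto)
  also have "... = \<Phi> (p ** (u ** b)) z v"
   by (rule sw_counit_right) (insert uv p z b, auto intro!: lin \<Phi>_lin)
  finally show "sw TA (\<lambda>u' v'. \<Phi> (p ** (u ** u')) z (v ** v')) b = \<Phi> (p ** (u ** b)) z v" .
 qed simp
 finally show ?thesis .
qed

lemma \<Phi>_collapse:
 assumes q: "q .: A" and w: "w .: A"
 shows "sw TA (\<lambda>v y. \<Phi> q (S y) v) w = eA (q ** S w) \<one>"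
proof -
 have "sw TA (\<lambda>v y. \<Phi> q (S y) v) w = sw TA (\<lambda>s r. sw TA (\<lambda>t y. eA (q ** S s) (t ** S y)) r) w"
  unfolding \<Phi>_def
  by (rule sw_coassoc[symmetric, of _ "\<lambda>s t y. eA (q ** S s) (t ** S y)"]) (insert q w, auto intro!: trilinI lin S_lin0)
 also have "... = sw TA (\<lambda>s r. eps r \<odot>\<^bsub>TA\<^esub> eA (q ** S s) \<one>) w"
 proof (rule sw_cong[OF _ _ w])
  show "bilin A A TA (\<lambda>s r. eps r \<odot>\<^bsub>TA\<^esub> eA (q ** S s) \<one>)" by (intro bilinI lin eps_lin0 S_lin0) (auto simp: q)
  fix s r assume "s .: A" "r .: A"
  then show "sw TA (\<lambda>t y. eA (q ** S s) (t ** S y)) r = eps r \<odot>\<^bsub>TA\<^esub> eA (q ** S s) \<one>"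
   using antipode_right[of "\<lambda>x. eA (q ** S s) x" TA r] q by (simp add: eA_lin lin_id)
 qed simp
 also have "... = eA (q ** S w) \<one>"
  by (rule sw_counit_right) (insert q w, auto intro!: lin S_lin0)
 finally show ?thesis .
qed

text \<open>Splitting off \<open>a(1)\<close> with \<open>\<Phi>\<close>, where \<open>b\<close> acts through the counit, moves \<open>a(1) b\<close> to the left factor;
then \<open>\<Phi>_collapse\<close> moves \<open>S(a(2))\<close> there as well.\<close>

lemma eA_act:
 assumes p: "p .: A" and a: "a .: A" and b: "b \<in> B"
 shows "eA p (act a b) = eA (p ** act a b) \<one>"
proof -
 have bi: "bilin A A A (\<lambda>x y. x ** b ** S y)" by (intro bilinI lin S_lin0) (auto simp: b)
 have "eA p (act a b) = sw TA (\<lambda>x y. eA p (x ** b ** S y)) a"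
  unfolding act_def by (rule lin_through_sw) (insert p a bi, auto intro!: lin)
 also have "... = sw TA (\<lambda>x y. sw TA (\<lambda>u v. \<Phi> (p ** (u ** b)) (S y) v) x) a"
  by (rule sw_cong) (insert p a b, auto simp: eA_split_B intro!: bilinI lin \<Phi>_lin S_lin0)
 also have "... = sw TA (\<lambda>u w. sw TA (\<lambda>v y. \<Phi> (p ** (u ** b)) (S y) v) w) a"
  by (rule sw_coassoc[symmetric, of _ "\<lambda>u v y. \<Phi> (p ** (u ** b)) (S y) v"]) (insert p a b, auto intro!: trilinI lin \<Phi>_lin S_lin0)
 also have "... = sw TA (\<lambda>u w. eA (p ** (u ** b ** S w)) \<one>) a"
  by (rule sw_cong) (insert p a b, auto simp: \<Phi>_collapse R.m_assoc intro!: bilinI lin S_lin0)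
 also have "... = eA (p ** act a b) \<one>"
  unfolding act_def by (rule lin_through_sw[symmetric, of "\<lambda>x. eA (p ** x) \<one>"]) (insert p a bi, auto intro!: lin)
 finally show ?thesis .
qed

lemma el_image:
 assumes C: "left_ideal C" and D: "left_ideal D" "C \<subseteq> D"
 shows "tlift (TT D) (\<lambda>a m. btel B AR (LM D) a m) \<in> lin_hom (TT C) (TT D)"
  and "p .: A ==> y \<in> C ==> tlift (TT D) (\<lambda>a m. btel B AR (LM D) a m) (el C p y) = el D p y"
proof -
 have "(\<lambda>x. x) \<in> lin_hom (LM C) (LM D)"
  by (rule lin_homI) (insert D, auto simp: LM_simps)
 then have bi: "bilin AR (LM C) (TT D) (\<lambda>a m. btel B AR (LM D) a m)"
  using D by (intro bilinI lin) (auto simp: LM_simps)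
 have bal: "balanced B AR (LM C) (\<lambda>a m. btel B AR (LM D) a m)"
  using C D btel_balanced[of _ AR _ B _ "LM D"] by (auto simp: balanced_def LM_simps left_ideal_def)
 show "tlift (TT D) (\<lambda>a m. btel B AR (LM D) a m) \<in> lin_hom (TT C) (TT D)"
  using bi bal C by (intro tlift_blin) (auto intro: vs_LM)
 show "p .: A ==> y \<in> C ==> tlift (TT D) (\<lambda>a m. btel B AR (LM D) a m) (el C p y) = el D p y"
  unfolding el_def using bi bal C by (subst tlift_btel) (auto intro: vs_LM simp: LM_simps)
qed

lemma left_ideal_zero: "left_ideal {\<zero>}"
 by (auto simp: left_ideal_def submodule_iff)

lemma TT_zero:
 assumes "t .: (TT {\<zero>})"
 shows "t = \<zero>\<^bsub>TT {\<zero>}\<^esub>"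
proof -
 have vsL: "vs (LM {\<zero>})" by (rule vs_LM[OF left_ideal_zero])
 have "(\<lambda>t. t) t = (\<lambda>t. \<zero>\<^bsub>TT {\<zero>}\<^esub>) t"
 proof (rule btens_lin_eqI[OF lin_id lin_zero_fun])
  fix v w assume v: "v .: AR" and "w .: (LM {\<zero>})"
  then have w: "w = \<zero>\<^bsub>LM {\<zero>}\<^esub>" by (simp add: LM_simps)
  show "btel B AR (LM {\<zero>}) v w = \<zero>\<^bsub>TT {\<zero>}\<^esub>"
   unfolding w by (rule lin_map_zero[OF bilin_right[OF bilin_btel v] vsL]) simp
 qed (use assms in auto)
 then show ?thesis .
qed

lemma LM_hom: "left_ideal C ==> left_ideal D ==> C \<subseteq> D ==> left_hom B (LM C) (LM D) (\<lambda>x. x)"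
 unfolding left_hom_def by (auto simp: LM_simps left_ideal_def subset_iff intro!: lin_homI)

text \<open>Faithfully flat descent.  The relation says that \<open>x\<close> behaves like an element of \<open>B\<close> in the
tensor product; with \<open>C = B + B x\<close> flatness brings the relation to the tensor product of \<open>A\<close> with \<open>C\<close>,
so that \<open>B\<close> and \<open>C\<close> have the same tensor product with \<open>A\<close>, and faithfulness gives \<open>B = C\<close>.\<close>

lemma descent:
 assumes x: "x .: A" and eq: "\<And>p. p .: A ==> eA p x = eA (p ** x) \<one>"
 shows "x \<in> B"
proof -
 define C where "C = {b \<oplus> b' ** x | b b'. b \<in> B \<and> b' \<in> B}"
 have C0: "left_ideal C"
  unfolding left_ideal_def submodule_iff[OF vsA]
 proof (intro conjI ballI allI)
  show "C \<subseteq> carrier A" using x by (auto simp: C_def)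
  have "\<zero> = \<zero> \<oplus> \<zero> ** x" using x by simp
  then show "\<zero> \<in> C" unfolding C_def by blast
  fix u assume "u \<in> C"
  then obtain b b' where u: "u = b \<oplus> b' ** x" "b \<in> B" "b' \<in> B" by (auto simp: C_def)
  have "c \<odot> u = c \<odot> b \<oplus> (c \<odot> b') ** x" for c
   using u x by (simp add: vs_smult_add smult_mult)
  then show "c \<odot> u \<in> C" for c using u unfolding C_def by blast
  have "d ** u = d ** b \<oplus> (d ** b') ** x" if "d \<in> B" for d
   using u x that by (simp add: R.r_distr R.m_assoc)
  then show "d ** u \<in> C" if "d \<in> B" for d using u that unfolding C_def by blast
  fix v assume "v \<in> C"
  then obtain d d' where v: "v = d \<oplus> d' ** x" "d \<in> B" "d' \<in> B" by (auto simp: C_def)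
  have "u \<oplus> v = (b \<oplus> d) \<oplus> (b' \<oplus> d') ** x"
   using u v x by (simp add: R.l_distr R.a_ac)
  then show "u \<oplus> v \<in> C" using u v unfolding C_def by blast
 qed
 have CA: "C \<subseteq> carrier A" using x by (auto simp: C_def)
 have b_in: "b \<in> C" if "b \<in> B" for b
 proof -
  have "b = b \<oplus> \<zero> ** x" using that x by simp
  then show ?thesis unfolding C_def using that by blast
 qed
 have x_in: "x \<in> C"
 proof -
  have "x = \<zero> \<oplus> \<one> ** x" using x by simp
  then show ?thesis unfolding C_def by blast
 qed
 have B0: "left_ideal B" using B_sub by (simp add: left_ideal_def)
 have zC: "{\<zero>} \<subseteq> C" using b_in by auto
 note elC = el_bilin[OF C0]
 have elC_l: "el C p (y \<oplus> y') = el C p y \<oplus>\<^bsub>TT C\<^esub> el C p y'" "el C p y .: (TT C)"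
  if "p .: A" "y \<in> C" "y' \<in> C" for p y y'
  using lin_add[OF bilin_right[OF elC that(1)], of y y'] bilin_closed[OF elC, of p y] that by auto
 have elC_r: "el C (p \<oplus> p') y = el C p y \<oplus>\<^bsub>TT C\<^esub> el C p' y"
  if "p .: A" "p' .: A" "y \<in> C" for p p' y
  using lin_add[OF bilin_left[OF elC, of y], of p p'] that by auto
 \<comment> \<open>flatness: the relation already holds in the tensor product with C\<close>
 have key: "el C p x = el C (p ** x) \<one>" if p: "p .: A" for p
 proof -
  have ex: "exact (LM {\<zero>}) (LM C) (LM (carrier A)) (\<lambda>x. x) (\<lambda>x. x)"
   using zC by (auto simp: exact_def LM_simps)
  have "exact (TT {\<zero>}) (TT C) TA (tlift (TT C) (\<lambda>a m. btel B AR (LM C) a m)) (tlift TA (\<lambda>a m. btel B AR (LM (carrier A)) a m))"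
   using ff[unfolded faithfully_flat_def, rule_format, of "LM {\<zero>}" "LM C" "LM (carrier A)" "\<lambda>x. x" "\<lambda>x. x"] ex
    LM_left_module[OF left_ideal_zero] LM_left_module[OF C0] LM_left_module[OF left_ideal_A]
    LM_hom[OF left_ideal_zero C0 zC] LM_hom[OF C0 left_ideal_A CA]
   by (simp add: Let_def)
  then have ker: "tlift (TT C) (\<lambda>a m. btel B AR (LM C) a m) ` carrier (TT {\<zero>}) =
    {v \<in> carrier (TT C). tlift TA (\<lambda>a m. btel B AR (LM (carrier A)) a m) v = \<zero>\<^bsub>TA\<^esub>}"
   by (simp add: exact_def)
  define d where "d = el C p x \<ominus>\<^bsub>TT C\<^esub> el C (p ** x) \<one>"
  have c: "el C p x .: (TT C)" "el C (p ** x) \<one> .: (TT C)"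
   using elC_l(2) p x x_in b_in by auto
  note im = el_image[OF C0 left_ideal_A CA]
  have "tlift TA (\<lambda>a m. btel B AR (LM (carrier A)) a m) d = eA p x \<ominus>\<^bsub>TA\<^esub> eA (p ** x) \<one>"
   unfolding d_def using lin_map_minus[OF im(1) _ _ c] im(2) p x x_in b_in by simp
  also have "... = \<zero>\<^bsub>TA\<^esub>" using eq[OF p] p x by simp
  finally have "d \<in> tlift (TT C) (\<lambda>a m. btel B AR (LM C) a m) ` carrier (TT {\<zero>})"
   unfolding ker using c by (simp add: d_def)
  then obtain t where "t .: (TT {\<zero>})" "d = tlift (TT C) (\<lambda>a m. btel B AR (LM C) a m) t" by auto
  then have "d = \<zero>\<^bsub>TT C\<^esub>"
   using TT_zero lin_map_zero[OF el_image(1)[OF left_ideal_zero C0 zC]] by simp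
  then show ?thesis using c by (simp add: d_def vs_minus_zero_iff)
 qed
 \<comment> \<open>faithfulness: hence B exhausts C\<close>
 have l0: "left_hom B (LM C) (LM {\<zero>}) (\<lambda>_. \<iota> \<zero>)"
  unfolding left_hom_def by (auto simp: LM_simps intro!: lin_homI)
 have gz: "tlift (TT {\<zero>}) (\<lambda>a m. btel B AR (LM {\<zero>}) a (\<iota> \<zero>)) v = \<zero>\<^bsub>TT {\<zero>}\<^esub>" if "v .: (TT C)" for v
 proof (rule TT_zero)
  have b0: "btel B AR (LM {\<zero>}) a (\<iota> \<zero>) = \<zero>\<^bsub>TT {\<zero>}\<^esub>" if "a .: A" for a
   using that by (intro TT_zero btel_closed) (auto simp: LM_simps)
  have bi: "bilin AR (LM C) (TT {\<zero>}) (\<lambda>a m. btel B AR (LM {\<zero>}) a (\<iota> \<zero>))"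
   by (rule bilin_cong[of _ _ _ "\<lambda>_ _. \<zero>\<^bsub>TT {\<zero>}\<^esub>"]) (auto simp: b0 vs_LM[OF C0] intro!: bilinI lin)
  have bal: "balanced B AR (LM C) (\<lambda>a m. btel B AR (LM {\<zero>}) a (\<iota> \<zero>))"
   using C0 by (auto simp: balanced_def LM_simps left_ideal_def b0)
  show "tlift (TT {\<zero>}) (\<lambda>a m. btel B AR (LM {\<zero>}) a (\<iota> \<zero>)) v .: (TT {\<zero>})"
   by (rule lin_closed[OF tlift_blin[OF _ _ _ bi bal] that]) (auto simp: vs_LM[OF C0])
 qed
 have BC: "B \<subseteq> C" using b_in by auto
 note imB = el_image[OF B0 C0 BC]
 have surj: "v \<in> tlift (TT C) (\<lambda>a m. btel B AR (LM C) a m) ` carrier (TT B)" if "v .: (TT C)" for v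
  using that vs_AR
 proof (induction v rule: btens_induct)
  case zero
  have "tlift (TT C) (\<lambda>a m. btel B AR (LM C) a m) \<zero>\<^bsub>TT B\<^esub> = \<zero>\<^bsub>TT C\<^esub>" using lin_map_zero[OF imB(1)] by simp
  then show ?case by (intro image_eqI[of _ _ "\<zero>\<^bsub>TT B\<^esub>"]) auto
 next
  case (gen p w)
  then obtain b b' where p: "p .: A" and w: "w = \<iota> (b \<oplus> b' ** x)" "b \<in> B" "b' \<in> B"
   by (auto simp: LM_simps C_def)
  have b'x: "b' ** x \<in> C" using C0 w x_in by (auto simp: left_ideal_def)
  have "btel B AR (LM C) p w = el C p b \<oplus>\<^bsub>TT C\<^esub> el C p (b' ** x)"
   using w p b_in b'x elC_l(1)[of p b "b' ** x"] by (simp add: el_def)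
  also have "el C p (b' ** x) = el C (p ** b' ** x) \<one>"
   using p w x x_in key[of "p ** b'"] el_balanced[of p b' x C] by simp
  also have "el C p b = el C (p ** b) \<one>"
   using p w el_balanced[of p b "\<one>" C] b_in by simp
  also have "el C (p ** b) \<one> \<oplus>\<^bsub>TT C\<^esub> el C (p ** b' ** x) \<one> = el C (p ** b \<oplus> p ** b' ** x) \<one>"
   using p w x b_in by (intro elC_r[symmetric]) auto
  also have "... = tlift (TT C) (\<lambda>a m. btel B AR (LM C) a m) (el B (p ** b \<oplus> p ** b' ** x) \<one>)"
   using p w x by (intro imB(2)[symmetric]) auto
  finally show ?case
   by (rule image_eqI) (insert p w x, auto simp: el_def LM_simps intro!: btel_closed)
 next
  case (add s t)
  then obtain s' t' where "s' .: (TT B)" "t' .: (TT B)"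
   "s = tlift (TT C) (\<lambda>a m. btel B AR (LM C) a m) s'" "t = tlift (TT C) (\<lambda>a m. btel B AR (LM C) a m) t'" by auto
  then show ?case using lin_add[OF imB(1), of s' t']
   by (intro image_eqI[of _ _ "s' \<oplus>\<^bsub>TT B\<^esub> t'"]) auto
 qed
 have "exact (TT B) (TT C) (TT {\<zero>}) (tlift (TT C) (\<lambda>a m. btel B AR (LM C) a m))
   (tlift (TT {\<zero>}) (\<lambda>a m. btel B AR (LM {\<zero>}) a (\<iota> \<zero>)))"
  unfolding exact_def using surj gz lin_closed[OF imB(1)] by auto
 then have "exact (LM B) (LM C) (LM {\<zero>}) (\<lambda>x. x) (\<lambda>_. \<iota> \<zero>)"
  using ff[unfolded faithfully_flat_def, rule_format, of "LM B" "LM C" "LM {\<zero>}" "\<lambda>x. x" "\<lambda>_. \<iota> \<zero>"]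
   LM_left_module[OF left_ideal_zero] LM_left_module[OF C0] LM_left_module[OF B0]
   LM_hom[OF B0 C0 BC] l0
  by (simp add: Let_def)
 then have "\<iota> ` B = \<iota> ` C" by (auto simp: exact_def LM_simps)
 then show ?thesis using x_in \<iota>_mem[of x B] \<iota>_mem[of x C] by simp
qed

lemma act_B [simp, intro]: "a .: A ==> b \<in> B ==> act a b \<in> B"
 by (rule descent) (use eA_act in auto)

end

section \<open>The coaction on \<open>B\<close>\<close>

context qhs
begin

abbreviation bc where "bc \<equiv> base_coact A B"
abbreviation AB where "AB \<equiv> ctens A BB"

lemma comodule_BB: "comodule A BB bc"
 unfolding comodule_def
proof (intro conjI ballI bc_lin)
 fix b assume "b .: BB"
 then have b: "b \<in> B" by simp
 have bi: "bilin A BB BB (\<lambda>a v. eps a \<odot>\<^bsub>BB\<^esub> v)" by (intro bilinI lin_smult_fun lin_scalar_fun lin_id eps_lin0) auto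
 have bi': "bilin A BB A (\<lambda>a v. eps a \<odot>\<^bsub>BB\<^esub> v)" using bi by (auto simp: bilin_def intro: lin_BB_A)
 have bi'': "bilin A A A (\<lambda>a v. eps a \<odot>\<^bsub>BB\<^esub> v)" by simp (intro bilinI lin eps_lin0; simp)
 have "tlift BB (\<lambda>a v. eps a \<odot>\<^bsub>BB\<^esub> v) (bc b) = tlift A (\<lambda>a v. eps a \<odot>\<^bsub>BB\<^esub> v) (bc b)"
  by (rule ctens_lin_eqI[OF lin_BB_A[OF tlift_lin[OF vsA vsBB vsBB bi]] tlift_lin[OF vsA vsBB vsA bi']])
   (insert b bc_closed bi bi', auto simp: tlift_ctel)
 also have "... = sw A (\<lambda>a v. eps a \<odot>\<^bsub>BB\<^esub> v) b"
  using bc_sw[OF vsA bi'' b] .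
 also have "... = b" using sw_counit_left[OF lin_id vsA, of b] b by simp
 finally show "tlift BB (\<lambda>a v. eps a \<odot>\<^bsub>BB\<^esub> v) (bc b) = b" .
 let ?AAA = "ctens A (ctens A A)" and ?T = "ctens A AB"
 have incl: "tlift (ctens A A) (ctel A A) \<in> lin_hom AB (ctens A A)"
  by (intro tlift_lin bilin_A_BB[OF bilin_ctel]) auto
 have bI: "bilin A BB (ctens A A) (ctel A A)" by (rule bilin_A_BB(1)[OF bilin_ctel])
 have biJ: "bilin A AB ?AAA (\<lambda>x s. ctel A (ctens A A) x (tlift (ctens A A) (ctel A A) s))"
  by (intro bilinI ctel_lin lin_id incl lin_closed[OF incl])
 define J where "J = tlift ?AAA (\<lambda>x s. ctel A (ctens A A) x (tlift (ctens A A) (ctel A A) s))"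
 have J: "J \<in> lin_hom ?T ?AAA" unfolding J_def by (intro tlift_lin biJ) auto
 have Jsl: "slice (ctens A A) xi (J s) = tlift (ctens A A) (ctel A A) (slice AB xi s)"
  if "xi \<in> lin_hom A CC" "s .: ?T" for xi s
 proof (rule ctens_lin_eqI[of "\<lambda>s. slice (ctens A A) xi (J s)" A AB "ctens A A"])
  show "(\<lambda>s. slice (ctens A A) xi (J s)) \<in> lin_hom ?T (ctens A A)"
   by (intro lin_comp[OF slice_lin[OF vsA vs_ctens that(1)]] J)
  show "(\<lambda>s. tlift (ctens A A) (ctel A A) (slice AB xi s)) \<in> lin_hom ?T (ctens A A)"
   by (intro lin_comp[OF incl] slice_lin that) auto
  show "slice (ctens A A) xi (J (ctel A AB v w)) = tlift (ctens A A) (ctel A A) (slice AB xi (ctel A AB v w))"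
   if "v .: A" "w .: AB" for v w
   using that \<open>xi \<in> lin_hom A CC\<close> biJ by (simp add: J_def tlift_ctel slice_ctel lin_closed[OF incl] lin_smult[OF incl])
 qed (use that in auto)
 have b1: "bilin A BB ?T (\<lambda>a v. ctel A AB a (bc v))"
  by (intro bilinI ctel_lin lin_id bc_lin bc_closed) auto
 have b1': "bilin A A ?AAA (\<lambda>a v. ctel A (ctens A A) a (\<Delta> v))"
  by (intro bilinI ctel_lin lin_id \<Delta>_lin0 \<Delta>_closed) auto
 have b2: "bilin A A ?T (\<lambda>x y. ctel A AB x (ctel A BB y v'))" if "v' \<in> B" for v'
  using that by (intro bilinI lin) auto
 have b2': "bilin A A ?AAA (\<lambda>x y. ctel A (ctens A A) x (ctel A A y v'))" if "v' .: A" for v'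
  using that by (intro bilinI lin) auto
 have b3: "bilin A BB ?T (\<lambda>a v'. sw ?T (\<lambda>x y. ctel A AB x (ctel A BB y v')) a)"
  by (intro bilinI lin b2) auto
 have b3': "bilin A A ?AAA (\<lambda>a v'. sw ?AAA (\<lambda>x y. ctel A (ctens A A) x (ctel A A y v')) a)"
  by (intro bilinI lin b2') auto
 have l: "J (id_tens A AB bc (bc b)) = sw ?AAA (\<lambda>a v. ctel A (ctens A A) a (\<Delta> v)) b"
 proof -
  have "J (id_tens A AB bc (bc b)) = tlift ?AAA (\<lambda>a v. J (ctel A AB a (bc v))) (bc b)"
   unfolding id_tens_def by (rule lin_through_tlift[OF J vsA vsBB]) (use b b1 bc_closed in auto)
  also have "... = tlift ?AAA (\<lambda>a v. ctel A (ctens A A) a (\<Delta> v)) (bc b)"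
   by (rule tlift_cong[OF vsA vsBB vs_ctens bilin_A_BB(1)[OF b1']])
    (insert b bc_closed biJ, auto simp: J_def tlift_ctel bc_incl)
  also have "... = sw ?AAA (\<lambda>a v. ctel A (ctens A A) a (\<Delta> v)) b"
   by (rule bc_sw) (use b b1' in auto)
  finally show ?thesis .
 qed
 have r: "J (tlift ?T (\<lambda>a v'. sw ?T (\<lambda>x y. ctel A AB x (ctel A BB y v')) a) (bc b)) =
   sw ?AAA (\<lambda>a v'. sw ?AAA (\<lambda>x y. ctel A (ctens A A) x (ctel A A y v')) a) b"
 proof -
  have "J (tlift ?T (\<lambda>a v'. sw ?T (\<lambda>x y. ctel A AB x (ctel A BB y v')) a) (bc b)) =
   tlift ?AAA (\<lambda>a v'. J (sw ?T (\<lambda>x y. ctel A AB x (ctel A BB y v')) a)) (bc b)"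
   by (rule lin_through_tlift[OF J vsA vsBB]) (use b b3 bc_closed in auto)
  also have "... = tlift ?AAA (\<lambda>a v'. sw ?AAA (\<lambda>x y. ctel A (ctens A A) x (ctel A A y v')) a) (bc b)"
  proof (rule tlift_cong[OF vsA vsBB vs_ctens bilin_A_BB(1)[OF b3'] bc_closed[OF b]])
   fix a v' assume a: "a .: A" "v' .: BB"
   have "J (sw ?T (\<lambda>x y. ctel A AB x (ctel A BB y v')) a) = sw ?AAA (\<lambda>x y. J (ctel A AB x (ctel A BB y v'))) a"
    by (rule lin_through_sw[OF J]) (use a b2 in auto)
   also have "... = sw ?AAA (\<lambda>x y. ctel A (ctens A A) x (ctel A A y v')) a"
    by (rule sw_cong) (insert a b2' biJ bI, auto simp: J_def tlift_ctel)
   finally show "J (sw ?T (\<lambda>x y. ctel A AB x (ctel A BB y v')) a) = sw ?AAA (\<lambda>x y. ctel A (ctens A A) x (ctel A A y v')) a" .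
  qed
  also have "... = sw ?AAA (\<lambda>a v'. sw ?AAA (\<lambda>x y. ctel A (ctens A A) x (ctel A A y v')) a) b"
   by (rule bc_sw) (use b b3' in auto)
  finally show ?thesis .
 qed
 have lr: "sw ?AAA (\<lambda>a v. ctel A (ctens A A) a (\<Delta> v)) b = sw ?AAA (\<lambda>a v'. sw ?AAA (\<lambda>x y. ctel A (ctens A A) x (ctel A A y v')) a) b"
  using comodule_coassoc[OF com_\<Delta>, of b] b by (simp add: id_tens_def)
 have c: "id_tens A AB bc (bc b) .: ?T" "tlift ?T (\<lambda>a v'. sw ?T (\<lambda>x y. ctel A AB x (ctel A BB y v')) a) (bc b) .: ?T"
  unfolding id_tens_def using tlift_closed[OF vsA vsBB vs_ctens b1 bc_closed[OF b]] tlift_closed[OF vsA vsBB vs_ctens b3 bc_closed[OF b]] by auto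
 show "id_tens A AB bc (bc b) = tlift ?T (\<lambda>a v'. sw ?T (\<lambda>x y. ctel A AB x (ctel A BB y v')) a) (bc b)"
 proof (rule slices_eqI[OF vsA vs_ctens c])
  fix xi assume xi: "xi \<in> lin_hom A CC"
  show "slice AB xi (id_tens A AB bc (bc b)) = slice AB xi (tlift ?T (\<lambda>a v'. sw ?T (\<lambda>x y. ctel A AB x (ctel A BB y v')) a) (bc b))"
   by (rule bc_eqI) (use Jsl[OF xi c(1)] Jsl[OF xi c(2)] l r lr lin_closed[OF slice_lin[OF vsA vs_ctens xi]] c in auto)
 qed
qed

lemmas bcw_closed [intro] = cw_closed[OF vsA vsBB comodule_BB, simplified]
lemmas bcw_lin_arg [lin] = cw_lin_arg[OF vsA vsBB comodule_BB]
lemmas bcw_lin_fun [lin] = cw_lin_fun[OF vsA vsBB comodule_BB, simplified]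
lemmas bcw_cong = cw_cong[OF vsA vsBB comodule_BB, simplified]
lemmas lin_through_bcw = lin_through_cw[OF vsA vsBB comodule_BB, simplified]
lemmas bcw_counit = cw_counit[OF vsA vsBB comodule_BB _ _ eps_lin0, simplified]
lemmas bcw_coassoc = cw_coassoc[OF vsA vsBB comodule_BB _ _ _ \<Delta>_lin0, simplified]

lemma multB_lin [lin]: "b \<in> B ==> g \<in> lin_hom X BB ==> (\<lambda>x. b ** g x) \<in> lin_hom X BB"
 "b \<in> B ==> g \<in> lin_hom X BB ==> (\<lambda>x. g x ** b) \<in> lin_hom X BB"
 by (rule lin_A_BB, rule mult_lin, simp, erule lin_BB_A, auto dest: lin_closed)+

lemma actB_lin [lin]: "a .: A ==> g \<in> lin_hom X BB ==> (\<lambda>x. act a (g x)) \<in> lin_hom X BB"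
 "b \<in> B ==> h \<in> lin_hom X A ==> (\<lambda>x. act (h x) b) \<in> lin_hom X BB"
 by (rule lin_A_BB, rule act_lin, (simp | erule lin_BB_A | assumption)+, (auto dest: lin_closed)[])+

lemma bcw_mult:
 assumes U: "vs U" and ph: "bilin A BB U ph" and b: "b \<in> B" "c \<in> B"
 shows "tlift U ph (bc (b ** c)) = tlift U (\<lambda>x y. tlift U (\<lambda>x' y'. ph (x ** x') (y ** y')) (bc c)) (bc b)"
proof -
 let ?t = "tlift AB (\<lambda>x y. tlift AB (\<lambda>x' y'. ctel A BB (x ** x') (y ** y')) (bc c)) (bc b)"
 let ?I = "tlift (ctens A A) (ctel A A)"
 have bI: "bilin A BB (ctens A A) (ctel A A)" by (rule bilin_A_BB[OF bilin_ctel])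
 have incl: "?I \<in> lin_hom AB (ctens A A)" by (intro tlift_lin bI) auto
 have b1: "bilin A BB AB (\<lambda>x' y'. ctel A BB (x ** x') (y ** y'))" if "x .: A" "y \<in> B" for x y
  using that by (intro bilinI lin) auto
 have b1': "bilin A A (ctens A A) (\<lambda>x' y'. ctel A A (x ** x') (y ** y'))" if "x .: A" "y .: A" for x y
  using that by (intro bilinI lin) auto
 have b2: "bilin A BB AB (\<lambda>x y. tlift AB (\<lambda>x' y'. ctel A BB (x ** x') (y ** y')) (bc c))"
  using b by (intro bilinI lin b1) auto
 have b2': "bilin A A (ctens A A) (\<lambda>x y. sw (ctens A A) (\<lambda>x' y'. ctel A A (x ** x') (y ** y')) c)"
  using b by (intro bilinI lin b1') auto
 have tc: "?t .: AB" using b b2 by auto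
 have "bc (b ** c) = ?t"
 proof (rule bc_eqI[OF _ tc])
  show "bc (b ** c) .: AB" using b bc_closed by auto
  have "?I ?t = tlift (ctens A A) (\<lambda>x y. ?I (tlift AB (\<lambda>x' y'. ctel A BB (x ** x') (y ** y')) (bc c))) (bc b)"
   by (rule lin_through_bcw[OF incl]) (use b b2 in auto)
  also have "... = tlift (ctens A A) (\<lambda>x y. sw (ctens A A) (\<lambda>x' y'. ctel A A (x ** x') (y ** y')) c) (bc b)"
  proof (rule bcw_cong[OF _ bilin_A_BB(1)[OF b2'] b(1)])
   fix x y assume xy: "x .: A" "y \<in> B"
   have "?I (tlift AB (\<lambda>x' y'. ctel A BB (x ** x') (y ** y')) (bc c)) = tlift (ctens A A) (\<lambda>x' y'. ?I (ctel A BB (x ** x') (y ** y'))) (bc c)"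
    by (rule lin_through_bcw[OF incl]) (use b b1 xy in auto)
   also have "... = tlift (ctens A A) (\<lambda>x' y'. ctel A A (x ** x') (y ** y')) (bc c)"
    by (rule bcw_cong) (insert b xy bI bilin_A_BB(1)[OF b1'], auto simp: tlift_ctel)
   also have "... = sw (ctens A A) (\<lambda>x' y'. ctel A A (x ** x') (y ** y')) c"
    by (rule bc_sw) (use b b1' xy in auto)
   finally show "?I (tlift AB (\<lambda>x' y'. ctel A BB (x ** x') (y ** y')) (bc c)) = sw (ctens A A) (\<lambda>x' y'. ctel A A (x ** x') (y ** y')) c" .
  qed simp
  also have "... = sw (ctens A A) (\<lambda>x y. sw (ctens A A) (\<lambda>x' y'. ctel A A (x ** x') (y ** y')) c) b"
   by (rule bc_sw) (use b b2' in auto)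
  also have "... = sw (ctens A A) (ctel A A) (b ** c)"
   by (rule sw_mult[symmetric]) (use b bilin_ctel in auto)
  also have "... = ?I (bc (b ** c))"
   using b by (simp add: bc_incl tlift_ctel_id)
  finally show "?I (bc (b ** c)) = ?I ?t" by simp
 qed
 then have "tlift U ph (bc (b ** c)) = tlift U ph ?t" by simp
 also have "... = tlift U (\<lambda>x y. tlift U ph (tlift AB (\<lambda>x' y'. ctel A BB (x ** x') (y ** y')) (bc c))) (bc b)"
  by (rule lin_through_bcw) (insert U ph b b2, auto intro!: tlift_lin)
 also have "... = tlift U (\<lambda>x y. tlift U (\<lambda>x' y'. ph (x ** x') (y ** y')) (bc c)) (bc b)"
 proof (rule bcw_cong[OF U _ b(1)])
  have b3: "bilin A BB U (\<lambda>x' y'. ph (x ** x') (y ** y'))" if "x .: A" "y \<in> B" for x y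
   using that by (intro bilinI lin_bilin_left[OF ph] lin_bilin_right[OF ph] lin) auto
  then show "bilin A BB U (\<lambda>x y. tlift U (\<lambda>x' y'. ph (x ** x') (y ** y')) (bc c))"
   using b U by (intro bilinI bcw_lin_fun lin_bilin_left[OF ph] lin_bilin_right[OF ph] lin) auto
  fix x y assume xy: "x .: A" "y \<in> B"
  have "tlift U ph (tlift AB (\<lambda>x' y'. ctel A BB (x ** x') (y ** y')) (bc c)) = tlift U (\<lambda>x' y'. tlift U ph (ctel A BB (x ** x') (y ** y'))) (bc c)"
   by (rule lin_through_bcw) (insert U ph b b1 xy, auto intro!: tlift_lin)
  also have "... = tlift U (\<lambda>x' y'. ph (x ** x') (y ** y')) (bc c)"
   by (rule bcw_cong) (insert b xy ph U b3, auto simp: tlift_ctel)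
  finally show "tlift U ph (tlift AB (\<lambda>x' y'. ctel A BB (x ** x') (y ** y')) (bc c)) = tlift U (\<lambda>x' y'. ph (x ** x') (y ** y')) (bc c)" .
 qed
 finally show ?thesis .
qed

text \<open>The adjoint action is not colinear; its coaction reads \<open>a(1) b(1) S(a(3)) \<otimes> act a(2) b(2)\<close>, here with
\<open>a(3)\<close> moved to the other side.\<close>

lemma act_coact_A:
 assumes U: "vs U" and ph: "bilin A A U ph" and a: "a .: A" and b: "b .: A"
 shows "sw U (\<lambda>x y. sw U (\<lambda>p q. ph (p ** y) q) (act x b)) a = sw U (\<lambda>p q. sw U (\<lambda>x y. ph (x ** p) (act y q)) a) b"
proof -
 note phl = lin_bilin_left[OF ph] lin_bilin_right[OF ph]
 note li = lin phl S_lin0 U a b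
 define G where "G s c = sw U (\<lambda>p q. ph p (q ** s)) c" for s c
 have Gbi: "bilin A A U (\<lambda>p q. ph p (q ** s))" if "s .: A" for s
  using that by (intro bilinI li) auto
 have Gl: "G s \<in> lin_hom A U" if "s .: A" for s
  unfolding G_def using that by (intro li Gbi) auto
 define X where "X = sw U (\<lambda>u w. G (S w) (u ** b)) a"
 have "sw U (\<lambda>u w. G (S w) (u ** b)) a = sw U (\<lambda>u w. sw U (\<lambda>x y. sw U (\<lambda>p q. ph (x ** p) (y ** q ** S w)) b) u) a"
 proof (rule sw_cong[OF U _ a])
  show "bilin A A U (\<lambda>u w. sw U (\<lambda>x y. sw U (\<lambda>p q. ph (x ** p) (y ** q ** S w)) b) u)"
   by (intro bilinI li) auto
  fix u w assume "u .: A" "w .: A"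
  then show "G (S w) (u ** b) = sw U (\<lambda>x y. sw U (\<lambda>p q. ph (x ** p) (y ** q ** S w)) b) u"
   unfolding G_def using b U Gbi by (intro sw_mult) auto
 qed
 also have "... = sw U (\<lambda>x r. sw U (\<lambda>y w. sw U (\<lambda>p q. ph (x ** p) (y ** q ** S w)) b) r) a"
  by (rule sw_coassoc[symmetric, of _ "\<lambda>x y w. sw U (\<lambda>p q. ph (x ** p) (y ** q ** S w)) b", OF U _ a])
   (intro trilinI li bilinI; simp add: a b)
 also have "... = sw U (\<lambda>x r. sw U (\<lambda>p q. ph (x ** p) (act r q)) b) a"
 proof (rule sw_cong[OF U _ a])
  show "bilin A A U (\<lambda>x r. sw U (\<lambda>p q. ph (x ** p) (act r q)) b)" by (intro bilinI li) auto
  fix x r assume xr: "x .: A" "r .: A"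
  have "sw U (\<lambda>y w. sw U (\<lambda>p q. ph (x ** p) (y ** q ** S w)) b) r = sw U (\<lambda>p q. sw U (\<lambda>y w. ph (x ** p) (y ** q ** S w)) r) b"
   by (rule tlift_swap[OF vsA vsA vsA vsA U]) (insert xr b, auto intro!: bilinI li)
  also have "... = sw U (\<lambda>p q. ph (x ** p) (act r q)) b"
  proof (rule sw_cong[OF U _ b])
   show "bilin A A U (\<lambda>p q. ph (x ** p) (act r q))" using xr by (intro bilinI li) auto
   fix p q assume "p .: A" "q .: A"
   then show "sw U (\<lambda>y w. ph (x ** p) (y ** q ** S w)) r = ph (x ** p) (act r q)"
    unfolding act_def using xr by (intro lin_through_sw[symmetric] bilin_right[OF ph] U bilinI li) auto
  qed
  finally show "sw U (\<lambda>y w. sw U (\<lambda>p q. ph (x ** p) (y ** q ** S w)) b) r = sw U (\<lambda>p q. ph (x ** p) (act r q)) b" .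
 qed
 also have "... = sw U (\<lambda>p q. sw U (\<lambda>x y. ph (x ** p) (act y q)) a) b"
  by (rule tlift_swap[OF vsA vsA vsA vsA U]) (insert a b, auto intro!: bilinI li)
 finally have R: "X = sw U (\<lambda>p q. sw U (\<lambda>x y. ph (x ** p) (act y q)) a) b" unfolding X_def .
 have "X = sw U (\<lambda>u w. sw U (\<lambda>x y. G (S w) (act x b ** y)) u) a"
  unfolding X_def
 proof (rule sw_cong[OF U _ a])
  show "bilin A A U (\<lambda>u w. sw U (\<lambda>x y. G (S w) (act x b ** y)) u)"
   unfolding G_def by (intro bilinI li Gbi) (auto simp: b)
  fix u w assume uw: "u .: A" "w .: A"
  have "G (S w) (u ** b) = G (S w) (sw A (\<lambda>x y. act x b ** y) u)" using uw b by (simp add: act_cancel)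
  also have "... = sw U (\<lambda>x y. G (S w) (act x b ** y)) u"
   by (rule lin_through_sw) (insert uw Gl U b, auto intro!: bilinI lin)
  finally show "G (S w) (u ** b) = sw U (\<lambda>x y. G (S w) (act x b ** y)) u" .
 qed
 also have "... = sw U (\<lambda>x r. sw U (\<lambda>y w. G (S w) (act x b ** y)) r) a"
  unfolding G_def
  by (rule sw_coassoc[symmetric, of _ "\<lambda>x y w. sw U (\<lambda>p q. ph p (q ** S w)) (act x b ** y)", OF U _ a])
   (intro trilinI li bilinI; simp add: a b)
 also have "... = sw U (\<lambda>x r. sw U (\<lambda>p q. ph (p ** r) q) (act x b)) a"
 proof (rule sw_cong[OF U _ a])
  show "bilin A A U (\<lambda>x r. sw U (\<lambda>p q. ph (p ** r) q) (act x b))" by (intro bilinI li) (auto simp: b)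
  fix x r assume xr: "x .: A" "r .: A"
  have "sw U (\<lambda>y w. G (S w) (act x b ** y)) r = sw U (\<lambda>y w. sw U (\<lambda>p q. sw U (\<lambda>p' q'. ph (p ** p') (q ** q' ** S w)) y) (act x b)) r"
   unfolding G_def
   by (rule sw_cong[OF U _ xr(2)]) (insert xr b U Gbi sw_mult[OF U Gbi], auto intro!: bilinI li)
  also have "... = sw U (\<lambda>p q. sw U (\<lambda>y w. sw U (\<lambda>p' q'. ph (p ** p') (q ** q' ** S w)) y) r) (act x b)"
   by (rule tlift_swap[OF vsA vsA vsA vsA U]) (insert xr b, auto intro!: bilinI li)
  also have "... = sw U (\<lambda>p q. ph (p ** r) q) (act x b)"
  proof (rule sw_cong[OF U])
   show "bilin A A U (\<lambda>p q. ph (p ** r) q)" using xr by (intro bilinI li) auto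
   show "act x b .: A" using xr b by simp
   fix p q assume pq: "p .: A" "q .: A"
   have "sw U (\<lambda>y w. sw U (\<lambda>p' q'. ph (p ** p') (q ** q' ** S w)) y) r = sw U (\<lambda>p' t. sw U (\<lambda>q' w. ph (p ** p') (q ** q' ** S w)) t) r"
    by (rule sw_coassoc[symmetric, of _ "\<lambda>p' q' w. ph (p ** p') (q ** q' ** S w)", OF U _ xr(2)])
     (intro trilinI li bilinI; simp add: pq)
   also have "... = sw U (\<lambda>p' t. eps t \<odot>\<^bsub>U\<^esub> ph (p ** p') q) r"
   proof (rule sw_cong[OF U _ xr(2)])
    show "bilin A A U (\<lambda>p' t. eps t \<odot>\<^bsub>U\<^esub> ph (p ** p') q)"
     by (intro bilinI li eps_lin0) (auto simp: pq intro!: bilin_closed[OF ph])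
    fix p' t assume pt: "p' .: A" "t .: A"
    have "sw U (\<lambda>q' w. ph (p ** p') (q ** q' ** S w)) t = sw U (\<lambda>q' w. ph (p ** p') (q ** (q' ** S w))) t"
     by (rule sw_cong[OF U _ pt(2)]) (insert pq pt, auto simp: R.m_assoc intro!: bilinI li)
    then show "sw U (\<lambda>q' w. ph (p ** p') (q ** q' ** S w)) t = eps t \<odot>\<^bsub>U\<^esub> ph (p ** p') q"
     using antipode_right[of "\<lambda>z. ph (p ** p') (q ** z)" U t] pq pt by (simp add: phl mult_lin lin_id U)
   qed
   also have "... = ph (p ** r) q"
    by (rule sw_counit_right) (insert pq xr, auto intro!: li)
   finally show "sw U (\<lambda>y w. sw U (\<lambda>p' q'. ph (p ** p') (q ** q' ** S w)) y) r = ph (p ** r) q" .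
  qed
  finally show "sw U (\<lambda>y w. G (S w) (act x b ** y)) r = sw U (\<lambda>p q. ph (p ** r) q) (act x b)" .
 qed
 finally show ?thesis using R by simp
qed

end

section \<open>Relative Hopf modules\<close>

lemma finsum_closure:
 assumes V: "vs V" and "finite I" and "\<And>i. i \<in> I ==> f i .: V \<and> P (f i)"
  and 0: "P \<zero>\<^bsub>V\<^esub>" and add: "\<And>x y. x .: V ==> y .: V ==> P x ==> P y ==> P (x \<oplus>\<^bsub>V\<^esub> y)"
 shows "P (finsum V f I)"
proof -
 interpret V: module CC V by (rule V)
 show ?thesis using assms(2,3)
  by (induction I rule: finite_induct) (auto simp: 0 V.finsum_insert Pi_iff intro!: add V.finsum_closed)
qed

definition additive_on :: "(complex, 'v, 'x) module_scheme \<Rightarrow> ('v \<Rightarrow> bool) \<Rightarrow> bool" where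
 "additive_on V P \<longleftrightarrow> P \<zero>\<^bsub>V\<^esub> \<and> (\<forall>x\<in>carrier V. \<forall>y\<in>carrier V. P x \<and> P y \<longrightarrow> P (x \<oplus>\<^bsub>V\<^esub> y))"

context qhs
begin

lemma act_coact_B:
 assumes U: "vs U" and ph: "bilin A BB U ph" and a: "a .: A" and b: "b \<in> B"
 shows "sw U (\<lambda>x y. tlift U (\<lambda>p q. ph (p ** y) q) (bc (act x b))) a = tlift U (\<lambda>p q. sw U (\<lambda>x y. ph (x ** p) (act y q)) a) (bc b)"
proof -
 let ?I = "tlift (ctens A A) (ctel A A)" and ?T = "ctens A A"
 have bI: "bilin A BB ?T (ctel A A)" by (rule bilin_A_BB(1)[OF bilin_ctel])
 have incl: "?I \<in> lin_hom AB ?T" by (intro tlift_lin bI) auto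
 note phl = lin_bilin_left[OF ph, simplified] lin_bilin_right[OF ph]
 note li = lin
 have b1: "bilin A BB AB (\<lambda>p q. ctel A BB (p ** y) q)" if "y .: A" for y
  using that by (intro bilinI lin) auto
 have b1': "bilin A A ?T (\<lambda>p q. ctel A A (p ** y) q)" if "y .: A" for y
  using that by (intro bilinI lin) auto
 have b1U: "bilin A BB U (\<lambda>p q. ph (p ** y) q)" if "y .: A" for y
  using that by (intro bilinI phl lin) auto
 have b2: "bilin A A AB (\<lambda>x y. tlift AB (\<lambda>p q. ctel A BB (p ** y) q) (bc (act x b)))"
  using b by (intro bilinI lin b1) auto
 have b2': "bilin A A ?T (\<lambda>x y. sw ?T (\<lambda>p q. ctel A A (p ** y) q) (act x b))"
  using b by (intro bilinI lin b1') auto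
 have b2U: "bilin A A U (\<lambda>x y. tlift U (\<lambda>p q. ph (p ** y) q) (bc (act x b)))"
  using b U by (intro bilinI lin b1U phl) auto
 have b3: "bilin A A AB (\<lambda>x y. ctel A BB (x ** p) (act y q))" if "p .: A" "q \<in> B" for p q
  using that by (intro bilinI lin) auto
 have b3': "bilin A A ?T (\<lambda>x y. ctel A A (x ** p) (act y q))" if "p .: A" "q .: A" for p q
  using that by (intro bilinI lin) auto
 have b3U: "bilin A A U (\<lambda>x y. ph (x ** p) (act y q))" if "p .: A" "q \<in> B" for p q
  using that by (intro bilinI phl lin) auto
 have b4: "bilin A BB AB (\<lambda>p q. sw AB (\<lambda>x y. ctel A BB (x ** p) (act y q)) a)"
  using a by (intro bilinI lin b3) auto
 have b4': "bilin A A ?T (\<lambda>p q. sw ?T (\<lambda>x y. ctel A A (x ** p) (act y q)) a)"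
  using a by (intro bilinI lin b3') auto
 have b4U: "bilin A BB U (\<lambda>p q. sw U (\<lambda>x y. ph (x ** p) (act y q)) a)"
  using a U by (intro bilinI lin b3U phl) auto
 let ?L = "sw AB (\<lambda>x y. tlift AB (\<lambda>p q. ctel A BB (p ** y) q) (bc (act x b))) a"
 let ?R = "tlift AB (\<lambda>p q. sw AB (\<lambda>x y. ctel A BB (x ** p) (act y q)) a) (bc b)"
 have "?L = ?R"
 proof (rule bc_eqI)
  show "?L .: AB" "?R .: AB" using b2 b4 a b by auto
  have "?I ?L = sw ?T (\<lambda>x y. ?I (tlift AB (\<lambda>p q. ctel A BB (p ** y) q) (bc (act x b)))) a"
   by (rule lin_through_sw[OF incl]) (use b2 a in auto)
  also have "... = sw ?T (\<lambda>x y. sw ?T (\<lambda>p q. ctel A A (p ** y) q) (act x b)) a"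
  proof (rule sw_cong[OF vs_ctens b2' a])
   fix x y assume xy: "x .: A" "y .: A"
   have "?I (tlift AB (\<lambda>p q. ctel A BB (p ** y) q) (bc (act x b))) = tlift ?T (\<lambda>p q. ?I (ctel A BB (p ** y) q)) (bc (act x b))"
    by (rule lin_through_bcw[OF incl]) (use b b1 xy in auto)
   also have "... = tlift ?T (\<lambda>p q. ctel A A (p ** y) q) (bc (act x b))"
    by (rule bcw_cong) (insert b xy bI bilin_A_BB(1)[OF b1'], auto simp: tlift_ctel)
   also have "... = sw ?T (\<lambda>p q. ctel A A (p ** y) q) (act x b)"
    by (rule bc_sw) (use b b1' xy in auto)
   finally show "?I (tlift AB (\<lambda>p q. ctel A BB (p ** y) q) (bc (act x b))) = sw ?T (\<lambda>p q. ctel A A (p ** y) q) (act x b)" .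
  qed
  also have "... = sw ?T (\<lambda>p q. sw ?T (\<lambda>x y. ctel A A (x ** p) (act y q)) a) b"
   by (rule act_coact_A) (use a b bilin_ctel in auto)
  also have "... = tlift ?T (\<lambda>p q. sw ?T (\<lambda>x y. ctel A A (x ** p) (act y q)) a) (bc b)"
   by (rule bc_sw[symmetric]) (use b b4' in auto)
  also have "... = tlift ?T (\<lambda>p q. ?I (sw AB (\<lambda>x y. ctel A BB (x ** p) (act y q)) a)) (bc b)"
  proof (rule bcw_cong[OF vs_ctens _ b])
   show "bilin A BB ?T (\<lambda>p q. ?I (sw AB (\<lambda>x y. ctel A BB (x ** p) (act y q)) a))"
    by (rule bilin_comp[OF incl b4])
   fix p q assume pq: "p .: A" "q \<in> B"
   have "?I (sw AB (\<lambda>x y. ctel A BB (x ** p) (act y q)) a) = sw ?T (\<lambda>x y. ?I (ctel A BB (x ** p) (act y q))) a"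
    by (rule lin_through_sw[OF incl]) (use a b3 pq in auto)
   also have "... = sw ?T (\<lambda>x y. ctel A A (x ** p) (act y q)) a"
    by (rule sw_cong) (insert a pq bI b3', auto simp: tlift_ctel)
   finally show "sw ?T (\<lambda>x y. ctel A A (x ** p) (act y q)) a = ?I (sw AB (\<lambda>x y. ctel A BB (x ** p) (act y q)) a)" by simp
  qed
  also have "... = ?I ?R"
   by (rule lin_through_bcw[symmetric, OF incl]) (use b b4 in auto)
  finally show "?I ?L = ?I ?R" .
 qed
 then have eq: "tlift U ph ?L = tlift U ph ?R" by simp
 have tl: "tlift U ph \<in> lin_hom AB U" by (intro tlift_lin ph U) auto
 have "tlift U ph ?L = sw U (\<lambda>x y. tlift U ph (tlift AB (\<lambda>p q. ctel A BB (p ** y) q) (bc (act x b)))) a"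
  by (rule lin_through_sw[OF tl]) (use b2 a U in auto)
 also have "... = sw U (\<lambda>x y. tlift U (\<lambda>p q. ph (p ** y) q) (bc (act x b))) a"
 proof (rule sw_cong[OF U b2U a])
  fix x y assume xy: "x .: A" "y .: A"
  have "tlift U ph (tlift AB (\<lambda>p q. ctel A BB (p ** y) q) (bc (act x b))) = tlift U (\<lambda>p q. tlift U ph (ctel A BB (p ** y) q)) (bc (act x b))"
   by (rule lin_through_bcw[OF tl]) (use b b1 xy U in auto)
  also have "... = tlift U (\<lambda>p q. ph (p ** y) q) (bc (act x b))"
   by (rule bcw_cong) (insert b xy b1U U ph, auto simp: tlift_ctel)
  finally show "tlift U ph (tlift AB (\<lambda>p q. ctel A BB (p ** y) q) (bc (act x b))) = tlift U (\<lambda>p q. ph (p ** y) q) (bc (act x b))" .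
 qed
 finally have L: "tlift U ph ?L = sw U (\<lambda>x y. tlift U (\<lambda>p q. ph (p ** y) q) (bc (act x b))) a" .
 have "tlift U ph ?R = tlift U (\<lambda>p q. tlift U ph (sw AB (\<lambda>x y. ctel A BB (x ** p) (act y q)) a)) (bc b)"
  by (rule lin_through_bcw[OF tl]) (use b b4 U in auto)
 also have "... = tlift U (\<lambda>p q. sw U (\<lambda>x y. ph (x ** p) (act y q)) a) (bc b)"
 proof (rule bcw_cong[OF U b4U b])
  fix p q assume pq: "p .: A" "q \<in> B"
  have "tlift U ph (sw AB (\<lambda>x y. ctel A BB (x ** p) (act y q)) a) = sw U (\<lambda>x y. tlift U ph (ctel A BB (x ** p) (act y q))) a"
   by (rule lin_through_sw[OF tl]) (use a b3 pq U in auto)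
  also have "... = sw U (\<lambda>x y. ph (x ** p) (act y q)) a"
   by (rule sw_cong) (insert a pq U ph b3U, auto simp: tlift_ctel)
  finally show "tlift U ph (sw AB (\<lambda>x y. ctel A BB (x ** p) (act y q)) a) = sw U (\<lambda>x y. ph (x ** p) (act y q)) a" .
 qed
 finally show ?thesis using L eq by simp
qed

lemma tlift_closure:
 assumes V: "vs V" and t: "t .: (ctens A V)"
 shows "\<exists>Y. finite Y \<and> Y \<subseteq> carrier V \<and>
   (\<forall>ph P. bilin A V V ph \<longrightarrow> additive_on V P \<longrightarrow> (\<forall>a\<in>carrier A. \<forall>y\<in>Y. P (ph a y)) \<longrightarrow> P (tlift V ph t))"
 using t vsA
proof (induction t rule: ctens_induct)
 case zero
 show ?case
 proof (rule exI[of _ "{}"], intro conjI allI impI)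
  fix ph P assume "bilin A V V ph" and P: "additive_on V P"
  then have "tlift V ph \<zero>\<^bsub>ctens A V\<^esub> = \<zero>\<^bsub>V\<^esub>"
   by (intro lin_map_zero tlift_lin) (auto simp: V)
  then show "P (tlift V ph \<zero>\<^bsub>ctens A V\<^esub>)" using P by (simp add: additive_on_def)
 qed auto
next
 case (gen a v)
 show ?case
 proof (rule exI[of _ "{v}"], intro conjI allI impI)
  fix ph P assume "bilin A V V ph" and P: "\<forall>a\<in>carrier A. \<forall>y\<in>{v}. P (ph a y)"
  then have "tlift V ph (ctel A V a v) = ph a v"
   using gen V by (intro tlift_ctel) auto
  then show "P (tlift V ph (ctel A V a v))" using P gen by simp
 qed (use gen in auto)
next
 case (add s t)
 obtain Y where Y: "finite Y" "Y \<subseteq> carrier V"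
   "\<forall>ph P. bilin A V V ph \<longrightarrow> additive_on V P \<longrightarrow> (\<forall>a\<in>carrier A. \<forall>y\<in>Y. P (ph a y)) \<longrightarrow> P (tlift V ph s)"
  using add.IH(1) by (elim exE conjE)
 obtain Z where Z: "finite Z" "Z \<subseteq> carrier V"
   "\<forall>ph P. bilin A V V ph \<longrightarrow> additive_on V P \<longrightarrow> (\<forall>a\<in>carrier A. \<forall>y\<in>Z. P (ph a y)) \<longrightarrow> P (tlift V ph t)"
  using add.IH(2) by (elim exE conjE)
 show ?case
 proof (rule exI[of _ "Y \<union> Z"], intro conjI allI impI)
  fix ph P assume ph: "bilin A V V ph" and P: "additive_on V P" and PY: "\<forall>a\<in>carrier A. \<forall>y\<in>Y \<union> Z. P (ph a y)"
  have "P (tlift V ph s)" using Y(3)[THEN spec, THEN spec, of ph P] ph P PY by simp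
  moreover have "P (tlift V ph t)" using Z(3)[THEN spec, THEN spec, of ph P] ph P PY by simp
  moreover have "tlift V ph s .: V" "tlift V ph t .: V"
   using tlift_closed[OF vsA V V ph] add by auto
  ultimately have "P (tlift V ph s \<oplus>\<^bsub>V\<^esub> tlift V ph t)" using P by (simp add: additive_on_def)
  then show "P (tlift V ph (s \<oplus>\<^bsub>ctens A V\<^esub> t))"
   using add lin_add[OF tlift_lin[OF vsA V V ph]] by simp
 qed (use Y Z in auto)
qed

context
 fixes V :: "('a, 'f, 'z) relmod_scheme"
 assumes V: "relmod_obj A B V"
begin

lemma rel_vs: "vs V" and rel_com: "comodule A V (coact V)" and rel_lact: "bilin BB V V (lact V)"
 using V by (auto simp: relmod_obj_def left_module_def bilin_def lin_hom_B)

lemma rel_lact_closed: "b \<in> B ==> v .: V ==> lact V b v .: V"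
 using bilin_closed[OF rel_lact] by simp

lemma rel_lact_one: "v .: V ==> lact V \<one> v = v"
 and rel_lact_assoc: "v .: V ==> b \<in> B ==> b' \<in> B ==> lact V (b ** b') v = lact V b (lact V b' v)"
 using V by (auto simp: relmod_obj_def left_module_def)

lemmas rel_lact_lin = lin_bilin_right[OF rel_lact, simplified] lin_bilin_left[OF rel_lact]

lemmas rcw_closed = cw_closed[OF vsA rel_vs rel_com]
lemmas rcw_lin_arg = cw_lin_arg[OF vsA rel_vs rel_com]
lemmas rcw_lin_fun = cw_lin_fun[OF vsA rel_vs rel_com]
lemmas rcw_cong = cw_cong[OF vsA rel_vs rel_com]
lemmas lin_through_rcw = lin_through_cw[OF vsA rel_vs rel_com]
lemmas rcw_counit = cw_counit[OF vsA rel_vs rel_com _ _ eps_lin0]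
lemmas rcw_coassoc = cw_coassoc[OF vsA rel_vs rel_com _ _ _ \<Delta>_lin0]
lemmas rel_coact_closed = comodule_closed[OF rel_com]

lemma rel_ract: "v .: V ==> b \<in> B ==> ract V v b = tlift V (\<lambda>a v'. lact V (act a b) v') (coact V v)"
 using V by (simp add: relmod_obj_def induced_ract_def act_def)

lemma rel_act_bilin: "b \<in> B ==> bilin A V V (\<lambda>a v'. lact V (act a b) v')"
 by (intro bilinI rel_lact_lin lin) auto

lemma rel_ract_bilin: "bilin V BB V (ract V)"
proof (intro bilinI)
 fix v assume v: "v .: V"
 have "(\<lambda>b. tlift V (\<lambda>a v'. lact V (act a b) v') (coact V v)) \<in> lin_hom BB V"
  using v by (intro rcw_lin_fun rel_vs vsBB rel_act_bilin rel_lact_lin lin) auto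
 then show "(\<lambda>b. ract V v b) \<in> lin_hom BB V"
  by (rule lin_cong) (insert v, auto simp: rel_ract)
next
 fix b assume b: "b .: BB"
 have "(\<lambda>v. tlift V (\<lambda>a v'. lact V (act a b) v') (coact V v)) \<in> lin_hom V V"
  using b by (intro rcw_lin_arg rel_vs rel_act_bilin lin) auto
 then show "(\<lambda>v. ract V v b) \<in> lin_hom V V"
  by (rule lin_cong) (insert b rel_vs, auto simp: rel_ract)
qed

lemma rel_ract_closed: "v .: V ==> b \<in> B ==> ract V v b .: V"
 using bilin_closed[OF rel_ract_bilin] by simp

lemmas rel_ract_lin = lin_bilin_right[OF rel_ract_bilin] lin_bilin_left[OF rel_ract_bilin, simplified]

text \<open>The induced right action is \<open>v b = act v(-1) b v(0)\<close>; this inverts the formula.\<close>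

lemma rel_lact_as_ract:
 assumes v: "v .: V" and b: "b \<in> B"
 shows "lact V b v = tlift V (\<lambda>a v'. ract V v' (act (S' a) b)) (coact V v)"
proof -
 note li = lin rel_lact_lin S'_lin0 rel_vs
 have "tlift V (\<lambda>a v'. ract V v' (act (S' a) b)) (coact V v) =
   tlift V (\<lambda>a v'. tlift V (\<lambda>a' v''. lact V (act a' (act (S' a) b)) v'') (coact V v')) (coact V v)"
  by (rule rcw_cong[OF rel_vs _ v])
   (insert b v rel_vs, auto simp: rel_ract intro!: bilinI rcw_lin_arg rcw_lin_fun li)
 also have "... = tlift V (\<lambda>c v''. sw V (\<lambda>a a'. lact V (act a' (act (S' a) b)) v'') c) (coact V v)"
  by (rule rcw_coassoc[OF rel_vs _ v, of "\<lambda>a a' v''. lact V (act a' (act (S' a) b)) v''"]) (insert b, auto intro!: trilinI li)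
 also have "... = tlift V (\<lambda>c v''. eps c \<odot>\<^bsub>V\<^esub> lact V b v'') (coact V v)"
 proof (rule rcw_cong[OF rel_vs _ v])
  show "bilin A V V (\<lambda>c v''. eps c \<odot>\<^bsub>V\<^esub> lact V b v'')"
   by (intro bilinI li eps_lin0) (auto simp: b rel_lact_closed)
  fix c v'' assume cv: "c .: A" "v'' .: V"
  have "sw V (\<lambda>a a'. lact V (act a' (act (S' a) b)) v'') c = sw V (\<lambda>a a'. lact V (act (a' ** S' a) b) v'') c"
   by (rule sw_cong[OF rel_vs _ cv(1)]) (insert cv b, auto simp: act_mult intro!: bilinI li)
  also have "... = eps c \<odot>\<^bsub>V\<^esub> lact V (act \<one> b) v''"
   by (rule S'_left[of "\<lambda>z. lact V (act z b) v''"]) (insert cv b, auto intro!: li)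
  finally show "sw V (\<lambda>a a'. lact V (act a' (act (S' a) b)) v'') c = eps c \<odot>\<^bsub>V\<^esub> lact V b v''"
   using b by (simp add: act_one)
 qed
 also have "... = lact V b v"
  by (rule rcw_counit) (insert b v, auto intro!: li)
 finally show ?thesis by simp
qed

lemma rel_coact_lact:
 assumes U: "vs U" and ph: "bilin A V U ph" and v: "v .: V" and b: "b \<in> B"
 shows "tlift U ph (coact V (lact V b v)) = tlift U (\<lambda>x b'. tlift U (\<lambda>y v'. ph (x ** y) (lact V b' v')) (coact V v)) (bc b)"
proof -
 note li = lin rel_lact_lin rel_vs lin_bilin_left[OF ph] lin_bilin_right[OF ph]
 let ?T = "ctens A V"
 have b1: "bilin A V ?T (\<lambda>y v'. ctel A V (x ** y) (lact V b' v'))" if "x .: A" "b' \<in> B" for x b'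
  using that by (intro bilinI li) (auto simp: rel_lact_closed)
 have b1': "bilin A V U (\<lambda>y v'. ph (x ** y) (lact V b' v'))" if "x .: A" "b' \<in> B" for x b'
  using that by (intro bilinI li) (auto simp: rel_lact_closed)
 have b2: "bilin A BB ?T (\<lambda>x b'. tlift ?T (\<lambda>y v'. ctel A V (x ** y) (lact V b' v')) (coact V v))"
  using v b1 by (intro bilinI rcw_lin_fun li) (auto simp: rel_lact_closed)
 have b2': "bilin A BB U (\<lambda>x b'. tlift U (\<lambda>y v'. ph (x ** y) (lact V b' v')) (coact V v))"
  using v b1' U by (intro bilinI rcw_lin_fun li) (auto simp: rel_lact_closed)
 have tl: "tlift U ph \<in> lin_hom ?T U" by (intro tlift_lin ph U rel_vs) auto
 have "coact V (lact V b v) = tlift ?T (\<lambda>x b'. tlift ?T (\<lambda>y v'. ctel A V (x ** y) (lact V b' v')) (coact V v)) (bc b)"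
  using V v b by (simp add: relmod_obj_def)
 then have "tlift U ph (coact V (lact V b v)) = tlift U (\<lambda>x b'. tlift U ph (tlift ?T (\<lambda>y v'. ctel A V (x ** y) (lact V b' v')) (coact V v))) (bc b)"
  using lin_through_bcw[OF tl vs_ctens U b2 b] by simp
 also have "... = tlift U (\<lambda>x b'. tlift U (\<lambda>y v'. ph (x ** y) (lact V b' v')) (coact V v)) (bc b)"
 proof (rule bcw_cong[OF U b2' b])
  fix x b' assume xb: "x .: A" "b' \<in> B"
  have "tlift U ph (tlift ?T (\<lambda>y v'. ctel A V (x ** y) (lact V b' v')) (coact V v)) =
    tlift U (\<lambda>y v'. tlift U ph (ctel A V (x ** y) (lact V b' v'))) (coact V v)"
   by (rule lin_through_rcw[OF tl vs_ctens U b1[OF xb] v])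
  also have "... = tlift U (\<lambda>y v'. ph (x ** y) (lact V b' v')) (coact V v)"
   by (rule rcw_cong[OF U b1'[OF xb] v]) (insert xb U ph, auto simp: tlift_ctel rel_lact_closed rel_vs)
  finally show "tlift U ph (tlift ?T (\<lambda>y v'. ctel A V (x ** y) (lact V b' v')) (coact V v)) =
   tlift U (\<lambda>y v'. ph (x ** y) (lact V b' v')) (coact V v)" .
 qed
 finally show ?thesis .
qed

text \<open>The induced right action makes the module a right Hopf module as well, although only left
covariance is part of the definition.\<close>

lemma rel_coact_ract:
 assumes U: "vs U" and ph: "bilin A V U ph" and v: "v .: V" and b: "b \<in> B"
 shows "tlift U ph (coact V (ract V v b)) = tlift U (\<lambda>a v'. tlift U (\<lambda>p q. ph (a ** p) (ract V v' q)) (bc b)) (coact V v)"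
proof -
 note phl = lin_bilin_left[OF ph] lin_bilin_right[OF ph]
 note cl = rel_lact_closed rel_ract_closed rel_coact_closed rcw_closed
 note li = lin rel_lact_lin rel_ract_lin rel_vs phl rcw_lin_arg rcw_lin_fun
 note si = cl v b U
 have tl: "(\<lambda>v. tlift U ph (coact V v)) \<in> lin_hom V U"
  by (intro rcw_lin_arg U ph lin)
 have "tlift U ph (coact V (ract V v b)) = tlift U ph (coact V (tlift V (\<lambda>a v'. lact V (act a b) v') (coact V v)))"
  using v b by (simp add: rel_ract)
 also have "... = tlift U (\<lambda>a v'. tlift U ph (coact V (lact V (act a b) v'))) (coact V v)"
  by (rule lin_through_rcw[OF tl rel_vs U rel_act_bilin[OF b] v])
 also have "... = tlift U (\<lambda>a v'. tlift U (\<lambda>y v''. tlift U (\<lambda>p q. ph (p ** y) (lact V q v'')) (bc (act a b))) (coact V v')) (coact V v)"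
 proof (rule rcw_cong[OF U _ v])
  show "bilin A V U (\<lambda>a v'. tlift U (\<lambda>y v''. tlift U (\<lambda>p q. ph (p ** y) (lact V q v'')) (bc (act a b))) (coact V v'))"
   by (intro bilinI li; simp add: si)
  fix a v' assume av: "a .: A" "v' .: V"
  have "tlift U ph (coact V (lact V (act a b) v')) = tlift U (\<lambda>p q. tlift U (\<lambda>y v''. ph (p ** y) (lact V q v'')) (coact V v')) (bc (act a b))"
   by (rule rel_coact_lact) (use av b U ph in auto)
  also have "... = tlift U (\<lambda>y v''. tlift U (\<lambda>p q. ph (p ** y) (lact V q v'')) (bc (act a b))) (coact V v')"
   by (rule tlift_swap[OF vsA vsBB vsA rel_vs U]) (insert av b, auto simp: cl bc_closed intro!: bilinI li)
  finally show "tlift U ph (coact V (lact V (act a b) v')) =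
    tlift U (\<lambda>y v''. tlift U (\<lambda>p q. ph (p ** y) (lact V q v'')) (bc (act a b))) (coact V v')" .
 qed
 also have "... = tlift U (\<lambda>c v''. sw U (\<lambda>a y. tlift U (\<lambda>p q. ph (p ** y) (lact V q v'')) (bc (act a b))) c) (coact V v)"
  by (rule rcw_coassoc[OF U _ v, of "\<lambda>a y v''. tlift U (\<lambda>p q. ph (p ** y) (lact V q v'')) (bc (act a b))"])
   (intro trilinI li bilinI; simp add: si)
 also have "... = tlift U (\<lambda>c v''. sw U (\<lambda>a y. tlift U (\<lambda>p q. ph (a ** p) (lact V (act y q) v'')) (bc b)) c) (coact V v)"
 proof (rule rcw_cong[OF U _ v])
  show "bilin A V U (\<lambda>c v''. sw U (\<lambda>a y. tlift U (\<lambda>p q. ph (a ** p) (lact V (act y q) v'')) (bc b)) c)"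
   by (intro bilinI li; simp add: si)
  fix c v'' assume cv: "c .: A" "v'' .: V"
  have "sw U (\<lambda>a y. tlift U (\<lambda>p q. ph (p ** y) (lact V q v'')) (bc (act a b))) c =
   tlift U (\<lambda>p q. sw U (\<lambda>a y. ph (a ** p) (lact V (act y q) v'')) c) (bc b)"
   by (rule act_coact_B[OF U _ cv(1) b, of "\<lambda>p q. ph p (lact V q v'')"]) (insert cv, intro bilinI li; simp add: si)
  also have "... = sw U (\<lambda>a y. tlift U (\<lambda>p q. ph (a ** p) (lact V (act y q) v'')) (bc b)) c"
   by (rule tlift_swap[OF vsA vsBB vsA vsA U]) (insert cv b, auto simp: cl bc_closed intro!: bilinI li)
  finally show "sw U (\<lambda>a y. tlift U (\<lambda>p q. ph (p ** y) (lact V q v'')) (bc (act a b))) c =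
    sw U (\<lambda>a y. tlift U (\<lambda>p q. ph (a ** p) (lact V (act y q) v'')) (bc b)) c" .
 qed
 also have "... = tlift U (\<lambda>a v'. tlift U (\<lambda>y v''. tlift U (\<lambda>p q. ph (a ** p) (lact V (act y q) v'')) (bc b)) (coact V v')) (coact V v)"
  by (rule rcw_coassoc[symmetric, OF U _ v, of "\<lambda>a y v''. tlift U (\<lambda>p q. ph (a ** p) (lact V (act y q) v'')) (bc b)"])
   (intro trilinI li bilinI; simp add: si)
 also have "... = tlift U (\<lambda>a v'. tlift U (\<lambda>p q. ph (a ** p) (ract V v' q)) (bc b)) (coact V v)"
 proof (rule rcw_cong[OF U _ v])
  show "bilin A V U (\<lambda>a v'. tlift U (\<lambda>p q. ph (a ** p) (ract V v' q)) (bc b))"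
   by (intro bilinI li; simp add: si)
  fix a v' assume av: "a .: A" "v' .: V"
  have "tlift U (\<lambda>y v''. tlift U (\<lambda>p q. ph (a ** p) (lact V (act y q) v'')) (bc b)) (coact V v') =
   tlift U (\<lambda>p q. tlift U (\<lambda>y v''. ph (a ** p) (lact V (act y q) v'')) (coact V v')) (bc b)"
   by (rule tlift_swap[OF vsA rel_vs vsA vsBB U]) (insert av b, auto simp: cl bc_closed intro!: bilinI li)
  also have "... = tlift U (\<lambda>p q. ph (a ** p) (ract V v' q)) (bc b)"
  proof (rule bcw_cong[OF U _ b])
   show "bilin A BB U (\<lambda>p q. ph (a ** p) (ract V v' q))" using av by (intro bilinI li; simp add: si)
   fix p q assume "p .: A" "q \<in> B"
   then show "tlift U (\<lambda>y v''. ph (a ** p) (lact V (act y q) v'')) (coact V v') = ph (a ** p) (ract V v' q)"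
    using av U by (simp add: rel_ract lin_through_rcw[OF bilin_right[OF ph] rel_vs U rel_act_bilin])
  qed
  finally show "tlift U (\<lambda>y v''. tlift U (\<lambda>p q. ph (a ** p) (lact V (act y q) v'')) (bc b)) (coact V v') =
    tlift U (\<lambda>p q. ph (a ** p) (ract V v' q)) (bc b)" .
 qed
 finally show ?thesis .
qed

lemma rel_left_generated:
 "\<exists>X. finite X \<and> X \<subseteq> carrier V \<and> (\<forall>P v. additive_on V P \<and> (\<forall>b\<in>B. \<forall>x\<in>X. P (lact V b x)) \<and> v .: V \<longrightarrow> P v)"
proof -
 have "left_fin_gen B V" using V by (simp add: relmod_obj_def)
 then obtain X where X: "finite X" "X \<subseteq> carrier V"
  "\<forall>m\<in>carrier V. \<exists>c\<in>(X \<rightarrow> B). m = finsum V (\<lambda>x. lact V (c x) x) X" by (auto simp: left_fin_gen_def)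
 have H: "P v" if P: "additive_on V P" "\<forall>b\<in>B. \<forall>x\<in>X. P (lact V b x)" and v: "v .: V" for P v
 proof -
  obtain c where c: "c \<in> X \<rightarrow> B" "v = finsum V (\<lambda>x. lact V (c x) x) X" using X(3) v by auto
  have cB: "c x \<in> B" if "x \<in> X" for x using c(1) that by auto
  show "P v" unfolding c(2)
   by (rule finsum_closure[where P = P, OF rel_vs X(1)]) (insert X(2) P cB, auto intro!: rel_lact_closed simp: additive_on_def)
 qed
 show ?thesis
 proof (rule exI[of _ X], intro conjI allI impI X(1,2))
  fix P v assume "additive_on V P \<and> (\<forall>b\<in>B. \<forall>x\<in>X. P (lact V b x)) \<and> v .: V"
  then show "P v" by (elim conjE) (rule H[of P v])
 qed
qed

text \<open>Generation is phrased as an induction principle.  The right generators are the second legs of the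
coactions of the left generators, by \<open>rel_lact_as_ract\<close>.\<close>

lemma rel_right_generated:
 "\<exists>Y. finite Y \<and> Y \<subseteq> carrier V \<and> (\<forall>P v. additive_on V P \<and> (\<forall>b\<in>B. \<forall>y\<in>Y. P (ract V y b)) \<and> v .: V \<longrightarrow> P v)"
proof -
 obtain X where X: "finite X" "X \<subseteq> carrier V" and
  XP: "\<forall>P v. additive_on V P \<and> (\<forall>b\<in>B. \<forall>x\<in>X. P (lact V b x)) \<and> v .: V \<longrightarrow> P v"
  using rel_left_generated by (elim exE conjE)
 have "\<forall>x\<in>X. \<exists>Y. finite (Y) \<and> Y \<subseteq> carrier V \<and> (\<forall>ph P. bilin A V V ph \<longrightarrow> additive_on V P \<longrightarrow> (\<forall>a\<in>carrier A. \<forall>y\<in>Y. P (ph a y)) \<longrightarrow> P (tlift V ph (coact V x)))"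
  using X(2) rel_coact_closed by (intro ballI tlift_closure rel_vs) auto
 from bchoice[OF this] obtain Y where Y: "\<forall>x\<in>X. finite (Y x) \<and> Y x \<subseteq> carrier V \<and> (\<forall>ph P. bilin A V V ph \<longrightarrow> additive_on V P \<longrightarrow> (\<forall>a\<in>carrier A. \<forall>y\<in>Y x. P (ph a y)) \<longrightarrow> P (tlift V ph (coact V x)))"
  by (elim exE)
 have H: "P v" if P: "additive_on V P" "\<forall>b\<in>B. \<forall>y\<in>\<Union>(Y ` X). P (ract V y b)" and v: "v .: V" for P v
 proof (rule XP[rule_format, OF conjI[OF P(1) conjI[OF _ v]]], intro ballI)
  fix b x assume b: "b \<in> B" and x: "x \<in> X"
  have bi: "bilin A V V (\<lambda>a v'. ract V v' (act (S' a) b))"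
   using b by (intro bilinI rel_ract_lin lin S'_lin0) auto
  have "P (ract V y (act (S' a) b))" if "a .: A" "y \<in> Y x" for a y
   using P(2) x that b by auto
  then have "P (tlift V (\<lambda>a v'. ract V v' (act (S' a) b)) (coact V x))"
   using conjunct2[OF conjunct2[OF bspec[OF Y x]], THEN spec, THEN spec, of "\<lambda>a v'. ract V v' (act (S' a) b)" P]
    bi P(1) by simp
  then show "P (lact V b x)" using rel_lact_as_ract[of x b] b x X(2) by auto
 qed
 show ?thesis
 proof (rule exI[of _ "\<Union>(Y ` X)"], intro conjI allI impI)
  show "finite (\<Union>(Y ` X))" using X(1) bspec[OF Y] by auto
  show "\<Union>(Y ` X) \<subseteq> carrier V" using bspec[OF Y] by blast
  fix P v assume "additive_on V P \<and> (\<forall>b\<in>B. \<forall>y\<in>\<Union>(Y ` X). P (ract V y b)) \<and> v .: V"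
  then show "P v" by (elim conjE) (rule H[of P v])
 qed
qed

end

end

section \<open>The coaction on the dual\<close>

context qhs
begin

context
 fixes V :: "('a, 'f, 'z) relmod_scheme"
 assumes V: "relmod_obj A B V"
begin

abbreviation DV where "DV \<equiv> dual_bimod A B V"

lemma DV_simps: "zero DV = (\<lambda>f\<in>carrier V. \<zero>)" "ph \<oplus>\<^bsub>DV\<^esub> ps = (\<lambda>f\<in>carrier V. ph f \<oplus> ps f)"
 "c \<odot>\<^bsub>DV\<^esub> ph = (\<lambda>f\<in>carrier V. c \<odot> ph f)"
 by (simp_all add: dual_bimod_def)

lemma DV_mem: "ph .: DV \<longleftrightarrow> ph \<in> extensional (carrier V) \<and> ph \<in> lin_hom V BB \<and>
  (\<forall>b\<in>B. \<forall>f\<in>carrier V. ph (ract V f b) = ph f ** b)"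
 by (auto simp: dual_bimod_def right_hom_def)

lemma DV_restrict:
 assumes "th \<in> lin_hom V BB" "\<And>b f. b \<in> B ==> f .: V ==> th (ract V f b) = th f ** b"
 shows "(\<lambda>f\<in>carrier V. th f) .: DV"
 unfolding DV_mem
 using assms(2) rel_ract_closed[OF V] lin_cong[OF assms(1) rel_vs[OF V], of "\<lambda>f\<in>carrier V. th f"] by auto

lemma DV_lin: "ph .: DV ==> ph \<in> lin_hom V BB" by (simp add: DV_mem)
lemma DV_ract: "ph .: DV ==> b \<in> B ==> f .: V ==> ph (ract V f b) = ph f ** b" by (simp add: DV_mem)
lemma DV_closed: "ph .: DV ==> f .: V ==> ph f \<in> B" using lin_closed[OF DV_lin] by simp
lemma DV_eqI: "ph .: DV ==> ps .: DV ==> (\<And>f. f .: V ==> ph f = ps f) ==> ph = ps"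
 by (auto simp: DV_mem intro: extensionalityI)

lemma vs_DV: "vs DV"
proof -
 have zero: "zero DV .: DV" unfolding DV_simps
  by (rule DV_restrict) (auto intro: lin_A_BB[OF lin_zero_fun])
 have add: "ph \<oplus>\<^bsub>DV\<^esub> ps .: DV" if "ph .: DV" "ps .: DV" for ph ps
  unfolding DV_simps using lin_add_fun[OF vsBB DV_lin[OF that(1)] DV_lin[OF that(2)]] that
  by (intro DV_restrict) (auto simp: DV_ract DV_closed R.l_distr)
 have smult: "c \<odot>\<^bsub>DV\<^esub> ph .: DV" if "ph .: DV" for c ph
  unfolding DV_simps using lin_smult_fun[OF vsBB DV_lin[OF that], of c] that
  by (intro DV_restrict) (auto simp: DV_ract DV_closed smult_mult)
 note cl = zero add smult
 have AA: "ph f .: A" if "ph .: DV" "f .: V" for ph f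
  using DV_closed[OF that] by simp
 have "abelian_group DV"
 proof (rule abelian_groupI)
  fix x assume x: "x .: DV"
  have "(-1) \<odot>\<^bsub>DV\<^esub> x \<oplus>\<^bsub>DV\<^esub> x = \<zero>\<^bsub>DV\<^esub>"
  proof (rule DV_eqI[OF cl(2)[OF cl(3)[OF x] x] cl(1)])
   fix f assume f: "f .: V"
   show "((-1) \<odot>\<^bsub>DV\<^esub> x \<oplus>\<^bsub>DV\<^esub> x) f = \<zero>\<^bsub>DV\<^esub> f"
    using f AA[OF x f] R.l_neg[OF AA[OF x f]] by (simp add: DV_simps vs_neg[OF vsA])
  qed
  then show "\<exists>y\<in>carrier DV. y \<oplus>\<^bsub>DV\<^esub> x = \<zero>\<^bsub>DV\<^esub>" using cl x by blast
  show "\<zero>\<^bsub>DV\<^esub> \<oplus>\<^bsub>DV\<^esub> x = x"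
   by (rule DV_eqI, (intro cl x)[1], (intro cl x)[1], simp add: AA x DV_simps)
  fix y assume y: "y .: DV"
  show "x \<oplus>\<^bsub>DV\<^esub> y = y \<oplus>\<^bsub>DV\<^esub> x"
   by (rule DV_eqI, (intro cl x y)[1], (intro cl x y)[1], simp add: AA x y DV_simps R.a_comm)
  fix z assume z: "z .: DV"
  show "x \<oplus>\<^bsub>DV\<^esub> y \<oplus>\<^bsub>DV\<^esub> z = x \<oplus>\<^bsub>DV\<^esub> (y \<oplus>\<^bsub>DV\<^esub> z)"
   by (rule DV_eqI, (intro cl x y z)[1], (intro cl x y z)[1], simp add: AA x y z DV_simps R.a_assoc)
 qed (use cl in auto)
 then show ?thesis
 proof (rule vsI)
  fix c d x assume x: "x .: DV"
  show "c \<odot>\<^bsub>DV\<^esub> x .: DV" using cl x by auto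
  show "(c + d) \<odot>\<^bsub>DV\<^esub> x = c \<odot>\<^bsub>DV\<^esub> x \<oplus>\<^bsub>DV\<^esub> d \<odot>\<^bsub>DV\<^esub> x"
   by (rule DV_eqI, (intro cl x)[1], (intro cl x)[1], simp add: AA x DV_simps vs_add_smult[OF vsA])
  show "(c * d) \<odot>\<^bsub>DV\<^esub> x = c \<odot>\<^bsub>DV\<^esub> (d \<odot>\<^bsub>DV\<^esub> x)"
   by (rule DV_eqI, (intro cl x)[1], (intro cl x)[1], simp add: AA x DV_simps)
  show "1 \<odot>\<^bsub>DV\<^esub> x = x"
   by (rule DV_eqI, (intro cl x)[1], (intro cl x)[1], simp add: AA x DV_simps)
  fix y assume y: "y .: DV"
  show "c \<odot>\<^bsub>DV\<^esub> (x \<oplus>\<^bsub>DV\<^esub> y) = c \<odot>\<^bsub>DV\<^esub> x \<oplus>\<^bsub>DV\<^esub> c \<odot>\<^bsub>DV\<^esub> y"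
   by (rule DV_eqI, (intro cl x y)[1], (intro cl x y)[1], simp add: AA x y DV_simps vs_smult_add[OF vsA])
 qed
qed

lemma DV_eval_lin: "f .: V ==> (\<lambda>ps. ps f) \<in> lin_hom DV BB"
 by (rule lin_homI) (auto simp: DV_closed DV_simps)

definition evl where "evl f = tlift AB (\<lambda>x ps. ctel A BB x (ps f))"

lemma evl_bi: "f .: V ==> bilin A DV AB (\<lambda>x ps. ctel A BB x (ps f))"
 by (intro bilinI lin DV_eval_lin) (auto simp: DV_closed)

lemma evl_lin: "f .: V ==> evl f \<in> lin_hom (ctens A DV) AB"
 unfolding evl_def by (intro tlift_lin evl_bi vs_DV) auto

lemma evl_slice:
 assumes "f .: V" "xi \<in> lin_hom A CC" "t .: (ctens A DV)"
 shows "slice BB xi (evl f t) = slice DV xi t f"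
proof (rule ctens_lin_eqI[of "\<lambda>t. slice BB xi (evl f t)" A DV BB])
 show "(\<lambda>t. slice BB xi (evl f t)) \<in> lin_hom (ctens A DV) BB"
  by (intro lin_comp[OF slice_lin[OF vsA vsBB assms(2)]] evl_lin assms)
 show "(\<lambda>t. slice DV xi t f) \<in> lin_hom (ctens A DV) BB"
  by (intro lin_comp[OF DV_eval_lin] slice_lin vs_DV assms) auto
 show "slice BB xi (evl f (ctel A DV v w)) = slice DV xi (ctel A DV v w) f" if "v .: A" "w .: DV" for v w
  using that assms evl_bi[OF assms(1)] vs_DV
  by (simp add: evl_def tlift_ctel slice_ctel DV_closed DV_simps)
qed (use assms in auto)

lemma evl_inj:
 assumes "s .: (ctens A DV)" "t .: (ctens A DV)" "\<And>f. f .: V ==> evl f s = evl f t"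
 shows "s = t"
proof (rule slices_eqI[OF vsA vs_DV assms(1,2)])
 fix xi assume xi: "xi \<in> lin_hom A CC"
 show "slice DV xi s = slice DV xi t"
 proof (rule DV_eqI)
  show "slice DV xi s .: DV" "slice DV xi t .: DV"
   using lin_closed[OF slice_lin[OF vsA vs_DV xi]] assms by auto
  fix f assume f: "f .: V"
  show "slice DV xi s f = slice DV xi t f"
   using evl_slice[OF f xi assms(1)] evl_slice[OF f xi assms(2)] assms(3)[OF f] by simp
 qed
qed

definition Nm where "Nm y = tlift AB (\<lambda>x z. ctel A BB (x ** y) z)"

lemma Nm_bi: "y .: A ==> bilin A BB AB (\<lambda>x z. ctel A BB (x ** y) z)"
 by (intro bilinI lin) auto

lemma Nm_lin: "y .: A ==> g \<in> lin_hom X AB ==> (\<lambda>t. Nm y (g t)) \<in> lin_hom X AB"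
 unfolding Nm_def by (rule lin_tlift_arg[OF vsA vsBB vs_ctens Nm_bi])

lemma Nm_lin_fun:
 assumes t: "t .: AB" and g: "g \<in> lin_hom X A" and X: "vs X"
 shows "(\<lambda>y. Nm (g y) t) \<in> lin_hom X AB"
 unfolding Nm_def
 by (rule lin_tlift_fun[OF vsA vsBB vs_ctens t Nm_bi _ X]) (insert lin_closed[OF g], auto intro!: lin g)

lemma Nm_closed: "y .: A ==> t .: AB ==> Nm y t .: AB"
 unfolding Nm_def by (intro tlift_closed[OF _ _ _ Nm_bi]) auto

lemma Nm_ctel: "y .: A ==> x .: A ==> z \<in> B ==> Nm y (ctel A BB x z) = ctel A BB (x ** y) z"
 unfolding Nm_def by (simp add: tlift_ctel Nm_bi)

lemma Nm_Nm: "y .: A ==> w .: A ==> t .: AB ==> Nm w (Nm y t) = Nm (y ** w) t"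
 by (rule ctens_lin_eqI[of "\<lambda>t. Nm w (Nm y t)" A BB AB]) (auto simp: Nm_ctel R.m_assoc intro!: Nm_lin lin_id)

lemma Nm_one: "t .: AB ==> Nm \<one> t = t"
 by (rule ctens_lin_eqI[of "\<lambda>t. Nm \<one> t" A BB AB]) (auto simp: Nm_ctel intro!: Nm_lin lin_id)

text \<open>The map \<open>Mt t f\<close> is the left hand side of the equation that defines \<open>dual_coact\<close>.\<close>

definition Mt where "Mt t f = tlift AB (\<lambda>x ps. tlift AB (\<lambda>y k. ctel A BB (x ** y) (ps k)) (coact V f)) t"

lemma Mt_evl:
 assumes t: "t .: (ctens A DV)" and f: "f .: V"
 shows "Mt t f = tlift AB (\<lambda>y k. Nm y (evl k t)) (coact V f)"
proof -
 note vV = rel_vs[OF V]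
 note li = lin DV_eval_lin rcw_lin_fun[OF V] vs_DV vV DV_lin
 have "Mt t f = tlift AB (\<lambda>y k. tlift AB (\<lambda>x ps. ctel A BB (x ** y) (ps k)) t) (coact V f)"
  unfolding Mt_def
  by (rule tlift_swap[OF vsA vs_DV vsA vV]) (insert t f rel_coact_closed[OF V], auto intro!: bilinI li simp: DV_closed)
 also have "... = tlift AB (\<lambda>y k. Nm y (evl k t)) (coact V f)"
 proof (rule rcw_cong[OF V vs_ctens _ f])
  have evk: "(\<lambda>k. evl k t) \<in> lin_hom V AB"
   unfolding evl_def by (rule lin_tlift_fun[OF vsA vs_DV]) (insert t evl_bi vV, auto intro!: li simp: DV_closed)
  show "bilin A V AB (\<lambda>y k. Nm y (evl k t))"
   by (intro bilinI Nm_lin evk Nm_lin_fun lin lin_closed[OF evk]) auto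
  fix y k assume yk: "y .: A" "k .: V"
  have "Nm y (evl k t) = tlift AB (\<lambda>x ps. Nm y (ctel A BB x (ps k))) t"
   unfolding evl_def by (rule lin_through_tlift[OF Nm_lin[OF yk(1) lin_id] vsA vs_DV]) (use yk evl_bi t in auto)
  also have "... = tlift AB (\<lambda>x ps. ctel A BB (x ** y) (ps k)) t"
   by (rule tlift_cong[OF vsA vs_DV]) (insert yk t, auto simp: Nm_ctel DV_closed intro!: bilinI li)
  finally show "tlift AB (\<lambda>x ps. ctel A BB (x ** y) (ps k)) t = Nm y (evl k t)" by simp
 qed
 finally show ?thesis .
qed

context
 fixes ph
 assumes ph: "ph .: DV"
begin

text \<open>The explicit formula for \<open>x \<otimes> ps f\<close>, where \<open>x \<otimes> ps\<close> stands for the coaction of \<open>ph\<close>.\<close>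

definition DD where "DD f = tlift AB (\<lambda>a f'. Nm (S' a) (bc (ph f'))) (coact V f)"

lemma bcph_lin: "g \<in> lin_hom X V ==> (\<lambda>f. bc (ph (g f))) \<in> lin_hom X AB"
 by (intro lin_comp[OF bc_lin] lin_comp[OF DV_lin[OF ph]])

lemma bcph_closed: "f .: V ==> bc (ph f) .: AB"
 using DV_closed[OF ph] bc_closed by auto

lemma DD_bi: "bilin A V AB (\<lambda>a f'. Nm (S' a) (bc (ph f')))"
 by (intro bilinI Nm_lin bcph_lin lin_id Nm_lin_fun S'_lin0) (auto simp: bcph_closed)

lemma DD_lin: "DD \<in> lin_hom V AB"
 unfolding DD_def[abs_def] by (intro rcw_lin_arg[OF V] DD_bi lin_id) auto

lemma DD_closed: "f .: V ==> DD f .: AB"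
 by (rule lin_closed[OF DD_lin])

definition Rm where "Rm b = tlift AB (\<lambda>x z. ctel A BB x (z ** b))"

lemma Rm_bi: "b \<in> B ==> bilin A BB AB (\<lambda>x z. ctel A BB x (z ** b))"
 by (intro bilinI lin) auto

lemma Rm_lin: "b \<in> B ==> Rm b \<in> lin_hom AB AB"
 unfolding Rm_def by (intro tlift_lin Rm_bi) auto

lemma Rm_ctel: "b \<in> B ==> x .: A ==> z \<in> B ==> Rm b (ctel A BB x z) = ctel A BB x (z ** b)"
 unfolding Rm_def by (simp add: tlift_ctel Rm_bi)

lemma DD_ract:
 assumes f: "f .: V" and b: "b \<in> B"
 shows "DD (ract V f b) = Rm b (DD f)"
proof -
 note vV = rel_vs[OF V]
 have key: "tlift AB (\<lambda>p q. Nm (S' (a ** p)) (bc (c ** q))) (bc b) = Rm b (Nm (S' a) (bc c))"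
  if a: "a .: A" and c: "c \<in> B" for a c
 proof -
  have b0: "bilin A BB AB (\<lambda>p' q'. ctel A BB (x ** p' ** S' (a ** p)) (y ** q'))" if "x .: A" "y \<in> B" "p .: A" for x y p
   using that a by (intro bilinI lin) auto
  have Ne: "Nm y (bc d) = tlift AB (\<lambda>x z. ctel A BB (x ** y) z) (bc d)" for y d by (simp add: Nm_def)
  have "tlift AB (\<lambda>p q. Nm (S' (a ** p)) (bc (c ** q))) (bc b) =
    tlift AB (\<lambda>p q. tlift AB (\<lambda>x y. tlift AB (\<lambda>p' q'. ctel A BB (x ** p' ** S' (a ** p)) (y ** q')) (bc q)) (bc c)) (bc b)"
  proof (rule bcw_cong[OF vs_ctens _ b])
   show "bilin A BB AB (\<lambda>p q. tlift AB (\<lambda>x y. tlift AB (\<lambda>p' q'. ctel A BB (x ** p' ** S' (a ** p)) (y ** q')) (bc q)) (bc c))"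
    by (intro bilinI lin S'_lin0 lin_id; simp add: a c)
   fix p q assume "p .: A" "q \<in> B"
   then show "Nm (S' (a ** p)) (bc (c ** q)) = tlift AB (\<lambda>x y. tlift AB (\<lambda>p' q'. ctel A BB (x ** p' ** S' (a ** p)) (y ** q')) (bc q)) (bc c)"
    unfolding Ne by (intro bcw_mult Nm_bi) (auto simp: a c)
  qed
  also have "... = tlift AB (\<lambda>x y. tlift AB (\<lambda>p q. tlift AB (\<lambda>p' q'. ctel A BB (x ** p' ** S' (a ** p)) (y ** q')) (bc q)) (bc b)) (bc c)"
   by (rule tlift_swap[OF vsA vsBB vsA vsBB vs_ctens bc_closed[OF b] bc_closed[OF c]]; intro bilinI lin S'_lin0 lin_id; simp add: a c)
  also have "... = tlift AB (\<lambda>x y. ctel A BB (x ** S' a) (y ** b)) (bc c)"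
  proof (rule bcw_cong[OF vs_ctens _ c])
   show "bilin A BB AB (\<lambda>x y. ctel A BB (x ** S' a) (y ** b))"
    by (intro bilinI lin; simp add: a b)
   fix x y assume xy: "x .: A" "y \<in> B"
   have "tlift AB (\<lambda>p q. tlift AB (\<lambda>p' q'. ctel A BB (x ** p' ** S' (a ** p)) (y ** q')) (bc q)) (bc b) =
     tlift AB (\<lambda>d q'. sw AB (\<lambda>p p'. ctel A BB (x ** p' ** S' (a ** p)) (y ** q')) d) (bc b)"
    by (rule bcw_coassoc[where ph = "\<lambda>p p' q'. ctel A BB (x ** p' ** S' (a ** p)) (y ** q')", OF vs_ctens _ b])
     (intro trilinI lin S'_lin0 lin_id; simp add: a xy)
   also have "... = tlift AB (\<lambda>d q'. eps d \<odot>\<^bsub>AB\<^esub> ctel A BB (x ** S' a) (y ** q')) (bc b)"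
   proof (rule bcw_cong[OF vs_ctens _ b])
    show "bilin A BB AB (\<lambda>d q'. eps d \<odot>\<^bsub>AB\<^esub> ctel A BB (x ** S' a) (y ** q'))"
     by (intro bilinI lin eps_lin0; simp add: a xy)
    fix d q' assume d: "d .: A" "q' \<in> B"
    have "sw AB (\<lambda>p p'. ctel A BB (x ** p' ** S' (a ** p)) (y ** q')) d = sw AB (\<lambda>p p'. ctel A BB (x ** (p' ** S' p) ** S' a) (y ** q')) d"
     by (rule sw_cong[OF vs_ctens _ d(1)]) (insert a xy d, auto simp: S'_mult R.m_assoc intro!: bilinI lin S'_lin0)
    also have "... = eps d \<odot>\<^bsub>AB\<^esub> ctel A BB (x ** \<one> ** S' a) (y ** q')"
     by (rule S'_left[of "\<lambda>z. ctel A BB (x ** z ** S' a) (y ** q')"]) (insert a xy d, auto intro!: lin)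
    finally show "sw AB (\<lambda>p p'. ctel A BB (x ** p' ** S' (a ** p)) (y ** q')) d = eps d \<odot>\<^bsub>AB\<^esub> ctel A BB (x ** S' a) (y ** q')"
     using xy by simp
   qed
   also have "... = ctel A BB (x ** S' a) (y ** b)"
    by (rule bcw_counit) (insert a xy b, auto intro!: lin)
   finally show "tlift AB (\<lambda>p q. tlift AB (\<lambda>p' q'. ctel A BB (x ** p' ** S' (a ** p)) (y ** q')) (bc q)) (bc b) = ctel A BB (x ** S' a) (y ** b)" .
  qed
  also have "... = tlift AB (\<lambda>x z. Rm b (ctel A BB (x ** S' a) z)) (bc c)"
   by (rule bcw_cong[OF vs_ctens _ c]) (insert a b, auto simp: Rm_ctel intro!: bilin_comp[OF Rm_lin[OF b]] Nm_bi)
  also have "... = Rm b (Nm (S' a) (bc c))"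
   unfolding Nm_def by (rule lin_through_bcw[symmetric, OF Rm_lin[OF b]]) (use a c Nm_bi in auto)
  finally show ?thesis .
 qed
 have "DD (ract V f b) = tlift AB (\<lambda>a f'. tlift AB (\<lambda>p q. Nm (S' (a ** p)) (bc (ph (ract V f' q)))) (bc b)) (coact V f)"
  unfolding DD_def by (rule rel_coact_ract[OF V vs_ctens DD_bi f b])
 also have "... = tlift AB (\<lambda>a f'. Rm b (Nm (S' a) (bc (ph f')))) (coact V f)"
 proof (rule rcw_cong[OF V vs_ctens bilin_comp[OF Rm_lin[OF b] DD_bi] f])
  fix a f' assume af: "a .: A" "f' .: V"
  have "tlift AB (\<lambda>p q. Nm (S' (a ** p)) (bc (ph (ract V f' q)))) (bc b) = tlift AB (\<lambda>p q. Nm (S' (a ** p)) (bc (ph f' ** q))) (bc b)"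
  proof (rule bcw_cong[OF vs_ctens _ b])
   show "bilin A BB AB (\<lambda>p q. Nm (S' (a ** p)) (bc (ph f' ** q)))"
    by (intro bilinI Nm_lin Nm_lin_fun lin lin_comp[OF bc_lin] S'_lin0) (insert af DV_closed[OF ph], auto simp: bc_closed)
  qed (insert af, auto simp: DV_ract[OF ph])
  then show "tlift AB (\<lambda>p q. Nm (S' (a ** p)) (bc (ph (ract V f' q)))) (bc b) = Rm b (Nm (S' a) (bc (ph f')))"
   using key[OF af(1) DV_closed[OF ph af(2)]] by simp
 qed
 also have "... = Rm b (DD f)"
  unfolding DD_def by (rule lin_through_rcw[symmetric, OF V Rm_lin[OF b] _ _ DD_bi f]) auto
 finally show ?thesis .
qed

lemma Rm_slice:
 assumes "b \<in> B" "xi \<in> lin_hom A CC" "t .: AB"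
 shows "slice BB xi (Rm b t) = slice BB xi t ** b"
 by (rule ctens_lin_eqI[of "\<lambda>t. slice BB xi (Rm b t)" A BB BB])
  (insert assms, auto intro!: lin_comp[OF slice_lin[OF vsA vsBB assms(2)]] multB_lin slice_lin Rm_lin lin_id simp: Rm_ctel slice_ctel smult_mult)

lemma DD_slice: "xi \<in> lin_hom A CC ==> (\<lambda>f\<in>carrier V. slice BB xi (DD f)) .: DV"
 by (rule DV_restrict) (auto simp: DD_ract Rm_slice DD_closed intro!: lin_comp[OF slice_lin[OF vsA vsBB]] DD_lin)

text \<open>Every slice of \<open>DD\<close> is an element of the dual.  As the module is finitely generated on the right, one
projection of finite rank on \<open>A\<close> fixes the left legs of all values of \<open>DD\<close>, so that finitely many slices
assemble to an element of the tensor product.\<close>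

lemma DD_represented: "\<exists>t\<in>carrier (ctens A DV). \<forall>f\<in>carrier V. evl f t = DD f"
proof -
 from rel_right_generated[OF V]
 obtain Y where Y0: "finite Y \<and> Y \<subseteq> carrier V \<and>
  (\<forall>P v. additive_on V P \<and> (\<forall>b\<in>B. \<forall>y\<in>Y. P (ract V y b)) \<and> v .: V \<longrightarrow> P v)" ..
 have Y: "finite Y" "Y \<subseteq> carrier V" using Y0 by simp_all
 have YP: "P v" if "additive_on V P" "\<And>b y. b \<in> B ==> y \<in> Y ==> P (ract V y b)" "v .: V" for P v
  using Y0[THEN conjunct2, THEN conjunct2, THEN spec, THEN spec, of P v] that by simp
 obtain P where P: "frank A P" and PY: "\<forall>t\<in>DD ` Y. tlift AB (\<lambda>v w. ctel A BB (P v) w) t = t"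
 proof -
  have "finite (DD ` Y)" "DD ` Y \<subseteq> carrier AB" using Y DD_closed by auto
  from finite_projection_tensor[OF vsA vsBB this] show ?thesis using that by (elim exE conjE)
 qed
 define PP where "PP = tlift AB (\<lambda>v w. ctel A BB (P v) w)"
 note Pl = frank_lin[OF P vsA]
 have Pbi: "bilin A BB AB (\<lambda>v w. ctel A BB (P v) w)" by (rule bilin_left_map[OF Pl vsA])
 have PPl: "PP \<in> lin_hom AB AB" unfolding PP_def by (rule tlift_lin[OF vsA vsBB vs_ctens Pbi])
 have PP_ctel: "PP (ctel A BB x z) = ctel A BB (P x) z" if "x .: A" "z \<in> B" for x z
  unfolding PP_def using tlift_ctel[OF vsA vsBB vs_ctens Pbi that(1)] that(2) by simp
 have PPR: "PP (Rm b t) = Rm b (PP t)" if b: "b \<in> B" and t: "t .: AB" for b t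
 proof (rule ctens_lin_eqI[OF lin_comp[OF PPl Rm_lin[OF b]] lin_comp[OF Rm_lin[OF b] PPl] vsA vs_ctens _ t])
  fix x z assume xz: "x .: A" "z .: BB"
  then have "PP (Rm b (ctel A BB x z)) = ctel A BB (P x) (z ** b)"
   using b by (simp add: Rm_ctel PP_ctel)
  also have "... = Rm b (PP (ctel A BB x z))"
   using xz b lin_closed[OF Pl xz(1)] by (simp add: Rm_ctel PP_ctel)
  finally show "PP (Rm b (ctel A BB x z)) = Rm b (PP (ctel A BB x z))" .
 qed
 have PPD: "PP (DD f) = DD f" if f: "f .: V" for f
 proof (rule YP[of "\<lambda>f. PP (DD f) = DD f" f, OF _ _ f])
  show "additive_on V (\<lambda>f. PP (DD f) = DD f)"
   using lin_map_zero[OF DD_lin rel_vs[OF V] vs_ctens] lin_map_zero[OF PPl vs_ctens vs_ctens]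
   by (auto simp: additive_on_def lin_add[OF DD_lin] lin_add[OF PPl] DD_closed)
  fix b y assume "b \<in> B" "y \<in> Y"
  then show "PP (DD (ract V y b)) = DD (ract V y b)"
   using PY[folded PP_def] subsetD[OF Y(2), of y] by (simp add: DD_ract PPR DD_closed)
 qed
 have "\<exists>t\<in>carrier (ctens A DV). \<forall>f\<in>carrier V. evl f t = tlift AB (\<lambda>v w. ctel A BB (P v) w) (DD f)"
  using P(1)
 proof induction
  case zero
  have z: "ctel A BB \<zero> w = \<zero>\<^bsub>AB\<^esub>" if "w .: BB" for w
   by (rule lin_map_zero[OF bilin_left[OF bilin_ctel that] vsA vs_ctens])
  note bz = bilin_left_map[OF lin_zero_fun[OF vsA] vsA, of BB]
  have "tlift AB (\<lambda>v w. ctel A BB \<zero> w) t = \<zero>\<^bsub>AB\<^esub>" if "t .: AB" for t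
  proof (rule ctens_lin_eqI[OF tlift_lin[OF vsA vsBB vs_ctens bz] lin_zero_fun[OF vs_ctens] vsA vs_ctens _ that])
   fix v w assume "v .: A" "w .: BB"
   then show "tlift AB (\<lambda>v w. ctel A BB \<zero> w) (ctel A BB v w) = \<zero>\<^bsub>AB\<^esub>"
    by (simp only: tlift_ctel[OF vsA vsBB vs_ctens bz] z)
  qed
  then show ?case using lin_map_zero[OF evl_lin vs_ctens vs_ctens] DD_closed
   by (intro bexI[of _ "\<zero>\<^bsub>ctens A DV\<^esub>"]) auto
 next
  case (add P xi e)
  then obtain t where t: "t .: (ctens A DV)" "\<forall>f\<in>carrier V. evl f t = tlift AB (\<lambda>v w. ctel A BB (P v) w) (DD f)" by auto
  let ?ps = "\<lambda>f\<in>carrier V. slice BB xi (DD f)"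
  have ps: "?ps .: DV" by (rule DD_slice[OF add(2)])
  have "evl f (t \<oplus>\<^bsub>ctens A DV\<^esub> ctel A DV e ?ps) = tlift AB (\<lambda>v w. ctel A BB (P v \<oplus> xi v \<odot> e) w) (DD f)"
   if f: "f .: V" for f
  proof -
   have "evl f (t \<oplus>\<^bsub>ctens A DV\<^esub> ctel A DV e ?ps) = evl f t \<oplus>\<^bsub>AB\<^esub> evl f (ctel A DV e ?ps)"
    by (rule lin_add[OF evl_lin[OF f] t(1)]) (use ps add in auto)
   also have "evl f (ctel A DV e ?ps) = ctel A BB e (slice BB xi (DD f))"
    unfolding evl_def using tlift_ctel[OF vsA vs_DV vs_ctens evl_bi[OF f] add(3) ps] f by simp
   also have "evl f t \<oplus>\<^bsub>AB\<^esub> ctel A BB e (slice BB xi (DD f)) = tlift AB (\<lambda>v w. ctel A BB (P v \<oplus> xi v \<odot> e) w) (DD f)"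
    using t(2) f frank_tensor_expand[OF vsA vsBB frank_lin[OF add(1) vsA] add(2,3) DD_closed[OF f]] by simp
   finally show ?thesis .
  qed
  moreover have "t \<oplus>\<^bsub>ctens A DV\<^esub> ctel A DV e ?ps .: (ctens A DV)"
   using t(1) ps add(3) by auto
  ultimately show ?case
   by (intro bexI[of _ "t \<oplus>\<^bsub>ctens A DV\<^esub> ctel A DV e ?ps"] ballI)
 qed
 then show ?thesis using PPD by (simp add: PP_def)
qed

lemma Mt_if_evl:
 assumes t: "t .: (ctens A DV)" and ev: "\<And>f. f .: V ==> evl f t = DD f" and f: "f .: V"
 shows "Mt t f = bc (ph f)"
proof -
 note li = Nm_lin Nm_lin_fun lin S'_lin0 bcph_lin lin_id DD_lin rel_vs[OF V] rcw_lin_arg[OF V] rcw_lin_fun[OF V]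
 have "Mt t f = tlift AB (\<lambda>y k. Nm y (evl k t)) (coact V f)" by (rule Mt_evl[OF t f])
 also have "... = tlift AB (\<lambda>y k. tlift AB (\<lambda>a k'. Nm y (Nm (S' a) (bc (ph k')))) (coact V k)) (coact V f)"
 proof (rule rcw_cong[OF V vs_ctens _ f])
  show "bilin A V AB (\<lambda>y k. tlift AB (\<lambda>a k'. Nm y (Nm (S' a) (bc (ph k')))) (coact V k))"
   by (intro bilinI li; simp add: Nm_closed bcph_closed)
  fix y k assume yk: "y .: A" "k .: V"
  show "Nm y (evl k t) = tlift AB (\<lambda>a k'. Nm y (Nm (S' a) (bc (ph k')))) (coact V k)"
   unfolding ev[OF yk(2)] DD_def
   by (rule lin_through_rcw[OF V Nm_lin[OF yk(1) lin_id] _ _ DD_bi yk(2)]) auto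
 qed
 also have "... = tlift AB (\<lambda>c k'. sw AB (\<lambda>y a. Nm y (Nm (S' a) (bc (ph k')))) c) (coact V f)"
  by (rule rcw_coassoc[where ph = "\<lambda>y a k'. Nm y (Nm (S' a) (bc (ph k')))", OF V vs_ctens _ f])
   (intro trilinI li; simp add: Nm_closed bcph_closed)
 also have "... = tlift AB (\<lambda>c k'. eps c \<odot>\<^bsub>AB\<^esub> bc (ph k')) (coact V f)"
 proof (rule rcw_cong[OF V vs_ctens _ f])
  show "bilin A V AB (\<lambda>c k'. eps c \<odot>\<^bsub>AB\<^esub> bc (ph k'))"
   by (intro bilinI li eps_lin0; simp add: bcph_closed)
  fix c k' assume c: "c .: A" "k' .: V"
  have "sw AB (\<lambda>y a. Nm y (Nm (S' a) (bc (ph k')))) c = sw AB (\<lambda>y a. Nm (S' a ** y) (bc (ph k'))) c"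
   by (rule sw_cong[OF vs_ctens _ c(1)]) (insert c, auto simp: Nm_Nm bcph_closed intro!: bilinI li)
  also have "... = eps c \<odot>\<^bsub>AB\<^esub> Nm \<one> (bc (ph k'))"
   by (rule S'_right[of "\<lambda>z. Nm z (bc (ph k'))"]) (insert c, auto intro!: li simp: bcph_closed)
  finally show "sw AB (\<lambda>y a. Nm y (Nm (S' a) (bc (ph k')))) c = eps c \<odot>\<^bsub>AB\<^esub> bc (ph k')"
   using c by (simp add: Nm_one bcph_closed)
 qed
 also have "... = bc (ph f)"
  by (rule rcw_counit[OF V]) (insert f, auto intro!: li)
 finally show ?thesis .
qed

lemma evl_if_Mt:
 assumes t: "t .: (ctens A DV)" and M: "\<And>f. f .: V ==> Mt t f = bc (ph f)" and f: "f .: V"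
 shows "evl f t = DD f"
proof -
 note vV = rel_vs[OF V]
 have evk: "(\<lambda>k. evl k t) \<in> lin_hom V AB"
  unfolding evl_def by (rule lin_tlift_fun[OF vsA vs_DV]) (insert t evl_bi vV, auto intro!: lin DV_lin simp: DV_closed)
 have evc: "evl k t .: AB" if "k .: V" for k using lin_closed[OF evk that] .
 note li = Nm_lin Nm_lin_fun lin S'_lin0 lin_id lin_comp[OF evk] vV rcw_lin_arg[OF V] rcw_lin_fun[OF V]
 have "DD f = tlift AB (\<lambda>a f'. tlift AB (\<lambda>y k. Nm (S' a) (Nm y (evl k t))) (coact V f')) (coact V f)"
  unfolding DD_def
 proof (rule rcw_cong[OF V vs_ctens _ f])
  show "bilin A V AB (\<lambda>a f'. tlift AB (\<lambda>y k. Nm (S' a) (Nm y (evl k t))) (coact V f'))"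
   by (intro bilinI li; simp add: Nm_closed evc)
  fix a f' assume af: "a .: A" "f' .: V"
  have "bilin A V AB (\<lambda>y k. Nm y (evl k t))" by (intro bilinI li; simp add: evc)
  then show "Nm (S' a) (bc (ph f')) = tlift AB (\<lambda>y k. Nm (S' a) (Nm y (evl k t))) (coact V f')"
   unfolding M[OF af(2), symmetric] Mt_evl[OF t af(2)]
   by (intro lin_through_rcw[OF V Nm_lin[OF _ lin_id]]) (use af in auto)
 qed
 also have "... = tlift AB (\<lambda>c k. sw AB (\<lambda>a y. Nm (S' a) (Nm y (evl k t))) c) (coact V f)"
  by (rule rcw_coassoc[where ph = "\<lambda>a y k. Nm (S' a) (Nm y (evl k t))", OF V vs_ctens _ f])
   (intro trilinI li; simp add: Nm_closed evc)
 also have "... = tlift AB (\<lambda>c k. eps c \<odot>\<^bsub>AB\<^esub> evl k t) (coact V f)"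
 proof (rule rcw_cong[OF V vs_ctens _ f])
  show "bilin A V AB (\<lambda>c k. eps c \<odot>\<^bsub>AB\<^esub> evl k t)"
   by (intro bilinI li eps_lin0; simp add: evc)
  fix c k assume c: "c .: A" "k .: V"
  have "sw AB (\<lambda>a y. Nm (S' a) (Nm y (evl k t))) c = sw AB (\<lambda>a y. Nm (y ** S' a) (evl k t)) c"
   by (rule sw_cong[OF vs_ctens _ c(1)]) (insert c, auto simp: Nm_Nm evc intro!: bilinI li)
  also have "... = eps c \<odot>\<^bsub>AB\<^esub> Nm \<one> (evl k t)"
   by (rule S'_left[of "\<lambda>z. Nm z (evl k t)"]) (insert c, auto intro!: li simp: evc)
  finally show "sw AB (\<lambda>a y. Nm (S' a) (Nm y (evl k t))) c = eps c \<odot>\<^bsub>AB\<^esub> evl k t"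
   using c by (simp add: Nm_one evc)
 qed
 also have "... = evl f t"
  by (rule rcw_counit[OF V evk]) (use f in auto)
 finally show ?thesis by simp
qed

text \<open>Hence the description in the definition of the dual coaction is satisfied by exactly one tensor.\<close>

lemma dual_coact_spec: "dual_coact A B V ph .: (ctens A DV) \<and> (\<forall>f\<in>carrier V. Mt (dual_coact A B V ph) f = bc (ph f))"
proof -
 obtain t where t: "t .: (ctens A DV)" "\<forall>f\<in>carrier V. evl f t = DD f" using DD_represented by auto
 have Mt_t: "\<forall>f\<in>carrier V. Mt t f = bc (ph f)" using Mt_if_evl t by auto
 have "dual_coact A B V ph = t"
  unfolding dual_coact_def
 proof (rule the_equality)
  show "t .: (ctens A DV) \<and> (\<forall>f\<in>carrier V. tlift AB (\<lambda>x ps. tlift AB (\<lambda>y k. ctel A BB (x ** y) (ps k)) (coact V f)) t = bc (ph f))"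
   using t Mt_t by (auto simp: Mt_def)
  fix s assume "s .: (ctens A DV) \<and> (\<forall>f\<in>carrier V. tlift AB (\<lambda>x ps. tlift AB (\<lambda>y k. ctel A BB (x ** y) (ps k)) (coact V f)) s = bc (ph f))"
  then have s: "s .: (ctens A DV)" "\<And>f. f .: V ==> Mt s f = bc (ph f)" by (auto simp: Mt_def)
  show "s = t"
   by (rule evl_inj[OF s(1) t(1)]) (use evl_if_Mt[OF s] t in auto)
 qed
 then show ?thesis using t Mt_t by auto
qed

end

end

end

section \<open>Direct sums\<close>

lemma decomposition_unique:
 assumes "direct_sum V I U W" "v \<in> W" "decomposition V I U v c"
 shows "(THE c. decomposition V I U v c) = c"
 using assms by (intro the1_equality) (auto simp: direct_sum_def)

lemma decompositionI:
 assumes V: "vs V" and U: "\<And>i. i \<in> I ==> U i \<subseteq> carrier V" and S: "finite S" "S \<subseteq> I" and c: "c \<in> Pi\<^sub>E I U"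
  and 0: "\<And>i. i \<in> I ==> i \<notin> S ==> c i = \<zero>\<^bsub>V\<^esub>" and v: "v = finsum V c S"
 shows "decomposition V I U v c"
proof -
 interpret V: module CC V by (rule V)
 have sub: "{i \<in> I. c i \<noteq> \<zero>\<^bsub>V\<^esub>} \<subseteq> S" using 0 by auto
 have cl: "c i .: V" if "i \<in> I" for i using c U[OF that] that by auto
 have "finsum V c {i \<in> I. c i \<noteq> \<zero>\<^bsub>V\<^esub>} = finsum V c S"
  by (rule V.add.finprod_mono_neutral_cong_left) (use S sub cl in auto)
 then show ?thesis
  unfolding decomposition_def using c v finite_subset[OF sub S(1)] by simp
qed

context
 fixes V :: "(complex, 'v, 'x) module_scheme" (structure) and I :: "'i set" and U W
 assumes V: "vs V" and ds: "direct_sum V I U W"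
begin

text \<open>The components in a direct sum, as a family of projections.\<close>

definition dpr :: "'i \<Rightarrow> 'v \<Rightarrow> 'v" where "dpr i v = (THE c. decomposition V I U v c) i"

lemma ds_sub: "i \<in> I ==> submodule (U i) CC V" "i \<in> I ==> U i \<subseteq> W" "submodule W CC V"
 using ds by (auto simp: direct_sum_def)

lemma ds_carrier: "i \<in> I ==> u \<in> U i ==> u .: V"
 using submoduleD(1)[OF V ds_sub(1)] by auto


lemma dpr_dec: "v \<in> W ==> decomposition V I U v (\<lambda>i. dpr i v)"
 using ds theI'[of "decomposition V I U v"] by (auto simp: direct_sum_def dpr_def)

lemma dpr_U: "v \<in> W ==> i \<in> I ==> dpr i v \<in> U i"
 using dpr_dec[of v] by (auto simp: decomposition_def)

lemma dpr_fin: "v \<in> W ==> finite {i \<in> I. dpr i v \<noteq> \<zero>}" "v \<in> W ==> v = finsum V (\<lambda>i. dpr i v) {i \<in> I. dpr i v \<noteq> \<zero>}"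
 using dpr_dec[of v] by (auto simp: decomposition_def)

lemma dpr_unique:
 assumes S: "finite S" "S \<subseteq> I" and c: "c \<in> Pi\<^sub>E I U" and 0: "\<And>i. i \<in> I ==> i \<notin> S ==> c i = \<zero>"
  and v: "v \<in> W" "v = finsum V c S"
 shows "dpr i v = c i"
 unfolding dpr_def
 by (subst decomposition_unique[OF ds v(1) decompositionI[OF V _ S c 0 v(2)]]) (use ds_carrier in auto)

lemma dpr_sum:
 assumes "v \<in> W" "finite S" "S \<subseteq> I" "{i \<in> I. dpr i v \<noteq> \<zero>} \<subseteq> S"
 shows "v = finsum V (\<lambda>i. dpr i v) S"
proof -
 interpret V: module CC V by (rule V)
 have "finsum V (\<lambda>i. dpr i v) {i \<in> I. dpr i v \<noteq> \<zero>} = finsum V (\<lambda>i. dpr i v) S"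
  by (rule V.add.finprod_mono_neutral_cong_left) (insert assms dpr_U ds_carrier, auto simp: subset_iff)
 then show ?thesis using dpr_fin(2)[OF assms(1)] by simp
qed

lemma dpr_lin: assumes i: "i \<in> I" shows "dpr i \<in> lin_hom (V\<lparr>carrier := W\<rparr>) V"
proof (rule lin_homI)
 interpret V: module CC V by (rule V)
 note WD = submoduleD[OF V ds_sub(3)] and UD = submoduleD[OF V ds_sub(1)]
 fix x y c assume "x .: (V\<lparr>carrier := W\<rparr>)"
 then have x: "x \<in> W" by simp
 have xc: "dpr j x .: V" if "j \<in> I" for j using dpr_U[OF x that] ds_carrier that by auto
 show "dpr i x .: V" using xc i by auto
 let ?Sx = "{i \<in> I. dpr i x \<noteq> \<zero>}"
 have "dpr i (c \<odot> x) = (\<lambda>j\<in>I. c \<odot> dpr j x) i"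
 proof (rule dpr_unique[of ?Sx])
  show "finite ?Sx" "c \<odot> x \<in> W" using dpr_fin x WD by auto
  have "c \<odot> x = c \<odot> finsum V (\<lambda>i. dpr i x) ?Sx" using dpr_fin(2)[OF x] by simp
  also have "... = finsum V (\<lambda>i. c \<odot> dpr i x) ?Sx"
   by (rule lin_map_finsum) (insert V dpr_fin[OF x] xc, auto intro!: lin)
  also have "... = finsum V (\<lambda>j\<in>I. c \<odot> dpr j x) ?Sx"
   by (rule V.finsum_cong') (use V xc in auto)
  finally show "c \<odot> x = finsum V (\<lambda>j\<in>I. c \<odot> dpr j x) ?Sx" .
 qed (use x xc V UD dpr_U in auto)
 then show "dpr i (c \<odot>\<^bsub>V\<lparr>carrier := W\<rparr>\<^esub> x) = c \<odot> dpr i x" using i by simp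
 assume "y .: (V\<lparr>carrier := W\<rparr>)"
 then have y: "y \<in> W" by simp
 have yc: "dpr j y .: V" if "j \<in> I" for j using dpr_U[OF y that] ds_carrier that by auto
 let ?S = "?Sx \<union> {i \<in> I. dpr i y \<noteq> \<zero>}"
 have "dpr i (x \<oplus> y) = (\<lambda>j\<in>I. dpr j x \<oplus> dpr j y) i"
 proof (rule dpr_unique[of ?S])
  show S: "finite ?S" "x \<oplus> y \<in> W" using dpr_fin x y WD by auto
  have "x \<oplus> y = finsum V (\<lambda>i. dpr i x) ?S \<oplus> finsum V (\<lambda>i. dpr i y) ?S"
   using dpr_sum[OF x S(1)] dpr_sum[OF y S(1)] by auto
  also have "... = finsum V (\<lambda>i. dpr i x \<oplus> dpr i y) ?S"
   by (rule V.finsum_addf[symmetric]) (use xc yc in auto)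
  also have "... = finsum V (\<lambda>j\<in>I. dpr j x \<oplus> dpr j y) ?S"
   by (rule V.finsum_cong') (use V xc yc in auto)
  finally show "x \<oplus> y = finsum V (\<lambda>j\<in>I. dpr j x \<oplus> dpr j y) ?S" .
 qed (use x y xc yc V UD dpr_U in auto)
 then show "dpr i (x \<oplus>\<^bsub>V\<lparr>carrier := W\<rparr>\<^esub> y) = dpr i x \<oplus> dpr i y" using i by simp
qed

lemma dpr_on:
 assumes "j \<in> I" "u \<in> U j" "i \<in> I"
 shows "dpr i u = (if i = j then u else \<zero>)"
proof -
 interpret V: module CC V by (rule V)
 have uc: "u .: V" "u \<in> W" using ds_carrier ds_sub(2) assms by auto
 have "dpr i u = (\<lambda>i\<in>I. if i = j then u else \<zero>) i"
 proof (rule dpr_unique[of "{j}"])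
  show "u = finsum V (\<lambda>i\<in>I. if i = j then u else \<zero>) {j}"
   using V.finsum_insert[of "{}" j "\<lambda>i\<in>I. if i = j then u else \<zero>"] assms uc by simp
 qed (insert assms uc submoduleD(2)[OF V ds_sub(1)], auto split: if_splits)
 then show ?thesis using assms by simp
qed

lemma ds_span:
 assumes P: "additive_on V P" and PU: "\<And>i u. i \<in> I ==> u \<in> U i ==> P u" and v: "v \<in> W"
 shows "P v"
proof -
 have c: "dpr i v .: V \<and> P (dpr i v)" if "i \<in> {i \<in> I. dpr i v \<noteq> \<zero>}" for i
  using that dpr_U[OF v] ds_carrier PU by auto
 have "P (finsum V (\<lambda>i. dpr i v) {i \<in> I. dpr i v \<noteq> \<zero>})"
  by (rule finsum_closure[where P = P, OF V dpr_fin(1)[OF v] c]) (insert P, auto simp: additive_on_def)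
 then show ?thesis using dpr_fin(2)[OF v] by simp
qed

end

lemma finite_direct_sum_projections:
 assumes V: "vs V" and I: "finite I" and U: "\<And>i. i \<in> I ==> submodule (U i) CC V"
  and span: "\<And>P v. additive_on V P ==> (\<And>i u. i \<in> I ==> u \<in> U i ==> P u) ==> v .: V ==> P v"
  and ind: "\<And>al. (\<And>i. i \<in> I ==> al i \<in> U i) ==> finsum V al I = \<zero>\<^bsub>V\<^esub> ==> (\<And>i. i \<in> I ==> al i = \<zero>\<^bsub>V\<^esub>)"
 shows "direct_sum V I U (carrier V)"
proof -
 interpret V: module CC V by (rule V)
 note UD = submoduleD[OF V U]
 have Uc: "u .: V" if "i \<in> I" "u \<in> U i" for i u using UD(1)[OF that(1)] that by auto
 have ex: "\<exists>al. al \<in> Pi\<^sub>E I U \<and> v = finsum V al I" if "v .: V" for v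
 proof (rule span[where P = "\<lambda>v. \<exists>al. al \<in> Pi\<^sub>E I U \<and> v = finsum V al I", OF _ _ that])
  show "additive_on V (\<lambda>v. \<exists>al. al \<in> Pi\<^sub>E I U \<and> v = finsum V al I)"
   unfolding additive_on_def
  proof (intro conjI ballI impI)
   have "finsum V (\<lambda>i\<in>I. \<zero>\<^bsub>V\<^esub>) I = finsum V (\<lambda>i. \<zero>\<^bsub>V\<^esub>) I" by (rule V.finsum_cong') auto
   then show "\<exists>al. al \<in> Pi\<^sub>E I U \<and> \<zero>\<^bsub>V\<^esub> = finsum V al I"
    using UD(2) by (intro exI[of _ "\<lambda>i\<in>I. \<zero>\<^bsub>V\<^esub>"]) (auto simp: V.finsum_zero)
   fix x y assume "(\<exists>al. al \<in> Pi\<^sub>E I U \<and> x = finsum V al I) \<and> (\<exists>al. al \<in> Pi\<^sub>E I U \<and> y = finsum V al I)"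
   then obtain a b where ab: "a \<in> Pi\<^sub>E I U" "x = finsum V a I" "b \<in> Pi\<^sub>E I U" "y = finsum V b I" by auto
   have c: "a i .: V" "b i .: V" if "i \<in> I" for i using ab Uc that by auto
   have "finsum V (\<lambda>i\<in>I. a i \<oplus>\<^bsub>V\<^esub> b i) I = finsum V (\<lambda>i. a i \<oplus>\<^bsub>V\<^esub> b i) I" by (rule V.finsum_cong') (use c in auto)
   also have "... = x \<oplus>\<^bsub>V\<^esub> y" unfolding ab by (rule V.finsum_addf) (use c in auto)
   finally show "\<exists>al. al \<in> Pi\<^sub>E I U \<and> x \<oplus>\<^bsub>V\<^esub> y = finsum V al I"
    using UD(3)[OF _ PiE_mem[OF ab(1)] PiE_mem[OF ab(3)]] by (intro exI[of _ "\<lambda>i\<in>I. a i \<oplus>\<^bsub>V\<^esub> b i"]) auto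
  qed
  fix j u assume j: "j \<in> I" "u \<in> U j"
  have "finsum V (\<lambda>i\<in>I. if i = j then u else \<zero>\<^bsub>V\<^esub>) I = finsum V (\<lambda>i. if j = i then u else \<zero>\<^bsub>V\<^esub>) I"
   by (rule V.finsum_cong') (use j Uc in auto)
  also have "... = u" using V.finsum_singleton[OF j(1) I, of "\<lambda>_. u"] j Uc by auto
  finally show "\<exists>al. al \<in> Pi\<^sub>E I U \<and> u = finsum V al I"
   using j UD(2) by (intro exI[of _ "\<lambda>i\<in>I. if i = j then u else \<zero>\<^bsub>V\<^esub>"]) auto
 qed
 have dec: "decomposition V I U v al \<longleftrightarrow> al \<in> Pi\<^sub>E I U \<and> v = finsum V al I" for v al
 proof -
  have "finsum V al {i \<in> I. al i \<noteq> \<zero>\<^bsub>V\<^esub>} = finsum V al I" if "al \<in> Pi\<^sub>E I U"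
   by (rule V.add.finprod_mono_neutral_cong_left) (use I that Uc in auto)
  then show ?thesis using I by (auto simp: decomposition_def)
 qed
 have "\<exists>!c. decomposition V I U v c" if "v .: V" for v
 proof -
  from ex[OF that] obtain a where a: "a \<in> Pi\<^sub>E I U" "v = finsum V a I" by auto
  show ?thesis
  proof (rule ex1I[of _ a])
   show "decomposition V I U v a" using a dec by auto
   fix b assume "decomposition V I U v b"
   then have b: "b \<in> Pi\<^sub>E I U" "v = finsum V b I" using dec by auto
   have c: "a i .: V" "b i .: V" if "i \<in> I" for i using a b Uc that by auto
   have "finsum V (\<lambda>i. a i \<oplus>\<^bsub>V\<^esub> (-1) \<odot>\<^bsub>V\<^esub> b i) I = finsum V a I \<oplus>\<^bsub>V\<^esub> finsum V (\<lambda>i. (-1) \<odot>\<^bsub>V\<^esub> b i) I"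
    by (rule V.finsum_addf) (use c V in auto)
   also have "finsum V (\<lambda>i. (-1) \<odot>\<^bsub>V\<^esub> b i) I = (-1) \<odot>\<^bsub>V\<^esub> finsum V b I"
    by (rule lin_map_finsum[symmetric]) (insert V I c, auto intro!: lin)
   also have "finsum V a I \<oplus>\<^bsub>V\<^esub> (-1) \<odot>\<^bsub>V\<^esub> finsum V b I = \<zero>\<^bsub>V\<^esub>"
    using a b that V vs_minus_eq[OF V, of v v] by simp
   finally have "a i \<oplus>\<^bsub>V\<^esub> (-1) \<odot>\<^bsub>V\<^esub> b i = \<zero>\<^bsub>V\<^esub>" if "i \<in> I" for i
    by (rule ind[rotated, OF _ that]) (use UD(3)[OF _ PiE_mem[OF a(1)] UD(4)[OF _ PiE_mem[OF b(1)]]] in auto)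
   then have "a i = b i" if "i \<in> I" for i
    using that c[OF that] vs_minus_eq[OF V, of "a i" "b i"] vs_minus_zero_iff[OF V, of "a i" "b i"] by simp
   then show "b = a" by (intro PiE_ext[OF b(1) a(1)]) auto
  qed
 qed
 then show ?thesis
  unfolding direct_sum_def using U UD(1) V by (auto simp: submodule_iff)
qed

section \<open>Hermitian structures and the Hodge map\<close>

locale herm = qhs A B for A :: "'a hopf" (structure) and B :: "'a set" +
 fixes Om :: "('a, 'w) dcalc" and OmOm :: "nat \<Rightarrow> nat \<Rightarrow> 'w set" and \<sigma> :: 'w and n :: nat
 assumes sc: "star_calculus A B Om" and cc: "covariant_calculus A B Om" and hs: "hermitian_structure Om OmOm \<sigma> n"
  and subob: "\<And>a b. subobject A B Om (OmOm a b)" and \<sigma>_coinv: "coact Om \<sigma> = ctel A Om \<one> \<sigma>"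
begin

abbreviation wedge (infixl "\<^bold>\<and>" 70) where "x \<^bold>\<and> y \<equiv> mult Om x y"

lemma dcD:
 shows Om_alg: "calgebra Om" and gr_ds: "direct_sum Om UNIV (grade Om) (carrier Om)"
  and gr_mult: "x \<in> grade Om k ==> y \<in> grade Om l ==> x \<^bold>\<and> y \<in> grade Om (k + l)"
  and emb_lin0: "emb Om \<in> lin_hom BB Om" and emb_bij: "bij_betw (emb Om) B (grade Om 0)"
  and emb_mult: "a \<in> B ==> b \<in> B ==> emb Om (a ** b) = emb Om a \<^bold>\<and> emb Om b"
  and emb_one: "emb Om \<one> = \<one>\<^bsub>Om\<^esub>"
  and Om_lact: "b \<in> B ==> x .: Om ==> lact Om b x = emb Om b \<^bold>\<and> x"
  and Om_ract: "b \<in> B ==> x .: Om ==> ract Om x b = x \<^bold>\<and> emb Om b"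
 using sc by (auto simp: star_calculus_def differential_calculus_def lin_hom_B ring_hom_def)

lemma vsOm [simp, intro]: "vs Om" and ringOm: "ring Om" and Om_mult_bilin: "bilin Om Om Om (\<lambda>x y. x \<^bold>\<and> y)"
 using Om_alg by (auto simp: calgebra_def)

sublocale O: ring Om by (rule ringOm)

lemmas Om_mult_lin [lin] = lin_bilin_right[OF Om_mult_bilin] lin_bilin_left[OF Om_mult_bilin]

lemma Om_rel: "relmod_obj A B Om" using cc by (simp add: covariant_calculus_def)

lemmas Om_com = rel_com[OF Om_rel]

lemma emb_gr: "b \<in> B ==> emb Om b \<in> grade Om 0"
 using emb_bij by (auto simp: bij_betw_def)

lemma gr_sub: "submodule (grade Om k) CC Om" using gr_ds by (simp add: direct_sum_def)
lemma gr_carrier: "x \<in> grade Om k ==> x .: Om" using submoduleD(1)[OF vsOm gr_sub] by auto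
lemma emb_closed [simp, intro]: "b \<in> B ==> emb Om b .: Om" using emb_gr gr_carrier by auto

lemma hsD:
 shows gr_zero: "k > 2 * n ==> x \<in> grade Om k ==> x = \<zero>\<^bsub>Om\<^esub>"
  and bg_ds: "direct_sum Om {(a, b). a + b = k} (\<lambda>(a, b). OmOm a b) (grade Om k)"
  and bg_mult: "x \<in> OmOm a b ==> y \<in> OmOm c d ==> x \<^bold>\<and> y \<in> OmOm (a + c) (b + d)"
  and bg_star: "fstar Om ` OmOm a b = OmOm b a"
  and \<sigma>_bg: "\<sigma> \<in> OmOm 1 1" and \<sigma>_central: "x .: Om ==> \<sigma> \<^bold>\<and> x = x \<^bold>\<and> \<sigma>"
  and lef_bij: "k < n ==> bij_betw (lefschetz Om \<sigma> ^^ (n - k)) (grade Om k) (grade Om (2 * n - k))"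
 using hs unfolding hermitian_structure_def complex_structure_def total_degree_def by auto

lemma bg_sub: "submodule (OmOm a b) CC Om" and bg_gr: "x \<in> OmOm a b ==> x \<in> grade Om (a + b)"
 using bg_ds[of "a + b"] by (auto simp: direct_sum_def)

lemma bg_carrier: "x \<in> OmOm a b ==> x .: Om" by (rule gr_carrier[OF bg_gr])
lemmas bg_submod = submoduleD[OF vsOm bg_sub]
lemmas gr_submod = submoduleD[OF vsOm gr_sub]

lemma \<sigma>_carrier [simp, intro]: "\<sigma> .: Om" using \<sigma>_bg bg_carrier by auto

lemma comp_dpr: "component Om k x = dpr Om UNIV (grade Om) k x"
 by (simp add: component_def dpr_def[OF vsOm gr_ds])

lemma comp_lin: "component Om k \<in> lin_hom Om Om"
proof -
 have "dpr Om UNIV (grade Om) k \<in> lin_hom (Om\<lparr>carrier := carrier Om\<rparr>) Om"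
  by (rule dpr_lin[OF vsOm gr_ds]) simp
 moreover have "lin_hom (Om\<lparr>carrier := carrier Om\<rparr>) Om = lin_hom Om Om"
  by (rule lin_hom_cong) simp_all
 ultimately show ?thesis by (simp add: comp_dpr[abs_def])
qed

lemma comp_gr: "x .: Om ==> component Om k x \<in> grade Om k"
 using dpr_U[OF vsOm gr_ds] by (simp add: comp_dpr)

lemma comp_on: "x \<in> grade Om l ==> component Om k x = (if k = l then x else \<zero>\<^bsub>Om\<^esub>)"
 using dpr_on[OF vsOm gr_ds, of l x k] by (simp add: comp_dpr)

text \<open>The projection of \<open>Om\<close> onto its component of bidegree \<open>(a, b)\<close>.\<close>

definition Q where "Q a b x = dpr Om {(c, d). c + d = a + b} (\<lambda>(c, d). OmOm c d) (a, b) (component Om (a + b) x)"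

lemma Q_lin: "Q a b \<in> lin_hom Om Om"
proof -
 have 1: "dpr Om {(c, d). c + d = a + b} (\<lambda>(c, d). OmOm c d) (a, b) \<in> lin_hom (Om\<lparr>carrier := grade Om (a + b)\<rparr>) Om"
  by (rule dpr_lin[OF vsOm bg_ds]) simp
 have 2: "component Om (a + b) \<in> lin_hom Om (Om\<lparr>carrier := grade Om (a + b)\<rparr>)"
  using comp_lin[of "a + b"] comp_gr by (auto simp: lin_hom_def)
 show ?thesis using lin_comp[OF 1 2] by (simp add: Q_def[abs_def])
qed

lemma Q_bg: "x .: Om ==> Q a b x \<in> OmOm a b"
 using dpr_U[OF vsOm bg_ds[of "a + b"], of "component Om (a + b) x" "(a, b)"] comp_gr by (simp add: Q_def)

lemma Q_on: "x \<in> OmOm c d ==> Q a b x = (if a = c \<and> b = d then x else \<zero>\<^bsub>Om\<^esub>)"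
proof -
 assume x: "x \<in> OmOm c d"
 show ?thesis
 proof (cases "a + b = c + d")
  case True
  then have "Q a b x = dpr Om {(c, d). c + d = a + b} (\<lambda>(c, d). OmOm c d) (a, b) x"
   using comp_on[OF bg_gr[OF x]] by (simp add: Q_def)
  also have "... = (if (a, b) = (c, d) then x else \<zero>\<^bsub>Om\<^esub>)"
   by (rule dpr_on[OF vsOm bg_ds]) (use True x in auto)
  finally show ?thesis by simp
 next
  case False
  then have "Q a b x = Q a b \<zero>\<^bsub>Om\<^esub>"
   using comp_on[OF bg_gr[OF x], of "a + b"] comp_on[OF gr_submod(2), of "a + b" "a + b"] by (simp add: Q_def)
  then show ?thesis using False lin_map_zero[OF Q_lin vsOm vsOm] by auto
 qed
qed

lemma bg_span:
 assumes P: "additive_on Om P" and Pbg: "\<And>a b x. x \<in> OmOm a b ==> P x" and v: "v .: Om"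
 shows "P v"
proof (rule ds_span[where P = P, OF vsOm gr_ds P _ v])
 fix k u assume u: "u \<in> grade Om k"
 show "P u"
  by (rule ds_span[where P = P, OF vsOm bg_ds P _ u]) (use Pbg in auto)
qed

lemma additive_on_eq:
 assumes "T \<in> lin_hom Om U" "T' \<in> lin_hom Om U" "vs U"
 shows "additive_on Om (\<lambda>x. T x = T' x)"
 using assms by (simp add: additive_on_def lin_map_zero[OF assms(1)] lin_map_zero[OF assms(2)] lin_add[OF assms(1)] lin_add[OF assms(2)])

abbreviation Lp where "Lp j \<equiv> lefschetz Om \<sigma> ^^ j"

lemma L_lin: "lefschetz Om \<sigma> \<in> lin_hom Om Om"
 unfolding lefschetz_def[abs_def] by (intro lin) simp

lemma Lp_lin: "Lp j \<in> lin_hom Om Om"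
proof (induction j)
 case 0
 show ?case using lin_id by (simp add: id_def)
next
 case (Suc j)
 then show ?case using lin_comp[OF L_lin Suc] by (simp add: comp_def)
qed

lemma Lp_closed [simp, intro]: "x .: Om ==> Lp j x .: Om" by (rule lin_closed[OF Lp_lin])
lemma Lp_zero [simp]: "Lp j \<zero>\<^bsub>Om\<^esub> = \<zero>\<^bsub>Om\<^esub>" by (rule lin_map_zero[OF Lp_lin]) auto

lemma Lp_Lp: "Lp i (Lp j x) = Lp (i + j) x" by (simp add: funpow_add)

lemma Lp_bg: "x \<in> OmOm a b ==> Lp j x \<in> OmOm (a + j) (b + j)"
proof (induction j)
 case (Suc j)
 then show ?case using bg_mult[OF \<sigma>_bg, of "Lp j x" "a + j" "b + j"] by (simp add: lefschetz_def[of _ _ "Lp j x"])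
qed simp

lemma Lp_gr: "x \<in> grade Om k ==> Lp j x \<in> grade Om (k + 2 * j)"
proof (induction j)
 case (Suc j)
 then show ?case using gr_mult[OF bg_gr[OF \<sigma>_bg], of "Lp j x" "k + 2 * j"] by (simp add: lefschetz_def[of _ _ "Lp j x"])
qed simp

lemma Lp_inj0: "m \<le> n ==> x \<in> grade Om m ==> Lp (n - m) x = \<zero>\<^bsub>Om\<^esub> ==> x = \<zero>\<^bsub>Om\<^esub>"
proof (cases "m = n")
 case False
 assume m: "m \<le> n" "x \<in> grade Om m" "Lp (n - m) x = \<zero>\<^bsub>Om\<^esub>"
 then have "inj_on (Lp (n - m)) (grade Om m)" using lef_bij[of m] False by (simp add: bij_betw_def)
 then show ?thesis using m gr_submod(2)[of m] by (auto simp: inj_on_def)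
qed simp

lemma Lp_inj: "m \<le> n ==> r + m \<le> n ==> x \<in> grade Om m ==> Lp r x = \<zero>\<^bsub>Om\<^esub> ==> x = \<zero>\<^bsub>Om\<^esub>"
 using Lp_inj0[of m x] Lp_Lp[of "n - m - r" r x] by simp

lemma Lp_surj: "m \<le> n ==> v \<in> grade Om (2 * n - m) ==> \<exists>y\<in>grade Om m. Lp (n - m) y = v"
proof (cases "m = n")
 case False
 assume m: "m \<le> n" "v \<in> grade Om (2 * n - m)"
 then have "Lp (n - m) ` grade Om m = grade Om (2 * n - m)" using lef_bij[of m] False by (simp add: bij_betw_def)
 then have "v \<in> Lp (n - m) ` grade Om m" using m by simp
 then show ?thesis by blast
qed auto

lemma Q_Lp: "x .: Om ==> Q (a + r) (b + r) (Lp r x) = Lp r (Q a b x)"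
 by (rule bg_span[where P = "\<lambda>x. Q (a + r) (b + r) (Lp r x) = Lp r (Q a b x)",
    OF additive_on_eq[OF lin_comp[OF Q_lin Lp_lin] lin_comp[OF Lp_lin Q_lin] vsOm]])
  (auto simp: Q_on Q_on[OF Lp_bg])

lemma Q_Lp0: "x .: Om ==> p < r \<or> q < r ==> Q p q (Lp r x) = \<zero>\<^bsub>Om\<^esub>"
 by (rule bg_span[where P = "\<lambda>x. Q p q (Lp r x) = \<zero>\<^bsub>Om\<^esub>",
    OF additive_on_eq[OF lin_comp[OF Q_lin Lp_lin] lin_zero_fun[OF vsOm] vsOm]])
  (auto simp: Q_on[OF Lp_bg])

lemma bg_surj:
 assumes v: "v \<in> OmOm p q" and m: "p + q + m = 2 * n" "m \<le> n"
 shows "v = \<zero>\<^bsub>Om\<^esub> \<or> (n - m \<le> p \<and> n - m \<le> q \<and> (\<exists>y\<in>OmOm (p - (n - m)) (q - (n - m)). Lp (n - m) y = v))"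
proof -
 have "v \<in> grade Om (2 * n - m)" using bg_gr[OF v] m by (metis add_diff_cancel_right')
 then obtain y where y: "y \<in> grade Om m" "Lp (n - m) y = v" using Lp_surj[OF m(2)] by auto
 have yc: "y .: Om" using y gr_carrier by auto
 have Qv: "Q p q v = v" using Q_on[OF v, of p q] by simp
 show ?thesis
 proof (cases "n - m \<le> p \<and> n - m \<le> q")
  case True
  then have "Lp (n - m) (Q (p - (n - m)) (q - (n - m)) y) = v"
   using Q_Lp[OF yc, of "p - (n - m)" "n - m" "q - (n - m)"] y Qv by simp
  then show ?thesis using True Q_bg[OF yc] by blast
 next
  case False
  then have "Q p q (Lp (n - m) y) = \<zero>\<^bsub>Om\<^esub>" using Q_Lp0[OF yc] by (auto simp: not_le)
  then show ?thesis using y Qv by simp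
 qed
qed

definition prim where "prim a b = primitive Om \<sigma> n (a + b) \<inter> OmOm a b"

lemma prim_iff: "a + b \<le> n ==> x \<in> prim a b \<longleftrightarrow> x \<in> OmOm a b \<and> Lp (n - (a + b) + 1) x = \<zero>\<^bsub>Om\<^esub>"
 using bg_gr by (auto simp: prim_def primitive_def)

lemma prim_sub: "a + b \<le> n ==> submodule (prim a b) CC Om"
 unfolding submodule_iff[OF vsOm] using submoduleD[OF vsOm bg_sub[of a b]]
 by (auto simp: prim_iff lin_add[OF Lp_lin] lin_smult[OF Lp_lin] bg_carrier simp del: funpow.simps Lp_Lp)

lemma prim_bg: "x \<in> prim a b ==> x \<in> OmOm a b" by (simp add: prim_def)

lemma prim_dec:
 assumes x: "x \<in> OmOm p q" and pq: "p + q \<le> n"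
 shows "x \<in> prim p q \<or> (1 \<le> p \<and> 1 \<le> q \<and> (\<exists>al\<in>prim p q. \<exists>y\<in>OmOm (p - 1) (q - 1). x = al \<oplus>\<^bsub>Om\<^esub> Lp 1 y))"
proof -
 define r where "r = n - (p + q) + 1"
 have z: "Lp r x \<in> OmOm (p + r) (q + r)" by (rule Lp_bg[OF x])
 show ?thesis
 proof (cases "Lp r x = \<zero>\<^bsub>Om\<^esub>")
  case True
  then show ?thesis using x pq by (simp add: prim_iff r_def)
 next
  case False
  have k2: "2 \<le> p + q"
  proof (rule ccontr)
   assume "\<not> 2 \<le> p + q"
   then have "2 * n < (p + r) + (q + r)" using pq by (auto simp: r_def)
   then show False using gr_zero[OF _ bg_gr[OF z]] False by auto
  qed
  define m where "m = p + q - 2"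
  have m: "p + r + (q + r) + m = 2 * n" "m \<le> n" "n - m = r + 1"
   using k2 pq by (auto simp: r_def m_def)
  obtain y where y: "n - m \<le> p + r" "n - m \<le> q + r" "y \<in> OmOm (p + r - (n - m)) (q + r - (n - m))" "Lp (n - m) y = Lp r x"
   using bg_surj[OF z m(1,2)] False by auto
  have y': "1 \<le> p" "1 \<le> q" "y \<in> OmOm (p - 1) (q - 1)" "Lp (r + 1) y = Lp r x" using y m(3) by auto
  define al where "al = x \<ominus>\<^bsub>Om\<^esub> Lp 1 y"
  have c: "x .: Om" "y .: Om" using x y' bg_carrier by auto
  have "Lp 1 y \<in> OmOm p q" using Lp_bg[OF y'(3), of 1] y' by simp
  then have "al \<in> OmOm p q" using x submoduleD(3,4)[OF vsOm bg_sub[of p q]] c by (simp add: al_def vs_minus_eq del: funpow.simps)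
  moreover have "Lp r al = \<zero>\<^bsub>Om\<^esub>"
   unfolding al_def using lin_map_minus[OF Lp_lin vsOm vsOm c(1) Lp_closed[OF c(2), of 1], of r] y'(4) Lp_Lp[of r 1 y] c
   by (simp del: funpow.simps)
  ultimately have "al \<in> prim p q" using pq by (simp add: prim_iff r_def)
  moreover have "x = al \<oplus>\<^bsub>Om\<^esub> Lp 1 y" unfolding al_def using vs_minus_add[OF vsOm c(1) Lp_closed[OF c(2), of 1]] by simp
  ultimately show ?thesis using y' by blast
 qed
qed

lemma lef_span:
 assumes P: "additive_on Om P" and PL: "\<And>j a b x. j + (a + b) \<le> n ==> x \<in> prim a b ==> P (Lp j x)" and v: "v .: Om"
 shows "P v"
proof (rule bg_span[where P = P, OF P _ v])
 have low: "P (Lp j x)" if "x \<in> OmOm p q" "j + (p + q) \<le> n" for x p q j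
  using that
 proof (induction "p + q" arbitrary: p q x j rule: less_induct)
  case less
  from prim_dec[OF less.prems(1)] less.prems(2)
  consider "x \<in> prim p q" | al y where "1 \<le> p" "1 \<le> q" "al \<in> prim p q" "y \<in> OmOm (p - 1) (q - 1)" "x = al \<oplus>\<^bsub>Om\<^esub> Lp 1 y"
   by auto
  then show ?case
  proof cases
   case 1
   then show ?thesis using PL less.prems(2) by blast
  next
   case 2
   have c: "al .: Om" "y .: Om" using 2 prim_bg bg_carrier by blast+
   have "Lp j x = Lp j al \<oplus>\<^bsub>Om\<^esub> Lp (j + 1) y"
    using 2 c lin_add[OF Lp_lin, of al "Lp 1 y" j] Lp_Lp[of j 1 y] by (simp del: funpow.simps)
   moreover have "P (Lp j al)" using PL 2 less.prems(2) by blast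
   moreover have "P (Lp (j + 1) y)"
    by (rule less.hyps[OF _ 2(4)]) (use 2 less.prems(2) in auto)
   ultimately show ?thesis using P c by (auto simp: additive_on_def simp del: funpow.simps)
  qed
 qed
 fix p q x assume x: "x \<in> OmOm p q"
 have P0: "P \<zero>\<^bsub>Om\<^esub>" using P by (simp add: additive_on_def)
 show "P x"
 proof (cases "p + q \<le> n")
  case True
  then show ?thesis using low[OF x, of 0] by simp
 next
  case False
  show ?thesis
  proof (cases "p + q \<le> 2 * n")
   case True
   define m where "m = 2 * n - (p + q)"
   have m: "p + q + m = 2 * n" "m \<le> n" using True False by (auto simp: m_def)
   show ?thesis
   proof (cases "x = \<zero>\<^bsub>Om\<^esub>")
    case False
    then obtain y where y: "n - m \<le> p" "n - m \<le> q" "y \<in> OmOm (p - (n - m)) (q - (n - m))" "Lp (n - m) y = x"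
     using bg_surj[OF x m] by auto
    then show ?thesis using low[OF y(3), of "n - m"] m by auto
   qed (use P0 in simp)
  next
   case False
   then show ?thesis using gr_zero[OF _ bg_gr[OF x]] P0 by auto
  qed
 qed
qed

text \<open>Independence: the first term of a vanishing sum is killed by the power of \<open>L\<close> that its primitivity provides.\<close>

lemma lef_indep_sum:
 assumes al: "\<And>j. j < N ==> al j = \<zero>\<^bsub>Om\<^esub> \<or> (2 * j \<le> k \<and> k - j \<le> n \<and> al j \<in> grade Om (k - 2 * j) \<and> Lp (n - (k - 2 * j) + 1) (al j) = \<zero>\<^bsub>Om\<^esub>)"
  and sum: "finsum Om (\<lambda>j. Lp j (al j)) {..<N} = \<zero>\<^bsub>Om\<^esub>" and j: "j < N"
 shows "al j = \<zero>\<^bsub>Om\<^esub>"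
proof -
 have ac: "al j .: Om" if "j < N" for j using al[OF that] gr_carrier by auto
 have "i \<le> N ==> finsum Om (\<lambda>j. Lp j (al j)) {i..<N} = \<zero>\<^bsub>Om\<^esub> \<and> (\<forall>j<i. al j = \<zero>\<^bsub>Om\<^esub>)" for i
 proof (induction i)
  case 0
  then show ?case using sum by (simp add: atLeast0LessThan)
 next
  case (Suc i)
  then have i: "i < N" and IH: "finsum Om (\<lambda>j. Lp j (al j)) {i..<N} = \<zero>\<^bsub>Om\<^esub>" "\<forall>j<i. al j = \<zero>\<^bsub>Om\<^esub>" by auto
  define s where "s = finsum Om (\<lambda>j. Lp j (al j)) {Suc i..<N}"
  define w where "w = finsum Om (\<lambda>j. Lp (j - Suc i) (al j)) {Suc i..<N}"
  have sc: "s .: Om" "w .: Om" unfolding s_def w_def using ac by auto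
  have "{i..<N} = insert i {Suc i..<N}" using i by auto
  then have is0: "Lp i (al i) \<oplus>\<^bsub>Om\<^esub> s = \<zero>\<^bsub>Om\<^esub>"
   using IH(1) ac i unfolding s_def by (subst (asm) \<open>{i..<N} = _\<close>, subst (asm) O.finsum_insert) auto
  have "Lp (Suc i) w = finsum Om (\<lambda>j. Lp (Suc i) (Lp (j - Suc i) (al j))) {Suc i..<N}"
   unfolding w_def by (rule lin_map_finsum[OF Lp_lin]) (use ac in auto)
  also have "... = s"
   unfolding s_def by (rule O.finsum_cong') (insert ac, auto simp del: funpow.simps simp: Lp_Lp)
  finally have sw: "Lp (Suc i) w = s" .
  show ?case
  proof (cases "al i = \<zero>\<^bsub>Om\<^esub>")
   case True
   then show ?thesis using is0 sc IH(2) by (auto simp: s_def less_Suc_eq)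
  next
   case False
   then have k: "2 * i \<le> k" "k - i \<le> n" "al i \<in> grade Om (k - 2 * i)" "Lp (n - (k - 2 * i) + 1) (al i) = \<zero>\<^bsub>Om\<^esub>"
    using al[OF i] by auto
   define r where "r = n - (k - 2 * i) + 1 - i"
   have r: "r + i = n - (k - 2 * i) + 1" using k by (auto simp: r_def)
   have "Lp r (Lp i (al i)) = \<zero>\<^bsub>Om\<^esub>" unfolding Lp_Lp r by (rule k(4))
   moreover have "Lp r (Lp i (al i) \<oplus>\<^bsub>Om\<^esub> s) = \<zero>\<^bsub>Om\<^esub>" using is0 by simp
   ultimately have "Lp r s = \<zero>\<^bsub>Om\<^esub>"
    using lin_add[OF Lp_lin, of "Lp i (al i)" s r] sc ac[OF i] by simp
   then have Lw: "Lp (r + Suc i) w = \<zero>\<^bsub>Om\<^esub>" using sw Lp_Lp[of r "Suc i" w] by (simp del: funpow.simps)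
   have w0: "w = \<zero>\<^bsub>Om\<^esub>"
   proof (cases "2 * Suc i \<le> k")
    case True
    define m where "m = k - 2 * Suc i"
    have "w \<in> grade Om m"
     unfolding w_def
    proof (rule finsum_closure[where P = "\<lambda>x. x \<in> grade Om m", OF vsOm, THEN mp[OF impI]])
     fix j assume j: "j \<in> {Suc i..<N}"
     show "Lp (j - Suc i) (al j) .: Om \<and> Lp (j - Suc i) (al j) \<in> grade Om m"
     proof (cases "al j = \<zero>\<^bsub>Om\<^esub>")
      case True
      then show ?thesis using gr_submod(2) by simp
     next
      case False
      then have "2 * j \<le> k" "al j \<in> grade Om (k - 2 * j)" using al[of j] j by auto
      then have "Lp (j - Suc i) (al j) \<in> grade Om (k - 2 * j + 2 * (j - Suc i))" by (intro Lp_gr)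
      moreover have "k - 2 * j + 2 * (j - Suc i) = m" using j \<open>2 * j \<le> k\<close> by (auto simp: m_def)
      ultimately show ?thesis using ac j by auto
     qed
    qed (use gr_submod(2,3) in auto)
    moreover have "m \<le> n" "r + Suc i + m \<le> n" using k True by (auto simp: m_def r_def)
    ultimately show ?thesis using Lp_inj[of m "r + Suc i" w] Lw by blast
   next
    case False
    have "al j = \<zero>\<^bsub>Om\<^esub>" if "j \<in> {Suc i..<N}" for j using al[of j] that False by auto
    then have "w = finsum Om (\<lambda>j. \<zero>\<^bsub>Om\<^esub>) {Suc i..<N}"
     unfolding w_def by (intro O.finsum_cong') auto
    then show ?thesis by (simp add: O.finsum_zero)
   qed
   then have "s = \<zero>\<^bsub>Om\<^esub>" using sw Lp_zero[of "Suc i"] by (simp del: funpow.simps)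
   then have "Lp i (al i) = \<zero>\<^bsub>Om\<^esub>" using is0 ac[OF i] by simp
   then have "al i = \<zero>\<^bsub>Om\<^esub>" using Lp_inj[OF _ _ k(3), of i] k by auto
   then show ?thesis using False by simp
  qed
 qed
 from this[of N] j show ?thesis by auto
qed

end

lemma submodule_image:
 assumes "vs V" "vs W" "T \<in> lin_hom V W" "submodule U CC V"
 shows "submodule (T ` U) CC W"
proof -
 note UD = submoduleD[OF assms(1,4)]
 show ?thesis
  unfolding submodule_iff[OF assms(2)]
 proof (intro conjI ballI allI)
  show "T ` U \<subseteq> carrier W" using UD(1) lin_closed[OF assms(3)] by auto
  show "\<zero>\<^bsub>W\<^esub> \<in> T ` U" using lin_map_zero[OF assms(3,1,2)] UD(2) by (metis imageI)
  fix x assume "x \<in> T ` U"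
  then obtain u where u: "u \<in> U" "x = T u" by auto
  show "c \<odot>\<^bsub>W\<^esub> x \<in> T ` U" for c
   using u UD(1,4) lin_smult[OF assms(3), of u c] by (metis imageI subsetD)
  fix y assume "y \<in> T ` U"
  then obtain w where w: "w \<in> U" "y = T w" by auto
  show "x \<oplus>\<^bsub>W\<^esub> y \<in> T ` U"
   using u w UD(1,3) lin_add[OF assms(3), of u w] by (metis imageI subsetD)
 qed
qed

context herm
begin

text \<open>The Lefschetz decomposition has the summands \<open>L^j P\<close> with \<open>P\<close> the primitive forms of bidegree \<open>(a, b)\<close>.
Only the indices with \<open>j + a + b \<le> n\<close> contribute, since \<open>L^j\<close> kills the primitive forms otherwise.\<close>

definition IL :: "(nat \<times> nat \<times> nat) set" where "IL = {(j, a, b). j + (a + b) \<le> n}"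
definition UL :: "nat \<times> nat \<times> nat \<Rightarrow> 'w set" where "UL = (\<lambda>(j, a, b). Lp j ` prim a b)"

lemma IL_finite: "finite IL"
proof -
 have "IL \<subseteq> {..n} \<times> {..n} \<times> {..n}" by (auto simp: IL_def)
 then show ?thesis by (rule finite_subset) auto
qed

text \<open>Independence is reduced to a single bidegree by the projection \<open>Q p q\<close>: the summands of bidegree
\<open>(p, q)\<close> are indexed by \<open>j\<close> alone.\<close>

lemma lef_ds: "direct_sum Om IL UL (carrier Om)"
proof (rule finite_direct_sum_projections[OF vsOm IL_finite])
 fix i assume "i \<in> IL"
 then show "submodule (UL i) CC Om"
  by (auto simp: IL_def UL_def intro!: submodule_image[OF vsOm vsOm Lp_lin] prim_sub)
next
 fix P v assume P: "additive_on Om P" "\<And>i u. i \<in> IL ==> u \<in> UL i ==> P u" "v .: Om"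
 show "P v"
 proof (rule lef_span[where P = P, OF P(1) _ P(3)])
  fix j a b x assume "j + (a + b) \<le> n" "x \<in> prim a b"
  then show "P (Lp j x)" by (intro P(2)[of "(j, a, b)"]) (auto simp: IL_def UL_def)
 qed
next
 fix al i assume al: "\<And>i. i \<in> IL ==> al i \<in> UL i" and sum: "finsum Om al IL = \<zero>\<^bsub>Om\<^esub>" and i: "i \<in> IL"
 obtain j0 a0 b0 where i0: "i = (j0, a0, b0)" by (cases i)
 define p q where "p = a0 + j0" and "q = b0 + j0"
 have ex: "\<exists>x. x \<in> prim a b \<and> al (j, a, b) = Lp j x" if "j + (a + b) \<le> n" for j a b
  using al[of "(j, a, b)"] that by (auto simp: IL_def UL_def)
 have albg: "al (j, a, b) \<in> OmOm (a + j) (b + j)" if "j + (a + b) \<le> n" for j a b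
  using ex[OF that] Lp_bg prim_bg by auto
 have alc: "al i .: Om" if "i \<in> IL" for i
 proof -
  obtain j a b where "i = (j, a, b)" by (cases i)
  then show ?thesis using bg_carrier[OF albg[of j a b]] that by (simp add: IL_def)
 qed
 define J where "J = {j. j \<le> p \<and> j \<le> q \<and> j + ((p - j) + (q - j)) \<le> n}"
 define \<beta> where "\<beta> j = (if j \<in> J then SOME x. x \<in> prim (p - j) (q - j) \<and> al (j, p - j, q - j) = Lp j x else \<zero>\<^bsub>Om\<^esub>)" for j
 have \<beta>: "\<beta> j \<in> prim (p - j) (q - j) \<and> al (j, p - j, q - j) = Lp j (\<beta> j)" if "j \<in> J" for j
 proof -
  have jj: "j + ((p - j) + (q - j)) \<le> n" using that by (simp only: J_def mem_Collect_eq)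
  show ?thesis using someI_ex[OF ex[OF jj]] that by (simp add: \<beta>_def)
 qed
 have \<beta>c: "\<beta> j .: Om" for j
 proof (cases "j \<in> J")
  case True
  then show ?thesis using bg_carrier[OF prim_bg] \<beta>[OF True] by blast
 qed (simp add: \<beta>_def)
 have Jn: "J \<subseteq> {..<Suc n}" by (auto simp: J_def)
 have inj: "inj_on (\<lambda>j. (j, p - j, q - j)) J" by (auto simp: inj_on_def)
 have JI: "(\<lambda>j. (j, p - j, q - j)) ` J \<subseteq> IL" by (auto simp: J_def IL_def)
 have "finsum Om (\<lambda>j. Lp j (\<beta> j)) {..<Suc n} = finsum Om (\<lambda>j. Lp j (\<beta> j)) J"
  by (rule O.add.finprod_mono_neutral_cong_left[symmetric]) (insert Jn \<beta>c, auto simp: \<beta>_def)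
 also have "... = finsum Om (\<lambda>j. al (j, p - j, q - j)) J"
  by (rule O.finsum_cong') (use \<beta> \<beta>c in auto)
 also have "... = finsum Om al ((\<lambda>j. (j, p - j, q - j)) ` J)"
  by (rule O.finsum_reindex[OF _ inj, symmetric]) (use alc JI in auto)
 also have "... = finsum Om (\<lambda>i. Q p q (al i)) IL"
 proof (rule O.add.finprod_mono_neutral_cong_left[OF IL_finite JI])
  show "Q p q (al i) = \<zero>\<^bsub>Om\<^esub>" if i: "i \<in> IL - (\<lambda>j. (j, p - j, q - j)) ` J" for i
  proof -
   obtain j a b where jab: "i = (j, a, b)" by (cases i)
   have "\<not> (p = a + j \<and> q = b + j)"
   proof
    assume "p = a + j \<and> q = b + j"
    then have "j \<in> J" "i = (j, p - j, q - j)" using i jab by (auto simp: J_def IL_def)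
    then show False using i by auto
   qed
   then show ?thesis using i jab Q_on[OF albg[of j a b], of p q] by (auto simp: IL_def)
  qed
  show "al x = Q p q (al x)" if x: "x \<in> (\<lambda>j. (j, p - j, q - j)) ` J" for x
  proof -
   obtain j where j: "j \<in> J" "x = (j, p - j, q - j)" using x by auto
   then have jj: "j \<le> p" "j \<le> q" "j + ((p - j) + (q - j)) \<le> n" by (simp_all only: J_def mem_Collect_eq)
   then have "p - j + j = p" "q - j + j = q" by auto
   then show ?thesis using Q_on[OF albg[of j "p - j" "q - j", OF jj(3)], of p q] unfolding j(2) by simp
  qed
  show "(\<lambda>i. Q p q (al i)) \<in> IL \<rightarrow> carrier Om" using alc lin_closed[OF Q_lin] by auto
 qed
 also have "... = Q p q (finsum Om al IL)"
  by (rule lin_map_finsum[OF Q_lin, symmetric]) (use IL_finite alc in auto)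
 also have "... = \<zero>\<^bsub>Om\<^esub>" using sum lin_map_zero[OF Q_lin vsOm vsOm] by simp
 finally have S: "finsum Om (\<lambda>j. Lp j (\<beta> j)) {..<Suc n} = \<zero>\<^bsub>Om\<^esub>" .
 have j0: "j0 \<in> J" "p - j0 = a0" "q - j0 = b0" using i i0 by (auto simp: J_def p_def q_def IL_def)
 have "\<beta> j0 = \<zero>\<^bsub>Om\<^esub>"
 proof (rule lef_indep_sum[of "Suc n" \<beta> "p + q", OF _ S])
  show "j0 < Suc n" using j0 Jn by auto
  fix j show "\<beta> j = \<zero>\<^bsub>Om\<^esub> \<or> (2 * j \<le> p + q \<and> p + q - j \<le> n \<and> \<beta> j \<in> grade Om (p + q - 2 * j) \<and> Lp (n - (p + q - 2 * j) + 1) (\<beta> j) = \<zero>\<^bsub>Om\<^esub>)"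
  proof (cases "j \<in> J")
   case True
   then have jJ: "j \<le> p" "j \<le> q" "j + ((p - j) + (q - j)) \<le> n" by (auto simp: J_def)
   have e: "p + q - 2 * j = (p - j) + (q - j)" using jJ by auto
   have "\<beta> j \<in> prim (p - j) (q - j)" using \<beta>[OF True] by simp
   then have "\<beta> j \<in> OmOm (p - j) (q - j)" "Lp (n - ((p - j) + (q - j)) + 1) (\<beta> j) = \<zero>\<^bsub>Om\<^esub>"
    using prim_iff[of "p - j" "q - j"] jJ by auto
   then show ?thesis using bg_gr[of "\<beta> j" "p - j" "q - j"] jJ unfolding e by auto
  qed (simp add: \<beta>_def)
 qed
 then show "al i = \<zero>\<^bsub>Om\<^esub>" using \<beta>[OF j0(1)] j0 i0 by simp
qed

definition hc :: "nat \<Rightarrow> nat \<Rightarrow> nat \<Rightarrow> complex" where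
 "hc j a b = (-1) ^ ((a + b) * (a + b + 1) div 2) * \<i> powi (int a - int b) * (fact j / fact (n - j - (a + b)))"

lemma prim_Lp_inj: "j + (a + b) \<le> n ==> inj_on (Lp j) (prim a b)"
proof (rule inj_onI)
 fix x y assume j: "j + (a + b) \<le> n" and xy: "x \<in> prim a b" "y \<in> prim a b" "Lp j x = Lp j y"
 have c: "x \<in> OmOm a b" "y \<in> OmOm a b" using xy prim_bg by auto
 have cc: "x .: Om" "y .: Om" using c bg_carrier by auto
 have "x \<ominus>\<^bsub>Om\<^esub> y \<in> OmOm a b" using submoduleD(3,4)[OF vsOm bg_sub[of a b]] c cc by (simp add: vs_minus_eq)
 moreover have "Lp j (x \<ominus>\<^bsub>Om\<^esub> y) = \<zero>\<^bsub>Om\<^esub>" using lin_map_minus[OF Lp_lin vsOm vsOm cc] xy(3) cc by simp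
 ultimately have "x \<ominus>\<^bsub>Om\<^esub> y = \<zero>\<^bsub>Om\<^esub>" using Lp_inj[of "a + b" j "x \<ominus>\<^bsub>Om\<^esub> y"] bg_gr[of "x \<ominus>\<^bsub>Om\<^esub> y" a b] j by auto
 then show "x = y" using cc by (simp add: vs_minus_zero_iff)
qed

definition hmap :: "nat \<times> nat \<times> nat \<Rightarrow> 'w \<Rightarrow> 'w" where
 "hmap = (\<lambda>(j, a, b) u. hc j a b \<odot>\<^bsub>Om\<^esub> Lp (n - j - (a + b)) (the_inv_into (prim a b) (Lp j) u))"

lemma hmap_Lp: "j + (a + b) \<le> n ==> x \<in> prim a b ==> hmap (j, a, b) (Lp j x) = hc j a b \<odot>\<^bsub>Om\<^esub> Lp (n - j - (a + b)) x"
 by (simp add: hmap_def the_inv_into_f_f prim_Lp_inj)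

lemma hmap_lin: "i \<in> IL ==> hmap i \<in> lin_hom (Om\<lparr>carrier := UL i\<rparr>) Om"
proof -
 assume i: "i \<in> IL"
 obtain j a b where ij: "i = (j, a, b)" by (cases i)
 have jab: "j + (a + b) \<le> n" using i ij by (simp add: IL_def)
 note pD = submoduleD[OF vsOm prim_sub[of a b]]
 have pc: "x .: Om" if "x \<in> prim a b" for x using that prim_bg bg_carrier by blast
 show ?thesis
  unfolding ij
 proof (rule lin_homI)
  fix u v c assume "u .: (Om\<lparr>carrier := UL (j, a, b)\<rparr>)"
  then obtain x where x: "x \<in> prim a b" "u = Lp j x" by (auto simp: UL_def)
  show "hmap (j, a, b) u .: Om" using x jab pc by (simp add: hmap_Lp)
  have "c \<odot>\<^bsub>Om\<^esub> u = Lp j (c \<odot>\<^bsub>Om\<^esub> x)" using x pc lin_smult[OF Lp_lin] by simp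
  then have "hmap (j, a, b) (c \<odot>\<^bsub>Om\<^esub> u) = hc j a b \<odot>\<^bsub>Om\<^esub> Lp (n - j - (a + b)) (c \<odot>\<^bsub>Om\<^esub> x)"
   using hmap_Lp[OF jab pD(4)[of x c]] x jab by simp
  also have "... = c \<odot>\<^bsub>Om\<^esub> hmap (j, a, b) u"
   using x pc lin_smult[OF Lp_lin] hmap_Lp[OF jab x(1)] by (simp add: mult.commute)
  finally show "hmap (j, a, b) (c \<odot>\<^bsub>Om\<lparr>carrier := UL (j, a, b)\<rparr>\<^esub> u) = c \<odot>\<^bsub>Om\<^esub> hmap (j, a, b) u" by simp
  assume "v .: (Om\<lparr>carrier := UL (j, a, b)\<rparr>)"
  then obtain y where y: "y \<in> prim a b" "v = Lp j y" by (auto simp: UL_def)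
  have "u \<oplus>\<^bsub>Om\<^esub> v = Lp j (x \<oplus>\<^bsub>Om\<^esub> y)" using x y pc lin_add[OF Lp_lin] by simp
  then have "hmap (j, a, b) (u \<oplus>\<^bsub>Om\<^esub> v) = hc j a b \<odot>\<^bsub>Om\<^esub> Lp (n - j - (a + b)) (x \<oplus>\<^bsub>Om\<^esub> y)"
   using hmap_Lp[OF jab pD(3)[of x y]] x y jab by simp
  also have "... = hmap (j, a, b) u \<oplus>\<^bsub>Om\<^esub> hmap (j, a, b) v"
   using x y pc lin_add[OF Lp_lin] hmap_Lp[OF jab x(1)] hmap_Lp[OF jab y(1)] by (simp add: vs_smult_add)
  finally show "hmap (j, a, b) (u \<oplus>\<^bsub>Om\<lparr>carrier := UL (j, a, b)\<rparr>\<^esub> v) = hmap (j, a, b) u \<oplus>\<^bsub>Om\<^esub> hmap (j, a, b) v" by simp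
 qed
qed

definition hodge0 where "hodge0 v = finsum Om (\<lambda>i. hmap i (dpr Om IL UL i v)) IL"

lemma hodge0_lin: "hodge0 \<in> lin_hom Om Om"
 unfolding hodge0_def[abs_def]
proof (rule lin_finsum_fun[OF vsOm IL_finite _ vsOm])
 fix i assume i: "i \<in> IL"
 have "dpr Om IL UL i \<in> lin_hom Om (Om\<lparr>carrier := UL i\<rparr>)"
  using dpr_lin[OF vsOm lef_ds i] dpr_U[OF vsOm lef_ds _ i] by (auto simp: lin_hom_def)
 then show "(\<lambda>x. hmap i (dpr Om IL UL i x)) \<in> lin_hom Om Om"
  by (rule lin_comp[OF hmap_lin[OF i]])
qed

lemma hodge0_Lp:
 assumes j: "j + (a + b) \<le> n" and x: "x \<in> prim a b"
 shows "hodge0 (Lp j x) = hc j a b \<odot>\<^bsub>Om\<^esub> Lp (n - j - (a + b)) x"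
proof -
 have i: "(j, a, b) \<in> IL" and u: "Lp j x \<in> UL (j, a, b)" using j x by (auto simp: IL_def UL_def)
 have xc: "x .: Om" using x prim_bg bg_carrier by blast
 have "hmap i' (dpr Om IL UL i' (Lp j x)) = (if (j, a, b) = i' then hmap (j, a, b) (Lp j x) else \<zero>\<^bsub>Om\<^esub>)" if "i' \<in> IL" for i'
 proof -
  have sub: "submodule (UL i') CC Om" by (rule ds_sub(1)[OF vsOm lef_ds that])
  have "hmap i' \<zero>\<^bsub>Om\<^esub> = \<zero>\<^bsub>Om\<^esub>"
   using lin_map_zero[OF hmap_lin[OF that] vs_sub[OF vsOm sub] vsOm] by simp
  then show ?thesis using dpr_on[OF vsOm lef_ds i u that] by auto
 qed
 then have "hodge0 (Lp j x) = finsum Om (\<lambda>i'. if (j, a, b) = i' then hmap (j, a, b) (Lp j x) else \<zero>\<^bsub>Om\<^esub>) IL"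
  unfolding hodge0_def by (intro O.finsum_cong') (insert j x xc, auto simp: hmap_Lp)
 also have "... = hmap (j, a, b) (Lp j x)"
  by (rule O.finsum_singleton[OF i IL_finite]) (insert j x xc, auto simp: hmap_Lp)
 finally show ?thesis using hmap_Lp[OF j x] by simp
qed

abbreviation H where "H \<equiv> hodge Om OmOm \<sigma> n"

text \<open>The Lefschetz decomposition gives existence and uniqueness of the map described in \<open>hodge\<close>.\<close>

lemma hodge_spec:
 shows H_lin0: "H \<in> lin_hom Om Om"
  and H_Lp: "j + (a + b) \<le> n ==> x \<in> prim a b ==> H (Lp j x) = hc j a b \<odot>\<^bsub>Om\<^esub> Lp (n - j - (a + b)) x"
proof -
 define Hr where "Hr = restrict hodge0 (carrier Om)"
 have Hr: "Hr \<in> lin_hom Om Om" unfolding Hr_def by (rule lin_cong[OF hodge0_lin vsOm]) simp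
 have pc: "x .: Om" if "x \<in> prim a b" for x a b using that prim_bg bg_carrier by blast
 have HrL: "Hr (Lp j x) = hc j a b \<odot>\<^bsub>Om\<^esub> Lp (n - j - (a + b)) x" if "j + (a + b) \<le> n" "x \<in> prim a b" for j a b x
  using hodge0_Lp[OF that] pc[OF that(2)] by (simp add: Hr_def)
 have "H = Hr"
  unfolding hodge_def
 proof (rule the_equality)
  show "Hr \<in> lin_hom Om Om \<inter> extensional (carrier Om) \<and>
   (\<forall>a b j k. \<forall>al\<in>primitive Om \<sigma> n k \<inter> OmOm a b. a + b = k \<and> j + k \<le> n \<longrightarrow>
    Hr (Lp j al) = ((-1) ^ (k * (k + 1) div 2) * \<i> powi (int a - int b) * (fact j / fact (n - j - k))) \<odot>\<^bsub>Om\<^esub> Lp (n - j - k) al)"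
   using Hr HrL by (auto simp: Hr_def hc_def prim_def)
 next
  fix G assume G: "G \<in> lin_hom Om Om \<inter> extensional (carrier Om) \<and>
   (\<forall>a b j k. \<forall>al\<in>primitive Om \<sigma> n k \<inter> OmOm a b. a + b = k \<and> j + k \<le> n \<longrightarrow>
    G (Lp j al) = ((-1) ^ (k * (k + 1) div 2) * \<i> powi (int a - int b) * (fact j / fact (n - j - k))) \<odot>\<^bsub>Om\<^esub> Lp (n - j - k) al)"
  then have G1: "G \<in> lin_hom Om Om" "G \<in> extensional (carrier Om)" by auto
  have G2: "G (Lp j x) = Hr (Lp j x)" if "j + (a + b) \<le> n" "x \<in> prim a b" for j a b x
   using G that HrL[OF that] by (auto simp: prim_def hc_def)
  show "G = Hr"
  proof (rule extensionalityI[OF G1(2)])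
   show "Hr \<in> extensional (carrier Om)" by (simp add: Hr_def)
   fix x assume x: "x .: Om"
   show "G x = Hr x"
    by (rule lef_span[where P = "\<lambda>x. G x = Hr x", OF additive_on_eq[OF G1(1) Hr vsOm] G2 x])
  qed
 qed
 then show "H \<in> lin_hom Om Om" "j + (a + b) \<le> n ==> x \<in> prim a b ==> H (Lp j x) = hc j a b \<odot>\<^bsub>Om\<^esub> Lp (n - j - (a + b)) x"
  using Hr HrL by auto
qed

lemmas H_lin = lin_comp[OF H_lin0]
lemma H_closed [simp, intro]: "x .: Om ==> H x .: Om" by (rule lin_closed[OF H_lin0])

text \<open>Such an operator maps primitive forms to primitive forms and commutes with \<open>L\<close>, so the formula for
the Hodge map can be compared on both sides.  This yields at once linearity over \<open>B\<close> on both sides and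
colinearity.\<close>

lemma H_commute:
 assumes \<Xi>: "\<Xi> \<in> lin_hom Om Om" and bg: "\<And>a b x. x \<in> OmOm a b ==> \<Xi> x \<in> OmOm a b"
  and L: "\<And>x. x .: Om ==> \<Xi> (\<sigma> \<^bold>\<and> x) = \<sigma> \<^bold>\<and> \<Xi> x" and x: "x .: Om"
 shows "H (\<Xi> x) = \<Xi> (H x)"
proof -
 have Lp: "\<Xi> (Lp j x) = Lp j (\<Xi> x)" if "x .: Om" for j x
 proof (induction j)
  case (Suc j)
  then show ?case using L[OF Lp_closed[OF that], of j] by (simp add: lefschetz_def[of _ _ "Lp j _"])
 qed simp
 show ?thesis
 proof (rule lef_span[where P = "\<lambda>x. H (\<Xi> x) = \<Xi> (H x)", OF additive_on_eq[OF lin_comp[OF H_lin0 \<Xi>] lin_comp[OF \<Xi> H_lin0] vsOm] _ x])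
  fix j a b x assume j: "j + (a + b) \<le> n" and x: "x \<in> prim a b"
  have xc: "x .: Om" using x prim_bg bg_carrier by blast
  have "\<Xi> x \<in> prim a b"
   using x j bg Lp[OF xc, of "n - (a + b) + 1"] lin_map_zero[OF \<Xi> vsOm vsOm] by (simp add: prim_iff del: funpow.simps)
  then show "H (\<Xi> (Lp j x)) = \<Xi> (H (Lp j x))"
   using j x xc by (simp add: Lp H_Lp lin_smult[OF \<Xi>])
 qed
qed

lemma comp_commute:
 assumes \<Xi>: "\<Xi> \<in> lin_hom Om Om" and bg: "\<And>a b x. x \<in> OmOm a b ==> \<Xi> x \<in> OmOm a b" and x: "x .: Om"
 shows "component Om k (\<Xi> x) = \<Xi> (component Om k x)"
 by (rule bg_span[where P = "\<lambda>x. component Om k (\<Xi> x) = \<Xi> (component Om k x)",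
    OF additive_on_eq[OF lin_comp[OF comp_lin \<Xi>] lin_comp[OF \<Xi> comp_lin] vsOm] _ x])
  (use comp_on[OF bg_gr] comp_on[OF bg_gr[OF bg]] lin_map_zero[OF \<Xi> vsOm vsOm] in auto)

lemma H_comp:
 assumes x: "x .: Om" and k: "k \<le> 2 * n"
 shows "component Om (2 * n - k) (H x) = H (component Om k x)"
proof (rule lef_span[where P = "\<lambda>x. component Om (2 * n - k) (H x) = H (component Om k x)",
   OF additive_on_eq[OF lin_comp[OF comp_lin H_lin0] lin_comp[OF H_lin0 comp_lin] vsOm] _ x])
 fix j a b x assume j: "j + (a + b) \<le> n" and x: "x \<in> prim a b"
 have xg: "x \<in> grade Om (a + b)" using x prim_bg bg_gr by blast
 have xc: "x .: Om" using xg gr_carrier by blast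
 have "hc j a b \<odot>\<^bsub>Om\<^esub> Lp (n - j - (a + b)) x \<in> grade Om (a + b + 2 * (n - j - (a + b)))"
  using Lp_gr[OF xg] gr_submod(4) by blast
 then have 1: "component Om (2 * n - k) (H (Lp j x)) = (if 2 * n - k = a + b + 2 * (n - j - (a + b)) then H (Lp j x) else \<zero>\<^bsub>Om\<^esub>)"
  using H_Lp[OF j x] comp_on by auto
 have 2: "component Om k (Lp j x) = (if k = a + b + 2 * j then Lp j x else \<zero>\<^bsub>Om\<^esub>)"
  using comp_on[OF Lp_gr[OF xg]] by auto
 have "2 * n - k = a + b + 2 * (n - j - (a + b)) \<longleftrightarrow> k = a + b + 2 * j" using j k by auto
 then show "component Om (2 * n - k) (H (Lp j x)) = H (component Om k (Lp j x))"
  using 1 2 lin_map_zero[OF H_lin0 vsOm vsOm] by auto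
qed

lemma H_gr: "x \<in> grade Om k ==> k \<le> 2 * n ==> H x \<in> grade Om (2 * n - k)"
 using H_comp[of x k] comp_on[of x k k] comp_gr[of "H x" "2 * n - k"] gr_carrier[of x k] by simp

end

section \<open>Colinearity of the Hodge map\<close>

lemma tens_in_ev:
 assumes V: "vs V" and W: "vs W" and X: "vs X" and t: "t .: (ctens V W)" "tens_in t (carrier V) U" and U: "U \<subseteq> carrier W"
 shows "\<exists>p. Poly_Mapping.keys p \<subseteq> carrier V \<times> U \<and> (\<forall>ph. bilin V W X ph \<longrightarrow> tlift X ph t = ev X (case_prod ph) p)"
proof -
 obtain p where p: "p \<in> t" "Poly_Mapping.keys p \<subseteq> carrier V \<times> U" using t(2) by (auto simp: tens_in_def)
 obtain q where q: "t = tclass V W {} q" using t(1) by (auto simp: ctens_simps tspace_simps)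
 have "p - q \<in> tnull V W {}" using p q by (simp add: tclass_def)
 then have tp: "t = tclass V W {} p" using q by (metis tclass_eq_iff)
 have p': "Poly_Mapping.keys p \<subseteq> carrier V \<times> carrier W" using p(2) U by auto
 have "tlift X ph t = ev X (case_prod ph) p" if "bilin V W X ph" for ph
  unfolding tp using that p' by (intro tlift_tclass mid_empty V W X)
 then show ?thesis using p(2) by blast
qed

lemma tens_in_tlift:
 assumes "vs V" "vs W" "vs X" "t .: (ctens V W)" "tens_in t (carrier V) U" "U \<subseteq> carrier W"
  and ph: "bilin V W X ph" and Y: "submodule Y CC X" "\<And>a u. a .: V ==> u \<in> U ==> ph a u \<in> Y"
 shows "tlift X ph t \<in> Y"
proof -
 obtain p where p: "Poly_Mapping.keys p \<subseteq> carrier V \<times> U" "tlift X ph t = ev X (case_prod ph) p"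
  using tens_in_ev[OF assms(1-6)] ph by blast
 note YD = submoduleD[OF assms(3) Y(1)]
 have "ev X (case_prod ph) p \<in> Y"
  unfolding ev_def
  by (rule finsum_closure[where P = "\<lambda>x. x \<in> Y", OF assms(3)]) (insert p(1) Y(2) YD, auto simp: subset_iff)
 then show ?thesis using p(2) by simp
qed


lemma tlift_add_fun:
 assumes "vs V" "vs W" "vs X" "bilin V W X ph" "bilin V W X ps" "t .: (ctens V W)"
 shows "tlift X (\<lambda>a b. ph a b \<oplus>\<^bsub>X\<^esub> ps a b) t = tlift X ph t \<oplus>\<^bsub>X\<^esub> tlift X ps t"
proof -
 have b: "bilin V W X (\<lambda>a b. ph a b \<oplus>\<^bsub>X\<^esub> ps a b)"
  by (intro bilinI lin_add_fun assms bilin_right[OF assms(4)] bilin_right[OF assms(5)] bilin_left[OF assms(4)] bilin_left[OF assms(5)])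
 show ?thesis
  by (rule ctens_lin_eqI[OF tlift_lin[OF assms(1-3) b] lin_add_fun[OF assms(3) tlift_lin[OF assms(1-4)] tlift_lin[OF assms(1-3,5)]] assms(1,3) _ assms(6)])
   (simp add: tlift_ctel[OF assms(1-3)] b assms(4,5))
qed

lemma tlift_zero_fun:
 assumes "vs V" "vs W" "vs X" "t .: (ctens V W)"
 shows "tlift X (\<lambda>a b. \<zero>\<^bsub>X\<^esub>) t = \<zero>\<^bsub>X\<^esub>"
proof -
 have b: "bilin V W X (\<lambda>a b. \<zero>\<^bsub>X\<^esub>)" by (intro bilinI lin_zero_fun assms)
 show ?thesis
  by (rule ctens_lin_eqI[OF tlift_lin[OF assms(1-3) b] lin_zero_fun[OF assms(3)] assms(1,3) _ assms(4)])
   (simp add: tlift_ctel[OF assms(1-3) b])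
qed

context qhs
begin

lemma bc_star:
 assumes U: "vs U" and ph: "bilin A BB U ph" and b: "b \<in> B"
 shows "tlift U ph (bc (st b)) = tlift (conj_vs U) (\<lambda>x y. ph (st x) (st y)) (bc b)"
proof -
 let ?T = "ctens A A" and ?I = "tlift (ctens A A) (ctel A A)"
 have bI: "bilin A BB ?T (ctel A A)" by (rule bilin_A_BB(1)[OF bilin_ctel])
 have incl: "?I \<in> lin_hom AB ?T" by (intro tlift_lin bI) auto
 then have incl': "?I \<in> lin_hom (conj_vs AB) (conj_vs ?T)" by (simp add: lin_conj_both)
 have stB: "st \<in> lin_hom (conj_vs BB) BB"
  using st_lin' B_st by (auto simp: lin_hom_def)
 have st1: "bilin A BB (conj_vs W) (\<lambda>x y. ps (st x) (st y))" if "bilin A BB W ps" for ps :: "'a \<Rightarrow> 'a \<Rightarrow> ('a, 'a) tensor" and W :: "(complex, ('a, 'a) tensor) module"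
  using lin_comp[OF bilin_right[OF that] stB] lin_comp[OF bilin_left[OF that] st_lin'] B_st
  by (intro bilinI, unfold lin_conj_swap) auto
 have st2: "bilin A BB (conj_vs U) (\<lambda>x y. ph (st x) (st y))"
  using lin_comp[OF bilin_right[OF ph] stB] lin_comp[OF bilin_left[OF ph] st_lin'] B_st
  by (intro bilinI, unfold lin_conj_swap) auto
 have st3: "bilin A A (conj_vs ?T) (\<lambda>x y. ctel A A (st x) (st y))"
  by (intro bilinI, unfold lin_conj_swap) (intro lin st_lin'; auto)+
 note b1 = st1[OF bilin_ctel]
 define t where "t = tlift (conj_vs AB) (\<lambda>x y. ctel A BB (st x) (st y)) (bc b)"
 have t: "t .: AB" unfolding t_def using tlift_closed[OF vsA vsBB vs_conj[OF vs_ctens] b1 bc_closed[OF b]] by simp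
 have "bc (st b) = t"
 proof (rule bc_eqI[OF bc_closed[OF B_st[OF b]] t])
  have "?I t = tlift (conj_vs ?T) (\<lambda>x y. ?I (ctel A BB (st x) (st y))) (bc b)"
   unfolding t_def by (rule lin_through_tlift[OF incl' vsA vsBB]) (use b1 bc_closed b in auto)
  also have "... = tlift (conj_vs ?T) (\<lambda>x y. ctel A A (st x) (st y)) (bc b)"
   by (rule tlift_cong[OF vsA vsBB _ bilin_A_BB(1)[OF st3] bc_closed[OF b]]) (insert bI B_st, auto simp: tlift_ctel)
  also have "... = sw (conj_vs ?T) (\<lambda>x y. ctel A A (st x) (st y)) b"
   by (rule bc_sw) (use st3 b in auto)
  also have "... = sw ?T (ctel A A) (st b)" by (rule sw_star[symmetric]) (use b bilin_ctel in auto)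
  also have "... = ?I (bc (st b))" using bc_incl[OF B_st[OF b]] b by (simp add: tlift_ctel_id)
  finally show "?I (bc (st b)) = ?I t" by simp
 qed
 then have "tlift U ph (bc (st b)) = tlift U ph t" by simp
 also have "... = tlift (conj_vs U) (\<lambda>x y. tlift U ph (ctel A BB (st x) (st y))) (bc b)"
  unfolding t_def
 proof (rule lin_through_tlift[OF _ vsA vsBB])
  show "tlift U ph \<in> lin_hom (conj_vs AB) (conj_vs U)" using tlift_lin[OF vsA vsBB U ph] by (simp add: lin_conj_both)
 qed (use b1 bc_closed b U in auto)
 also have "... = tlift (conj_vs U) (\<lambda>x y. ph (st x) (st y)) (bc b)"
  by (rule tlift_cong[OF vsA vsBB _ st2 bc_closed[OF b]]) (insert U ph B_st, auto simp: tlift_ctel)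
 finally show ?thesis .
qed

end

context herm
begin

abbreviation \<rho> where "\<rho> \<equiv> coact Om"
abbreviation fs where "fs \<equiv> fstar Om"
abbreviation AOm where "AOm \<equiv> ctens A Om"

lemmas \<rho>_lin = comodule_lin[OF Om_com]
lemma \<rho>_closed [simp, intro]: "x .: Om ==> \<rho> x .: AOm" by (rule lin_closed[OF \<rho>_lin])

lemmas ocw_closed [intro] = rcw_closed[OF Om_rel]
lemmas ocw_lin_arg [lin] = rcw_lin_arg[OF Om_rel]
lemmas ocw_lin_fun [lin] = rcw_lin_fun[OF Om_rel]
lemmas ocw_cong = rcw_cong[OF Om_rel]
lemmas lin_through_ocw = lin_through_rcw[OF Om_rel]

lemma ocw_mult:
 assumes U: "vs U" and ph: "bilin A Om U ph" and ab: "a .: Om" "b .: Om"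
 shows "tlift U ph (\<rho> (a \<^bold>\<and> b)) = tlift U (\<lambda>x y. tlift U (\<lambda>x' y'. ph (x ** x') (y \<^bold>\<and> y')) (\<rho> b)) (\<rho> a)"
proof -
 let ?T = "tspace A Om {}"
 have tl: "tlift ?T = (tlift AOm :: ('a \<Rightarrow> 'w \<Rightarrow> _) \<Rightarrow> _)"
  by (intro ext) (simp add: tlift_def ctens_def finsum_def)
 note phl = lin_bilin_left[OF ph] lin_bilin_right[OF ph]
 have b2: "bilin A Om AOm (\<lambda>v' w'. ctel A Om (v ** v') (w \<^bold>\<and> w'))" if "v .: A" "w .: Om" for v w
  using that by (intro bilinI lin) auto
 have b1: "bilin A Om AOm (\<lambda>v w. tlift AOm (\<lambda>v' w'. ctel A Om (v ** v') (w \<^bold>\<and> w')) (\<rho> b))"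
  using ab b2 by (intro bilinI lin) auto
 have b3: "bilin A Om U (\<lambda>x' y'. ph (x ** x') (y \<^bold>\<and> y'))" if "x .: A" "y .: Om" for x y
  using that by (intro bilinI lin phl) auto
 have tp: "tlift U ph \<in> lin_hom AOm U" using U ph by (intro tlift_lin) auto
 have "\<rho> (a \<^bold>\<and> b) = \<rho> a \<otimes>\<^bsub>AOm\<^esub> \<rho> b"
  using cc ab by (simp add: covariant_calculus_def ring_hom_def)
 also have "... = tlift AOm (\<lambda>v w. tlift AOm (\<lambda>v' w'. ctel A Om (v ** v') (w \<^bold>\<and> w')) (\<rho> b)) (\<rho> a)"
  by (subst (1) ctens_def) (simp add: tl)
 finally have "tlift U ph (\<rho> (a \<^bold>\<and> b)) = tlift U ph (tlift AOm (\<lambda>v w. tlift AOm (\<lambda>v' w'. ctel A Om (v ** v') (w \<^bold>\<and> w')) (\<rho> b)) (\<rho> a))"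
  by simp
 also have "... = tlift U (\<lambda>v w. tlift U ph (tlift AOm (\<lambda>v' w'. ctel A Om (v ** v') (w \<^bold>\<and> w')) (\<rho> b))) (\<rho> a)"
  by (rule lin_through_ocw[OF tp vs_ctens U b1 ab(1)])
 also have "... = tlift U (\<lambda>x y. tlift U (\<lambda>x' y'. ph (x ** x') (y \<^bold>\<and> y')) (\<rho> b)) (\<rho> a)"
 proof (rule ocw_cong[OF U _ ab(1)])
  show "bilin A Om U (\<lambda>x y. tlift U (\<lambda>x' y'. ph (x ** x') (y \<^bold>\<and> y')) (\<rho> b))"
   using ab b3 U by (intro bilinI lin phl) auto
  fix x y assume xy: "x .: A" "y .: Om"
  have "tlift U ph (tlift AOm (\<lambda>v' w'. ctel A Om (x ** v') (y \<^bold>\<and> w')) (\<rho> b)) = tlift U (\<lambda>x' y'. tlift U ph (ctel A Om (x ** x') (y \<^bold>\<and> y'))) (\<rho> b)"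
   by (rule lin_through_ocw[OF tp vs_ctens U b2[OF xy] ab(2)])
  also have "... = tlift U (\<lambda>x' y'. ph (x ** x') (y \<^bold>\<and> y')) (\<rho> b)"
   by (rule ocw_cong[OF U b3[OF xy] ab(2)]) (insert U ph xy, auto simp: tlift_ctel)
  finally show "tlift U ph (tlift AOm (\<lambda>v' w'. ctel A Om (x ** v') (y \<^bold>\<and> w')) (\<rho> b)) = tlift U (\<lambda>x' y'. ph (x ** x') (y \<^bold>\<and> y')) (\<rho> b)" .
 qed
 finally show ?thesis .
qed

text \<open>The operator on \<open>Om\<close> obtained from the coaction by applying a functional to the first leg.\<close>

definition sl where "sl xi x = slice Om xi (\<rho> x)"

lemma sl_lin: "xi \<in> lin_hom A CC ==> sl xi \<in> lin_hom Om Om"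
 unfolding sl_def[abs_def] by (rule lin_comp[OF slice_lin[OF vsA vsOm] \<rho>_lin])

lemma sl_bg: "xi \<in> lin_hom A CC ==> x \<in> OmOm a b ==> sl xi x \<in> OmOm a b"
 unfolding sl_def slice_def
 by (rule tens_in_tlift[OF vsA vsOm vsOm, of _ "OmOm a b"])
  (insert subob[of a b] bg_carrier bg_submod(4), auto simp: subobject_def intro!: bilin_slice bg_sub)

lemma sl_\<sigma>: assumes xi: "xi \<in> lin_hom A CC" and x: "x .: Om"
 shows "sl xi (\<sigma> \<^bold>\<and> x) = \<sigma> \<^bold>\<and> sl xi x"
proof -
 note b = bilin_slice[OF vsOm xi]
 have b2: "bilin A Om Om (\<lambda>a w. tlift Om (\<lambda>a' w'. xi (a ** a') \<odot>\<^bsub>Om\<^esub> (w \<^bold>\<and> w')) (\<rho> x))"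
  using x by (intro bilinI lin lin_comp[OF xi]) auto
 have "sl xi (\<sigma> \<^bold>\<and> x) = tlift Om (\<lambda>a w. tlift Om (\<lambda>a' w'. xi (a ** a') \<odot>\<^bsub>Om\<^esub> (w \<^bold>\<and> w')) (\<rho> x)) (\<rho> \<sigma>)"
  unfolding sl_def slice_def by (rule ocw_mult[OF vsOm b]) (use x in auto)
 also have "... = tlift Om (\<lambda>a' w'. xi (\<one> ** a') \<odot>\<^bsub>Om\<^esub> (\<sigma> \<^bold>\<and> w')) (\<rho> x)"
  unfolding \<sigma>_coinv by (rule tlift_ctel[OF vsA vsOm vsOm b2]) auto
 also have "... = tlift Om (\<lambda>a' w'. \<sigma> \<^bold>\<and> (xi a' \<odot>\<^bsub>Om\<^esub> w')) (\<rho> x)"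
  by (rule ocw_cong[OF vsOm _ x])
   (auto simp: lin_smult[OF bilin_right[OF Om_mult_bilin]] intro!: bilin_comp[OF _ b] lin)
 also have "... = \<sigma> \<^bold>\<and> sl xi x"
  unfolding sl_def slice_def by (rule lin_through_ocw[symmetric]) (insert b x, auto intro!: lin)
 finally show ?thesis .
qed

text \<open>Tensors are separated by slices, so a map is colinear as soon as it commutes with all slices of the coaction.\<close>

lemma colinear_from_slices:
 assumes T: "T \<in> lin_hom Om Om" and sl: "\<And>xi x. xi \<in> lin_hom A CC ==> x .: Om ==> T (sl xi x) = sl xi (T x)"
  and U: "vs U" and ph: "bilin A Om U ph" and x: "x .: Om"
 shows "tlift U ph (\<rho> (T x)) = tlift U (\<lambda>a w. ph a (T w)) (\<rho> x)"
proof -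
 have b: "bilin A Om AOm (\<lambda>a w. ctel A Om a (T w))" by (intro bilinI lin T) (auto intro: lin_closed[OF T])
 define t where "t = tlift AOm (\<lambda>a w. ctel A Om a (T w)) (\<rho> x)"
 have t: "t .: AOm" unfolding t_def using b x by auto
 have "\<rho> (T x) = t"
 proof (rule slices_eqI[OF vsA vsOm _ t])
  show "\<rho> (T x) .: AOm" using lin_closed[OF T x] by auto
  fix xi assume xi: "xi \<in> lin_hom A CC"
  have "slice Om xi t = tlift Om (\<lambda>a w. slice Om xi (ctel A Om a (T w))) (\<rho> x)"
   unfolding t_def by (rule lin_through_ocw[OF slice_lin[OF vsA vsOm xi]]) (use b x in auto)
  also have "... = tlift Om (\<lambda>a w. T (xi a \<odot>\<^bsub>Om\<^esub> w)) (\<rho> x)"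
   by (rule ocw_cong[OF vsOm bilin_comp[OF T bilin_slice[OF vsOm xi]] x])
    (insert xi, auto simp: slice_ctel lin_smult[OF T] lin_closed[OF T])
  also have "... = T (sl xi x)"
   unfolding sl_def slice_def by (rule lin_through_ocw[OF T, symmetric]) (use bilin_slice[OF vsOm xi] x in auto)
  finally show "slice Om xi (\<rho> (T x)) = slice Om xi t" using sl[OF xi x] by (simp add: sl_def)
 qed
 then have "tlift U ph (\<rho> (T x)) = tlift U ph t" by simp
 also have "... = tlift U (\<lambda>a w. tlift U ph (ctel A Om a (T w))) (\<rho> x)"
  unfolding t_def by (rule lin_through_ocw) (insert U ph b x, auto intro!: tlift_lin)
 also have "... = tlift U (\<lambda>a w. ph a (T w)) (\<rho> x)"
 proof (rule ocw_cong[OF U _ x])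
  show "bilin A Om U (\<lambda>a w. ph a (T w))"
   by (intro bilinI lin_bilin_right[OF ph] T) (auto intro!: bilin_left[OF ph] lin_closed[OF T])
 qed (insert U ph lin_closed[OF T], auto simp: tlift_ctel)
 finally show ?thesis .
qed

lemma ocw_H: "vs U ==> bilin A Om U ph ==> x .: Om ==> tlift U ph (\<rho> (H x)) = tlift U (\<lambda>a w. ph a (H w)) (\<rho> x)"
 by (rule colinear_from_slices[OF H_lin0]) (auto intro!: H_commute sl_lin sl_bg sl_\<sigma>)

lemma ocw_comp: "vs U ==> bilin A Om U ph ==> x .: Om ==> tlift U ph (\<rho> (component Om k x)) = tlift U (\<lambda>a w. ph a (component Om k w)) (\<rho> x)"
 by (rule colinear_from_slices[OF comp_lin]) (auto intro!: comp_commute sl_lin sl_bg)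

lemma ocw_emb:
 assumes U: "vs U" and ph: "bilin A Om U ph" and b: "b \<in> B"
 shows "tlift U ph (\<rho> (emb Om b)) = tlift U (\<lambda>a b'. ph a (emb Om b')) (bc b)"
proof -
 have bi: "bilin A BB AOm (\<lambda>a b'. ctel A Om a (emb Om b'))" by (intro bilinI lin emb_lin0) auto
 have "\<rho> (emb Om b) = tlift AOm (\<lambda>a b'. ctel A Om a (emb Om b')) (bc b)"
  using cc b by (simp add: covariant_calculus_def id_tens_def)
 then have "tlift U ph (\<rho> (emb Om b)) = tlift U (\<lambda>a b'. tlift U ph (ctel A Om a (emb Om b'))) (bc b)"
  using lin_through_bcw[OF tlift_lin[OF vsA vsOm U ph] vs_ctens U bi b] by simp
 also have "... = tlift U (\<lambda>a b'. ph a (emb Om b')) (bc b)"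
 proof (rule bcw_cong[OF U _ b])
  show "bilin A BB U (\<lambda>a b'. ph a (emb Om b'))"
   by (intro bilinI lin_bilin_right[OF ph] emb_lin0) (auto intro!: bilin_left[OF ph])
 qed (insert U ph, auto simp: tlift_ctel)
 finally show ?thesis .
qed

lemma dif_lin: "dif Om \<in> lin_hom Om Om"
 using sc by (simp add: star_calculus_def differential_calculus_def)

lemma ocw_dif:
 assumes U: "vs U" and ph: "bilin A Om U ph" and x: "x .: Om"
 shows "tlift U ph (\<rho> (dif Om x)) = tlift U (\<lambda>a w. ph a (dif Om w)) (\<rho> x)"
proof -
 have b: "bilin A Om AOm (\<lambda>a w. ctel A Om a (dif Om w))" by (intro bilinI lin dif_lin) (auto intro: lin_closed[OF dif_lin])
 have "\<rho> (dif Om x) = tlift AOm (\<lambda>a w. ctel A Om a (dif Om w)) (\<rho> x)"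
  using cc x by (simp add: covariant_calculus_def comodule_map_def id_tens_def)
 then have "tlift U ph (\<rho> (dif Om x)) = tlift U (\<lambda>a w. tlift U ph (ctel A Om a (dif Om w))) (\<rho> x)"
  using lin_through_ocw[OF tlift_lin[OF vsA vsOm U ph] vs_ctens U b x] by simp
 also have "... = tlift U (\<lambda>a w. ph a (dif Om w)) (\<rho> x)"
 proof (rule ocw_cong[OF U _ x])
  show "bilin A Om U (\<lambda>a w. ph a (dif Om w))"
   by (intro bilinI lin_bilin_right[OF ph] dif_lin) (auto intro!: bilin_left[OF ph] lin_closed[OF dif_lin])
 qed (insert U ph lin_closed[OF dif_lin], auto simp: tlift_ctel)
 finally show ?thesis .
qed

end

section \<open>Covariance of the involution and of the metric\<close>

context herm
begin

lemma fs_lin0: "fs \<in> lin_hom Om (conj_vs Om)"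
 and fs_emb: "b \<in> B ==> fs (emb Om b) = emb Om (st b)"
 and fs_dif: "x .: Om ==> dif Om (fs x) = fs (dif Om x)"
 and fs_mult: "x \<in> grade Om k ==> y \<in> grade Om l ==> fs (x \<^bold>\<and> y) = (-1) ^ (k * l) \<odot>\<^bsub>Om\<^esub> (fs y \<^bold>\<and> fs x)"
 and dif_gr: "x \<in> grade Om k ==> dif Om x \<in> grade Om (k + 1)"
 using sc by (auto simp: star_calculus_def differential_calculus_def)

lemma fs_lin': "fs \<in> lin_hom (conj_vs Om) Om" using fs_lin0 by (simp add: lin_conj_swap)
lemma fs_closed [simp, intro]: "x .: Om ==> fs x .: Om" using lin_closed[OF fs_lin0] by simp
lemma comp_closed [simp, intro]: "x .: Om ==> component Om k x .: Om" by (rule lin_closed[OF comp_lin])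
lemma dif_closed [simp, intro]: "x .: Om ==> dif Om x .: Om" by (rule lin_closed[OF dif_lin])

lemma fs_comp: "x .: Om ==> component Om k (fs x) = fs (component Om k x)"
proof (rule bg_span[where P = "\<lambda>x. component Om k (fs x) = fs (component Om k x)"])
 have "component Om k \<in> lin_hom (conj_vs Om) (conj_vs Om)" using comp_lin by (simp add: lin_conj_both)
 from lin_comp[OF this fs_lin0] lin_comp[OF fs_lin0 comp_lin]
 show "additive_on Om (\<lambda>x. component Om k (fs x) = fs (component Om k x))"
  by (rule additive_on_eq) auto
 fix a b x assume x: "x \<in> OmOm a b"
 then have "fs x \<in> OmOm b a" using bg_star[of a b] by blast
 then have "fs x \<in> grade Om (a + b)" using bg_gr[of "fs x" b a] by (simp add: add.commute)
 then show "component Om k (fs x) = fs (component Om k x)"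
  using comp_on[OF bg_gr[OF x]] comp_on lin_map_zero[OF fs_lin0] by auto
qed

lemma fs_gr: "x \<in> grade Om k ==> fs x \<in> grade Om k"
 using fs_comp[of x k] comp_on[of x k k] comp_gr[of "fs x" k] gr_carrier[of x k] by simp

lemma bilin_star: 
 assumes ph: "bilin A Om U ph"
 shows "bilin A Om (conj_vs U) (\<lambda>x y. ph (st x) (fs y))"
 using lin_comp[OF bilin_right[OF ph] fs_lin'] lin_comp[OF bilin_left[OF ph] st_lin']
 by (intro bilinI, unfold lin_conj_swap) auto

text \<open>The covariance of the involution at one form.  It follows from the covariance of the
differential, since the forms with this property include \<open>b\<close> and \<open>d b\<close> for \<open>b\<close> in \<open>B\<close>
and are closed under products of homogeneous elements.\<close>

definition good where "good x \<longleftrightarrow> \<rho> (fs x) = tlift (conj_vs AOm) (\<lambda>a w. ctel A Om (st a) (fs w)) (\<rho> x)"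

lemma good_cw:
 assumes g: "good x" and x: "x .: Om" and U: "vs U" and ph: "bilin A Om U ph"
 shows "tlift U ph (\<rho> (fs x)) = tlift (conj_vs U) (\<lambda>a w. ph (st a) (fs w)) (\<rho> x)"
proof -
 have "tlift U ph (\<rho> (fs x)) = tlift U ph (tlift (conj_vs AOm) (\<lambda>a w. ctel A Om (st a) (fs w)) (\<rho> x))"
  using g by (simp add: good_def)
 also have "... = tlift (conj_vs U) (\<lambda>a w. tlift U ph (ctel A Om (st a) (fs w))) (\<rho> x)"
 proof (rule lin_through_ocw)
  show "tlift U ph \<in> lin_hom (conj_vs AOm) (conj_vs U)" using tlift_lin[OF vsA vsOm U ph] by (simp add: lin_conj_both)
 qed (use bilin_star[OF bilin_ctel] U x in auto)
 also have "... = tlift (conj_vs U) (\<lambda>a w. ph (st a) (fs w)) (\<rho> x)"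
  by (rule ocw_cong[OF vs_conj[OF U] bilin_star[OF ph] x]) (insert U ph, auto simp: tlift_ctel)
 finally show ?thesis .
qed

text \<open>The coaction preserves the degree, so second legs of a form of degree \<open>k\<close> may be taken of degree \<open>k\<close>.\<close>

lemma ocw_gr_cong:
 assumes U: "vs U" and ph: "bilin A Om U ph" and ps: "bilin A Om U ps" and x: "x \<in> grade Om k"
  and eq: "\<And>a w. a .: A ==> w \<in> grade Om k ==> ph a w = ps a w"
 shows "tlift U ph (\<rho> x) = tlift U ps (\<rho> x)"
proof -
 have xc: "x .: Om" and cx: "component Om k x = x" using x gr_carrier comp_on[OF x, of k] by auto
 have b: "bilin A Om U (\<lambda>a w. ps a (component Om k w))"
  by (intro bilinI lin_bilin_right[OF ps] comp_lin) (auto intro!: bilin_left[OF ps])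
 have "tlift U (\<lambda>a w. ph a (component Om k w)) (\<rho> x) = tlift U (\<lambda>a w. ps a (component Om k w)) (\<rho> x)"
  by (rule ocw_cong[OF U b xc]) (use eq comp_gr in auto)
 then show ?thesis using ocw_comp[OF U ph xc, of k] ocw_comp[OF U ps xc, of k] cx by simp
qed

lemma ocw_bilin:
 assumes U: "vs U" and 1: "\<And>a w. a .: A ==> w .: Om ==> bilin A Om U (\<Psi> a w)"
  and 2: "\<And>a w. a .: A ==> w .: Om ==> bilin A Om U (\<lambda>x y. \<Psi> x y a w)" and y: "y .: Om"
 shows "bilin A Om U (\<lambda>a w. tlift U (\<Psi> a w) (\<rho> y))"
 by (intro bilinI ocw_lin_fun U vsA vsOm y 1 bilin_right[OF 2] bilin_left[OF 2])

lemma good_mult: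
 assumes x: "x \<in> grade Om i" "good x" and y: "y \<in> grade Om j" "good y"
 shows "good (x \<^bold>\<and> y)"
proof -
 let ?U = "conj_vs AOm" and ?c = "ctel A Om"
 define s :: complex where "s = (-1) ^ (i * j)"
 have s: "cnj s = s" by (simp add: s_def)
 have xc: "x .: Om" and yc: "y .: Om" using x y gr_carrier by auto
 have U: "vs ?U" by simp
 \<comment> \<open>the summand of the coaction of \<open>fs y\<close> times \<open>fs x\<close> with all Sweedler legs fixed\<close>
 define P where "P a' w' a w = ?c (st a ** st a') (fs w \<^bold>\<and> fs w')" for a' w' a w
 have P1: "bilin A Om ?U (P a' w')" if "a' .: A" "w' .: Om" for a' w'
  unfolding P_def using that by (intro bilinI; unfold lin_conj_swap) (auto intro!: lin st_lin' fs_lin')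
 have P2: "bilin A Om ?U (\<lambda>a' w'. P a' w' a w)" if "a .: A" "w .: Om" for a w
  unfolding P_def using that by (intro bilinI; unfold lin_conj_swap) (auto intro!: lin st_lin' fs_lin')
 have K1: "bilin A Om AOm (\<lambda>a' w'. ?c (a ** a') (w \<^bold>\<and> w'))" if "a .: A" "w .: Om" for a w
  using that by (intro bilinI lin) auto
 have K2: "bilin A Om AOm (\<lambda>a w. ?c (a ** a') (w \<^bold>\<and> w'))" if "a' .: A" "w' .: Om" for a' w'
  using that by (intro bilinI lin) auto
 have K: "bilin A Om AOm (\<lambda>a w. tlift AOm (\<lambda>a' w'. ?c (a ** a') (w \<^bold>\<and> w')) (\<rho> (fs x)))"
  by (rule ocw_bilin[OF vs_ctens K1 K2]) (use xc in auto)
 have L: "\<rho> (fs y \<^bold>\<and> fs x) = tlift ?U (\<lambda>a' w'. tlift ?U (P a' w') (\<rho> y)) (\<rho> x)"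
 proof -
  have "\<rho> (fs y \<^bold>\<and> fs x) = tlift AOm ?c (\<rho> (fs y \<^bold>\<and> fs x))"
   using xc yc by (intro tlift_ctel_id[symmetric]) auto
  also have "... = tlift AOm (\<lambda>a w. tlift AOm (\<lambda>a' w'. ?c (a ** a') (w \<^bold>\<and> w')) (\<rho> (fs x))) (\<rho> (fs y))"
   by (rule ocw_mult[OF vs_ctens bilin_ctel]) (use xc yc in auto)
  also have "... = tlift ?U (\<lambda>a w. tlift AOm (\<lambda>a' w'. ?c (st a ** a') (fs w \<^bold>\<and> w')) (\<rho> (fs x))) (\<rho> y)"
   by (rule good_cw[OF y(2) yc vs_ctens K])
  also have "... = tlift ?U (\<lambda>a w. tlift ?U (\<lambda>a' w'. P a' w' a w) (\<rho> x)) (\<rho> y)"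
  proof (rule ocw_cong[OF U ocw_bilin[OF U P2 P1 xc] yc])
   fix a w assume "a .: A" "w .: Om"
   then show "tlift AOm (\<lambda>a' w'. ?c (st a ** a') (fs w \<^bold>\<and> w')) (\<rho> (fs x)) = tlift ?U (\<lambda>a' w'. P a' w' a w) (\<rho> x)"
    unfolding P_def by (intro good_cw[OF x(2) xc vs_ctens] K1) auto
  qed
  also have "... = tlift ?U (\<lambda>a' w'. tlift ?U (P a' w') (\<rho> y)) (\<rho> x)"
   by (rule tlift_swap[OF vsA vsOm vsA vsOm U \<rho>_closed[OF yc] \<rho>_closed[OF xc] P1 P2])
  finally show ?thesis .
 qed
 \<comment> \<open>the corresponding summand for the image of the coaction of the product under the involution\<close>
 define M where "M a' w' a w = ?c (st (a' ** a)) (fs (w' \<^bold>\<and> w))" for a' w' a w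
 have cb: "bilin A Om ?U (\<lambda>a w. ?c (st a) (fs w))" by (rule bilin_star[OF bilin_ctel])
 have M1: "bilin A Om ?U (M a' w')" if "a' .: A" "w' .: Om" for a' w'
  unfolding M_def
  by (intro bilinI lin_bilin_right[OF cb] lin_bilin_left[OF cb]) (insert that, auto intro!: lin lin_id)
 have M2: "bilin A Om ?U (\<lambda>a' w'. M a' w' a w)" if "a .: A" "w .: Om" for a w
  unfolding M_def
  by (intro bilinI lin_bilin_right[OF cb] lin_bilin_left[OF cb]) (insert that, auto intro!: lin lin_id)
 have sl: "(\<lambda>t. s \<odot>\<^bsub>?U\<^esub> t) \<in> lin_hom ?U ?U" by (rule lin_smult_fun[OF U lin_id])
 have sP1: "bilin A Om ?U (\<lambda>a w. s \<odot>\<^bsub>?U\<^esub> P a' w' a w)" if "a' .: A" "w' .: Om" for a' w'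
  by (rule bilin_comp[OF sl P1[OF that]])
 have sP: "bilin A Om ?U (\<lambda>a' w'. s \<odot>\<^bsub>?U\<^esub> tlift ?U (P a' w') (\<rho> y))"
  by (rule bilin_comp[OF sl ocw_bilin[OF U P1 P2 yc]])
 have "tlift ?U (\<lambda>a w. ?c (st a) (fs w)) (\<rho> (x \<^bold>\<and> y)) = tlift ?U (\<lambda>a' w'. tlift ?U (M a' w') (\<rho> y)) (\<rho> x)"
  unfolding M_def by (rule ocw_mult[OF U cb xc yc])
 also have "... = tlift ?U (\<lambda>a' w'. s \<odot>\<^bsub>?U\<^esub> tlift ?U (P a' w') (\<rho> y)) (\<rho> x)"
 proof (rule ocw_gr_cong[OF U ocw_bilin[OF U M1 M2 yc] sP x(1)])
  fix a' w' assume aw: "a' .: A" "w' \<in> grade Om i"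
  have w'c: "w' .: Om" using aw gr_carrier by auto
  have "tlift ?U (M a' w') (\<rho> y) = tlift ?U (\<lambda>a w. s \<odot>\<^bsub>?U\<^esub> P a' w' a w) (\<rho> y)"
  proof (rule ocw_gr_cong[OF U M1[OF aw(1) w'c] sP1[OF aw(1) w'c] y(1)])
   fix a w assume a: "a .: A" "w \<in> grade Om j"
   have wc: "w .: Om" using a gr_carrier by auto
   show "M a' w' a w = s \<odot>\<^bsub>?U\<^esub> P a' w' a w"
    using fs_mult[OF aw(2) a(2)] a aw wc w'c s lin_smult[OF bilin_right[OF bilin_ctel, of _ A Om], of "st a ** st a'" "fs w \<^bold>\<and> fs w'" s]
    by (simp add: M_def P_def st_mult s_def[symmetric])
  qed
  also have "... = s \<odot>\<^bsub>?U\<^esub> tlift ?U (P a' w') (\<rho> y)"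
   by (rule lin_through_ocw[OF sl U U P1[OF aw(1) w'c] yc, symmetric])
  finally show "tlift ?U (M a' w') (\<rho> y) = s \<odot>\<^bsub>?U\<^esub> tlift ?U (P a' w') (\<rho> y)" .
 qed
 also have "... = s \<odot>\<^bsub>?U\<^esub> tlift ?U (\<lambda>a' w'. tlift ?U (P a' w') (\<rho> y)) (\<rho> x)"
  by (rule lin_through_ocw[OF sl U U ocw_bilin[OF U P1 P2 yc] xc, symmetric])
 also have "... = s \<odot>\<^bsub>AOm\<^esub> \<rho> (fs y \<^bold>\<and> fs x)" using L s by simp
 also have "... = \<rho> (fs (x \<^bold>\<and> y))"
  using fs_mult[OF x(1) y(1)] lin_smult[OF \<rho>_lin, of "fs y \<^bold>\<and> fs x" s] xc yc by (simp add: s_def)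
 finally show ?thesis by (simp add: good_def)
qed

lemma good_sub: "submodule {x \<in> carrier Om. good x} CC Om"
proof -
 let ?U = "conj_vs AOm"
 have 1: "(\<lambda>x. \<rho> (fs x)) \<in> lin_hom Om ?U"
  by (rule lin_comp[OF _ fs_lin0]) (insert \<rho>_lin, simp add: lin_conj_both)
 have 2: "(\<lambda>x. tlift ?U (\<lambda>a w. ctel A Om (st a) (fs w)) (\<rho> x)) \<in> lin_hom Om ?U"
  by (rule lin_tlift_arg[OF vsA vsOm vs_conj[OF vs_ctens] bilin_star[OF bilin_ctel] \<rho>_lin])
 show ?thesis
  unfolding submodule_iff[OF vsOm] good_def
  using lin_map_zero[OF 1] lin_map_zero[OF 2] lin_add[OF 1] lin_add[OF 2] lin_smult[OF 1] lin_smult[OF 2] by auto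
qed

lemmas good_subD = submoduleD[OF vsOm good_sub, simplified]

lemma good_emb: "b \<in> B ==> good (emb Om b)"
proof -
 assume b: "b \<in> B"
 let ?U = "conj_vs AOm"
 have e: "emb Om \<in> lin_hom BB Om" by (rule emb_lin0)
 have bi: "bilin A BB AOm (\<lambda>a b'. ctel A Om a (emb Om b'))" by (intro bilinI lin e) auto
 have cb: "bilin A Om ?U (\<lambda>a w. ctel A Om (st a) (fs w))" by (rule bilin_star[OF bilin_ctel])
 have cb': "bilin A BB ?U (\<lambda>a b'. ctel A Om (st a) (fs (emb Om b')))"
  by (intro bilinI lin_bilin_right[OF cb] e bilin_left[OF cb]) auto
 have "\<rho> (fs (emb Om b)) = tlift AOm (ctel A Om) (\<rho> (emb Om (st b)))"
  using b fs_emb by (simp add: tlift_ctel_id B_st)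
 also have "... = tlift AOm (\<lambda>a b'. ctel A Om a (emb Om b')) (bc (st b))"
  by (rule ocw_emb[OF vs_ctens bilin_ctel B_st[OF b]])
 also have "... = tlift ?U (\<lambda>a b'. ctel A Om (st a) (emb Om (st b'))) (bc b)"
  by (rule bc_star[OF vs_ctens bi b])
 also have "... = tlift ?U (\<lambda>a b'. ctel A Om (st a) (fs (emb Om b'))) (bc b)"
  by (rule bcw_cong[OF _ cb' b]) (auto simp: fs_emb)
 also have "... = tlift ?U (\<lambda>a w. ctel A Om (st a) (fs w)) (\<rho> (emb Om b))"
  by (rule ocw_emb[OF _ cb b, symmetric]) simp
 finally show ?thesis by (simp add: good_def)
qed

lemma good_dif: "x .: Om ==> good x ==> good (dif Om x)"
proof -
 assume x: "x .: Om" and g: "good x"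
 let ?U = "conj_vs AOm"
 have bi: "bilin A Om AOm (\<lambda>a w. ctel A Om a (dif Om w))" by (intro bilinI lin dif_lin) auto
 have cb: "bilin A Om ?U (\<lambda>a w. ctel A Om (st a) (fs w))" by (rule bilin_star[OF bilin_ctel])
 have cb': "bilin A Om ?U (\<lambda>a w. ctel A Om (st a) (fs (dif Om w)))"
  by (intro bilinI lin_bilin_right[OF cb] dif_lin bilin_left[OF cb]) auto
 have "\<rho> (fs (dif Om x)) = tlift AOm (ctel A Om) (\<rho> (dif Om (fs x)))"
  using x fs_dif by (simp add: tlift_ctel_id)
 also have "... = tlift AOm (\<lambda>a w. ctel A Om a (dif Om w)) (\<rho> (fs x))"
  by (rule ocw_dif[OF vs_ctens bilin_ctel fs_closed[OF x]])
 also have "... = tlift ?U (\<lambda>a w. ctel A Om (st a) (dif Om (fs w))) (\<rho> x)"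
  by (rule good_cw[OF g x vs_ctens bi])
 also have "... = tlift ?U (\<lambda>a w. ctel A Om (st a) (fs (dif Om w))) (\<rho> x)"
  by (rule ocw_cong[OF _ cb' x]) (auto simp: fs_dif)
 also have "... = tlift ?U (\<lambda>a w. ctel A Om (st a) (fs w)) (\<rho> (dif Om x))"
  by (rule ocw_dif[OF _ cb x, symmetric]) simp
 finally show ?thesis by (simp add: good_def)
qed

lemma comp_sum: "x .: Om ==> x = finsum Om (\<lambda>k. component Om k x) {..2 * n}"
proof -
 assume x: "x .: Om"
 have "component Om k x = \<zero>\<^bsub>Om\<^esub>" if "k > 2 * n" for k using gr_zero[OF that comp_gr[OF x]] .
 then have "{k \<in> UNIV. dpr Om UNIV (grade Om) k x \<noteq> \<zero>\<^bsub>Om\<^esub>} \<subseteq> {..2 * n}"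
  by (auto simp: comp_dpr) (meson not_le)
 from dpr_sum[OF vsOm gr_ds x _ _ this] show ?thesis by (simp add: comp_dpr)
qed

text \<open>The sign rule for the involution of a product only concerns homogeneous forms, hence the passage
to components.\<close>

definition GX where "GX = {x \<in> carrier Om. \<forall>k. good (component Om k x)}"

lemma GX_sub: "submodule GX CC Om"
 unfolding submodule_iff[OF vsOm] GX_def
 using good_subD(2-4) lin_map_zero[OF comp_lin vsOm vsOm] by (auto simp: lin_add[OF comp_lin] lin_smult[OF comp_lin])

lemmas GX_subD = submoduleD[OF vsOm GX_sub]

lemma GX_homogeneous: "x \<in> grade Om k ==> good x ==> x \<in> GX"
 using good_subD(2) comp_on gr_carrier by (auto simp: GX_def)

lemma GX_finsum: "finite I ==> (\<And>i. i \<in> I ==> f i \<in> GX) ==> finsum Om f I \<in> GX"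
 by (rule finsum_closure[where P = "\<lambda>x. x \<in> GX", OF vsOm]) (use GX_subD in auto)

lemma GX_mult: assumes x: "x \<in> GX" and y: "y \<in> GX" shows "x \<^bold>\<and> y \<in> GX"
proof -
 let ?x = "\<lambda>i. component Om i x" and ?y = "\<lambda>j. component Om j y"
 have c: "x .: Om" "y .: Om" using x y by (auto simp: GX_def)
 have "?x i \<^bold>\<and> ?y j \<in> GX" for i j
  by (rule GX_homogeneous[OF gr_mult[OF comp_gr comp_gr] good_mult[OF comp_gr _ comp_gr]]) (insert x y c, auto simp: GX_def)
 then have 1: "finsum Om (\<lambda>j. ?x i \<^bold>\<and> ?y j) {..2 * n} \<in> GX" for i by (intro GX_finsum) auto
 have "?x i \<^bold>\<and> y = finsum Om (\<lambda>j. ?x i \<^bold>\<and> ?y j) {..2 * n}" for i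
  by (subst comp_sum[OF c(2)]) (insert c, auto intro!: O.finsum_rdistr)
 with 1 have "?x i \<^bold>\<and> y \<in> GX" for i by simp
 then have 2: "finsum Om (\<lambda>i. ?x i \<^bold>\<and> y) {..2 * n} \<in> GX" by (intro GX_finsum) auto
 have "x \<^bold>\<and> y = finsum Om (\<lambda>i. ?x i \<^bold>\<and> y) {..2 * n}"
  by (subst comp_sum[OF c(1)]) (insert c, auto intro!: O.finsum_ldistr)
 with 2 show ?thesis by simp
qed

lemma star_covariant: "x .: Om ==> good x"
proof -
 assume x: "x .: Om"
 have gen: "\<And>X. subalg Om X ==> emb Om ` B \<subseteq> X ==> dif Om ` emb Om ` B \<subseteq> X ==> X = carrier Om"
  using sc by (auto simp: star_calculus_def differential_calculus_def)
 have e: "emb Om b \<in> GX" if "b \<in> B" for b by (rule GX_homogeneous[OF emb_gr[OF that] good_emb[OF that]])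
 have d: "dif Om (emb Om b) \<in> GX" if "b \<in> B" for b
  by (rule GX_homogeneous[OF dif_gr[OF emb_gr[OF that]] good_dif[OF emb_closed[OF that] good_emb[OF that]]])
 have "\<one>\<^bsub>Om\<^esub> \<in> GX" using e[OF B_one] emb_one by simp
 then have "GX = carrier Om" using GX_sub GX_mult e d by (intro gen) (auto simp: subalg_def)
 then have g: "good (component Om k x)" for k using x by (auto simp: GX_def)
 have "finsum Om (\<lambda>k. component Om k x) {..2 * n} \<in> {x \<in> carrier Om. good x}"
  by (rule finsum_closure[where P = "\<lambda>x. x \<in> {x \<in> carrier Om. good x}", OF vsOm]) (use good_subD g x in auto)
 then show ?thesis using comp_sum[OF x] by simp
qed

lemmas ocw_star = good_cw[OF star_covariant]

lemma emb_bg: "b \<in> B ==> emb Om b \<in> OmOm 0 0"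
proof (rule ds_span[where P = "\<lambda>x. x \<in> OmOm 0 0", OF vsOm bg_ds[where k = 0]])
 show "additive_on Om (\<lambda>x. x \<in> OmOm 0 0)" using submoduleD(2,3)[OF vsOm bg_sub[of 0 0]] by (auto simp: additive_on_def)
qed (auto simp: emb_gr)

text \<open>The component of degree zero, read as an element of \<open>B\<close>; unlike the inverse of \<open>emb\<close> it is linear
on all of \<open>Om\<close>.\<close>

definition ie where "ie x = the_inv_into B (emb Om) (component Om 0 x)"

lemma ie_grade: "x .: Om ==> ie x \<in> B" "x .: Om ==> emb Om (ie x) = component Om 0 x"
proof -
 assume "x .: Om"
 then have c: "component Om 0 x \<in> emb Om ` B" using comp_gr[of x 0] emb_bij by (simp add: bij_betw_def)
 have i: "inj_on (emb Om) B" using emb_bij by (simp add: bij_betw_def)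
 show "ie x \<in> B" "emb Om (ie x) = component Om 0 x"
  unfolding ie_def using the_inv_into_into[OF i c subset_refl] f_the_inv_into_f[OF i c] by auto
qed

lemma emb_eqD: "a \<in> B ==> b \<in> B ==> emb Om a = emb Om b ==> a = b"
 using emb_bij by (auto simp: bij_betw_def inj_on_def)

lemma ie_emb: "b \<in> B ==> ie (emb Om b) = b"
 by (rule emb_eqD) (use ie_grade[of "emb Om b"] comp_on[OF emb_gr, of b 0] in auto)

lemma ie_comp: "x .: Om ==> ie (component Om 0 x) = ie x"
 using comp_on[OF comp_gr, of x 0 0] by (simp add: ie_def)

lemma ie_lin0: "ie \<in> lin_hom Om BB"
proof (rule lin_homI)
 fix x y c assume x: "x .: Om"
 show "ie x .: BB" using ie_grade(1)[OF x] by simp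
 show "ie (c \<odot>\<^bsub>Om\<^esub> x) = c \<odot>\<^bsub>BB\<^esub> ie x"
  by (rule emb_eqD) (use x ie_grade[of x] ie_grade[of "c \<odot>\<^bsub>Om\<^esub> x"] lin_smult[OF emb_lin0, of "ie x" c] lin_smult[OF comp_lin x] in auto)
 assume y: "y .: Om"
 show "ie (x \<oplus>\<^bsub>Om\<^esub> y) = ie x \<oplus>\<^bsub>BB\<^esub> ie y"
  by (rule emb_eqD) (use x y ie_grade[of x] ie_grade[of y] ie_grade[of "x \<oplus>\<^bsub>Om\<^esub> y"] lin_add[OF emb_lin0, of "ie x" "ie y"] lin_add[OF comp_lin x y] in auto)
qed

lemmas ie_lin = lin_comp[OF ie_lin0]
lemmas ie_closed [simp, intro] = ie_grade(1)

lemma ie_right: assumes x: "x .: Om" and b: "b \<in> B" shows "ie (x \<^bold>\<and> emb Om b) = ie x ** b"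
proof (rule emb_eqD)
 have "component Om 0 (x \<^bold>\<and> emb Om b) = component Om 0 x \<^bold>\<and> emb Om b"
  by (rule comp_commute[where \<Xi> = "\<lambda>x. x \<^bold>\<and> emb Om b"]) (insert x b bg_mult[OF _ emb_bg[OF b]], auto intro!: lin)
 then show "emb Om (ie (x \<^bold>\<and> emb Om b)) = emb Om (ie x ** b)" using x b by (simp add: ie_grade emb_mult)
qed (use x b in auto)

lemma ie_left: assumes x: "x .: Om" and b: "b \<in> B" shows "ie (emb Om b \<^bold>\<and> x) = b ** ie x"
proof (rule emb_eqD)
 have "component Om 0 (emb Om b \<^bold>\<and> x) = emb Om b \<^bold>\<and> component Om 0 x"
  by (rule comp_commute[where \<Xi> = "\<lambda>x. emb Om b \<^bold>\<and> x"]) (insert x b bg_mult[OF emb_bg[OF b]], auto intro!: lin)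
 then show "emb Om (ie (emb Om b \<^bold>\<and> x)) = emb Om (b ** ie x)" using x b by (simp add: ie_grade emb_mult)
qed (use x b in auto)

lemma H_right: assumes x: "x .: Om" and b: "b \<in> B" shows "H (x \<^bold>\<and> emb Om b) = H x \<^bold>\<and> emb Om b"
 by (rule H_commute[where \<Xi> = "\<lambda>x. x \<^bold>\<and> emb Om b"])
  (insert x b bg_mult[OF _ emb_bg[OF b]], auto intro!: lin simp: O.m_assoc)

lemma H_left: assumes x: "x .: Om" and b: "b \<in> B" shows "H (emb Om b \<^bold>\<and> x) = emb Om b \<^bold>\<and> H x"
proof (rule H_commute[where \<Xi> = "\<lambda>x. emb Om b \<^bold>\<and> x"])
 fix x assume x: "x .: Om"
 have "emb Om b \<^bold>\<and> (\<sigma> \<^bold>\<and> x) = (emb Om b \<^bold>\<and> \<sigma>) \<^bold>\<and> x" using x b by (simp add: O.m_assoc)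
 also have "... = (\<sigma> \<^bold>\<and> emb Om b) \<^bold>\<and> x" using \<sigma>_central[OF emb_closed[OF b]] by simp
 finally show "emb Om b \<^bold>\<and> (\<sigma> \<^bold>\<and> x) = \<sigma> \<^bold>\<and> (emb Om b \<^bold>\<and> x)" using x b by (simp add: O.m_assoc)
qed (insert x b bg_mult[OF emb_bg[OF b]], auto intro!: lin)

text \<open>The summand of degree \<open>k\<close> of the metric, and below its partial sums \<open>mks\<close>.\<close>

definition mk where "mk k x y = ie (H (H (fs (component Om k x)) \<^bold>\<and> component Om k y))"

abbreviation met where "met \<equiv> metric A B Om OmOm \<sigma> n"

lemma met_mk: assumes "x .: Om" "y .: Om" shows "met x y = finsum A (\<lambda>k. mk k x y) {..2 * n}"
 unfolding metric_def
proof (rule R.finsum_cong')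
 fix k assume k: "k \<in> {..2 * n}"
 then have "H (fs (component Om k x)) \<^bold>\<and> component Om k y \<in> grade Om (2 * n - k + k)"
  using assms by (intro gr_mult H_gr fs_gr comp_gr) auto
 then have "H (H (fs (component Om k x)) \<^bold>\<and> component Om k y) \<in> grade Om 0"
  using H_gr[of _ "2 * n"] k by force
 then show "the_inv_into B (emb Om) (H (H (fs (component Om k x)) \<^bold>\<and> component Om k y)) = mk k x y"
  using comp_on by (simp add: mk_def ie_def)
qed (insert assms, auto simp: mk_def)

lemma mk_right_lin: "x .: Om ==> mk k x \<in> lin_hom Om BB"
 unfolding mk_def[abs_def] by (intro ie_lin H_lin Om_mult_lin comp_lin) auto

lemma mk_left_lin: "y .: Om ==> (\<lambda>x. mk k x y) \<in> lin_hom Om (conj_vs BB)"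
 unfolding mk_def[abs_def] lin_conj_swap
 by (intro ie_lin H_lin Om_mult_lin lin_comp[OF fs_lin']) (insert comp_lin, auto simp: lin_conj_both)

lemma mk_closed [simp, intro]: "x .: Om ==> y .: Om ==> mk k x y \<in> B"
 by (auto simp: mk_def)

lemma sum_B: "finite I ==> (\<And>i. i \<in> I ==> f i \<in> B) ==> finsum A f I \<in> B"
 by (rule finsum_closure[where P = "\<lambda>x. x \<in> B", OF vsA]) auto

definition mks where "mks K x y = finsum A (\<lambda>k. mk k x y) K"

lemma mks_closed [simp, intro]: "finite K ==> x .: Om ==> y .: Om ==> mks K x y \<in> B"
 unfolding mks_def by (rule sum_B) auto

lemma mks_right_lin: "finite K ==> x .: Om ==> mks K x \<in> lin_hom Om BB"
 unfolding mks_def[abs_def]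
 by (rule lin_A_BB[OF lin_finsum_fun]) (auto intro!: lin_BB_A mk_right_lin sum_B)

lemma mks_left_lin: "finite K ==> y .: Om ==> (\<lambda>x. mks K x y) \<in> lin_hom Om (conj_vs BB)"
 unfolding mks_def[abs_def] lin_conj_swap
 by (rule lin_A_BB[OF lin_finsum_fun]) (auto intro!: lin_BB_A mk_left_lin[unfolded lin_conj_swap] sum_B)

lemma mk_right: "x .: Om ==> y .: Om ==> b \<in> B ==> mk k x (y \<^bold>\<and> emb Om b) = mk k x y ** b"
proof -
 assume x: "x .: Om" and y: "y .: Om" and b: "b \<in> B"
 have "component Om k (y \<^bold>\<and> emb Om b) = component Om k y \<^bold>\<and> emb Om b"
  by (rule comp_commute[where \<Xi> = "\<lambda>x. x \<^bold>\<and> emb Om b"]) (insert y b bg_mult[OF _ emb_bg[OF b]], auto intro!: lin)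
 then show ?thesis using x y b by (simp add: mk_def O.m_assoc[symmetric] H_right ie_right)
qed

lemma mk_left: "x .: Om ==> y .: Om ==> b \<in> B ==> mk k (x \<^bold>\<and> emb Om b) y = st b ** mk k x y"
proof -
 assume x: "x .: Om" and y: "y .: Om" and b: "b \<in> B"
 have "component Om k (x \<^bold>\<and> emb Om b) = component Om k x \<^bold>\<and> emb Om b"
  by (rule comp_commute[where \<Xi> = "\<lambda>x. x \<^bold>\<and> emb Om b"]) (insert x b bg_mult[OF _ emb_bg[OF b]], auto intro!: lin)
 moreover have "fs (component Om k x \<^bold>\<and> emb Om b) = emb Om (st b) \<^bold>\<and> fs (component Om k x)"
  using fs_mult[OF comp_gr[OF x] emb_gr[OF b], of k] x b B_st by (simp add: fs_emb)
 ultimately show ?thesis using x y b B_st by (simp add: mk_def O.m_assoc H_left ie_left)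
qed

lemma ocw_ie:
 assumes U: "vs U" and ph: "bilin A BB U ph" and z: "z .: Om"
 shows "tlift U ph (bc (ie z)) = tlift U (\<lambda>a w. ph a (ie w)) (\<rho> z)"
proof -
 have b: "bilin A Om U (\<lambda>a w. ph a (ie w))"
  by (intro bilinI lin_bilin_right[OF ph] ie_lin0 bilin_left[OF ph]) auto
 have "tlift U ph (bc (ie z)) = tlift U (\<lambda>a b'. ph a (ie (emb Om b'))) (bc (ie z))"
  by (rule bcw_cong[OF U, symmetric, OF ph]) (insert z, auto simp: ie_emb)
 also have "... = tlift U (\<lambda>a w. ph a (ie w)) (\<rho> (component Om 0 z))"
  using ocw_emb[OF U b ie_closed[OF z]] ie_grade(2)[OF z] by simp
 also have "... = tlift U (\<lambda>a w. ph a (ie (component Om 0 w))) (\<rho> z)" by (rule ocw_comp[OF U b z])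
 also have "... = tlift U (\<lambda>a w. ph a (ie w)) (\<rho> z)" by (rule ocw_cong[OF U b z]) (auto simp: ie_comp)
 finally show ?thesis .
qed

definition sesq :: "('w \<Rightarrow> 'w \<Rightarrow> 'a) \<Rightarrow> bool" where
 "sesq G \<longleftrightarrow> (\<forall>x\<in>carrier Om. G x \<in> lin_hom Om BB \<and> (\<lambda>y. G y x) \<in> lin_hom Om (conj_vs BB))"

lemma sesq_mk: "sesq (mk k)" by (simp add: sesq_def mk_right_lin mk_left_lin)
lemma sesq_mks: "finite K ==> sesq (mks K)" by (simp add: sesq_def mks_right_lin mks_left_lin)

lemma sesq_bilin:
 assumes ph: "bilin A BB U ph" and U: "vs U" and G: "sesq G"
 shows "a .: A ==> w .: Om ==> bilin A Om U (\<lambda>a' w'. ph (st a ** a') (G w w'))"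
  and "y .: Om ==> bilin A Om (conj_vs U) (\<lambda>a w. tlift U (\<lambda>a' w'. ph (st a ** a') (G w w')) (\<rho> y))"
proof -
 have 1: "G x \<in> lin_hom Om BB" and 2: "(\<lambda>y. G y x) \<in> lin_hom Om (conj_vs BB)" if "x .: Om" for x
  using G that by (auto simp: sesq_def)
 have c: "G x y \<in> B" if "x .: Om" "y .: Om" for x y using lin_closed[OF 1[OF that(1)] that(2)] by simp
 show 3: "bilin A Om U (\<lambda>a' w'. ph (st a ** a') (G w w'))" if "a .: A" "w .: Om" for a w
  using that c by (intro bilinI lin_bilin_right[OF ph] lin_bilin_left[OF ph] 1) (auto intro!: lin)
 have st1: "(\<lambda>a. st a ** a') \<in> lin_hom (conj_vs A) A" if "a' .: A" for a'
  using that by (intro mult_lin st_lin') auto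
 show "bilin A Om (conj_vs U) (\<lambda>a w. tlift U (\<lambda>a' w'. ph (st a ** a') (G w w')) (\<rho> y))" if y: "y .: Om"
 proof (intro bilinI; unfold lin_conj_swap)
  fix a assume a: "a .: A"
  show "(\<lambda>w. tlift U (\<lambda>a' w'. ph (st a ** a') (G w w')) (\<rho> y)) \<in> lin_hom (conj_vs Om) U"
   by (rule ocw_lin_fun[OF U vs_conj[OF vsOm] y])
    (insert 3 a 2 c, auto simp: lin_conj_swap intro!: lin_bilin_right[OF ph])
 next
  fix w assume w: "w .: Om"
  show "(\<lambda>a. tlift U (\<lambda>a' w'. ph (st a ** a') (G w w')) (\<rho> y)) \<in> lin_hom (conj_vs A) U"
   by (rule ocw_lin_fun[OF U vs_conj[OF vsA] y])
    (insert 3 w c, auto intro!: lin_bilin_left[OF ph] st1)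
 qed
qed

lemma mk_covariant:
 assumes U: "vs U" and ph: "bilin A BB U ph" and x: "x .: Om" and y: "y .: Om"
 shows "tlift U ph (bc (mk k x y)) = tlift (conj_vs U) (\<lambda>a w. tlift U (\<lambda>a' w'. ph (st a ** a') (mk k w w')) (\<rho> y)) (\<rho> x)"
proof -
 let ?p = "H (fs (component Om k x))" and ?q = "component Om k y"
 have b1: "bilin A Om U (\<lambda>a w. ph a (ie w))"
  by (intro bilinI lin_bilin_right[OF ph] ie_lin0 bilin_left[OF ph]) auto
 have b2: "bilin A Om U (\<lambda>a w. ph a (ie (H w)))"
  by (intro bilinI lin_bilin_right[OF ph] ie_lin H_lin0 bilin_left[OF ph]) auto
 have b3: "bilin A Om U (\<lambda>a' w'. ph (a ** a') (ie (H (w \<^bold>\<and> w'))))" if "a .: A" "w .: Om" for a w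
  using that by (intro bilinI lin_bilin_right[OF ph] lin_bilin_left[OF ph] ie_lin H_lin) (auto intro!: lin)
 have b4: "bilin A Om U (\<lambda>a w. ph (a ** a') (ie (H (w \<^bold>\<and> w'))))" if "a' .: A" "w' .: Om" for a' w'
  using that by (intro bilinI lin_bilin_right[OF ph] lin_bilin_left[OF ph] ie_lin H_lin) (auto intro!: lin)
 have b3': "bilin A Om U (\<lambda>a' w'. ph (a ** a') (ie (H (w \<^bold>\<and> component Om k w'))))" if "a .: A" "w .: Om" for a w
  using that by (intro bilinI lin_bilin_right[OF ph] lin_bilin_left[OF ph] ie_lin H_lin Om_mult_lin comp_lin) (auto intro!: lin)
 have b4': "bilin A Om U (\<lambda>a w. ph (a ** a') (ie (H (w \<^bold>\<and> component Om k w'))))" if "a' .: A" "w' .: Om" for a' w'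
  using b4[OF that(1) comp_closed[OF that(2)]] .
 note B = ocw_bilin[OF U b3' b4' y]
 have BH: "bilin A Om U (\<lambda>a w. tlift U (\<lambda>a' w'. ph (a ** a') (ie (H (H w \<^bold>\<and> component Om k w')))) (\<rho> y))"
  using bilin_closed[OF B] by (intro bilinI lin_bilin_right[OF B] H_lin0 bilin_left[OF B]) auto
 have "tlift U ph (bc (mk k x y)) = tlift U (\<lambda>a w. ph a (ie w)) (\<rho> (H (?p \<^bold>\<and> ?q)))"
  unfolding mk_def by (rule ocw_ie[OF U ph]) (use x y in auto)
 also have "... = tlift U (\<lambda>a w. ph a (ie (H w))) (\<rho> (?p \<^bold>\<and> ?q))"
  by (rule ocw_H[OF U b1]) (use x y in auto)
 also have "... = tlift U (\<lambda>a w. tlift U (\<lambda>a' w'. ph (a ** a') (ie (H (w \<^bold>\<and> w')))) (\<rho> ?q)) (\<rho> ?p)"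
  by (rule ocw_mult[OF U b2]) (use x y in auto)
 also have "... = tlift U (\<lambda>a w. tlift U (\<lambda>a' w'. ph (a ** a') (ie (H (w \<^bold>\<and> component Om k w')))) (\<rho> y)) (\<rho> ?p)"
  by (rule ocw_cong[OF U B]) (insert x y, auto intro!: ocw_comp[OF U b3])
 also have "... = tlift U (\<lambda>a w. tlift U (\<lambda>a' w'. ph (a ** a') (ie (H (H w \<^bold>\<and> component Om k w')))) (\<rho> y)) (\<rho> (fs (component Om k x)))"
  by (rule ocw_H[OF U B]) (use x in auto)
 also have "... = tlift (conj_vs U) (\<lambda>a w. tlift U (\<lambda>a' w'. ph (st a ** a') (ie (H (H (fs w) \<^bold>\<and> component Om k w')))) (\<rho> y)) (\<rho> (component Om k x))"
  by (rule ocw_star[OF _ _ U BH]) (use x in auto)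
 also have "... = tlift (conj_vs U) (\<lambda>a w. tlift U (\<lambda>a' w'. ph (st a ** a') (ie (H (H (fs (component Om k w)) \<^bold>\<and> component Om k w')))) (\<rho> y)) (\<rho> x)"
  by (rule ocw_comp[OF vs_conj[OF U] bilin_star[OF BH] x])
 finally show ?thesis by (simp add: mk_def)
qed

lemma mks_covariant:
 assumes U: "vs U" and ph: "bilin A BB U ph" and x: "x .: Om" and y: "y .: Om" and K: "finite K"
 shows "tlift U ph (bc (mks K x y)) = tlift (conj_vs U) (\<lambda>a w. tlift U (\<lambda>a' w'. ph (st a ** a') (mks K w w')) (\<rho> y)) (\<rho> x)"
 using K
proof (induction K)
 case empty
 note ph0 = lin_map_zero[OF bilin_right[OF ph] vsBB U, simplified]
 have "tlift (conj_vs U) (\<lambda>a w. tlift U (\<lambda>a' w'. ph (st a ** a') (mks {} w w')) (\<rho> y)) (\<rho> x) = tlift (conj_vs U) (\<lambda>a w. \<zero>\<^bsub>U\<^esub>) (\<rho> x)"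
 proof (rule ocw_cong[OF vs_conj[OF U] _ x])
  show "bilin A Om (conj_vs U) (\<lambda>a w. \<zero>\<^bsub>U\<^esub>)" using lin_zero_fun[OF vs_conj[OF U], of Om] lin_zero_fun[OF vs_conj[OF U], of A] by (intro bilinI) auto
  fix a w assume aw: "a .: A" "w .: Om"
  have "tlift U (\<lambda>a' w'. ph (st a ** a') (mks {} w w')) (\<rho> y) = tlift U (\<lambda>a' w'. \<zero>\<^bsub>U\<^esub>) (\<rho> y)"
   by (rule ocw_cong[OF U _ y]) (insert lin_zero_fun[OF U, of Om] lin_zero_fun[OF U, of A] ph0 aw, auto intro!: bilinI simp: mks_def)
  then show "tlift U (\<lambda>a' w'. ph (st a ** a') (mks {} w w')) (\<rho> y) = \<zero>\<^bsub>U\<^esub>"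
   using tlift_zero_fun[OF vsA vsOm U \<rho>_closed[OF y]] by simp
 qed
 also have "... = \<zero>\<^bsub>U\<^esub>" using tlift_zero_fun[OF vsA vsOm vs_conj[OF U] \<rho>_closed[OF x]] by simp
 finally show ?case
  using lin_map_zero[OF bc_lin vsBB vs_ctens] lin_map_zero[OF tlift_lin[OF vsA vsBB U ph] vs_ctens U] by (simp add: mks_def)
next
 case (insert k K)
 have e: "mks (insert k K) w w' = mk k w w' \<oplus> mks K w w'" if "w .: Om" "w' .: Om" for w w'
  unfolding mks_def using insert that by (intro R.finsum_insert) auto
 have cU: "vs (conj_vs U)" using U by simp
 note k = sesq_bilin[OF ph U sesq_mk[of k]]
 note K = sesq_bilin[OF ph U sesq_mks[OF insert(1)]]
 have i: "finite (insert k K)" using insert by simp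
 have "tlift U ph (bc (mks (insert k K) x y)) = tlift U ph (bc (mk k x y)) \<oplus>\<^bsub>U\<^esub> tlift U ph (bc (mks K x y))"
  using e[OF x y] x y insert(1) lin_add[OF lin_comp[OF tlift_lin[OF vsA vsBB U ph] bc_lin], of "mk k x y" "mks K x y"] by simp
 also have "... = tlift (conj_vs U) (\<lambda>a w. tlift U (\<lambda>a' w'. ph (st a ** a') (mk k w w')) (\<rho> y)) (\<rho> x) \<oplus>\<^bsub>conj_vs U\<^esub>
   tlift (conj_vs U) (\<lambda>a w. tlift U (\<lambda>a' w'. ph (st a ** a') (mks K w w')) (\<rho> y)) (\<rho> x)"
  using mk_covariant[OF U ph x y] insert.IH by simp
 also have "... = tlift (conj_vs U) (\<lambda>a w. tlift U (\<lambda>a' w'. ph (st a ** a') (mk k w w')) (\<rho> y) \<oplus>\<^bsub>conj_vs U\<^esub> tlift U (\<lambda>a' w'. ph (st a ** a') (mks K w w')) (\<rho> y)) (\<rho> x)"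
  by (rule tlift_add_fun[OF vsA vsOm cU k(2)[OF y] K(2)[OF y] \<rho>_closed[OF x], symmetric])
 also have "... = tlift (conj_vs U) (\<lambda>a w. tlift U (\<lambda>a' w'. ph (st a ** a') (mks (insert k K) w w')) (\<rho> y)) (\<rho> x)"
 proof (rule ocw_cong[OF cU _ x])
  show "bilin A Om (conj_vs U) (\<lambda>a w. tlift U (\<lambda>a' w'. ph (st a ** a') (mks (insert k K) w w')) (\<rho> y))"
   by (rule sesq_bilin(2)[OF ph U sesq_mks[OF i] y])
  fix a w assume aw: "a .: A" "w .: Om"
  have "tlift U (\<lambda>a' w'. ph (st a ** a') (mks (insert k K) w w')) (\<rho> y)
    = tlift U (\<lambda>a' w'. ph (st a ** a') (mk k w w') \<oplus>\<^bsub>U\<^esub> ph (st a ** a') (mks K w w')) (\<rho> y)"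
  proof (rule ocw_cong[OF U _ y])
   show "bilin A Om U (\<lambda>a' w'. ph (st a ** a') (mk k w w') \<oplus>\<^bsub>U\<^esub> ph (st a ** a') (mks K w w'))"
    by (intro bilinI lin_add_fun U bilin_right[OF k(1)[OF aw]] bilin_right[OF K(1)[OF aw]] bilin_left[OF k(1)[OF aw]] bilin_left[OF K(1)[OF aw]])
  qed (use aw e insert(1) lin_add[OF bilin_right[OF ph]] in auto)
  then show "tlift U (\<lambda>a' w'. ph (st a ** a') (mk k w w')) (\<rho> y) \<oplus>\<^bsub>conj_vs U\<^esub> tlift U (\<lambda>a' w'. ph (st a ** a') (mks K w w')) (\<rho> y) =
    tlift U (\<lambda>a' w'. ph (st a ** a') (mks (insert k K) w w')) (\<rho> y)"
   using tlift_add_fun[OF vsA vsOm U k(1)[OF aw] K(1)[OF aw] \<rho>_closed[OF y]] by simp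
 qed
 finally show ?case .
qed

lemma met_mks: "x .: Om ==> y .: Om ==> met x y = mks {..2 * n} x y"
 by (simp add: met_mk mks_def)

lemma met_closed [simp, intro]: "x .: Om ==> y .: Om ==> met x y \<in> B"
 by (simp add: met_mks)

lemma met_right_lin: "x .: Om ==> met x \<in> lin_hom Om BB"
 by (rule lin_cong[OF mks_right_lin vsOm]) (auto simp: met_mks)

lemma met_left_lin: "y .: Om ==> (\<lambda>x. met x y) \<in> lin_hom Om (conj_vs BB)"
 by (rule lin_cong[OF mks_left_lin vsOm]) (auto simp: met_mks)

lemma met_right: "x .: Om ==> y .: Om ==> b \<in> B ==> met x (y \<^bold>\<and> emb Om b) = met x y ** b"
 by (simp add: met_mk mk_right R.finsum_ldistr Pi_iff B_carrier)

lemma met_left: "x .: Om ==> y .: Om ==> b \<in> B ==> met (x \<^bold>\<and> emb Om b) y = st b ** met x y"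
 by (simp add: met_mk mk_left R.finsum_rdistr Pi_iff B_carrier)

text \<open>The coaction of \<open>met x y\<close> is \<open>x(-1)^* y(-1) \<otimes> met x(0) y(0)\<close>: every ingredient of the metric is
covariant.\<close>

lemma met_covariant:
 assumes U: "vs U" and ph: "bilin A BB U ph" and x: "x .: Om" and y: "y .: Om"
 shows "tlift U ph (bc (met x y)) = tlift (conj_vs U) (\<lambda>a w. tlift U (\<lambda>a' w'. ph (st a ** a') (met w w')) (\<rho> y)) (\<rho> x)"
proof -
 note b = sesq_bilin[OF ph U sesq_mks[OF finite_atMost]]
 have "tlift U ph (bc (met x y)) = tlift (conj_vs U) (\<lambda>a w. tlift U (\<lambda>a' w'. ph (st a ** a') (mks {..2 * n} w w')) (\<rho> y)) (\<rho> x)"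
  using mks_covariant[OF U ph x y, of "{..2 * n}"] met_mks[OF x y] by simp
 also have "... = tlift (conj_vs U) (\<lambda>a w. tlift U (\<lambda>a' w'. ph (st a ** a') (met w w')) (\<rho> y)) (\<rho> x)"
  by (rule ocw_cong[OF vs_conj[OF U] b(2)[OF y] x, symmetric])
   (auto simp: met_mks intro!: ocw_cong[OF U b(1) y])
 finally show ?thesis .
qed

end

context qhs
begin

context
 fixes V :: "('a, 'f, 'z) bimod_scheme" and \<eta> :: "'f \<Rightarrow> 'f \<Rightarrow> 'a"
 assumes whm: "weak_hermitian_module A B V \<eta>"
begin

lemma whm_bimodule: "bimodule A B V" using whm by (simp add: weak_hermitian_module_def)
lemma whm_vs: "vs V" using whm_bimodule by (simp add: bimodule_def left_module_def)
lemma whm_lact_bilin: "bilin BB V V (lact V)" and whm_ract_bilin: "bilin V BB V (ract V)"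
 using whm_bimodule by (auto simp: bimodule_def left_module_def right_module_def bilin_def lin_hom_B)
lemma whm_lact_ract: "x .: V ==> b \<in> B ==> b' \<in> B ==> ract V (lact V b x) b' = lact V b (ract V x b')"
 using whm_bimodule by (simp add: bimodule_def)

lemma whm_iso: "left_hom B (conj_bimod A V) (dual_bimod A B V) \<eta>" "right_hom B (conj_bimod A V) (dual_bimod A B V) \<eta>"
  "bij_betw \<eta> (carrier V) (carrier (dual_bimod A B V))"
 using whm by (simp_all add: weak_hermitian_module_def bimod_iso_def conj_bimod_def)

lemma whm_dual: "x .: V ==> \<eta> x .: (dual_bimod A B V)"
 using whm_iso(3) by (auto simp: bij_betw_def)

lemma whm_lin: "x .: V ==> \<eta> x \<in> lin_hom V BB"
 and whm_ract: "x .: V ==> y .: V ==> b \<in> B ==> \<eta> x (ract V y b) = \<eta> x y ** b"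
 using whm_dual[of x] by (auto simp: dual_bimod_def right_hom_def regular_def)

lemma whm_closed: "x .: V ==> y .: V ==> \<eta> x y \<in> B"
 using lin_closed[OF whm_lin] by simp

lemma whm_conj: "y .: V ==> (\<lambda>x. \<eta> x y) \<in> lin_hom V (conj_vs BB)"
proof (rule lin_homI)
 assume y: "y .: V"
 have l: "\<eta> \<in> lin_hom (conj_bimod A V) (dual_bimod A B V)" using whm_iso(1) by (simp add: left_hom_def)
 fix x x' c assume x: "x .: V"
 show "\<eta> x y .: (conj_vs BB)" using whm_closed[OF x y] by simp
 show "\<eta> (c \<odot>\<^bsub>V\<^esub> x) y = c \<odot>\<^bsub>conj_vs BB\<^esub> \<eta> x y"
  using lin_smult[OF l, of x "cnj c"] x y by (simp add: conj_bimod_def dual_bimod_def)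
 assume x': "x' .: V"
 show "\<eta> (x \<oplus>\<^bsub>V\<^esub> x') y = \<eta> x y \<oplus>\<^bsub>conj_vs BB\<^esub> \<eta> x' y"
  using lin_add[OF l, of x x'] x x' y by (simp add: conj_bimod_def dual_bimod_def)
qed

lemma whm_lact: "x .: V ==> y .: V ==> b \<in> B ==> \<eta> (lact V b x) y = \<eta> x (lact V (st b) y)"
proof -
 assume x: "x .: V" and y: "y .: V" and b: "b \<in> B"
 have "\<eta> (ract (conj_bimod A V) x (st b)) = ract (dual_bimod A B V) (\<eta> x) (st b)"
  using whm_iso(2) x B_st[OF b] by (simp add: right_hom_def conj_bimod_def)
 then show ?thesis using y b by (simp add: conj_bimod_def dual_bimod_def)
qed

lemma whm_star: "x .: V ==> y .: V ==> \<eta> x y = st (\<eta> y x)"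
 and whm_pos: "x .: V ==> x \<noteq> \<zero>\<^bsub>V\<^esub> ==> \<eta> x x \<in> positive_elements A B"
 using whm unfolding weak_hermitian_module_def by blast+

lemma whm_represents:
 assumes "ph \<in> lin_hom V BB" "\<And>y b. y .: V ==> b \<in> B ==> ph (ract V y b) = ph y ** b"
 shows "\<exists>x\<in>carrier V. \<forall>y\<in>carrier V. \<eta> x y = ph y"
proof -
 have "(\<lambda>y\<in>carrier V. ph y) .: (dual_bimod A B V)"
  using assms lin_cong[OF assms(1) whm_vs, of "\<lambda>y\<in>carrier V. ph y"] bilin_closed[OF whm_ract_bilin]
  by (simp add: dual_bimod_def right_hom_def regular_def)
 then have "(\<lambda>y\<in>carrier V. ph y) \<in> \<eta> ` carrier V" using whm_iso(3) by (simp add: bij_betw_def)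
 then obtain x where "x .: V" "(\<lambda>y\<in>carrier V. ph y) = \<eta> x" by blast
 then show ?thesis by (metis restrict_apply')
qed

end

end

section \<open>Twisted forms\<close>

locale hmod = herm A B Om OmOm \<sigma> n for A :: "'a hopf" (structure) and B :: "'a set" and Om :: "('a, 'w) dcalc"
  and OmOm :: "nat \<Rightarrow> nat \<Rightarrow> 'w set" and \<sigma> :: 'w and n :: nat +
 fixes F :: "('a, 'f) relmod" and h :: "'f \<Rightarrow> 'f \<Rightarrow> 'a"
 assumes chm: "covariant_hermitian_module A B Om OmOm \<sigma> n F h"
begin

lemma chmD:
 shows F_whm: "weak_hermitian_module A B F h"
  and M_whm: "weak_hermitian_module A B (tens_relmod A B Om F) (twisted_metric A B Om OmOm \<sigma> n F h)"
  and F_rel: "relmod_obj A B F"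
  and h_hom: "relmod_hom A B (conj_relmod A F) (dual_relmod A B F) h"
 using chm by (auto simp: covariant_hermitian_module_def)

lemmas vsF [simp, intro] = rel_vs[OF F_rel]
lemmas h_lin = whm_lin[OF F_whm]
lemmas h_closed [simp, intro] = whm_closed[OF F_whm]
lemmas h_conj = whm_conj[OF F_whm]
lemmas Fl_closed [simp, intro] = rel_lact_closed[OF F_rel]
lemmas F_lact_lin = rel_lact_lin[OF F_rel]
lemmas fcw_closed = rcw_closed[OF F_rel]
lemmas fcw_lin_arg = rcw_lin_arg[OF F_rel]
lemmas fcw_lin_fun = rcw_lin_fun[OF F_rel]
lemmas fcw_cong = rcw_cong[OF F_rel]
lemmas lin_through_fcw = lin_through_rcw[OF F_rel]
abbreviation \<rho>F where "\<rho>F \<equiv> coact F"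
lemmas \<rho>F_closed [simp, intro] = rel_coact_closed[OF F_rel]

lemma h_comp_lin: "f .: F ==> g \<in> lin_hom X F ==> (\<lambda>x. h f (g x)) \<in> lin_hom X BB"
 by (rule lin_comp[OF h_lin])

text \<open>Colinearity of \<open>h\<close> as a map to the dual, evaluated by the characterisation of the dual coaction.\<close>

lemma h_coaction:
 assumes f: "f .: F" and k: "k .: F"
 shows "bc (h f k) = tlift (conj_vs AB) (\<lambda>a f'. tlift AB (\<lambda>y k'. ctel A BB (st a ** y) (h f' k')) (\<rho>F k)) (\<rho>F f)"
proof -
 let ?D = "dual_relmod A B F" and ?DV = "dual_bimod A B F" and ?C = "conj_bimod A F"
 have Ds: "carrier ?D = carrier ?DV" "add ?D = add ?DV" "smult ?D = smult ?DV" "zero ?D = zero ?DV" "coact ?D = dual_coact A B F"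
  by (simp_all add: dual_relmod_def bimod.defs relmod.defs dual_bimod_def)
 have vsD: "vs ?D" by (rule vs_cong[OF vs_DV[OF F_rel]]) (simp_all add: Ds)
 have Cs: "carrier ?C = carrier F" "add ?C = add F" "zero ?C = zero F" "smult ?C = smult (conj_vs F)"
  by (simp_all add: conj_bimod_def conj_vs_def)
 have vsC: "vs ?C" by (rule vs_cong[OF vs_conj[OF vsF]]) (simp_all add: Cs)
 have hD: "h f .: ?DV" by (rule whm_dual[OF F_whm f])
 have hl: "h \<in> lin_hom ?C ?D"
  using whm_iso(1)[OF F_whm] lin_hom_cong[of ?C ?C ?D ?DV] by (simp add: left_hom_def Ds)
 have evD: "(\<lambda>ps. ps z) \<in> lin_hom ?D BB" if "z .: F" for z
  using DV_eval_lin[OF F_rel that] lin_hom_cong[of ?D ?DV BB BB] by (simp add: Ds)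
 have DVB: "ps \<in> lin_hom F BB" if "ps .: ?DV" for ps using DV_lin[OF F_rel that] .
 define Mf where "Mf x ps = tlift AB (\<lambda>y k. ctel A BB (x ** y) (ps k)) (\<rho>F k)" for x and ps :: "'f \<Rightarrow> 'a"
 have Mb: "bilin A F AB (\<lambda>y k. ctel A BB (x ** y) (ps k))" if "x .: A" "ps .: ?DV" for x ps
  using that DVB[OF that(2)] lin_closed[OF DVB[OF that(2)]] by (intro bilinI lin) auto
 have Mf: "bilin A ?D AB Mf"
  unfolding Mf_def
  by (intro bilinI fcw_lin_fun vs_ctens vsD vsA k Mb) (insert lin_closed[OF DVB] evD, auto simp: Ds intro!: lin)
 have Mfh: "bilin A ?C AB (\<lambda>v u. Mf v (h u))"
  by (intro bilinI lin_bilin_right[OF Mf] hl bilin_left[OF Mf]) (insert whm_dual[OF F_whm], auto simp: Cs Ds)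
 have cC: "bilin A F (conj_vs (ctens A ?C)) (\<lambda>a f'. ctel A ?C (st a) f')"
 proof (intro bilinI; unfold lin_conj_swap)
  fix a assume "a .: A"
  moreover have "(\<lambda>x. x) \<in> lin_hom (conj_vs F) ?C" by (rule lin_homI) (auto simp: Cs)
  ultimately show "(\<lambda>w. ctel A ?C (st a) w) \<in> lin_hom (conj_vs F) (ctens A ?C)" by (intro ctel_lin) auto
 next
  fix w assume "w .: F"
  then show "(\<lambda>v. ctel A ?C (st v) w) \<in> lin_hom (conj_vs A) (ctens A ?C)" by (intro ctel_lin st_lin') (simp add: Cs)
 qed
 define t where "t = tlift (conj_vs (ctens A ?C)) (\<lambda>a f'. ctel A ?C (st a) f') (\<rho>F f)"
 have t: "t .: (ctens A ?C)" unfolding t_def using fcw_closed[OF vs_conj[OF vs_ctens] cC f] by simp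
 have fc: "f .: (conj_relmod A F)" using f by (simp add: conj_relmod_def conj_bimod_def)
 have "coact ?D (h f) = id_tens A ?D h (coact (conj_relmod A F) f)"
  using h_hom fc unfolding relmod_hom_def comodule_map_def by blast
 then have dc: "dual_coact A B F (h f) = tlift (ctens A ?D) (\<lambda>v u. ctel A ?D v (h u)) t"
  by (simp add: Ds id_tens_def conj_relmod_def t_def)
 have hb: "bilin A ?C (ctens A ?D) (\<lambda>v u. ctel A ?D v (h u))"
  by (intro bilinI ctel_lin hl lin_id) (use lin_closed[OF hl] in auto)
 have "bc (h f k) = tlift AB Mf (dual_coact A B F (h f))"
  using conjunct2[OF dual_coact_spec[OF F_rel hD], THEN bspec, OF k] by (simp add: Mt_def[OF F_rel] Mf_def[abs_def])
 also have "... = tlift AB (\<lambda>v u. tlift AB Mf (ctel A ?D v (h u))) t"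
  unfolding dc by (rule lin_through_tlift[OF tlift_lin[OF vsA vsD vs_ctens Mf] vsA vsC vs_ctens vs_ctens hb t])
 also have "... = tlift AB (\<lambda>v u. Mf v (h u)) t"
  by (rule tlift_cong[OF vsA vsC vs_ctens Mfh t]) (insert lin_closed[OF hl], auto intro!: tlift_ctel[OF vsA vsD vs_ctens Mf])
 also have "... = tlift (conj_vs AB) (\<lambda>a f'. tlift AB (\<lambda>v u. Mf v (h u)) (ctel A ?C (st a) f')) (\<rho>F f)"
  unfolding t_def
 proof (rule lin_through_fcw[OF _ _ _ cC f])
  show "tlift AB (\<lambda>v u. Mf v (h u)) \<in> lin_hom (conj_vs (ctens A ?C)) (conj_vs AB)"
   unfolding lin_conj_both by (rule tlift_lin[OF vsA vsC vs_ctens Mfh])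
 qed auto
 also have "... = tlift (conj_vs AB) (\<lambda>a f'. Mf (st a) (h f')) (\<rho>F f)"
 proof (rule fcw_cong[OF _ _ f])
  show "bilin A F (conj_vs AB) (\<lambda>a f'. Mf (st a) (h f'))"
  proof (intro bilinI; unfold lin_conj_swap)
   fix a assume "a .: A"
   moreover have "h \<in> lin_hom (conj_vs F) ?D" using hl lin_hom_cong[of "conj_vs F" ?C ?D ?D] by (simp add: Cs)
   ultimately show "(\<lambda>w. Mf (st a) (h w)) \<in> lin_hom (conj_vs F) AB" by (intro lin_bilin_right[OF Mf]) auto
  next
   fix w assume "w .: F"
   then show "(\<lambda>v. Mf (st v) (h w)) \<in> lin_hom (conj_vs A) AB"
    by (intro lin_bilin_left[OF Mf] st_lin') (insert whm_dual[OF F_whm], auto simp: Ds)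
  qed
 qed (auto simp: Cs intro!: tlift_ctel[OF vsA vsC vs_ctens Mfh])
 finally show ?thesis by (simp add: Mf_def)
qed

text \<open>Applying the counit to the second leg leaves a scalar there, which is what the estimate needs.\<close>

lemma h_covariant:
 assumes f: "f .: F" and k: "k .: F"
 shows "h f k = tlift (conj_vs A) (\<lambda>a f'. tlift A (\<lambda>y k'. eps (h f' k') \<odot> (st a ** y)) (\<rho>F k)) (\<rho>F f)"
proof -
 let ?e = "\<lambda>x z. eps z \<odot> x"
 have e: "bilin A A A ?e" by (intro bilinI lin eps_lin0) auto
 have e': "bilin A BB A ?e" by (rule bilin_A_BB(1)[OF e])
 have E: "tlift A ?e \<in> lin_hom AB A" by (rule tlift_lin[OF vsA vsBB vsA e'])
 have hc: "(\<lambda>x. h x z) \<in> lin_hom (conj_vs F) BB" if "z .: F" for z using h_conj[OF that] by (simp add: lin_conj_swap)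
 have i: "bilin A F AB (\<lambda>y k'. ctel A BB (st a ** y) (h f' k'))" if "a .: A" "f' .: F" for a f'
  using that by (intro bilinI ctel_lin h_lin) (auto intro!: lin)
 have i2: "bilin A F A (\<lambda>y k'. eps (h f' k') \<odot> (st a ** y))" if "a .: A" "f' .: F" for a f'
  using that by (intro bilinI lin eps_lin lin_BB_A[OF h_lin]) (auto intro!: lin)
 have o: "bilin A F (conj_vs AB) (\<lambda>a f'. tlift AB (\<lambda>y k'. ctel A BB (st a ** y) (h f' k')) (\<rho>F k))"
  by (intro bilinI; unfold lin_conj_swap; intro fcw_lin_fun vs_ctens vs_conj vsF vsA k i ctel_lin hc)
   (auto intro!: mult_lin st_lin')
 have o2: "bilin A F (conj_vs A) (\<lambda>a f'. tlift A (\<lambda>y k'. eps (h f' k') \<odot> (st a ** y)) (\<rho>F k))"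
  by (intro bilinI; unfold lin_conj_swap; intro fcw_lin_fun vs_conj vsF vsA k i2 lin_scalar_fun lin_smult_fun eps_lin lin_BB_A[OF hc])
   (auto intro!: mult_lin st_lin')
 have "h f k = tlift A ?e (bc (h f k))"
  using bc_sw[OF vsA e h_closed[OF f k]] sw_counit_right[OF lin_id vsA, of "h f k"] f k by simp
 also have "... = tlift (conj_vs A) (\<lambda>a f'. tlift A ?e (tlift AB (\<lambda>y k'. ctel A BB (st a ** y) (h f' k')) (\<rho>F k))) (\<rho>F f)"
  unfolding h_coaction[OF f k]
  by (rule lin_through_fcw[OF _ _ _ o f]) (insert E, auto simp: lin_conj_both)
 also have "... = tlift (conj_vs A) (\<lambda>a f'. tlift A (\<lambda>y k'. eps (h f' k') \<odot> (st a ** y)) (\<rho>F k)) (\<rho>F f)"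
 proof (rule fcw_cong[OF vs_conj[OF vsA] o2 f])
  fix a f' assume af: "a .: A" "f' .: F"
  have "tlift A ?e (tlift AB (\<lambda>y k'. ctel A BB (st a ** y) (h f' k')) (\<rho>F k)) = tlift A (\<lambda>y k'. tlift A ?e (ctel A BB (st a ** y) (h f' k'))) (\<rho>F k)"
   by (rule lin_through_fcw[OF E vs_ctens vsA i[OF af] k])
  also have "... = tlift A (\<lambda>y k'. eps (h f' k') \<odot> (st a ** y)) (\<rho>F k)"
   by (rule fcw_cong[OF vsA i2[OF af] k]) (insert af, auto simp: tlift_ctel[OF vsA vsBB vsA e'])
  finally show "tlift A ?e (tlift AB (\<lambda>y k'. ctel A BB (st a ** y) (h f' k')) (\<rho>F k)) = tlift A (\<lambda>y k'. eps (h f' k') \<odot> (st a ** y)) (\<rho>F k)" .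
 qed
 finally show ?thesis .
qed

end

lemma tlift_bilin:
 assumes "vs V" "vs W" "vs U" "vs X" "vs Y" "t .: (ctens V W)"
  and 1: "\<And>x y. x .: X ==> y .: Y ==> bilin V W U (\<Psi> x y)"
  and 2: "\<And>v w. v .: V ==> w .: W ==> bilin X Y U (\<lambda>x y. \<Psi> x y v w)"
 shows "bilin X Y U (\<lambda>x y. tlift U (\<Psi> x y) t)"
proof (rule bilinI)
 fix x assume "x .: X"
 then show "(\<lambda>y. tlift U (\<Psi> x y) t) \<in> lin_hom Y U"
  by (intro lin_tlift_fun[OF assms(1-3,6) _ _ assms(5)] 1 bilin_right[OF 2])
next
 fix y assume "y .: Y"
 then show "(\<lambda>x. tlift U (\<Psi> x y) t) \<in> lin_hom X U"
  by (intro lin_tlift_fun[OF assms(1-3,6) _ _ assms(4)] 1 bilin_left[OF 2])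
qed

lemma (in qhs) actB_lin': "b \<in> B ==> k \<in> lin_hom X A ==> (\<And>x. x .: X ==> k x .: A) ==> (\<lambda>x. act (k x) b) \<in> lin_hom X BB"
 by (rule lin_A_BB) (auto intro: act_lin)

context hmod
begin

abbreviation M where "M \<equiv> btens B Om F"
abbreviation DM where "DM \<equiv> tens_relmod A B Om F"
abbreviation bt where "bt \<equiv> btel B Om F"
abbreviation AM where "AM \<equiv> ctens A M"
abbreviation g where "g \<equiv> twisted_metric A B Om OmOm \<sigma> n F h"

lemma DM_simps [simp]: "carrier DM = carrier M" "add DM = add M" "zero DM = zero M" "smult DM = smult M"
 by (simp_all add: tens_relmod_def Let_def)

lemma lin_DM: "lin_hom DM X = lin_hom M X" "lin_hom X DM = lin_hom X M"
 by (rule lin_hom_cong; simp)+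

lemma bilin_DM: "bilin X DM U ph = bilin X M U ph" "bilin DM Y W ps = bilin M Y W ps" "bilin P Z DM th = bilin P Z M th"
 by (simp_all add: bilin_def lin_DM)

lemma vsM [simp, intro]: "vs M" by simp

lemma bt_closed [simp, intro]: "w .: Om ==> f .: F ==> bt w f .: M" by (rule btel_closed)

lemma balancedI:
 "(\<And>v b w. v .: Om ==> b \<in> B ==> w .: F ==> ph (v \<^bold>\<and> emb Om b) w = ph v (lact F b w)) ==> balanced B Om F ph"
 by (simp add: balanced_def Om_ract Fl_closed)

lemma bt_balanced: "v .: Om ==> b \<in> B ==> w .: F ==> bt (v \<^bold>\<and> emb Om b) w = bt v (lact F b w)"
 using btel_balanced[of v Om b B w F] by (simp add: Om_ract)

lemmas M_eqI = btens_lin_eqI[OF _ _ vsOm]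

lemma lact_bilin: "b \<in> B ==> bilin Om F M (\<lambda>v w. bt (lact Om b v) w)"
 by (intro bilinI btel_lin rel_lact_lin(1)[OF Om_rel] lin_id) (auto intro: rel_lact_closed[OF Om_rel])

lemma lact_balanced: "b \<in> B ==> balanced B Om F (\<lambda>v w. bt (lact Om b v) w)"
 by (rule balancedI) (simp add: Om_lact O.m_assoc[symmetric] bt_balanced)

lemma lactM_lin: "b \<in> B ==> lact DM b \<in> lin_hom M M"
 using tlift_blin[OF vsOm vsF vsM lact_bilin lact_balanced, of b] by (simp add: tens_relmod_def Let_def)

lemma lactM_bt: "b \<in> B ==> v .: Om ==> w .: F ==> lact DM b (bt v w) = bt (lact Om b v) w"
 using tlift_btel[OF vsOm vsF vsM lact_bilin lact_balanced, of b v w] by (simp add: tens_relmod_def Let_def)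

lemmas M_lact_bilin = whm_lact_bilin[OF M_whm, unfolded bilin_DM]
lemmas M_ract_bilin = whm_ract_bilin[OF M_whm, unfolded bilin_DM]

lemma ractM_bt: "b \<in> B ==> v .: Om ==> w .: F ==> ract DM (bt v w) b = bt v (ract F w b)"
proof -
 assume b: "b \<in> B" and vw: "v .: Om" "w .: F"
 have 1: "bilin Om F M (\<lambda>v w. bt v (ract F w b))"
  by (intro bilinI btel_lin rel_ract_lin(2)[OF F_rel] lin_id) (insert b, auto intro: rel_ract_closed[OF F_rel])
 have 2: "balanced B Om F (\<lambda>v w. bt v (ract F w b))"
  by (rule balancedI) (insert b, simp add: whm_lact_ract[OF F_whm] bt_balanced rel_ract_closed[OF F_rel])
 show ?thesis using tlift_btel[OF vsOm vsF vsM 1 2 vw] by (simp add: tens_relmod_def Let_def)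
qed

section \<open>The coaction on twisted forms\<close>

definition \<Gamma> where "\<Gamma> v w = tlift AM (\<lambda>x v'. tlift AM (\<lambda>y w'. ctel A M (x ** y) (bt v' w')) (\<rho>F w)) (\<rho> v)"

lemma pair_bilin:
 assumes U: "vs U" and ph: "bilin A M U ph"
 shows "x .: A ==> v .: Om ==> bilin A F U (\<lambda>y w. ph (x ** y) (bt v w))"
  and "y .: A ==> w .: F ==> bilin A Om U (\<lambda>x v. ph (x ** y) (bt v w))"
  and "w .: F ==> bilin A Om U (\<lambda>x v. tlift U (\<lambda>y w'. ph (x ** y) (bt v w')) (\<rho>F w))"
proof -
 note l = lin_bilin_right[OF ph] lin_bilin_left[OF ph]
 show 1: "bilin A F U (\<lambda>y w. ph (x ** y) (bt v w))" if "x .: A" "v .: Om" for x v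
  using that by (intro bilinI l) (auto intro!: lin)
 show 2: "bilin A Om U (\<lambda>x v. ph (x ** y) (bt v w))" if "y .: A" "w .: F" for y w
  using that by (intro bilinI l) (auto intro!: lin)
 show "bilin A Om U (\<lambda>x v. tlift U (\<lambda>y w'. ph (x ** y) (bt v w')) (\<rho>F w))" if "w .: F"
  by (intro bilinI fcw_lin_fun U vsA vsOm that 1 bilin_right[OF 2] bilin_left[OF 2])
qed

lemma \<Gamma>_bilin: "bilin Om F AM \<Gamma>"
proof (rule bilinI)
 note P = pair_bilin[OF vs_ctens bilin_ctel]
 fix v assume v: "v .: Om"
 show "\<Gamma> v \<in> lin_hom F AM"
  unfolding \<Gamma>_def[abs_def]
  by (rule ocw_lin_fun[OF vs_ctens vsF v P(3)]) (auto intro!: fcw_lin_arg[OF vs_ctens P(1)] lin_id)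
next
 note P = pair_bilin[OF vs_ctens bilin_ctel]
 fix w assume w: "w .: F"
 show "(\<lambda>v. \<Gamma> v w) \<in> lin_hom Om AM"
  unfolding \<Gamma>_def[abs_def] by (rule ocw_lin_arg[OF vs_ctens P(3)[OF w] lin_id])
qed

lemma \<Gamma>_balanced: "balanced B Om F \<Gamma>"
proof (rule balancedI)
 fix v b w assume v: "v .: Om" and b: "b \<in> B" and w: "w .: F"
 note P = pair_bilin[OF vs_ctens bilin_ctel]
 have i: "bilin A F AM (\<lambda>y w'. ctel A M (x ** y) (bt v' w'))" if "x .: A" "v' .: Om" for x v'
  using P(1)[OF that] .
 have eq: "tlift AM (\<lambda>p q. tlift AM (\<lambda>y w'. ctel A M (a ** p ** y) (bt (ract Om v' q) w')) (\<rho>F w)) (bc b)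
   = tlift AM (\<lambda>y w'. ctel A M (a ** y) (bt v' w')) (\<rho>F (lact F b w))" if "a .: A" "v' .: Om" for a v'
 proof -
  have q: "q \<in> B ==> ract Om v' q .: Om" for q using that by (simp add: Om_ract)
  have j: "bilin A F AM (\<lambda>y w'. ctel A M (a ** p ** y) (bt (ract Om v' q) w'))" if "p .: A" "q .: BB" for p q
   using i[OF _ q, of "a ** p" q] that \<open>a .: A\<close> by simp
  have j2: "bilin A BB AM (\<lambda>p q. ctel A M (a ** p ** y) (bt (ract Om v' q) w'))" if "y .: A" "w' .: F" for y w'
   using that \<open>a .: A\<close> \<open>v' .: Om\<close> q
   by (intro bilinI ctel_lin btel_lin rel_ract_lin(1)[OF Om_rel] lin_id) (auto intro!: lin)
  have k: "bilin A BB AM (\<lambda>p q. tlift AM (\<lambda>y w'. ctel A M (a ** p ** y) (bt (ract Om v' q) w')) (\<rho>F w))"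
   by (rule tlift_bilin[OF vsA vsF vs_ctens vsA vsBB \<rho>F_closed[OF w] j j2])
  have "tlift AM (\<lambda>y w'. ctel A M (a ** y) (bt v' w')) (\<rho>F (lact F b w))
    = tlift AM (\<lambda>p q. tlift AM (\<lambda>y w'. ctel A M (a ** (p ** y)) (bt v' (lact F q w'))) (\<rho>F w)) (bc b)"
   by (rule rel_coact_lact[OF F_rel vs_ctens i[OF that] w b])
  also have "... = tlift AM (\<lambda>p q. tlift AM (\<lambda>y w'. ctel A M (a ** p ** y) (bt (ract Om v' q) w')) (\<rho>F w)) (bc b)"
   by (rule bcw_cong[OF vs_ctens k b], rule fcw_cong[OF vs_ctens j w])
    (insert that, simp_all add: R.m_assoc Om_ract bt_balanced)
  finally show ?thesis by simp
 qed
 have "\<Gamma> (v \<^bold>\<and> emb Om b) w = tlift AM (\<lambda>x v'. tlift AM (\<lambda>y w'. ctel A M (x ** y) (bt v' w')) (\<rho>F w)) (\<rho> (ract Om v b))"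
  by (simp add: \<Gamma>_def Om_ract v b)
 also have "... = tlift AM (\<lambda>a v'. tlift AM (\<lambda>p q. tlift AM (\<lambda>y w'. ctel A M (a ** p ** y) (bt (ract Om v' q) w')) (\<rho>F w)) (bc b)) (\<rho> v)"
  by (rule rel_coact_ract[OF Om_rel vs_ctens P(3)[OF w] v b])
 also have "... = \<Gamma> v (lact F b w)"
  unfolding \<Gamma>_def
  by (rule ocw_cong[OF vs_ctens P(3) v]) (use b w eq in auto)
 finally show "\<Gamma> (v \<^bold>\<and> emb Om b) w = \<Gamma> v (lact F b w)" .
qed

abbreviation \<rho>M where "\<rho>M \<equiv> coact DM"

lemma \<rho>M_lin: "\<rho>M \<in> lin_hom M AM" and \<rho>M_bt: "v .: Om ==> w .: F ==> \<rho>M (bt v w) = \<Gamma> v w"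
proof -
 have e: "\<rho>M = tlift AM \<Gamma>" by (simp add: tens_relmod_def Let_def \<Gamma>_def[abs_def])
 show "\<rho>M \<in> lin_hom M AM" unfolding e by (rule tlift_blin[OF vsOm vsF vs_ctens \<Gamma>_bilin \<Gamma>_balanced])
 show "\<rho>M (bt v w) = \<Gamma> v w" if "v .: Om" "w .: F"
  unfolding e by (rule tlift_btel[OF vsOm vsF vs_ctens \<Gamma>_bilin \<Gamma>_balanced that])
qed

lemma \<rho>M_closed [simp, intro]: "m .: M ==> \<rho>M m .: AM" by (rule lin_closed[OF \<rho>M_lin])

lemmas mcw_closed = tlift_closed[OF vsA vsM _ _ \<rho>M_closed]
lemmas mcw_cong = tlift_cong[OF vsA vsM _ _ \<rho>M_closed]
lemmas mcw_lin_fun = lin_tlift_fun[OF vsA vsM _ \<rho>M_closed]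
lemmas lin_through_mcw = lin_through_tlift[OF _ vsA vsM _ _ _ \<rho>M_closed]

lemma mcw_bt:
 assumes U: "vs U" and ph: "bilin A M U ph" and v: "v .: Om" and w: "w .: F"
 shows "tlift U ph (\<rho>M (bt v w)) = tlift U (\<lambda>x v'. tlift U (\<lambda>y w'. ph (x ** y) (bt v' w')) (\<rho>F w)) (\<rho> v)"
proof -
 note P = pair_bilin[OF vs_ctens bilin_ctel] and Q = pair_bilin[OF U ph]
 have T: "tlift U ph \<in> lin_hom AM U" by (rule tlift_lin[OF vsA vsM U ph])
 have "tlift U ph (\<rho>M (bt v w)) = tlift U (\<lambda>x v'. tlift U ph (tlift AM (\<lambda>y w'. ctel A M (x ** y) (bt v' w')) (\<rho>F w))) (\<rho> v)"
  unfolding \<rho>M_bt[OF v w] \<Gamma>_def by (rule lin_through_ocw[OF T vs_ctens U P(3)[OF w] v])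
 also have "... = tlift U (\<lambda>x v'. tlift U (\<lambda>y w'. ph (x ** y) (bt v' w')) (\<rho>F w)) (\<rho> v)"
 proof (rule ocw_cong[OF U Q(3)[OF w] v])
  fix x v' assume xv: "x .: A" "v' .: Om"
  have "tlift U ph (tlift AM (\<lambda>y w'. ctel A M (x ** y) (bt v' w')) (\<rho>F w)) = tlift U (\<lambda>y w'. tlift U ph (ctel A M (x ** y) (bt v' w'))) (\<rho>F w)"
   by (rule lin_through_fcw[OF T vs_ctens U P(1)[OF xv] w])
  also have "... = tlift U (\<lambda>y w'. ph (x ** y) (bt v' w')) (\<rho>F w)"
   by (rule fcw_cong[OF U Q(1)[OF xv] w]) (insert xv, auto intro!: tlift_ctel[OF vsA vsM U ph])
  finally show "tlift U ph (tlift AM (\<lambda>y w'. ctel A M (x ** y) (bt v' w')) (\<rho>F w)) = tlift U (\<lambda>y w'. ph (x ** y) (bt v' w')) (\<rho>F w)" .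
 qed
 finally show ?thesis .
qed

section \<open>The metric on twisted forms\<close>

lemmas g_lin = whm_lin[OF M_whm, unfolded lin_DM DM_simps]
lemmas g_closed [simp, intro] = whm_closed[OF M_whm, unfolded DM_simps]
lemmas g_conj = whm_conj[OF M_whm, unfolded lin_DM DM_simps]
lemmas g_ract = whm_ract[OF M_whm, unfolded DM_simps]
lemmas g_star = whm_star[OF M_whm, unfolded DM_simps]
lemmas g_pos = whm_pos[OF M_whm, unfolded DM_simps]
lemmas g_represents = whm_represents[OF M_whm, unfolded lin_DM DM_simps]

lemma hl_right_lin: "f .: F ==> v .: Om ==> (\<lambda>w. h f (lact F (met v v') w)) \<in> lin_hom F BB" if "v' .: Om" for v'
 using that by (intro h_comp_lin F_lact_lin lin_id) auto

lemma hl_mid_lin: "f .: F ==> v .: Om ==> w .: F ==> (\<lambda>v'. h f (lact F (met v v') w)) \<in> lin_hom Om BB"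
 by (intro h_comp_lin F_lact_lin met_right_lin) auto

lemma hl_first_lin: "v .: Om ==> v' .: Om ==> w .: F ==> (\<lambda>f. h f (lact F (met v v') w)) \<in> lin_hom (conj_vs F) BB"
 using h_conj by (simp add: lin_conj_swap)

lemma hl_form_lin: "f .: F ==> v' .: Om ==> w .: F ==> (\<lambda>v. h f (lact F (met v v') w)) \<in> lin_hom (conj_vs Om) BB"
 by (intro h_comp_lin F_lact_lin met_left_lin[unfolded lin_conj_swap]) auto

text \<open>The double \<open>tlift\<close> in the definition of the twisted metric may be evaluated on elementary tensors
because both maps are balanced.\<close>

lemma g_bt:
 assumes v: "v .: Om" and f: "f .: F" and v': "v' .: Om" and k: "k .: F"
 shows "g (bt v f) (bt v' k) = h f (lact F (met v v') k)"
proof -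
 have i: "bilin Om F A (\<lambda>v' k. h f (lact F (met v v') k))" if "v .: Om" "f .: F" for v f
  using that by (intro bilinI lin_BB_A[OF hl_right_lin] lin_BB_A[OF hl_mid_lin])
 have ib: "balanced B Om F (\<lambda>v' k. h f (lact F (met v v') k))" if "v .: Om" "f .: F" for v f
  using that by (intro balancedI) (simp add: met_right rel_lact_assoc[OF F_rel])
 define \<Theta> where "\<Theta> v f = tlift A (\<lambda>v' k. h f (lact F (met v v') k))" for v f
 have \<Theta>_lin: "\<Theta> v f \<in> lin_hom M A" if "v .: Om" "f .: F" for v f
  unfolding \<Theta>_def by (rule tlift_blin[OF vsOm vsF vsA i[OF that] ib[OF that]])
 have \<Theta>_bt: "\<Theta> v f (bt v' k) = h f (lact F (met v v') k)" if "v .: Om" "f .: F" "v' .: Om" "k .: F" for v f v' k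
  unfolding \<Theta>_def using that by (intro tlift_btel[OF vsOm vsF vsA i ib])
 have \<Theta>_ext: "T t = T' t" if "T \<in> lin_hom M A" "T' \<in> lin_hom M A" "\<And>v' k. v' .: Om ==> k .: F ==> T (bt v' k) = T' (bt v' k)" "t .: M" for T T' t
  by (rule M_eqI[OF that(1,2) vsA that(3,4)])
 define t where "t = bt v' k"
 have t: "t .: M" using v' k by (simp add: t_def)
 have o: "bilin Om F (conj_vs A) (\<lambda>v f. \<Theta> v f t)"
 proof (intro bilinI lin_homI)
  fix v f assume vf: "v .: Om" "f .: F"
  show "\<Theta> v f t .: (conj_vs A)" using lin_closed[OF \<Theta>_lin[OF vf] t] by simp
  fix c
  show "\<Theta> v (c \<odot>\<^bsub>F\<^esub> f) t = c \<odot>\<^bsub>conj_vs A\<^esub> \<Theta> v f t"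
   unfolding conj_vs_simps
   by (rule \<Theta>_ext[OF _ _ _ t]) (insert vf lin_smult[OF h_conj], auto intro!: \<Theta>_lin lin_smult_fun simp: \<Theta>_bt)
  show "\<Theta> (c \<odot>\<^bsub>Om\<^esub> v) f t = c \<odot>\<^bsub>conj_vs A\<^esub> \<Theta> v f t"
   unfolding conj_vs_simps
   by (rule \<Theta>_ext[OF _ _ _ t]) (insert vf lin_smult[OF hl_form_lin], auto intro!: \<Theta>_lin lin_smult_fun simp: \<Theta>_bt lin_smult[OF met_left_lin] lin_smult[OF rel_lact_lin(2)[OF F_rel _ lin_id]] lin_smult[OF h_lin])
  fix f' assume f': "f' .: F"
  show "\<Theta> v (f \<oplus>\<^bsub>F\<^esub> f') t = \<Theta> v f t \<oplus>\<^bsub>conj_vs A\<^esub> \<Theta> v f' t"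
   unfolding conj_vs_simps
   by (rule \<Theta>_ext[OF _ _ _ t]) (insert vf f' lin_add[OF h_conj], auto intro!: \<Theta>_lin lin_add_fun simp: \<Theta>_bt)
 next
  fix v v' f assume vf: "v .: Om" "v' .: Om" "f .: F"
  show "\<Theta> v f t .: (conj_vs A)" using lin_closed[OF \<Theta>_lin[OF vf(1,3)] t] by simp
  show "\<Theta> (v \<oplus>\<^bsub>Om\<^esub> v') f t = \<Theta> v f t \<oplus>\<^bsub>conj_vs A\<^esub> \<Theta> v' f t"
   unfolding conj_vs_simps
   by (rule \<Theta>_ext[OF _ _ _ t]) (insert vf lin_add[OF hl_form_lin], auto intro!: \<Theta>_lin lin_add_fun simp: \<Theta>_bt)
 qed
 have ob: "balanced B Om F (\<lambda>v f. \<Theta> v f t)"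
 proof (rule balancedI)
  fix v b f assume vbf: "v .: Om" "b \<in> B" "f .: F"
  show "\<Theta> (v \<^bold>\<and> emb Om b) f t = \<Theta> v (lact F b f) t"
   by (rule \<Theta>_ext[OF _ _ _ t])
    (insert vbf, auto intro!: \<Theta>_lin simp: \<Theta>_bt met_left rel_lact_assoc[OF F_rel] B_st whm_lact[OF F_whm])
 qed
 have "g (bt v f) t = tlift (conj_vs A) (\<lambda>v f. \<Theta> v f t) (bt v f)"
  using t by (simp add: twisted_metric_def \<Theta>_def)
 also have "... = \<Theta> v f t" by (rule tlift_btel[OF vsOm vsF _ o ob v f]) simp
 finally show ?thesis using \<Theta>_bt[OF v f v' k] by (simp add: t_def)
qed

definition \<beta> where "\<beta> x y = eps (g x y)"

lemma \<beta>_lin: "x .: M ==> u \<in> lin_hom X M ==> (\<lambda>y. \<beta> x (u y)) \<in> lin_hom X CC"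
 unfolding \<beta>_def by (intro eps_lin lin_BB_A) (rule lin_comp[OF g_lin])

lemma \<beta>_conj: "y .: M ==> (\<lambda>x. \<beta> x y) \<in> lin_hom (conj_vs M) CC"
 unfolding \<beta>_def by (intro eps_lin lin_BB_A g_conj[unfolded lin_conj_swap])

lemma \<beta>_bilin: "x .: M ==> a .: A ==> bilin A M A (\<lambda>a' x'. \<beta> x x' \<odot> (a ** a'))"
 by (intro bilinI lin_smult_fun lin_scalar_fun vsA \<beta>_lin lin_id mult_lin) auto

lemma \<beta>_outer:
 "m .: M ==> bilin A M (conj_vs A) (\<lambda>a x. tlift A (\<lambda>a' x'. \<beta> x x' \<odot> (st a ** a')) (\<rho>M m))"
 by (intro bilinI; unfold lin_conj_swap; intro mcw_lin_fun vsA vsM vs_conj \<beta>_bilin)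
  (auto intro!: lin_smult_fun lin_scalar_fun \<beta>_conj mult_lin st_lin')

lemma metric_bt_covariant:
 assumes v: "v .: Om" and f: "f .: F" and u: "u .: Om" and k: "k .: F"
 shows "g (bt v f) (bt u k) = tlift (conj_vs A) (\<lambda>a x. tlift A (\<lambda>a' x'. \<beta> x x' \<odot> (st a ** a')) (\<rho>M (bt u k))) (\<rho>M (bt v f))"
proof -
 \<comment> \<open>\<open>Y\<close> is the summand with all Sweedler legs fixed, \<open>Z\<close> the sum over the legs of \<open>u\<close> and \<open>k\<close>\<close>
 define Y where "Y x v x' u y w y' k = eps (h w (lact F (met v u) k)) \<odot> (st y ** ((st x ** x') ** y'))" for x v x' u y w y' k
 define Z where "Z x v y w = tlift A (\<lambda>x' u. tlift A (\<lambda>y' k. Y x v x' u y w y' k) (\<rho>F k)) (\<rho> u)" for x v y w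
 have Y1: "bilin A F A (\<lambda>y' k. Y x v x' u y w y' k)" if "x .: A" "v .: Om" "x' .: A" "u .: Om" "y .: A" "w .: F" for x v x' u y w
  unfolding Y_def using that by (intro bilinI lin_smult_fun lin_scalar_fun vsA eps_lin lin_BB_A[OF hl_right_lin] mult_lin lin_id) auto
 have Y2: "bilin A Om A (\<lambda>x' u. Y x v x' u y w y' k)" if "x .: A" "v .: Om" "y .: A" "w .: F" "y' .: A" "k .: F" for x v y w y' k
  unfolding Y_def using that by (intro bilinI lin_smult_fun lin_scalar_fun vsA eps_lin lin_BB_A[OF hl_mid_lin] mult_lin lin_id) auto
 have Y3: "bilin A Om A (\<lambda>x' u. tlift A (\<lambda>y' k. Y x v x' u y w y' k) (\<rho>F k))" if "x .: A" "v .: Om" "y .: A" "w .: F" for x v y w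
  by (intro bilinI fcw_lin_fun vsA vsOm k Y1 bilin_right[OF Y2] bilin_left[OF Y2] that)
 have Z1: "bilin A Om (conj_vs A) (\<lambda>x v. Z x v y w)" if "y .: A" "w .: F" for y w
  unfolding Z_def
  by (intro bilinI; unfold lin_conj_swap; intro ocw_lin_fun fcw_lin_fun vsA vsOm vs_conj u k Y3 Y1)
   (insert that, auto simp: Y_def intro!: lin_smult_fun lin_scalar_fun eps_lin lin_BB_A[OF hl_form_lin] mult_lin st_lin')
 have Z2: "bilin A F (conj_vs A) (\<lambda>y w. Z x v y w)" if "x .: A" "v .: Om" for x v
  unfolding Z_def
  by (intro bilinI; unfold lin_conj_swap; intro ocw_lin_fun fcw_lin_fun vsA vsF vs_conj u k Y3 Y1)
   (insert that, auto simp: Y_def intro!: lin_smult_fun lin_scalar_fun eps_lin lin_BB_A[OF hl_first_lin] mult_lin st_lin')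
 have cA: "vs (conj_vs A)" by simp
 have Zo1: "bilin A F (conj_vs A) (\<lambda>y w. tlift (conj_vs A) (\<lambda>x v. Z x v y w) (\<rho> v))"
  by (intro bilinI ocw_lin_fun cA vsA vsF v Z1 bilin_right[OF Z2] bilin_left[OF Z2])
 have Zo2: "bilin A Om (conj_vs A) (\<lambda>x v. tlift (conj_vs A) (\<lambda>y w. Z x v y w) (\<rho>F f))"
  by (intro bilinI fcw_lin_fun cA vsA vsOm f Z2 bilin_right[OF Z1] bilin_left[OF Z1])
 let ?b = "met v u"
 have b: "?b \<in> B" using v u by auto
 have hb: "bilin A F A (\<lambda>y k'. eps (h f' k') \<odot> (st a ** y))" if "a .: A" "f' .: F" for a f'
  using that by (intro bilinI lin_smult_fun lin_scalar_fun vsA eps_lin lin_BB_A[OF h_lin] mult_lin lin_id) auto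
 have "g (bt v f) (bt u k) = tlift (conj_vs A) (\<lambda>a f'. tlift A (\<lambda>y k'. eps (h f' k') \<odot> (st a ** y)) (\<rho>F (lact F ?b k))) (\<rho>F f)"
  using g_bt[OF v f u k] h_covariant[OF f Fl_closed[OF b k]] by simp
 also have "... = tlift (conj_vs A) (\<lambda>y w. tlift (conj_vs A) (\<lambda>x v. Z x v y w) (\<rho> v)) (\<rho>F f)"
 proof (rule fcw_cong[OF cA Zo1 f])
  fix a f' assume af: "a .: A" "f' .: F"
  have i: "bilin A F A (\<lambda>y v'. eps (h f' (lact F b' v')) \<odot> (st a ** (x ** y)))" if "x .: A" "b' .: BB" for x b'
   using that af by (intro bilinI lin_smult_fun lin_scalar_fun vsA eps_lin lin_BB_A[OF h_comp_lin] F_lact_lin mult_lin lin_id) auto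
  have c2: "bilin A BB A (\<lambda>x b'. eps (h f' (lact F b' v')) \<odot> (st a ** (x ** y)))" if "y .: A" "v' .: F" for y v'
   using that af by (intro bilinI lin_smult_fun lin_scalar_fun vsA eps_lin lin_BB_A[OF h_comp_lin] F_lact_lin mult_lin lin_id) auto
  have c: "bilin A BB A (\<lambda>x b'. tlift A (\<lambda>y v'. eps (h f' (lact F b' v')) \<odot> (st a ** (x ** y))) (\<rho>F k))"
   by (rule tlift_bilin[OF vsA vsF vsA vsA vsBB \<rho>F_closed[OF k] i c2])
  have "tlift A (\<lambda>y k'. eps (h f' k') \<odot> (st a ** y)) (\<rho>F (lact F ?b k))
    = tlift A (\<lambda>x b'. tlift A (\<lambda>y v'. eps (h f' (lact F b' v')) \<odot> (st a ** (x ** y))) (\<rho>F k)) (bc ?b)"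
   by (rule rel_coact_lact[OF F_rel vsA hb[OF af] k b])
  also have "... = tlift (conj_vs A) (\<lambda>x v. Z x v a f') (\<rho> v)"
   unfolding Z_def Y_def by (rule met_covariant[OF vsA c v u])
  finally show "tlift A (\<lambda>y k'. eps (h f' k') \<odot> (st a ** y)) (\<rho>F (lact F ?b k)) = tlift (conj_vs A) (\<lambda>x v. Z x v a f') (\<rho> v)" .
 qed
 also have "... = tlift (conj_vs A) (\<lambda>x v. tlift (conj_vs A) (\<lambda>y w. Z x v y w) (\<rho>F f)) (\<rho> v)"
  by (rule tlift_swap[OF vsA vsF vsA vsOm cA \<rho>F_closed[OF f] \<rho>_closed[OF v] Z2 Z1])
 also have "... = tlift (conj_vs A) (\<lambda>x v. tlift (conj_vs A) (\<lambda>y w. tlift A (\<lambda>a' x'. \<beta> (bt v w) x' \<odot> (st (x ** y) ** a')) (\<rho>M (bt u k))) (\<rho>F f)) (\<rho> v)"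
 proof (rule ocw_cong[OF cA Zo2 v, symmetric], rule fcw_cong[OF cA Z2 f])
  fix x v y w assume xv: "x .: A" "v .: Om" and yw: "y .: A" "w .: F"
  have "tlift A (\<lambda>a' x'. \<beta> (bt v w) x' \<odot> (st (x ** y) ** a')) (\<rho>M (bt u k))
   = tlift A (\<lambda>x' u. tlift A (\<lambda>y' k. \<beta> (bt v w) (bt u k) \<odot> (st (x ** y) ** (x' ** y'))) (\<rho>F k)) (\<rho> u)"
   by (rule mcw_bt[OF vsA \<beta>_bilin u k]) (use xv yw in auto)
  also have "... = Z x v y w"
   unfolding Z_def
  proof (rule ocw_cong[OF vsA Y3[OF xv yw] u], rule fcw_cong[OF vsA Y1[OF xv _ _ yw] k])
   fix x' u y' k assume "x' .: A" "u .: Om" "y' .: A" "k .: F"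
   then show "\<beta> (bt v w) (bt u k) \<odot> (st (x ** y) ** (x' ** y')) = Y x v x' u y w y' k"
    using xv yw by (simp add: \<beta>_def g_bt Y_def st_mult R.m_assoc)
  qed
  finally show "tlift A (\<lambda>a' x'. \<beta> (bt v w) x' \<odot> (st (x ** y) ** a')) (\<rho>M (bt u k)) = Z x v y w" .
 qed
 also have "... = tlift (conj_vs A) (\<lambda>a x. tlift A (\<lambda>a' x'. \<beta> x x' \<odot> (st a ** a')) (\<rho>M (bt u k))) (\<rho>M (bt v f))"
  by (rule mcw_bt[OF cA \<beta>_outer v f, symmetric]) (use u k in auto)
 finally show ?thesis .
qed

lemma metric_covariant:
 assumes m: "m .: M" and m': "m' .: M"
 shows "g m m' = tlift (conj_vs A) (\<lambda>a x. tlift A (\<lambda>a' x'. \<beta> x x' \<odot> (st a ** a')) (\<rho>M m')) (\<rho>M m)"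
proof -
 define G where "G m m' = tlift (conj_vs A) (\<lambda>a x. tlift A (\<lambda>a' x'. \<beta> x x' \<odot> (st a ** a')) (\<rho>M m')) (\<rho>M m)" for m m'
 have cA: "vs (conj_vs A)" by simp
 have G1: "(\<lambda>m. G m m') \<in> lin_hom M (conj_vs A)" if "m' .: M" for m'
  unfolding G_def by (rule lin_tlift_arg[OF vsA vsM cA \<beta>_outer[OF that] \<rho>M_lin])
 have G2: "G m \<in> lin_hom M A" if "m .: M" for m
 proof -
  have "G m \<in> lin_hom (conj_vs M) (conj_vs A)"
   unfolding G_def[abs_def]
  proof (rule mcw_lin_fun[OF cA that])
   fix x assume "x .: (conj_vs M)"
   then show "bilin A M (conj_vs A) (\<lambda>a y. tlift A (\<lambda>a' x'. \<beta> y x' \<odot> (st a ** a')) (\<rho>M x))" using \<beta>_outer by simp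
  next
   fix a x assume "a .: A" "x .: M"
   then show "(\<lambda>m'. tlift A (\<lambda>a' x'. \<beta> x x' \<odot> (st a ** a')) (\<rho>M m')) \<in> lin_hom (conj_vs M) (conj_vs A)"
    unfolding lin_conj_both by (intro lin_tlift_arg[OF vsA vsM vsA \<beta>_bilin \<rho>M_lin]) auto
  qed simp
  then show ?thesis by (simp add: lin_conj_both)
 qed
 have gl: "g m \<in> lin_hom M A" if "m .: M" for m by (rule lin_BB_A[OF g_lin[OF that]])
 have gc: "(\<lambda>m. g m m') \<in> lin_hom M (conj_vs A)" if "m' .: M" for m'
  using lin_BB_A[OF g_conj[OF that, unfolded lin_conj_swap]] by (simp add: lin_conj_swap)
 have 1: "g (bt v f) m' = G (bt v f) m'" if "v .: Om" "f .: F" for v f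
  by (rule M_eqI[OF gl G2 vsA _ m']) (insert that metric_bt_covariant, auto simp: G_def)
 have "g m m' = G m m'"
  by (rule M_eqI[OF gc[OF m'] G1[OF m'] cA 1 m])
 then show ?thesis by (simp add: G_def)
qed

section \<open>Morphisms commute with the right action\<close>

text \<open>The right action on twisted forms, defined on the factor \<open>F\<close>, is again the one induced by the
coaction; the balancing moves the inner adjoint action from one factor to the other.\<close>

lemma M_ract_induced:
 assumes m: "m .: M" and b: "b \<in> B"
 shows "ract DM m b = tlift M (\<lambda>a x. lact DM (act a b) x) (\<rho>M m)"
proof -
 have bi: "bilin A M M (\<lambda>a x. lact DM (act a b) x)"
  using b by (intro bilinI lactM_lin lin_bilin_left[OF M_lact_bilin] actB_lin' lin_id) auto
 show ?thesis
 proof (rule M_eqI[where T = "\<lambda>m. ract DM m b" and T' = "\<lambda>m. tlift M (\<lambda>a x. lact DM (act a b) x) (\<rho>M m)", OF _ _ vsM _ m])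
  show "(\<lambda>m. ract DM m b) \<in> lin_hom M M" using bilin_left[OF M_ract_bilin, of b] b by simp
  show "(\<lambda>m. tlift M (\<lambda>a x. lact DM (act a b) x) (\<rho>M m)) \<in> lin_hom M M"
   by (rule lin_tlift_arg[OF vsA vsM vsM bi \<rho>M_lin])
  fix v w assume v: "v .: Om" and w: "w .: F"
  note Omr = rel_act_bilin[OF Om_rel] and Fr = rel_act_bilin[OF F_rel b]
  define K where "K x v y w = bt (lact Om (act x (act y b)) v) w" for x v y w
  have L: "lact Om b' v' .: Om" if "b' \<in> B" "v' .: Om" for b' v' using rel_lact_closed[OF Om_rel that] .
  have K1: "bilin A Om M (\<lambda>x v. K x v y w)" if "y .: A" "w .: F" for y w
  proof -
   have "(\<lambda>v. bt v w) \<in> lin_hom Om M" using that by (intro btel_lin lin_id)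
   from bilin_comp[OF this Omr[OF act_B[OF that(1) b]]] show ?thesis by (simp add: K_def)
  qed
  have K2: "bilin A F M (\<lambda>y w. K x v y w)" if "x .: A" "v .: Om" for x v
   unfolding K_def using that b L
   by (intro bilinI btel_lin lin_id rel_lact_lin(2)[OF Om_rel] actB_lin actB_lin') (auto intro: L)
  have K2o: "bilin A Om M (\<lambda>x v. tlift M (\<lambda>y w. K x v y w) (\<rho>F w))"
   by (intro bilinI fcw_lin_fun vsM vsA vsOm w K2 bilin_right[OF K1] bilin_left[OF K1])
  have K1o: "bilin A F M (\<lambda>y w. tlift M (\<lambda>x v. K x v y w) (\<rho> v))"
   by (intro bilinI ocw_lin_fun vsM vsA vsF v K1 bilin_right[OF K2] bilin_left[OF K2])
  have "tlift M (\<lambda>a x. lact DM (act a b) x) (\<rho>M (bt v w)) = tlift M (\<lambda>x v. tlift M (\<lambda>y w. lact DM (act (x ** y) b) (bt v w)) (\<rho>F w)) (\<rho> v)"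
   by (rule mcw_bt[OF vsM bi v w])
  also have "... = tlift M (\<lambda>x v. tlift M (\<lambda>y w. K x v y w) (\<rho>F w)) (\<rho> v)"
   by (rule ocw_cong[OF vsM K2o v], rule fcw_cong[OF vsM K2 w]) (insert b, auto simp: K_def lactM_bt act_mult)
  also have "... = tlift M (\<lambda>y w. tlift M (\<lambda>x v. K x v y w) (\<rho> v)) (\<rho>F w)"
   by (rule tlift_swap[OF vsA vsOm vsA vsF vsM \<rho>_closed[OF v] \<rho>F_closed[OF w] K1 K2])
  also have "... = tlift M (\<lambda>y w. bt v (lact F (act y b) w)) (\<rho>F w)"
  proof (rule fcw_cong[OF vsM _ w])
   have "(\<lambda>w. bt v w) \<in> lin_hom F M" using v by (intro btel_lin lin_id)
   from bilin_comp[OF this Fr] show "bilin A F M (\<lambda>y w. bt v (lact F (act y b) w))" .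
   fix y w' assume yw: "y .: A" "w' .: F"
   have "(\<lambda>v. bt v w') \<in> lin_hom Om M" using yw by (intro btel_lin lin_id)
   from lin_through_ocw[OF this vsOm vsM Omr[OF act_B[OF yw(1) b]] v]
   have "tlift M (\<lambda>x v. K x v y w') (\<rho> v) = bt (ract Om v (act y b)) w'"
    using rel_ract[OF Om_rel v act_B[OF yw(1) b]] by (simp add: K_def)
   then show "tlift M (\<lambda>x v. K x v y w') (\<rho> v) = bt v (lact F (act y b) w')"
    using bt_balanced[OF v act_B[OF yw(1) b] yw(2)] v yw b by (simp add: Om_ract)
  qed
  also have "... = bt v (ract F w b)"
  proof -
   have "(\<lambda>w. bt v w) \<in> lin_hom F M" using v by (intro btel_lin lin_id)
   from lin_through_fcw[OF this vsF vsM Fr w] show ?thesis using rel_ract[OF F_rel w b] by simp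
  qed
  finally show "ract DM (bt v w) b = tlift M (\<lambda>a x. lact DM (act a b) x) (\<rho>M (bt v w))"
   using ractM_bt[OF b v w] by simp
 qed
qed

end

section \<open>Positive semidefinite sesquilinear forms\<close>

locale semi_ip =
 fixes V :: "(complex, 'v, 'x) module_scheme" (structure) and ip :: "'v \<Rightarrow> 'v \<Rightarrow> complex"
 assumes V: "vs V" and ip_lin: "x .: V ==> ip x \<in> lin_hom V CC"
  and ip_sym: "x .: V ==> y .: V ==> ip x y = cnj (ip y x)"
  and ip_pos: "x .: V ==> 0 \<le> Re (ip x x)"
begin

lemma ip_add: "x .: V ==> y .: V ==> z .: V ==> ip x (y \<oplus> z) = ip x y + ip x z"
 using lin_add[OF ip_lin] by simp

lemma ip_smult: "x .: V ==> y .: V ==> ip x (c \<odot> y) = c * ip x y"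
 using lin_smult[OF ip_lin] by simp

lemma ip_add_left: "x .: V ==> y .: V ==> z .: V ==> ip (y \<oplus> z) x = ip y x + ip z x"
 using ip_sym[of "y \<oplus> z" x] ip_sym[of y x] ip_sym[of z x] V by (simp add: ip_add)

lemma ip_smult_left: "x .: V ==> y .: V ==> ip (c \<odot> y) x = cnj c * ip y x"
 using ip_sym[of "c \<odot> y" x] ip_sym[of y x] V by (simp add: ip_smult)

lemma ip_real: "x .: V ==> ip x x = of_real (Re (ip x x))"
 using ip_sym[of x x] by (simp add: complex_eq_iff)

definition nrm where "nrm x = sqrt (Re (ip x x))"

lemma nrm_sq: "x .: V ==> (nrm x)\<^sup>2 = Re (ip x x)" using ip_pos by (simp add: nrm_def)
lemma nrm_ge0: "x .: V ==> 0 \<le> nrm x" using ip_pos by (simp add: nrm_def)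

lemma ip_expand:
 assumes x: "x .: V" and y: "y .: V"
 shows "Re (ip (x \<oplus> c \<odot> y) (x \<oplus> c \<odot> y)) = (nrm x)\<^sup>2 + 2 * Re (c * ip x y) + (cmod c)\<^sup>2 * (nrm y)\<^sup>2"
proof -
 have "ip (x \<oplus> c \<odot> y) (x \<oplus> c \<odot> y) = ip x x + c * ip x y + cnj (c * ip x y) + (cnj c * c) * ip y y"
  using x y V ip_sym[OF y x] by (simp add: ip_add ip_add_left ip_smult ip_smult_left algebra_simps)
 also have "cnj c * c = of_real ((cmod c)\<^sup>2)" by (metis complex_norm_square mult.commute)
 finally show ?thesis using nrm_sq[OF x] nrm_sq[OF y] by simp
qed

lemma cauchy_schwarz:
 assumes x: "x .: V" and y: "y .: V"
 shows "cmod (ip x y) \<le> nrm x * nrm y"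
proof -
 define p where "p = ip x y"
 define P N Y where "P = (cmod p)\<^sup>2" and "N = (nrm x)\<^sup>2" and "Y = (nrm y)\<^sup>2"
 have key: "0 \<le> N - 2 * t * P + t\<^sup>2 * P * Y" for t :: real
 proof -
  define c where "c = - (of_real t * cnj p)"
  have 1: "c * p = - of_real (t * P)" unfolding c_def P_def by (simp add: complex_norm_square algebra_simps del: of_real_power)
  have 2: "(cmod c)\<^sup>2 = t\<^sup>2 * P" unfolding c_def P_def by (simp add: norm_mult power_mult_distrib)
  have "0 \<le> Re (ip (x \<oplus> c \<odot> y) (x \<oplus> c \<odot> y))" using x y V by (intro ip_pos) simp
  then show ?thesis using ip_expand[OF x y, of c] 1 2 by (simp add: p_def[symmetric] N_def Y_def)
 qed
 have P0: "0 \<le> P" and Y0: "0 \<le> Y" by (simp_all add: P_def Y_def)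
 have "P \<le> N * Y"
 proof (cases "Y = 0")
  case True
  have "P = 0"
  proof (rule ccontr)
   assume "P \<noteq> 0"
   \<comment> \<open>the value of \<open>t\<close> that contradicts \<open>key\<close>\<close>
   then have "N - 2 * ((N + 1) / (2 * P)) * P = -1" by (simp add: field_simps)
   then show False using key[of "(N + 1) / (2 * P)"] True by simp
  qed
  then show ?thesis using True by simp
 next
  case False
  then have "0 \<le> N - P / Y" using key[of "1 / Y"] by (simp add: field_simps power2_eq_square)
  then show ?thesis using False Y0 by (simp add: field_simps)
 qed
 then have "(cmod p)\<^sup>2 \<le> (nrm x * nrm y)\<^sup>2" by (simp add: P_def N_def Y_def power_mult_distrib)
 from power2_le_imp_le[OF this] nrm_ge0[OF x] nrm_ge0[OF y] show ?thesis unfolding p_def by simp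
qed

lemma triangle:
 assumes x: "x .: V" and y: "y .: V"
 shows "nrm (x \<oplus> y) \<le> nrm x + nrm y"
proof (rule power2_le_imp_le)
 have "Re (ip x y) \<le> nrm x * nrm y" using cauchy_schwarz[OF x y] complex_Re_le_cmod[of "ip x y"] by linarith
 moreover have "(nrm (x \<oplus> y))\<^sup>2 = (nrm x)\<^sup>2 + 2 * Re (ip x y) + (nrm y)\<^sup>2"
  using ip_expand[OF x y, of 1] x y V by (simp add: nrm_sq)
 ultimately show "(nrm (x \<oplus> y))\<^sup>2 \<le> (nrm x + nrm y)\<^sup>2" by (simp add: power2_sum)
qed (use nrm_ge0 x y in auto)

lemma nrm_smult: "x .: V ==> nrm (c \<odot> x) = cmod c * nrm x"
proof -
 assume x: "x .: V"
 have "ip (c \<odot> x) (c \<odot> x) = (cnj c * c) * ip x x" using x V by (simp add: ip_smult ip_smult_left)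
 also have "cnj c * c = of_real ((cmod c)\<^sup>2)" by (metis complex_norm_square mult.commute)
 finally show ?thesis by (simp add: nrm_def real_sqrt_mult)
qed

lemma nrm_zero: "nrm \<zero> = 0" using nrm_smult[of "\<zero>" 0] V by simp

lemma nrm_finsum: "finite E ==> (\<And>e. e \<in> E ==> u e .: V) ==> nrm (finsum V u E) \<le> (\<Sum>e\<in>E. nrm (u e))"
proof (induction E rule: finite_induct)
 case empty
 interpret M: module CC V by (rule V)
 show ?case by (simp add: nrm_zero)
next
 case (insert e E)
 interpret M: module CC V by (rule V)
 have "finsum V u (insert e E) = u e \<oplus> finsum V u E" using insert by (intro M.finsum_insert) auto
 then show ?case using triangle[of "u e" "finsum V u E"] insert V by force
qed

end

lemma finsum_smult:
 assumes V: "vs V" and "finite E" and a: "a .: V"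
 shows "finsum V (\<lambda>e. c e \<odot>\<^bsub>V\<^esub> a) E = (\<Sum>e\<in>E. c e) \<odot>\<^bsub>V\<^esub> a"
 using assms(2)
proof (induction E rule: finite_induct)
 interpret M: module CC V by (rule V)
 case empty
 show ?case using V a by simp
next
 interpret M: module CC V by (rule V)
 case (insert e E)
 have "finsum V (\<lambda>e. c e \<odot>\<^bsub>V\<^esub> a) (insert e E) = c e \<odot>\<^bsub>V\<^esub> a \<oplus>\<^bsub>V\<^esub> finsum V (\<lambda>e. c e \<odot>\<^bsub>V\<^esub> a) E"
  using insert V a by (intro M.finsum_insert) auto
 then show ?case using insert V a by (simp add: vs_add_smult)
qed

section \<open>The Haar state\<close>

context hopf_star
begin

text \<open>Evaluate \<open>\<eta>' a(1) \<eta> a(2)\<close> with either invariance.\<close>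

lemma haar_functional_unique:
 assumes "haar_functional A \<eta>" "haar_functional A \<eta>'"
 shows "\<eta> = \<eta>'"
proof (rule extensionalityI)
 show "\<eta> \<in> extensional (carrier A)" "\<eta>' \<in> extensional (carrier A)" using assms by (auto simp: haar_functional_def)
 fix a assume a: "a .: A"
 have l: "\<eta> \<in> lin_hom A CC" "\<eta>' \<in> lin_hom A CC" and 1: "\<eta> \<one> = 1" "\<eta>' \<one> = 1"
  and e: "sw A (\<lambda>x y. \<eta> y \<odot> x) a = \<eta> a \<odot> \<one>" and e': "sw A (\<lambda>x y. \<eta>' x \<odot> y) a = \<eta>' a \<odot> \<one>"
  using assms a by (auto simp: haar_functional_def)
 have b: "bilin A A A (\<lambda>x y. \<eta> y \<odot> x)" "bilin A A A (\<lambda>x y. \<eta>' x \<odot> y)"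
  by (intro bilinI lin l; simp)+
 have "\<eta> a = \<eta>' (sw A (\<lambda>x y. \<eta> y \<odot> x) a)" using e l 1 by (simp add: lin_smult[OF l(2)])
 also have "... = sw CC (\<lambda>x y. \<eta>' (\<eta> y \<odot> x)) a" by (rule lin_through_sw[OF l(2) vsA vs_CC b(1) a])
 also have "... = sw CC (\<lambda>x y. \<eta> (\<eta>' x \<odot> y)) a"
  by (rule sw_cong[OF vs_CC bilin_comp[OF l(1) b(2)] a]) (simp add: lin_smult[OF l(1)] lin_smult[OF l(2)])
 also have "... = \<eta> (sw A (\<lambda>x y. \<eta>' x \<odot> y) a)" by (rule lin_through_sw[OF l(1) vsA vs_CC b(2) a, symmetric])
 also have "... = \<eta>' a" using e' l 1 by (simp add: lin_smult[OF l(1)])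
 finally show "\<eta> a = \<eta>' a" .
qed

lemma haar_state:
 assumes "cqga A"
 shows haar_lin: "haar A \<in> lin_hom A CC" and haar_one: "haar A \<one> = 1"
  and haar_pos: "a .: A ==> haar A (st a ** a) \<in> \<real>\<^sub>\<ge>\<^sub>0"
proof -
 obtain \<eta> where \<eta>: "haar_functional A \<eta>" "\<forall>a\<in>carrier A. \<eta> (st a ** a) \<in> \<real>\<^sub>\<ge>\<^sub>0"
  using assms by (auto simp: cqga_def)
 have "haar A = \<eta>" unfolding haar_def by (rule the_equality[where P = "haar_functional A", OF \<eta>(1)]) (rule haar_functional_unique[OF _ \<eta>(1)])
 then show "haar A \<in> lin_hom A CC" "haar A \<one> = 1" "a .: A ==> haar A (st a ** a) \<in> \<real>\<^sub>\<ge>\<^sub>0"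
  using \<eta> by (auto simp: haar_functional_def)
qed

text \<open>A positive functional is Hermitian: expand the real number at \<open>(1 + x)^* (1 + x)\<close> for \<open>x = a\<close> and
\<open>x = i a\<close>.\<close>

lemma haar_star:
 assumes q: "cqga A" and a: "a .: A"
 shows "haar A (st a) = cnj (haar A a)"
proof -
 note l = haar_lin[OF q]
 have add: "haar A (x \<oplus> y) = haar A x + haar A y" if "x .: A" "y .: A" for x y using lin_add[OF l that] by simp
 have sm: "haar A (c \<odot> x) = c * haar A x" if "x .: A" for c x using lin_smult[OF l that] by simp
 have im: "Im (haar A (st x ** x)) = 0" if "x .: A" for x
  using haar_pos[OF q that] by (auto elim!: nonneg_Reals_cases)
 have ex: "st (\<one> \<oplus> x) ** (\<one> \<oplus> x) = (\<one> \<oplus> x) \<oplus> (st x \<oplus> st x ** x)" if "x .: A" for x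
  using that by (simp add: st_add st_one R.l_distr R.r_distr R.a_ac)
 have "Im (haar A x) + Im (haar A (st x)) = 0" if "x .: A" for x
 proof -
  have "Im (haar A ((\<one> \<oplus> x) \<oplus> (st x \<oplus> st x ** x))) = 0"
   unfolding ex[OF that, symmetric] using that by (intro im) simp
  then show ?thesis using that im[OF that] haar_one[OF q] by (simp add: add)
 qed
 from this[OF a] this[of "\<i> \<odot> a"] show ?thesis using a by (simp add: st_smult sm complex_eq_iff)
qed

lemma haar_semi_ip: "cqga A ==> semi_ip A (\<lambda>a b. haar A (st a ** b))"
proof (rule semi_ip.intro)
 assume q: "cqga A"
 fix x y assume x: "x .: A"
 show "(\<lambda>b. haar A (st x ** b)) \<in> lin_hom A CC" by (rule lin_comp[OF haar_lin[OF q]]) (insert x, auto intro!: lin)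
 show "0 \<le> Re (haar A (st x ** x))" using haar_pos[OF q x] by (auto elim!: nonneg_Reals_cases)
 assume y: "y .: A"
 show "haar A (st x ** y) = cnj (haar A (st y ** x))"
  using haar_star[OF q, of "st y ** x"] x y by (simp add: st_mult)
qed (rule vsA)

lemma eps_S': "a .: A ==> eps (S' a) = eps a"
proof -
 assume a: "a .: A"
 have l: "(\<lambda>x. eps (S' x)) \<in> lin_hom A CC" by (intro eps_lin S'_lin0)
 have "sw CC (\<lambda>x y. eps y \<odot>\<^bsub>CC\<^esub> eps (S' x)) a = eps (S' a)"
  by (rule sw_counit_right[OF l vs_CC a])
 moreover have "sw CC (\<lambda>x y. eps (y ** S' x)) a = eps a \<odot>\<^bsub>CC\<^esub> eps \<one>" by (rule S'_left[OF eps_lin0 vs_CC a])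
 moreover have "sw CC (\<lambda>x y. eps (y ** S' x)) a = sw CC (\<lambda>x y. eps y \<odot>\<^bsub>CC\<^esub> eps (S' x)) a"
  by (rule sw_cong[OF vs_CC _ a]) (auto simp: eps_mult intro!: bilinI lin_mult_CC l eps_lin0)
 ultimately show ?thesis by (simp add: eps_one)
qed

end

context qhs
begin

text \<open>On the right side of \<open>rel_lact_as_ract\<close> the functional only sees the counit of \<open>act (S' a) b\<close>, which is
\<open>eps a * eps b\<close>.\<close>

lemma character_ract_lact:
 fixes V :: "('a, 'f, 'z) relmod_scheme"
 assumes V: "relmod_obj A B V" and T: "T \<in> lin_hom V CC"
  and r: "\<And>v b. v .: V ==> b \<in> B ==> T (ract V v b) = eps b * T v" and v: "v .: V" and b: "b \<in> B"
 shows "T (lact V b v) = eps b * T v"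
proof -
 note vV = rel_vs[OF V]
 have bi: "bilin A V V (\<lambda>a v'. ract V v' (act (S' a) b))"
  by (intro bilinI rel_ract_lin(2)[OF V] lin_id rel_ract_lin(1)[OF V] lin_A_BB[OF act_lin(2)] S'_lin0) (use b in auto)
 have bT: "bilin A V CC (\<lambda>a v'. eps a \<odot>\<^bsub>CC\<^esub> T v')"
  by (intro bilinI) (auto intro!: lin_mult_CC T eps_lin0)
 have "T (lact V b v) = tlift CC (\<lambda>a v'. T (ract V v' (act (S' a) b))) (coact V v)"
  unfolding rel_lact_as_ract[OF V v b] by (rule lin_through_rcw[OF V T vV vs_CC bi v])
 also have "... = tlift CC (\<lambda>a v'. eps b \<odot>\<^bsub>CC\<^esub> (eps a \<odot>\<^bsub>CC\<^esub> T v')) (coact V v)"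
  by (rule rcw_cong[OF V vs_CC bilin_comp[OF lin_smult_fun[OF vs_CC lin_id] bT] v]) (insert b, auto simp: r eps_act eps_S')
 also have "... = eps b \<odot>\<^bsub>CC\<^esub> tlift CC (\<lambda>a v'. eps a \<odot>\<^bsub>CC\<^esub> T v') (coact V v)"
  by (rule lin_through_rcw[OF V lin_smult_fun[OF vs_CC lin_id] vs_CC vs_CC bT v, symmetric])
 also have "... = eps b * T v" using rcw_counit[OF V T vs_CC v] by simp
 finally show ?thesis .
qed

end

context hmod
begin

section \<open>The fibre of the metric at the counit\<close>

lemma g_positive:
 assumes T: "T \<in> lin_hom A CC" and pos: "\<And>b. b .: A ==> 0 \<le> Re (T (st b ** b))" and x: "x .: M"
 shows "0 \<le> Re (T (g x x))"
proof (cases "x = \<zero>\<^bsub>M\<^esub>")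
 case True
 then have "g x x = \<zero>" using lin_map_zero[OF g_lin[OF x] vsM vsBB] by simp
 then show ?thesis using lin_map_zero[OF T vsA vs_CC] by simp
next
 case False
 then obtain m :: nat and b where b: "b \<in> {..<m} \<rightarrow> B" "g x x = finsum A (\<lambda>i. st (b i) ** b i) {..<m}"
  using g_pos[OF x] by (auto simp: positive_elements_def)
 have bc: "b i .: A" if "i < m" for i using b(1) that by auto
 have "0 \<le> Re (T (finsum A (\<lambda>i. st (b i) ** b i) {..<m}))"
  by (rule finsum_closure[where P = "\<lambda>x. 0 \<le> Re (T x)", OF vsA])
   (insert bc pos, auto simp: lin_map_zero[OF T vsA vs_CC, simplified] lin_add[OF T])
 then show ?thesis using b(2) by simp
qed

lemma \<beta>_pos: "x .: M ==> 0 \<le> Re (\<beta> x x)"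
 unfolding \<beta>_def by (rule g_positive[OF eps_lin0]) (simp_all add: eps_mult eps_st)

sublocale \<beta>: semi_ip M \<beta>
proof (rule semi_ip.intro)
 fix x y assume x: "x .: M"
 show "\<beta> x \<in> lin_hom M CC" using \<beta>_lin[OF x lin_id] by simp
 show "0 \<le> Re (\<beta> x x)" using \<beta>_pos[OF x] .
 assume y: "y .: M"
 have "g x y = st (g y x)" by (rule g_star[OF x y])
 then show "\<beta> x y = cnj (\<beta> y x)" using eps_st[of "g y x"] g_closed[OF y x] by (simp add: \<beta>_def)
qed (rule vsM)

lemma \<beta>_ract: "x .: M ==> y .: M ==> b \<in> B ==> \<beta> x (ract DM y b) = eps b * \<beta> x y"
 by (simp add: \<beta>_def g_ract eps_mult)

lemma \<beta>_lact: 
 assumes x: "x .: M" and y: "y .: M" and b: "b \<in> B"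
 shows "\<beta> x (lact DM b y) = eps b * \<beta> x y"
proof -
 have 1: "\<beta> x (bt v (lact F b w)) = eps b * \<beta> x (bt v w)" if "v .: Om" "w .: F" "b \<in> B" for v w b
 proof (rule character_ract_lact[OF F_rel, where T = "\<lambda>w. \<beta> x (bt v w)"])
  show "(\<lambda>w. \<beta> x (bt v w)) \<in> lin_hom F CC" by (rule \<beta>_lin[OF x btel_lin(1)[OF that(1) lin_id]])
  show "\<beta> x (bt v (ract F w b)) = eps b * \<beta> x (bt v w)" if "w .: F" "b \<in> B" for w b
   using \<beta>_ract[OF x, of "bt v w" b] ractM_bt[of b v w] that \<open>v .: Om\<close> by simp
 qed (use that in auto)
 have 2: "\<beta> x (lact DM b (bt v w)) = eps b * \<beta> x (bt v w)" if "v .: Om" "w .: F" for v w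
  unfolding lactM_bt[OF b that]
 proof (rule character_ract_lact[OF Om_rel, where T = "\<lambda>v. \<beta> x (bt v w)"])
  show "(\<lambda>v. \<beta> x (bt v w)) \<in> lin_hom Om CC" by (rule \<beta>_lin[OF x btel_lin(2)[OF that(2) lin_id]])
  show "\<beta> x (bt (ract Om v b) w) = eps b * \<beta> x (bt v w)" if "v .: Om" "b \<in> B" for v b
   using 1[OF that(1) _ that(2)] bt_balanced[of v b w] that \<open>w .: F\<close> by (simp add: Om_ract)
 qed (use that b in auto)
 show ?thesis
  by (rule M_eqI[where T = "\<lambda>y. \<beta> x (lact DM b y)" and T' = "\<lambda>y. eps b * \<beta> x y", OF _ _ vs_CC 2 y])
   (auto intro!: \<beta>_lin x lactM_lin b lin_mult_CC lin_id)
qed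

lemma M_left_generated:
 "\<exists>X. finite X \<and> X \<subseteq> carrier M \<and> (\<forall>P m. additive_on M P \<and> (\<forall>b\<in>B. \<forall>x\<in>X. P (lact DM b x)) \<and> m .: M \<longrightarrow> P m)"
proof -
 obtain X where X: "finite X" "X \<subseteq> carrier Om" and
  XP: "\<forall>P v. additive_on Om P \<and> (\<forall>b\<in>B. \<forall>x\<in>X. P (lact Om b x)) \<and> v .: Om \<longrightarrow> P v"
  using rel_left_generated[OF Om_rel] by (elim exE conjE)
 obtain Y where Y: "finite Y" "Y \<subseteq> carrier F" and
  YP: "\<forall>P v. additive_on F P \<and> (\<forall>b\<in>B. \<forall>x\<in>Y. P (lact F b x)) \<and> v .: F \<longrightarrow> P v"
  using rel_left_generated[OF F_rel] by (elim exE conjE)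
 define Z where "Z = (\<lambda>(x, y). bt x y) ` (X \<times> Y)"
 have H: "P m" if P: "additive_on M P" "\<forall>b\<in>B. \<forall>x\<in>Z. P (lact DM b x)" and m: "m .: M" for P m
 proof -
  have P0: "P \<zero>\<^bsub>M\<^esub>" and Padd: "P (x \<oplus>\<^bsub>M\<^esub> y)" if "x .: M" "y .: M" "P x" "P y" for x y
   using P(1) that by (auto simp: additive_on_def)
  have P0: "P \<zero>\<^bsub>M\<^esub>" using P(1) by (auto simp: additive_on_def)
  have 1: "P (bt v y)" if v: "v .: Om" and y: "y \<in> Y" for v y
  proof (rule XP[THEN spec[of _ "\<lambda>v. P (bt v y)"], THEN spec[of _ v], THEN mp], intro conjI ballI)
   have yc: "y .: F" using y Y by auto
   note l = bilin_left[OF bilin_btel[of Om F B] yc]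
   show "additive_on Om (\<lambda>v. P (bt v y))"
    unfolding additive_on_def using lin_map_zero[OF l vsOm vsM] lin_add[OF l] P0 Padd yc by auto
   fix b x assume b: "b \<in> B" and x: "x \<in> X"
   have "P (lact DM b (bt x y))" using P(2) b x y by (auto simp: Z_def)
   then show "P (bt (lact Om b x) y)" using lactM_bt[OF b _ yc, of x] x X by auto
  qed (rule v)
  have 2: "P (bt v w)" if v: "v .: Om" and w: "w .: F" for v w
  proof (rule YP[THEN spec[of _ "\<lambda>w. P (bt v w)"], THEN spec[of _ w], THEN mp], intro conjI ballI)
   note l = bilin_right[OF bilin_btel[of Om F B] v]
   show "additive_on F (\<lambda>w. P (bt v w))"
    unfolding additive_on_def using lin_map_zero[OF l vsF vsM] lin_add[OF l] P0 Padd v by auto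
   fix b y assume b: "b \<in> B" and y: "y \<in> Y"
   have "P (bt (v \<^bold>\<and> emb Om b) y)" using v b y by (intro 1) auto
   then show "P (bt v (lact F b y))" using bt_balanced[OF v b, of y] y Y by auto
  qed (rule w)
  show "P m" using m vsOm by (induction m rule: btens_induct) (use P0 2 Padd in auto)
 qed
 show ?thesis
 proof (rule exI[of _ Z], intro conjI allI impI)
  show "finite Z" using X Y by (simp add: Z_def)
  show "Z \<subseteq> carrier M" using X Y by (auto simp: Z_def)
  fix P m assume "additive_on M P \<and> (\<forall>b\<in>B. \<forall>x\<in>Z. P (lact DM b x)) \<and> m .: M"
  then show "P m" by (elim conjE) (rule H[of P m])
 qed
qed

text \<open>The Gram-Schmidt process for a semidefinite form.  A vector whose remainder has norm zero adds nothing
to the system, since by the Cauchy-Schwarz inequality the remainder is orthogonal to everything.\<close>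

lemma orthonormal_expansion:
 assumes "finite G" "G \<subseteq> carrier M"
 shows "\<exists>E. finite E \<and> E \<subseteq> carrier M \<and> (\<forall>e\<in>E. \<forall>e'\<in>E. \<beta> e e' = (if e = e' then 1 else 0)) \<and>
  (\<forall>v\<in>G. \<forall>x\<in>carrier M. \<beta> x v = (\<Sum>e\<in>E. \<beta> x e * \<beta> e v))"
 using assms
proof (induction G rule: finite_induct)
 case empty
 show ?case by (rule exI[of _ "{}"]) simp
next
 case (insert v G)
 then obtain E where E: "finite E" "E \<subseteq> carrier M" and on: "\<forall>e\<in>E. \<forall>e'\<in>E. \<beta> e e' = (if e = e' then 1 else 0)"
  and ex: "\<forall>v\<in>G. \<forall>x\<in>carrier M. \<beta> x v = (\<Sum>e\<in>E. \<beta> x e * \<beta> e v)" by auto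
 have v: "v .: M" and G: "G \<subseteq> carrier M" using insert by auto
 interpret MM: module CC M by (rule vsM)
 define s where "s = finsum M (\<lambda>e. \<beta> e v \<odot>\<^bsub>M\<^esub> e) E"
 define r where "r = v \<ominus>\<^bsub>M\<^esub> s"
 have s: "s .: M" unfolding s_def using E by (intro finsum_closed'[OF vsM]) auto
 have r: "r .: M" unfolding r_def using v s by simp
 have vr: "v = r \<oplus>\<^bsub>M\<^esub> s" using vs_minus_add[OF vsM v s] by (simp add: r_def)
 have \<beta>s: "\<beta> x s = (\<Sum>e\<in>E. \<beta> x e * \<beta> e v)" if x: "x .: M" for x
 proof -
  have "\<beta> x s = finsum CC (\<lambda>e. \<beta> x (\<beta> e v \<odot>\<^bsub>M\<^esub> e)) E"
   unfolding s_def using E by (intro lin_map_finsum[OF \<beta>.ip_lin[OF x] vsM vs_CC]) auto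
  also have "... = finsum CC (\<lambda>e. (\<beta> x e * \<beta> e v) \<odot>\<^bsub>CC\<^esub> 1) E"
   using E x by (intro abelian_monoid.finsum_cong') (auto simp: \<beta>.ip_smult abelian_group.axioms(1)[OF vs_ag[OF vs_CC]] subset_iff)
  also have "... = (\<Sum>e\<in>E. \<beta> x e * \<beta> e v)" using finsum_smult[OF vs_CC E(1), of 1 "\<lambda>e. \<beta> x e * \<beta> e v"] by simp
  finally show ?thesis .
 qed
 have \<beta>v: "\<beta> x v = \<beta> x r + (\<Sum>e\<in>E. \<beta> x e * \<beta> e v)" if x: "x .: M" for x
  using \<beta>.ip_add[OF x r s] \<beta>s[OF x] vr by simp
 have orth: "\<beta> e r = 0" if e: "e \<in> E" for e
 proof -
  have "(\<Sum>e'\<in>E. \<beta> e e' * \<beta> e' v) = (\<Sum>e'\<in>E. if e = e' then \<beta> e v else 0)"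
   by (rule sum.cong) (use on e in auto)
  also have "... = \<beta> e v" using e E(1) by simp
  finally show ?thesis using \<beta>v[of e] e E by auto
 qed
 show ?case
 proof (cases "\<beta>.nrm r = 0")
  case True
  have "\<beta> x r = 0" if x: "x .: M" for x using \<beta>.cauchy_schwarz[OF x r] True by simp
  then have "\<forall>v\<in>insert v G. \<forall>x\<in>carrier M. \<beta> x v = (\<Sum>e\<in>E. \<beta> x e * \<beta> e v)" using ex \<beta>v by simp
  then show ?thesis using E on by blast
 next
  case False
  define \<nu> where "\<nu> = \<beta>.nrm r"
  define e0 where "e0 = complex_of_real (1 / \<nu>) \<odot>\<^bsub>M\<^esub> r"
  have e0: "e0 .: M" using r by (simp add: e0_def)
  have rr: "\<beta> r r = of_real (\<nu>\<^sup>2)" using \<beta>.ip_real[OF r] \<beta>.nrm_sq[OF r] by (simp add: \<nu>_def)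
  have \<nu>: "\<nu> \<noteq> 0" using False by (simp add: \<nu>_def)
  have x0: "\<beta> x e0 = of_real (1 / \<nu>) * \<beta> x r" if "x .: M" for x using \<beta>.ip_smult[OF that r] by (simp add: e0_def)
  have 0: "\<beta> e0 x = of_real (1 / \<nu>) * \<beta> r x" if "x .: M" for x using \<beta>.ip_smult_left[OF that r] by (simp add: e0_def)
  have e00: "\<beta> e0 e0 = 1" using x0[OF e0] 0[OF r] rr \<nu> by (simp add: power2_eq_square)
  have eE: "\<beta> e e0 = 0" "\<beta> e0 e = 0" if "e \<in> E" for e
   using x0[of e] orth[OF that] \<beta>.ip_sym[OF e0, of e] that E by auto
  have notin: "e0 \<notin> E" using eE(1)[of e0] e00 by auto
  have on': "\<forall>e\<in>insert e0 E. \<forall>e'\<in>insert e0 E. \<beta> e e' = (if e = e' then 1 else 0)"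
   using on e00 eE notin by auto
  have re: "\<beta> x r = \<beta> x e0 * of_real \<nu>" if "x .: M" for x using x0[OF that] \<nu> by simp
  have e0v: "\<beta> e0 v = of_real \<nu>" using \<beta>v[OF e0] re[OF e0] e00 eE by simp
  have "\<beta> x w = (\<Sum>e\<in>insert e0 E. \<beta> x e * \<beta> e w)" if w: "w \<in> insert v G" and x: "x .: M" for w x
  proof (cases "w = v")
   case True
   then show ?thesis using \<beta>v[OF x] re[OF x] e0v notin E(1) by simp
  next
   case False
   then have wG: "w \<in> G" using w by auto
   have "\<beta> e0 w = 0" using ex[THEN bspec, OF wG, THEN bspec, OF e0] eE by simp
   then show ?thesis using ex[THEN bspec, OF wG, THEN bspec, OF x] notin E(1) by simp
  qed
  then show ?thesis using on' E e0 by (intro exI[of _ "insert e0 E"]) auto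
 qed
qed

lemma \<beta>_finite_rank: "\<exists>E. finite E \<and> E \<subseteq> carrier M \<and> (\<forall>x\<in>carrier M. \<forall>y\<in>carrier M. \<beta> x y = (\<Sum>e\<in>E. \<beta> x e * \<beta> e y))"
proof -
 obtain X where X: "finite X" "X \<subseteq> carrier M" and
  XP: "\<forall>P m. additive_on M P \<and> (\<forall>b\<in>B. \<forall>x\<in>X. P (lact DM b x)) \<and> m .: M \<longrightarrow> P m"
  using M_left_generated by (elim exE conjE)
 obtain E where E: "finite E" "E \<subseteq> carrier M" "\<forall>v\<in>X. \<forall>x\<in>carrier M. \<beta> x v = (\<Sum>e\<in>E. \<beta> x e * \<beta> e v)"
  using orthonormal_expansion[OF X] by (elim exE conjE)
 have "\<beta> x y = (\<Sum>e\<in>E. \<beta> x e * \<beta> e y)" if x: "x .: M" and y: "y .: M" for x y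
 proof (rule XP[THEN spec[of _ "\<lambda>y. \<beta> x y = (\<Sum>e\<in>E. \<beta> x e * \<beta> e y)"], THEN spec[of _ y], THEN mp], intro conjI ballI)
  have 0: "\<beta> z \<zero>\<^bsub>M\<^esub> = 0" if "z .: M" for z using lin_map_zero[OF \<beta>.ip_lin[OF that] vsM vs_CC] by simp
  show "additive_on M (\<lambda>y. \<beta> x y = (\<Sum>e\<in>E. \<beta> x e * \<beta> e y))"
  proof -
   have "\<beta> x \<zero>\<^bsub>M\<^esub> = (\<Sum>e\<in>E. \<beta> x e * \<beta> e \<zero>\<^bsub>M\<^esub>)" using 0 x E(2) by (simp add: subset_iff)
   moreover have "\<beta> x (y \<oplus>\<^bsub>M\<^esub> z) = (\<Sum>e\<in>E. \<beta> x e * \<beta> e (y \<oplus>\<^bsub>M\<^esub> z))"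
    if yz: "y .: M" "z .: M" "\<beta> x y = (\<Sum>e\<in>E. \<beta> x e * \<beta> e y)" "\<beta> x z = (\<Sum>e\<in>E. \<beta> x e * \<beta> e z)" for y z
   proof -
    have "(\<Sum>e\<in>E. \<beta> x e * \<beta> e (y \<oplus>\<^bsub>M\<^esub> z)) = (\<Sum>e\<in>E. \<beta> x e * \<beta> e y + \<beta> x e * \<beta> e z)"
     by (rule sum.cong) (insert yz E(2), auto simp: \<beta>.ip_add ring_distribs)
    then show ?thesis using \<beta>.ip_add[OF x yz(1,2)] yz(3,4) by (simp add: sum.distrib)
   qed
   ultimately show ?thesis unfolding additive_on_def by blast
  qed
  fix b v assume b: "b \<in> B" and v: "v \<in> X"
  have vc: "v .: M" using v X by auto
  have "(\<Sum>e\<in>E. \<beta> x e * \<beta> e (lact DM b v)) = (\<Sum>e\<in>E. eps b * (\<beta> x e * \<beta> e v))"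
   by (rule sum.cong) (insert E(2) vc b, auto simp: \<beta>_lact)
  then show "\<beta> x (lact DM b v) = (\<Sum>e\<in>E. \<beta> x e * \<beta> e (lact DM b v))"
   using \<beta>_lact[OF x vc b] E(3) v x by (simp add: sum_distrib_left)
 qed (rule y)
 then show ?thesis using E by blast
qed

end

section \<open>Boundedness of morphisms\<close>

locale chmod = hmod A B Om OmOm \<sigma> n F h for A :: "'a hopf" (structure) and B :: "'a set" and Om :: "('a, 'w) dcalc"
  and OmOm :: "nat \<Rightarrow> nat \<Rightarrow> 'w set" and \<sigma> :: 'w and n :: nat and F :: "('a, 'f) relmod" and h :: "'f \<Rightarrow> 'f \<Rightarrow> 'a" +
 assumes cqga: "cqga A"
begin

abbreviation \<eta> where "\<eta> \<equiv> haar A"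

sublocale N: semi_ip A "\<lambda>a b. \<eta> (st a ** b)" by (rule haar_semi_ip[OF cqga])

sublocale L: semi_ip M "\<lambda>x y. \<eta> (g x y)"
proof (rule semi_ip.intro)
 fix x y assume x: "x .: M"
 show "(\<lambda>y. \<eta> (g x y)) \<in> lin_hom M CC" by (rule lin_comp[OF haar_lin[OF cqga] lin_BB_A[OF g_lin[OF x]]])
 show "0 \<le> Re (\<eta> (g x x))" by (rule g_positive[OF haar_lin[OF cqga] N.ip_pos x])
 assume y: "y .: M"
 have "g x y = st (g y x)" by (rule g_star[OF x y])
 then show "\<eta> (g x y) = cnj (\<eta> (g y x))" using haar_star[OF cqga, of "g y x"] g_closed[OF y x] by simp
qed (rule vsM)

text \<open>The matrix coefficients of the coaction on \<open>M\<close> with respect to \<open>\<beta>\<close>.\<close>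

definition u where "u e m = tlift A (\<lambda>a x. \<beta> e x \<odot> a) (\<rho>M m)"

lemma u_bilin: "e .: M ==> bilin A M A (\<lambda>a x. \<beta> e x \<odot> a)"
 by (intro bilinI lin_smult_fun lin_scalar_fun vsA \<beta>_lin lin_id)

lemma u_closed [simp, intro]: "e .: M ==> m .: M ==> u e m .: A"
 unfolding u_def by (rule mcw_closed[OF vsA u_bilin])

lemma metric_sum_of_squares:
 assumes E: "finite E" "E \<subseteq> carrier M" and ex: "\<And>x y. x .: M ==> y .: M ==> \<beta> x y = (\<Sum>e\<in>E. \<beta> x e * \<beta> e y)"
  and m: "m .: M" and m': "m' .: M"
 shows "g m m' = finsum A (\<lambda>e. st (u e m) ** u e m') E"
proof -
 have Ec: "e .: M" if "e \<in> E" for e using that E by auto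
 have cA: "vs (conj_vs A)" by simp
 have i: "tlift A (\<lambda>a' x'. \<beta> x x' \<odot> (st a ** a')) t = finsum A (\<lambda>e. \<beta> x e \<odot> (st a ** tlift A (\<lambda>a' x'. \<beta> e x' \<odot> a') t)) E"
  if a: "a .: A" and x: "x .: M" and t: "t .: AM" for a x t
 proof (rule ctens_lin_eqI[OF _ _ vsA vsA _ t])
  have bb: "bilin A M A (\<lambda>a' x'. \<beta> x x' \<odot> (st a ** a'))" using a x by (intro \<beta>_bilin) auto
  show "tlift A (\<lambda>a' x'. \<beta> x x' \<odot> (st a ** a')) \<in> lin_hom AM A" by (rule tlift_lin[OF vsA vsM vsA bb])
  show "(\<lambda>t. finsum A (\<lambda>e. \<beta> x e \<odot> (st a ** tlift A (\<lambda>a' x'. \<beta> e x' \<odot> a') t)) E) \<in> lin_hom AM A"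
   using a Ec by (intro lin_finsum_fun vsA E vs_ctens lin_smult_fun mult_lin tlift_lin u_bilin vsM) auto
  fix a' x' assume a': "a' .: A" and x': "x' .: M"
  have "finsum A (\<lambda>e. \<beta> x e \<odot> (st a ** tlift A (\<lambda>a' x'. \<beta> e x' \<odot> a') (ctel A M a' x'))) E
    = finsum A (\<lambda>e. (\<beta> x e * \<beta> e x') \<odot> (st a ** a')) E"
   by (rule R.finsum_cong') (insert a a' x' Ec, auto simp: tlift_ctel[OF vsA vsM vsA u_bilin] mult_smult)
  also have "... = \<beta> x x' \<odot> (st a ** a')" using finsum_smult[OF vsA E(1), of "st a ** a'" "\<lambda>e. \<beta> x e * \<beta> e x'"] ex[OF x x'] a a' by simp
  finally show "tlift A (\<lambda>a' x'. \<beta> x x' \<odot> (st a ** a')) (ctel A M a' x') =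
    finsum A (\<lambda>e. \<beta> x e \<odot> (st a ** tlift A (\<lambda>a' x'. \<beta> e x' \<odot> a') (ctel A M a' x'))) E"
   using tlift_ctel[OF vsA vsM vsA bb a' x'] by simp
 qed
 define W where "W a x = finsum A (\<lambda>e. \<beta> x e \<odot> (st a ** u e m')) E" for a x
 have W: "bilin A M (conj_vs A) W"
  unfolding W_def lin_conj_swap bilin_def
  using Ec m' by (intro conjI ballI lin_finsum_fun vsA E vsM vs_conj lin_scalar_fun lin_smult_fun \<beta>_conj mult_lin st_lin') auto
 have "g m m' = tlift (conj_vs A) (\<lambda>a x. tlift A (\<lambda>a' x'. \<beta> x x' \<odot> (st a ** a')) (\<rho>M m')) (\<rho>M m)"
  by (rule metric_covariant[OF m m'])
 also have "... = tlift (conj_vs A) W (\<rho>M m)"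
  by (rule mcw_cong[OF cA W m]) (insert i[OF _ _ \<rho>M_closed[OF m']], simp add: W_def u_def)
 also have "... = finsum A (\<lambda>e. st (tlift A (\<lambda>a x. \<beta> e x \<odot> a) (\<rho>M m)) ** u e m') E"
 proof (rule ctens_lin_eqI[where T' = "\<lambda>t. finsum A (\<lambda>e. st (tlift A (\<lambda>a x. \<beta> e x \<odot> a) t) ** u e m') E", OF _ _ vsA cA _ \<rho>M_closed[OF m]])
  show "tlift (conj_vs A) W \<in> lin_hom AM (conj_vs A)" by (rule tlift_lin[OF vsA vsM cA W])
  show "(\<lambda>t. finsum A (\<lambda>e. st (tlift A (\<lambda>a x. \<beta> e x \<odot> a) t) ** u e m') E) \<in> lin_hom AM (conj_vs A)"
   unfolding lin_conj_swap
   using Ec m' by (intro lin_finsum_fun vsA E vs_conj vs_ctens mult_lin st_lin tlift_lin u_bilin vsM) auto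
  fix a x assume a: "a .: A" and x: "x .: M"
  have "W a x = finsum A (\<lambda>e. st (tlift A (\<lambda>a x. \<beta> e x \<odot> a) (ctel A M a x)) ** u e m') E"
   unfolding W_def
  proof (rule R.finsum_cong')
   fix e assume e: "e \<in> E"
   have "\<beta> x e = cnj (\<beta> e x)" by (rule \<beta>.ip_sym[OF x Ec[OF e]])
   then show "\<beta> x e \<odot> (st a ** u e m') = st (tlift A (\<lambda>a x. \<beta> e x \<odot> a) (ctel A M a x)) ** u e m'"
    using a x Ec[OF e] m' by (simp add: tlift_ctel[OF vsA vsM vsA u_bilin] st_smult smult_mult)
  qed (insert a x Ec m', auto simp: tlift_ctel[OF vsA vsM vsA u_bilin])
  then show "tlift (conj_vs A) W (ctel A M a x) = finsum A (\<lambda>e. st (tlift A (\<lambda>a x. \<beta> e x \<odot> a) (ctel A M a x)) ** u e m') E"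
   using tlift_ctel[OF vsA vsM cA W a x] by simp
 qed
 finally show ?thesis by (simp add: u_def)
qed

context
 fixes f assumes f: "relmod_hom A B DM DM f"
begin

lemma f_lin: "f \<in> lin_hom M M" and f_lact: "b \<in> B ==> m .: M ==> f (lact DM b m) = lact DM b (f m)"
 and f_coact: "m .: M ==> \<rho>M (f m) = tlift AM (\<lambda>a x. ctel A M a (f x)) (\<rho>M m)"
proof -
 show "f \<in> lin_hom M M" "b \<in> B ==> m .: M ==> f (lact DM b m) = lact DM b (f m)"
  using f by (auto simp: relmod_hom_def left_hom_def lin_DM)
 have tn: "tnull A DM {} = tnull A M {}"
 proof (intro equalityI subsetI)
  show "p \<in> tnull A M {}" if "p \<in> tnull A DM {}" for p using that by induction (auto intro: tnull.intros[where V = A and W = M, simplified])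
  show "p \<in> tnull A DM {}" if "p \<in> tnull A M {}" for p using that by induction (auto intro: tnull.intros[where V = A and W = DM, simplified])
 qed
 have ct: "ctel A DM = ctel A M" by (intro ext) (simp add: ctel_def tclass_def tn)
 have ts: "tspace A DM {} = tspace A M {}" by (simp add: tspace_def tclass_def[abs_def] tn)
 have tl: "tlift (ctens A DM) = (tlift AM :: ('a \<Rightarrow> ('w, 'f) tensor \<Rightarrow> _) \<Rightarrow> _)"
  by (intro ext) (simp add: tlift_def finsum_def ctens_def ts)
 show "\<rho>M (f m) = tlift AM (\<lambda>a x. ctel A M a (f x)) (\<rho>M m)" if "m .: M"
  using f that by (simp add: relmod_hom_def comodule_map_def id_tens_def tl ct)
qed

lemma f_closed [simp, intro]: "m .: M ==> f m .: M" by (rule lin_closed[OF f_lin])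

lemma mcw_f:
 assumes U: "vs U" and ph: "bilin A M U ph" and m: "m .: M"
 shows "tlift U ph (\<rho>M (f m)) = tlift U (\<lambda>a x. ph a (f x)) (\<rho>M m)"
proof -
 have b: "bilin A M AM (\<lambda>a x. ctel A M a (f x))" by (intro bilinI ctel_lin f_lin lin_id) auto
 have b2: "bilin A M U (\<lambda>a x. ph a (f x))" by (intro bilinI lin_bilin_right[OF ph] f_lin bilin_left[OF ph]) auto
 have "tlift U ph (\<rho>M (f m)) = tlift U (\<lambda>a x. tlift U ph (ctel A M a (f x))) (\<rho>M m)"
  unfolding f_coact[OF m] by (rule lin_through_mcw[OF tlift_lin[OF vsA vsM U ph] vs_ctens U b m])
 also have "... = tlift U (\<lambda>a x. ph a (f x)) (\<rho>M m)"
  by (rule mcw_cong[OF U b2 m]) (auto intro!: tlift_ctel[OF vsA vsM U ph])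
 finally show ?thesis .
qed

lemma f_ract: 
 assumes m: "m .: M" and b: "b \<in> B"
 shows "f (ract DM m b) = ract DM (f m) b"
proof -
 have bi: "bilin A M M (\<lambda>a x. lact DM (act a b) x)"
  using b by (intro bilinI lactM_lin lin_bilin_left[OF M_lact_bilin] actB_lin' lin_id) auto
 have bi': "bilin A M M (\<lambda>a x. lact DM (act a b) (f x))"
  by (intro bilinI lin_bilin_right[OF bi] f_lin bilin_left[OF bi]) auto
 have "f (ract DM m b) = tlift M (\<lambda>a x. f (lact DM (act a b) x)) (\<rho>M m)"
  unfolding M_ract_induced[OF m b] by (rule lin_through_mcw[OF f_lin vsM vsM bi m])
 also have "... = tlift M (\<lambda>a x. lact DM (act a b) (f x)) (\<rho>M m)"
  by (rule mcw_cong[OF vsM bi' m]) (insert b, auto simp: f_lact)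
 also have "... = ract DM (f m) b"
  using mcw_f[OF vsM bi m] M_ract_induced[OF f_closed[OF m] b] by simp
 finally show ?thesis .
qed

text \<open>The functional \<open>m \<mapsto> g y (f m)\<close> is right linear, hence represented by the metric.\<close>

lemma adjoint_exists:
 assumes y: "y .: M"
 shows "\<exists>y'\<in>carrier M. \<forall>m\<in>carrier M. \<beta> y (f m) = \<beta> y' m"
proof -
 have "\<exists>y'\<in>carrier M. \<forall>m\<in>carrier M. g y' m = g y (f m)"
 proof (rule g_represents)
  show "(\<lambda>m. g y (f m)) \<in> lin_hom M BB" by (rule lin_comp[OF g_lin[OF y] f_lin])
  show "g y (f (ract DM m b)) = g y (f m) ** b" if "m .: M" "b \<in> B" for m b
   using that y f_ract[OF that] g_ract[OF y f_closed, of m b] by simp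
 qed
 then obtain y' where y': "y' .: M" "\<And>m. m .: M ==> g y' m = g y (f m)" by blast
 then have "\<forall>m\<in>carrier M. \<beta> y (f m) = \<beta> y' m" by (simp add: \<beta>_def)
 then show ?thesis using y'(1) by blast
qed

lemma u_f:
 assumes E: "finite E" "E \<subseteq> carrier M" and ex: "\<And>x y. x .: M ==> y .: M ==> \<beta> x y = (\<Sum>e\<in>E. \<beta> x e * \<beta> e y)"
  and e: "e .: M" and m: "m .: M"
 shows "u e (f m) = finsum A (\<lambda>l. \<beta> e (f l) \<odot> u l m) E"
proof -
 have Ec: "l .: M" if "l \<in> E" for l using that E by auto
 obtain e' where e': "e' .: M" "\<And>m. m .: M ==> \<beta> e (f m) = \<beta> e' m" using adjoint_exists[OF e] by blast
 have b: "bilin A M A (\<lambda>a x. \<beta> e (f x) \<odot> a)"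
  by (intro bilinI lin_smult_fun lin_scalar_fun vsA \<beta>_lin e f_lin lin_id)
 have "u e (f m) = tlift A (\<lambda>a x. \<beta> e (f x) \<odot> a) (\<rho>M m)" unfolding u_def by (rule mcw_f[OF vsA u_bilin[OF e] m])
 also have "... = finsum A (\<lambda>l. \<beta> e (f l) \<odot> tlift A (\<lambda>a x. \<beta> l x \<odot> a) (\<rho>M m)) E"
 proof (rule ctens_lin_eqI[where T' = "\<lambda>t. finsum A (\<lambda>l. \<beta> e (f l) \<odot> tlift A (\<lambda>a x. \<beta> l x \<odot> a) t) E", OF _ _ vsA vsA _ \<rho>M_closed[OF m]])
  show "tlift A (\<lambda>a x. \<beta> e (f x) \<odot> a) \<in> lin_hom AM A" by (rule tlift_lin[OF vsA vsM vsA b])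
  show "(\<lambda>t. finsum A (\<lambda>l. \<beta> e (f l) \<odot> tlift A (\<lambda>a x. \<beta> l x \<odot> a) t) E) \<in> lin_hom AM A"
   using Ec by (intro lin_finsum_fun vsA E vs_ctens lin_smult_fun tlift_lin u_bilin vsM)
  fix a x assume a: "a .: A" and x: "x .: M"
  have "finsum A (\<lambda>l. \<beta> e (f l) \<odot> tlift A (\<lambda>a x. \<beta> l x \<odot> a) (ctel A M a x)) E = finsum A (\<lambda>l. (\<beta> e' l * \<beta> l x) \<odot> a) E"
   by (rule R.finsum_cong') (insert a x Ec e', auto simp: tlift_ctel[OF vsA vsM vsA u_bilin])
  also have "... = \<beta> e (f x) \<odot> a" using finsum_smult[OF vsA E(1) a, of "\<lambda>l. \<beta> e' l * \<beta> l x"] ex[OF e'(1) x] e'(2)[OF x] by simp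
  finally show "tlift A (\<lambda>a x. \<beta> e (f x) \<odot> a) (ctel A M a x) = finsum A (\<lambda>l. \<beta> e (f l) \<odot> tlift A (\<lambda>a x. \<beta> l x \<odot> a) (ctel A M a x)) E"
   using tlift_ctel[OF vsA vsM vsA b a x] by simp
 qed
 finally show ?thesis by (simp add: u_def)
qed

text \<open>The square of the norm of \<open>m\<close> is the sum of the squares of the norms of its coefficients.\<close>

lemma f_bounded: "\<exists>C. \<forall>m\<in>carrier M. L.nrm (f m) \<le> C * L.nrm m"
proof -
 obtain E where E: "finite E" "E \<subseteq> carrier M" "\<forall>x\<in>carrier M. \<forall>y\<in>carrier M. \<beta> x y = (\<Sum>e\<in>E. \<beta> x e * \<beta> e y)"
  using \<beta>_finite_rank by (elim exE conjE)
 have ex: "\<beta> x y = (\<Sum>e\<in>E. \<beta> x e * \<beta> e y)" if "x .: M" "y .: M" for x y using E(3) that by blast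
 have Ec: "l .: M" if "l \<in> E" for l using that E by auto
 have sq: "(L.nrm m)\<^sup>2 = (\<Sum>e\<in>E. (N.nrm (u e m))\<^sup>2)" if m: "m .: M" for m
 proof -
  have "\<eta> (finsum A (\<lambda>e. st (u e m) ** u e m) E) = (\<Sum>e\<in>E. \<eta> (st (u e m) ** u e m))"
   using E(1) Ec
  proof (induction E rule: finite_induct)
   case empty
   show ?case using lin_map_zero[OF haar_lin[OF cqga] vsA vs_CC] by simp
  next
   case (insert e E)
   have "finsum A (\<lambda>e. st (u e m) ** u e m) (insert e E) = st (u e m) ** u e m \<oplus> finsum A (\<lambda>e. st (u e m) ** u e m) E"
    using insert m by (intro R.finsum_insert) auto
   moreover have "finsum A (\<lambda>e. st (u e m) ** u e m) E .: A" using insert m by (intro finsum_closed'[OF vsA]) auto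
   ultimately show ?case using insert m lin_add[OF haar_lin[OF cqga]] by simp
  qed
  moreover have "g m m = finsum A (\<lambda>e. st (u e m) ** u e m) E"
   by (rule metric_sum_of_squares[OF E(1,2) _ m m]) (rule ex)
  ultimately have "Re (\<eta> (g m m)) = (\<Sum>e\<in>E. Re (\<eta> (st (u e m) ** u e m)))" by simp
  also have "... = (\<Sum>e\<in>E. (N.nrm (u e m))\<^sup>2)" by (rule sum.cong) (insert Ec m, auto simp: N.nrm_sq)
  finally show ?thesis using L.nrm_sq[OF m] by simp
 qed
 have le: "N.nrm (u e m) \<le> L.nrm m" if e: "e \<in> E" and m: "m .: M" for e m
 proof (rule power2_le_imp_le)
  show "(N.nrm (u e m))\<^sup>2 \<le> (L.nrm m)\<^sup>2"
   unfolding sq[OF m] by (rule member_le_sum[OF e, where f = "\<lambda>e. (N.nrm (u e m))\<^sup>2"]) (use E(1) in auto)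
 qed (rule L.nrm_ge0[OF m])
 define c where "c e = (\<Sum>l\<in>E. cmod (\<beta> e (f l)))" for e
 have step: "N.nrm (u e (f m)) \<le> c e * L.nrm m" if e: "e \<in> E" and m: "m .: M" for e m
 proof -
  have uf: "u e (f m) = finsum A (\<lambda>l. \<beta> e (f l) \<odot> u l m) E"
   by (rule u_f[OF E(1,2) _ Ec[OF e] m]) (rule ex)
  have "N.nrm (u e (f m)) \<le> (\<Sum>l\<in>E. N.nrm (\<beta> e (f l) \<odot> u l m))"
   unfolding uf by (rule N.nrm_finsum[OF E(1)]) (use Ec m in auto)
  also have "... = (\<Sum>l\<in>E. cmod (\<beta> e (f l)) * N.nrm (u l m))"
   by (rule sum.cong) (insert Ec m, auto intro!: N.nrm_smult)
  also have "... \<le> (\<Sum>l\<in>E. cmod (\<beta> e (f l)) * L.nrm m)" by (intro sum_mono mult_left_mono le m) auto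
  finally show ?thesis by (simp add: c_def sum_distrib_right)
 qed
 have "L.nrm (f m) \<le> sqrt (\<Sum>e\<in>E. (c e)\<^sup>2) * L.nrm m" if m: "m .: M" for m
 proof (rule power2_le_imp_le)
  have "(L.nrm (f m))\<^sup>2 \<le> (\<Sum>e\<in>E. (c e * L.nrm m)\<^sup>2)"
   unfolding sq[OF f_closed[OF m]]
   by (intro sum_mono power_mono step m) (use Ec m N.nrm_ge0 in auto)
  also have "... = (\<Sum>e\<in>E. (c e)\<^sup>2) * (L.nrm m)\<^sup>2" by (simp add: power_mult_distrib sum_distrib_right)
  also have "... = (sqrt (\<Sum>e\<in>E. (c e)\<^sup>2) * L.nrm m)\<^sup>2" by (simp add: power_mult_distrib sum_nonneg)
  finally show "(L.nrm (f m))\<^sup>2 \<le> (sqrt (\<Sum>e\<in>E. (c e)\<^sup>2) * L.nrm m)\<^sup>2" .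
  show "0 \<le> sqrt (\<Sum>e\<in>E. (c e)\<^sup>2) * L.nrm m" using L.nrm_ge0[OF m] by (simp add: sum_nonneg)
 qed
 then show ?thesis by blast
qed

end

end

section \<open>Extension to the completion\<close>

locale pre_hilbert = semi_ip V "iprod V" for V :: "'m ipspace" (structure)
begin

lemma hnorm_nrm: "hnorm V x = nrm x" by (simp add: hnorm_def nrm_def)

lemma nrm_minus_commute: "x .: V ==> y .: V ==> nrm (x \<ominus> y) = nrm (y \<ominus> x)"
proof -
 assume xy: "x .: V" "y .: V"
 have "x \<ominus> y = (-1) \<odot> (y \<ominus> x)" using xy V by (simp add: vs_minus_eq vs_smult_add vs_add_comm)
 then show ?thesis using nrm_smult[of "y \<ominus> x" "-1"] xy V by simp
qed

lemma nrm_minus_triangle: "x .: V ==> y .: V ==> z .: V ==> nrm (x \<ominus> z) \<le> nrm (x \<ominus> y) + nrm (y \<ominus> z)"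
proof -
 assume xyz: "x .: V" "y .: V" "z .: V"
 interpret M: module CC V by (rule V)
 have "x \<ominus> z = (x \<ominus> y) \<oplus> (y \<ominus> z)" using xyz V by (simp add: M.minus_eq M.a_assoc M.l_neg M.r_neg1 M.r_neg2)
 then show ?thesis using triangle[of "x \<ominus> y" "y \<ominus> z"] xyz V by simp
qed

lemma nrm_diff: "x .: V ==> y .: V ==> \<bar>nrm x - nrm y\<bar> \<le> nrm (x \<ominus> y)"
proof -
 assume xy: "x .: V" "y .: V"
 have "nrm x \<le> nrm (x \<ominus> y) + nrm y" using triangle[of "x \<ominus> y" y] vs_minus_add[OF V xy] xy V by simp
 moreover have "nrm y \<le> nrm (y \<ominus> x) + nrm x" using triangle[of "y \<ominus> x" x] vs_minus_add[OF V xy(2,1)] xy V by simp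
 ultimately show ?thesis using nrm_minus_commute[OF xy] by simp
qed

abbreviation CS where "CS \<equiv> cauchy_seqs V"
definition sim where "sim s t \<longleftrightarrow> (\<lambda>i. nrm (s i \<ominus> t i)) \<longlonglongrightarrow> 0"

lemma CS_carrier: "s \<in> CS ==> s i .: V" by (auto simp: cauchy_seqs_def)

lemma CS_iff: "s \<in> CS \<longleftrightarrow> range s \<subseteq> carrier V \<and> (\<forall>e>0. \<exists>N. \<forall>i\<ge>N. \<forall>j\<ge>N. nrm (s i \<ominus> s j) < e)"
 by (simp add: cauchy_seqs_def hnorm_nrm)

lemma CS_D: "s \<in> CS ==> e > 0 ==> \<exists>N. \<forall>i\<ge>N. \<forall>j\<ge>N. nrm (s i \<ominus> s j) < e"
 by (simp add: CS_iff)

lemma seq_class_iff: "t \<in> seq_class V s \<longleftrightarrow> t \<in> CS \<and> sim s t"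
 by (simp add: seq_class_def sim_def hnorm_nrm)

lemma sim_refl: "s \<in> CS ==> sim s s" using CS_carrier V by (simp add: sim_def nrm_zero)

lemma sim_sym: "s \<in> CS ==> t \<in> CS ==> sim s t ==> sim t s"
 using CS_carrier nrm_minus_commute by (simp add: sim_def)

lemma sim_trans: "s \<in> CS ==> t \<in> CS ==> r \<in> CS ==> sim s t ==> sim t r ==> sim s r"
 unfolding sim_def
 by (rule real_tendsto_sandwich[where f = "\<lambda>_. 0" and h = "\<lambda>i. nrm (s i \<ominus> t i) + nrm (t i \<ominus> r i)"])
  (insert CS_carrier V, auto intro!: tendsto_eq_intros always_eventually nrm_minus_triangle nrm_ge0)

lemma seq_class_eq: "s \<in> CS ==> t \<in> CS ==> sim s t ==> seq_class V s = seq_class V t"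
proof (intro equalityI subsetI)
 assume st: "s \<in> CS" "t \<in> CS" "sim s t"
 fix x
 show "x \<in> seq_class V t" if "x \<in> seq_class V s"
  using that sim_trans[OF st(2,1) _ sim_sym[OF st]] by (simp add: seq_class_iff)
 show "x \<in> seq_class V s" if "x \<in> seq_class V t"
  using that sim_trans[OF st(1,2) _ st(3)] by (simp add: seq_class_iff)
qed

lemma some_rep: "s \<in> CS ==> (SOME t. t \<in> seq_class V s) \<in> CS \<and> sim s (SOME t. t \<in> seq_class V s)"
 using someI[of "\<lambda>t. t \<in> seq_class V s" s] by (simp add: seq_class_iff sim_refl)

lemma lipschitz_CS:
 assumes T: "T \<in> lin_hom V V" and C: "\<And>x. x .: V ==> nrm (T x) \<le> C * nrm x" and s: "s \<in> CS"
 shows "(\<lambda>i. T (s i)) \<in> CS"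
proof -
 have sc: "s i .: V" for i by (rule CS_carrier[OF s])
 have "\<exists>N. \<forall>i\<ge>N. \<forall>j\<ge>N. nrm (T (s i) \<ominus> T (s j)) < e" if "e > 0" for e
 proof -
  have e: "e / (\<bar>C\<bar> + 1) > 0" using that by simp
  obtain N where N: "\<forall>i\<ge>N. \<forall>j\<ge>N. nrm (s i \<ominus> s j) < e / (\<bar>C\<bar> + 1)"
   using CS_D[OF s e] ..
  have "nrm (T (s i) \<ominus> T (s j)) < e" if "i \<ge> N" "j \<ge> N" for i j
  proof -
   let ?x = "s i \<ominus> s j"
   have x: "?x .: V" using sc V by simp
   have "nrm (T (s i) \<ominus> T (s j)) = nrm (T ?x)" using lin_map_minus[OF T V V sc sc] by simp
   also have "... \<le> C * nrm ?x" by (rule C[OF x])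
   also have "... \<le> (\<bar>C\<bar> + 1) * nrm ?x" using nrm_ge0[OF x] by (intro mult_right_mono) auto
   also have "... < e" using N[rule_format, OF that] by (simp add: field_simps)
   finally show ?thesis .
  qed
  then show ?thesis by (intro exI[of _ N]) simp
 qed
 then show ?thesis using lin_closed[OF T sc] by (auto simp: CS_iff)
qed

lemma lipschitz_sim:
 assumes T: "T \<in> lin_hom V V" and C: "\<And>x. x .: V ==> nrm (T x) \<le> C * nrm x" and s: "s \<in> CS" "t \<in> CS" "sim s t"
 shows "sim (\<lambda>i. T (s i)) (\<lambda>i. T (t i))"
 unfolding sim_def
proof (rule real_tendsto_sandwich[where f = "\<lambda>_. 0" and h = "\<lambda>i. C * nrm (s i \<ominus> t i)"])
 have c: "s i .: V" "t i .: V" for i using CS_carrier s by auto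
 have c': "s i \<ominus> t i .: V" for i using c V by simp
 have e: "T (s i) \<ominus> T (t i) = T (s i \<ominus> t i)" for i using lin_map_minus[OF T V V c] by simp
 show "\<forall>\<^sub>F i in sequentially. 0 \<le> nrm (T (s i) \<ominus> T (t i))" using nrm_ge0[OF lin_closed[OF T c']] e by simp
 show "\<forall>\<^sub>F i in sequentially. nrm (T (s i) \<ominus> T (t i)) \<le> C * nrm (s i \<ominus> t i)" using C[OF c'] e by simp
 show "(\<lambda>i. C * nrm (s i \<ominus> t i)) \<longlonglongrightarrow> 0" using s(3) by (auto simp: sim_def intro!: tendsto_eq_intros)
qed simp

lemma add_CS:
 assumes s: "s \<in> CS" and t: "t \<in> CS"
 shows "(\<lambda>i. s i \<oplus> t i) \<in> CS"
proof -
 interpret M: module CC V by (rule V)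
 have c: "s i .: V" "t i .: V" for i using CS_carrier s t by auto
 have e: "(s i \<oplus> t i) \<ominus> (s j \<oplus> t j) = (s i \<ominus> s j) \<oplus> (t i \<ominus> t j)" for i j
  using c V by (simp add: M.minus_eq M.minus_add M.a_ac)
 have "\<exists>N. \<forall>i\<ge>N. \<forall>j\<ge>N. nrm ((s i \<oplus> t i) \<ominus> (s j \<oplus> t j)) < e" if "e > 0" for e
 proof -
  have e2: "e / 2 > 0" using that by simp
  obtain N1 where N1: "\<forall>i\<ge>N1. \<forall>j\<ge>N1. nrm (s i \<ominus> s j) < e / 2" using CS_D[OF s e2] ..
  obtain N2 where N2: "\<forall>i\<ge>N2. \<forall>j\<ge>N2. nrm (t i \<ominus> t j) < e / 2" using CS_D[OF t e2] ..
  have "nrm ((s i \<oplus> t i) \<ominus> (s j \<oplus> t j)) < e" if "i \<ge> max N1 N2" "j \<ge> max N1 N2" for i j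
  proof -
   have "nrm ((s i \<oplus> t i) \<ominus> (s j \<oplus> t j)) \<le> nrm (s i \<ominus> s j) + nrm (t i \<ominus> t j)"
    unfolding e by (rule triangle) (rule vs_minus[OF V c(1) c(1)], rule vs_minus[OF V c(2) c(2)])
   moreover have "nrm (s i \<ominus> s j) < e / 2" using N1 that by simp
   moreover have "nrm (t i \<ominus> t j) < e / 2" using N2 that by simp
   ultimately show ?thesis by linarith
  qed
  then show ?thesis by (intro exI[of _ "max N1 N2"]) simp
 qed
 then show ?thesis using c V by (auto simp: CS_iff)
qed

lemma add_sim:
 assumes s: "s \<in> CS" "s' \<in> CS" "sim s s'" and t: "t \<in> CS" "t' \<in> CS" "sim t t'"
 shows "sim (\<lambda>i. s i \<oplus> t i) (\<lambda>i. s' i \<oplus> t' i)"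
 unfolding sim_def
proof (rule real_tendsto_sandwich[where f = "\<lambda>_. 0" and h = "\<lambda>i. nrm (s i \<ominus> s' i) + nrm (t i \<ominus> t' i)"])
 interpret M: module CC V by (rule V)
 have c: "s i .: V" "t i .: V" "s' i .: V" "t' i .: V" for i using CS_carrier s t by auto
 have e: "(s i \<oplus> t i) \<ominus> (s' i \<oplus> t' i) = (s i \<ominus> s' i) \<oplus> (t i \<ominus> t' i)" for i
  using c V by (simp add: M.minus_eq M.minus_add M.a_ac)
 show "\<forall>\<^sub>F i in sequentially. 0 \<le> nrm ((s i \<oplus> t i) \<ominus> (s' i \<oplus> t' i))" using c V by (intro always_eventually allI nrm_ge0) simp
 show "\<forall>\<^sub>F i in sequentially. nrm ((s i \<oplus> t i) \<ominus> (s' i \<oplus> t' i)) \<le> nrm (s i \<ominus> s' i) + nrm (t i \<ominus> t' i)"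
  unfolding e using c V by (intro always_eventually allI triangle) auto
 show "(\<lambda>i. nrm (s i \<ominus> s' i) + nrm (t i \<ominus> t' i)) \<longlonglongrightarrow> 0" using s(3) t(3) by (auto simp: sim_def intro!: tendsto_eq_intros)
qed simp

lemma smult_lipschitz: "(\<lambda>x. c \<odot> x) \<in> lin_hom V V" "x .: V ==> nrm (c \<odot> x) \<le> cmod c * nrm x"
 by (intro lin_smult_fun V lin_id) (simp add: nrm_smult)

abbreviation cl where "cl \<equiv> seq_class V"
abbreviation VC where "VC \<equiv> completion V"

lemma completion_carrier: "X .: VC ==> \<exists>s\<in>CS. X = cl s" "s \<in> CS ==> cl s .: VC"
 by (auto simp: completion_def)

lemma completion_add: "s \<in> CS ==> t \<in> CS ==> cl s \<oplus>\<^bsub>VC\<^esub> cl t = cl (\<lambda>i. s i \<oplus> t i)"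
proof -
 assume st: "s \<in> CS" "t \<in> CS"
 note r = some_rep[OF st(1)] some_rep[OF st(2)]
 have "cl (\<lambda>i. (SOME r. r \<in> cl s) i \<oplus> (SOME r. r \<in> cl t) i) = cl (\<lambda>i. s i \<oplus> t i)"
  by (rule seq_class_eq[OF add_CS add_CS add_sim]) (use r st sim_sym in auto)
 then show ?thesis by (simp add: completion_def)
qed

lemma completion_smult: "s \<in> CS ==> c \<odot>\<^bsub>VC\<^esub> cl s = cl (\<lambda>i. c \<odot> s i)"
proof -
 assume s: "s \<in> CS"
 note r = some_rep[OF s]
 have "cl (\<lambda>i. c \<odot> (SOME t. t \<in> cl s) i) = cl (\<lambda>i. c \<odot> s i)"
  by (rule seq_class_eq[OF lipschitz_CS[OF smult_lipschitz] lipschitz_CS[OF smult_lipschitz] lipschitz_sim[OF smult_lipschitz]])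
   (use r s sim_sym in auto)
 then show ?thesis by (simp add: completion_def)
qed

lemma completion_norm:
 assumes s: "s \<in> CS"
 shows "(\<lambda>i. nrm (s i)) \<longlonglongrightarrow> hnorm VC (cl s)"
proof -
 define t where "t = (SOME t. t \<in> cl s)"
 have t: "t \<in> CS" "sim s t" using some_rep[OF s] by (auto simp: t_def)
 have c: "s i .: V" "t i .: V" for i using CS_carrier s t by auto
 have "Cauchy (\<lambda>i. nrm (t i))"
 proof (rule metric_CauchyI)
  fix e :: real assume e: "e > 0"
  obtain N where N: "\<forall>i\<ge>N. \<forall>j\<ge>N. nrm (t i \<ominus> t j) < e" using CS_D[OF t(1) e] ..
  show "\<exists>M. \<forall>m\<ge>M. \<forall>n\<ge>M. dist (nrm (t m)) (nrm (t n)) < e"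
  proof (intro exI[of _ N] allI impI)
   fix m n assume "N \<le> m" "N \<le> n"
   then show "dist (nrm (t m)) (nrm (t n)) < e"
    using N[rule_format, of m n] nrm_diff[OF c(2)[of m] c(2)[of n]] by (simp add: dist_real_def)
  qed
 qed
 then obtain l where l: "(\<lambda>i. nrm (t i)) \<longlonglongrightarrow> l" by (auto simp: Cauchy_convergent_iff convergent_def)
 have l0: "0 \<le> l" using l by (rule LIMSEQ_le_const) (use c nrm_ge0 in auto)
 have "(\<lambda>i. iprod V (t i) (t i)) \<longlonglongrightarrow> of_real (l\<^sup>2)"
 proof (rule Lim_transform_eventually)
  show "(\<lambda>i. complex_of_real ((nrm (t i))\<^sup>2)) \<longlonglongrightarrow> of_real (l\<^sup>2)" by (intro tendsto_of_real tendsto_power l)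
  show "\<forall>\<^sub>F i in sequentially. complex_of_real ((nrm (t i))\<^sup>2) = iprod V (t i) (t i)"
   using ip_real[OF c(2)] nrm_sq[OF c(2)] by simp
 qed
 then have "lim (\<lambda>i. iprod V (t i) (t i)) = of_real (l\<^sup>2)" by (rule limI)
 then have hl: "hnorm VC (cl s) = l" using l0 by (simp add: hnorm_def completion_def t_def[symmetric])
 have d: "(\<lambda>i. nrm (s i) - nrm (t i)) \<longlonglongrightarrow> 0"
  by (rule Lim_null_comparison[OF _ t(2)[unfolded sim_def]]) (simp add: nrm_diff c)
 show ?thesis using tendsto_add[OF d l] hl by simp
qed

text \<open>The extension applies the operator to an arbitrary representing Cauchy sequence.\<close>

lemma bounded_extension:
 assumes T: "bounded_operator V T"
 shows "\<exists>T'. bounded_operator VC T' \<and> (\<forall>x\<in>carrier V. T' (to_completion V x) = to_completion V (T x))"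
proof -
 have Tl: "T \<in> lin_hom V V" using T by (simp add: bounded_operator_def)
 obtain C where C: "\<And>x. x .: V ==> nrm (T x) \<le> C * nrm x" using T by (auto simp: bounded_operator_def hnorm_nrm)
 define T' where "T' X = cl (\<lambda>i. T ((SOME s. s \<in> X) i))" for X
 have TC: "(\<lambda>i. T (s i)) \<in> CS" if "s \<in> CS" for s by (rule lipschitz_CS[OF Tl _ that]) (rule C)
 have TS: "sim (\<lambda>i. T (s i)) (\<lambda>i. T (t i))" if "s \<in> CS" "t \<in> CS" "sim s t" for s t
  by (rule lipschitz_sim[OF Tl _ that]) (rule C)
 have T'cl: "T' (cl s) = cl (\<lambda>i. T (s i))" if s: "s \<in> CS" for s
  unfolding T'_def using some_rep[OF s] s by (intro seq_class_eq TC TS) (auto intro: sim_sym)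
 have "T' \<in> lin_hom VC VC"
 proof (rule lin_homI)
  fix X Y c assume "X .: VC"
  then obtain s where s: "s \<in> CS" "X = cl s" using completion_carrier by blast
  have sc: "s i .: V" for i by (rule CS_carrier[OF s(1)])
  show "T' X .: VC" using s T'cl TC completion_carrier(2) by simp
  have "(\<lambda>i. c \<odot> s i) \<in> CS" by (rule lipschitz_CS[OF smult_lipschitz s(1)])
  then show "T' (c \<odot>\<^bsub>VC\<^esub> X) = c \<odot>\<^bsub>VC\<^esub> T' X"
   using s T'cl TC lin_smult[OF Tl sc] by (simp add: completion_smult)
  assume "Y .: VC"
  then obtain t where t: "t \<in> CS" "Y = cl t" using completion_carrier by blast
  have tc: "t i .: V" for i by (rule CS_carrier[OF t(1)])
  show "T' (X \<oplus>\<^bsub>VC\<^esub> Y) = T' X \<oplus>\<^bsub>VC\<^esub> T' Y"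
   using s t T'cl TC add_CS[OF s(1) t(1)] lin_add[OF Tl sc tc] by (simp add: completion_add)
 qed
 moreover have "hnorm VC (T' X) \<le> C * hnorm VC X" if X: "X .: VC" for X
 proof -
  obtain s where s: "s \<in> CS" "X = cl s" using completion_carrier(1)[OF X] by blast
  have sc: "s i .: V" for i by (rule CS_carrier[OF s(1)])
  have "(\<lambda>i. nrm (T (s i))) \<longlonglongrightarrow> hnorm VC (T' X)" using completion_norm[OF TC[OF s(1)]] T'cl[OF s(1)] s(2) by simp
  moreover have "(\<lambda>i. C * nrm (s i)) \<longlonglongrightarrow> C * hnorm VC X" using completion_norm[OF s(1)] s(2) by (intro tendsto_mult_left) simp
  ultimately show ?thesis by (rule LIMSEQ_le) (use C sc in auto)
 qed
 moreover have "T' (to_completion V x) = to_completion V (T x)" if x: "x .: V" for x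
 proof -
  have "(\<lambda>_. x) \<in> CS" using x V by (auto simp: CS_iff nrm_zero)
  from T'cl[OF this] show ?thesis by (simp add: to_completion_def)
 qed
 ultimately show ?thesis by (auto simp: bounded_operator_def)
qed

end

theorem proposition3p4:
 fixes A :: "'a hopf" and B :: "'a set" and \<Omega> :: "('a, 'w) dcalc"
  and \<Omega>\<Omega> :: "nat \<Rightarrow> nat \<Rightarrow> 'w set" and \<sigma> :: 'w and n :: nat
  and F :: "('a, 'f) relmod" and h :: "'f \<Rightarrow> 'f \<Rightarrow> 'a"
  and f :: "('w, 'f) tensor \<Rightarrow> ('w, 'f) tensor"
 assumes "cqh_hermitian_space A B \<Omega> \<Omega>\<Omega> \<sigma> n"
  and "covariant_hermitian_module A B \<Omega> \<Omega>\<Omega> \<sigma> n F h"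
  and "relmod_hom A B (tens_relmod A B \<Omega> F) (tens_relmod A B \<Omega> F) f"
 shows "bounded_operator (twisted_forms A B \<Omega> \<Omega>\<Omega> \<sigma> n F h) f \<and>
  (\<exists>T. bounded_operator (L2_space A B \<Omega> \<Omega>\<Omega> \<sigma> n F h) T \<and>
   (\<forall>x\<in>carrier (twisted_forms A B \<Omega> \<Omega>\<Omega> \<sigma> n F h).
    T (to_completion (twisted_forms A B \<Omega> \<Omega>\<Omega> \<sigma> n F h) x) =
    to_completion (twisted_forms A B \<Omega> \<Omega>\<Omega> \<sigma> n F h) (f x)))"
proof -
 interpret chmod A B \<Omega> \<Omega>\<Omega> \<sigma> n F h
  by unfold_locales
   (use assms(1,2) in \<open>auto simp: cqh_hermitian_space_def cqga_homogeneous_space_def cqga_def\<close>)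
 let ?H = "twisted_forms A B \<Omega> \<Omega>\<Omega> \<sigma> n F h"
 have Hs: "carrier ?H = carrier M" "add ?H = add M" "zero ?H = zero M" "smult ?H = smult M" "iprod ?H = (\<lambda>x y. \<eta> (g x y))"
  by (simp_all add: twisted_forms_def module.defs ipspace.defs)
 have vsH: "vs ?H" by (rule vs_cong[OF vsM]) (simp_all add: Hs)
 interpret P: pre_hilbert ?H
 proof (intro pre_hilbert.intro semi_ip.intro vsH)
  fix x y assume "x \<in> carrier ?H"
  then have x: "x \<in> carrier M" by (simp add: Hs)
  show "iprod ?H x \<in> lin_hom ?H CC" using L.ip_lin[OF x] lin_hom_cong[of ?H M CC CC] by (simp add: Hs)
  show "0 \<le> Re (iprod ?H x x)" using L.ip_pos[OF x] by (simp add: Hs)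
  assume "y \<in> carrier ?H"
  then have y: "y \<in> carrier M" by (simp add: Hs)
  show "iprod ?H x y = cnj (iprod ?H y x)" unfolding Hs by (rule L.ip_sym[OF x y])
 qed
 have "f \<in> lin_hom ?H ?H" using f_lin[OF assms(3)] lin_hom_cong[of ?H M ?H M] by (simp add: Hs)
 moreover have "hnorm ?H x = L.nrm x" for x by (simp add: hnorm_def L.nrm_def Hs)
 ultimately have b: "bounded_operator ?H f" using f_bounded[OF assms(3)] by (simp add: bounded_operator_def Hs)
 then show ?thesis using P.bounded_extension[OF b] by (simp add: L2_space_def)
qed

end
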